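(* Let $k$ be a positive integer and $I \subseteq \{1,\dots,k\}$. Let $G$ be a $(26k+24|I|)$-connected graph and let $S = \{\{s_1,t_1\},\dots,\{s_k,t_k\}\}$ where $s_1,\dots,s_k,t_1,\dots,t_k$ are $2k$ distinct vertices of $G$. If there is a nice partition $(A,B)$ of $G$ that has a parity breaking matching for $(S,I)$, then for every choice of parities $(p_i)_{i \in I}$ with $p_i \in \{\text{even},\text{odd}\}$, $G$ contains pairwise vertex-disjoint paths $P_1,\dots,P_k$ such that $P_i$ has ends $s_i$ and $t_i$ for each $i \in \{1,\dots,k\}$, and the length of $P_i$ has parity $p_i$ for each $i \in I$.
   Context: All graphs are finite and simple. A partition $(A,B)$ of $G$ is a partition of $V(G)$ into two sets $A,B$. For such a partition, $G_{A,B}$ denotes the graph $G[A] \cup G[B]$, i.e. the graph whose edges are the edges of $G$ with both ends in $A$ or both ends in $B$. An odd cycle cover of $G$ is a set $X \subseteq V(G)$ such that $G - X$ is bipartite; it is minimum if it has the smallest possible size. A partition $(A,B)$ of $G$ is nice if there is a minimum odd cycle cover $X$ of $G$ such that $A \setminus X$ and $B \setminus X$ are both independent sets of $G$ (so $(A\setminus X, B\setminus X)$ is a bipartition of $G-X$), every vertex of $X$ having more neighbours in $B\setminus X$ than in $A \setminus X$ lies in $A$, and every vertex of $X$ having more neighbours in $A\setminus X$ than in $B\setminus X$ lies in $B$. For $S = \{\{s_1,t_1\},\dots,\{s_k,t_k\}\}$ and $I \subseteq \{1,\dots,k\}$, a parity breaking matching for $(S,I)$ with respect to a partition $(A,B)$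 is a matching $M = \{m_i\}_{i \in I}$ of $G$ (indexed by $I$) with $M \subseteq E(G_{A,B})$ such that $m_i \cap \{s_j,t_j\} = \emptyset$ for all $i \in I$ and all $j \in \{1,\dots,k\}$ with $j \neq i$. *)

theory Defs
  imports Main
begin

definition simple_graph :: "'a set \<Rightarrow> 'a set set \<Rightarrow> bool" where
  "simple_graph V E \<longleftrightarrow> finite V \<and> (\<forall>e\<in>E. e \<subseteq> V \<and> card e = 2)"

definition is_path :: "'a set \<Rightarrow> 'a set set \<Rightarrow> 'a list \<Rightarrow> bool" where
  "is_path V E P \<longleftrightarrow> P \<noteq> [] \<and> distinct P \<and> set P \<subseteq> V \<and>
     (\<forall>j. Suc j < length P \<longrightarrow> {P ! j, P ! Suc j} \<in> E)"

definition path_length :: "'a list \<Rightarrow> nat" where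
  "path_length P = length P - 1"

definition del_edges :: "'a set \<Rightarrow> 'a set set \<Rightarrow> 'a set set" where
  "del_edges X E = {e\<in>E. e \<inter> X = {}}"

definition connected_graph :: "'a set \<Rightarrow> 'a set set \<Rightarrow> bool" where
  "connected_graph V E \<longleftrightarrow> V \<noteq> {} \<and>
     (\<forall>u\<in>V. \<forall>v\<in>V. \<exists>P. is_path V E P \<and> hd P = u \<and> last P = v)"

definition k_connected :: "nat \<Rightarrow> 'a set \<Rightarrow> 'a set set \<Rightarrow> bool" where
  "k_connected k V E \<longleftrightarrow> card V > k \<and>
     (\<forall>X\<subseteq>V. card X < k \<longrightarrow> connected_graph (V - X) (del_edges X E))"

definition independent :: "'a set set \<Rightarrow> 'a set \<Rightarrow> bool" where
  "independent E A \<longleftrightarrow> (\<forall>e\<in>E. \<not> e \<subseteq> A)"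

definition bipartite :: "'a set \<Rightarrow> 'a set set \<Rightarrow> bool" where
  "bipartite V E \<longleftrightarrow> (\<exists>A B. A \<union> B = V \<and> A \<inter> B = {} \<and> independent E A \<and> independent E B)"

definition odd_cycle_cover :: "'a set \<Rightarrow> 'a set set \<Rightarrow> 'a set \<Rightarrow> bool" where
  "odd_cycle_cover V E X \<longleftrightarrow> X \<subseteq> V \<and> bipartite (V - X) (del_edges X E)"

definition min_odd_cycle_cover :: "'a set \<Rightarrow> 'a set set \<Rightarrow> 'a set \<Rightarrow> bool" where
  "min_odd_cycle_cover V E X \<longleftrightarrow> odd_cycle_cover V E X \<and>
     (\<forall>Y. odd_cycle_cover V E Y \<longrightarrow> card X \<le> card Y)"

definition neighbours :: "'a set set \<Rightarrow> 'a \<Rightarrow> 'a set" where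
  "neighbours E v = {u. {v, u} \<in> E}"

definition partition2 :: "'a set \<Rightarrow> 'a set \<Rightarrow> 'a set \<Rightarrow> bool" where
  "partition2 V A B \<longleftrightarrow> A \<union> B = V \<and> A \<inter> B = {}"

definition nice_partition :: "'a set \<Rightarrow> 'a set set \<Rightarrow> 'a set \<Rightarrow> 'a set \<Rightarrow> bool" where
  "nice_partition V E A B \<longleftrightarrow> partition2 V A B \<and>
     (\<exists>X. min_odd_cycle_cover V E X \<and>
        independent E (A - X) \<and> independent E (B - X) \<and>
        (\<forall>v\<in>X. card (neighbours E v \<inter> (B - X)) > card (neighbours E v \<inter> (A - X)) \<longrightarrow> v \<in> A) \<and>
        (\<forall>v\<in>X. card (neighbours E v \<inter> (A - X)) > card (neighbours E v \<inter> (B - X)) \<longrightarrow> v \<in> B))"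

definition edges_AB :: "'a set set \<Rightarrow> 'a set \<Rightarrow> 'a set \<Rightarrow> 'a set set" where
  "edges_AB E A B = {e\<in>E. e \<subseteq> A \<or> e \<subseteq> B}"

text \<open>Parity breaking matching for (S,I) w.r.t. (A,B), with S given by s, t on {1..k}.
  The matching is a family m indexed by I of pairwise disjoint edges of G_{A,B}.\<close>
definition parity_breaking_matching ::
  "'a set set \<Rightarrow> 'a set \<Rightarrow> 'a set \<Rightarrow> nat \<Rightarrow> (nat \<Rightarrow> 'a) \<Rightarrow> (nat \<Rightarrow> 'a) \<Rightarrow> nat set \<Rightarrow> (nat \<Rightarrow> 'a set) \<Rightarrow> bool" where
  "parity_breaking_matching E A B k s t I m \<longleftrightarrow>
     (\<forall>i\<in>I. m i \<in> edges_AB E A B) \<and>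
     (\<forall>i\<in>I. \<forall>j\<in>I. i \<noteq> j \<longrightarrow> m i \<inter> m j = {}) \<and>
     (\<forall>i\<in>I. \<forall>j\<in>{1..k}. j \<noteq> i \<longrightarrow> m i \<inter> {s j, t j} = {})"

end

theory Submission
  imports Defs "HOL-Library.Disjoint_Sets"
begin

text \<open>A path that uses only edges across a cut has its parity determined by its ends, so a pair gets the
  prescribed parity by choosing whether or not to route it through a path that breaks parity with
  respect to the cut. Write \<open>l = k + card I\<close>. All routing is done by the theorem of Thomas and Wollan: a set
  of at most \<open>2 * l\<close> vertices is linked if there are more than \<open>6 * l\<close> edges per vertex outside it, and not
  behind a small separation.

  If a minimum odd cycle cover is smaller than \<open>14 * k + 12 * card I\<close>, then by niceness the edges between
  \<open>A\<close> and \<open>B\<close> already link the terminals together with the ends of the parity breaking matching.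
  Otherwise take a maximum cut and a smallest set \<open>W\<close> that is still dense in it; the cut edges inside \<open>W\<close>
  link every set of at most \<open>2 * l\<close> vertices of \<open>W\<close>. Gallai's theorem on odd \<open>A\<close>-paths yields
  \<open>2 * k + card I\<close> disjoint parity breaking paths with ends in \<open>W\<close>, since a small hitting set would be a
  small odd cycle cover. Among all systems of \<open>2 * k\<close> disjoint paths from the terminals to \<open>W\<close>, one with
  fewest edges outside the parity breaking paths meets at most \<open>2 * k\<close> of them; the others serve \<open>I\<close>.\<close>

section \<open>Connected sets and Menger's theorem\<close>

text \<open>Where the constants come from. In a maximum cut, degree
  \<open>26 * k + 24 * card I\<close> is halved to \<open>12 * l + k\<close>: the
  \<open>12 * l\<close> is twice the density that the linkage theorem asks for, and the extra
  \<open>k\<close> pays for edges inside the linked set. A cover that leaves every vertex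
  \<open>12 * l + 1\<close> neighbours outside it is harmless, since niceness preserves half of them
  in the cut.

  The linked set has \<open>2 * l\<close> vertices because a pair in \<open>I\<close> may need two
  links, one on either side of its breaking path. Whether that detour is taken is settled only after
  the paths leading to \<open>W\<close> are fixed, as these may break parity themselves.

  The linkage theorem is proved on a smallest counterexample. Contracting an edge costs one vertex,
  so an edge with an end outside the linked set must lie in about \<open>6 * l\<close> triangles.
  The closed neighbourhood of a vertex of degree at most \<open>12 * l\<close> is then a small graph
  in which vertices see more than half of the others.

  Until parity matters, connected vertex sets replace paths: they can be united without removing
  repetitions, and gluing, clique replacement and contraction become operations on sets.\<close>

definition adj_in :: "'a set set \<Rightarrow> 'a set \<Rightarrow> ('a \<times> 'a) set" where
  "adj_in E U = {(a, b). a \<in> U \<and> b \<in> U \<and> {a, b} \<in> E}"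

definition conn :: "'a set set \<Rightarrow> 'a set \<Rightarrow> bool" where
  "conn E U \<longleftrightarrow> U \<noteq> {} \<and> (\<forall>u\<in>U. \<forall>v\<in>U. (u, v) \<in> (adj_in E U)\<^sup>*)"

definition comp_in :: "'a set set \<Rightarrow> 'a set \<Rightarrow> 'a \<Rightarrow> 'a set" where
  "comp_in E W v = {w. (v, w) \<in> (adj_in E W)\<^sup>*}"

text \<open>The order of the separation is \<open>card (A \<inter> B)\<close>. Degenerate
  separations with \<open>A \<subseteq> B\<close> or \<open>B \<subseteq> A\<close> are
  included.\<close>

definition sepn :: "'a set \<Rightarrow> 'a set set \<Rightarrow> 'a set \<Rightarrow> 'a set \<Rightarrow> bool" where
  "sepn V E A B \<longleftrightarrow> A \<union> B = V \<and> (\<forall>a\<in>A - B. \<forall>b\<in>B - A. {a, b} \<notin> E)"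

lemma adj_in_sym: "(a, b) \<in> adj_in E U \<Longrightarrow> (b, a) \<in> adj_in E U"
  by (auto simp: adj_in_def insert_commute)

lemma adj_in_rtrancl_sym: "(a, b) \<in> (adj_in E U)\<^sup>* \<Longrightarrow> (b, a) \<in> (adj_in E U)\<^sup>*"
  by (meson adj_in_sym rtrancl_converseI symD symI sym_rtrancl)

lemma adj_in_mono: "E \<subseteq> F \<Longrightarrow> U \<subseteq> W \<Longrightarrow> adj_in E U \<subseteq> adj_in F W"
  by (auto simp: adj_in_def)

lemma adj_in_rtrancl_mono:
  "(a, b) \<in> (adj_in E U)\<^sup>* \<Longrightarrow> E \<subseteq> F \<Longrightarrow> U \<subseteq> W \<Longrightarrow> (a, b) \<in> (adj_in F W)\<^sup>*"
  by (rule subsetD[OF rtrancl_mono[OF adj_in_mono]])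

lemma adj_in_rtrancl_in: "(a, b) \<in> (adj_in E U)\<^sup>* \<Longrightarrow> a \<in> U \<Longrightarrow> b \<in> U"
  by (induction rule: rtrancl_induct) (auto simp: adj_in_def)

lemma conn_singleton [simp]: "conn E {v}"
  by (auto simp: conn_def)

lemma conn_mono: "conn E U \<Longrightarrow> E \<subseteq> F \<Longrightarrow> conn F U"
  unfolding conn_def by (auto intro: adj_in_rtrancl_mono)

lemma conn_edges_cong:
  assumes "conn E U" "\<And>a b. a \<in> U \<Longrightarrow> b \<in> U \<Longrightarrow> {a, b} \<in> E \<Longrightarrow> {a, b} \<in> F"
  shows "conn F U"
proof -
  have "adj_in E U \<subseteq> adj_in F U" using assms(2) by (auto simp: adj_in_def)
  then show ?thesis using assms(1) rtrancl_mono unfolding conn_def by blast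
qed

lemma connI:
  assumes "r \<in> U" "\<And>u. u \<in> U \<Longrightarrow> (r, u) \<in> (adj_in E U)\<^sup>*"
  shows "conn E U"
  unfolding conn_def using assms adj_in_rtrancl_sym rtrancl_trans by (metis empty_iff)

lemma conn_Un:
  assumes "conn E U" "conn E W" "U \<inter> W \<noteq> {}"
  shows "conn E (U \<union> W)"
proof -
  obtain r where r: "r \<in> U" "r \<in> W" using assms(3) by blast
  show ?thesis
  proof (rule connI[of r])
    fix u assume "u \<in> U \<union> W"
    then have "(r, u) \<in> (adj_in E U)\<^sup>* \<or> (r, u) \<in> (adj_in E W)\<^sup>*"
      using assms r unfolding conn_def by blast
    then show "(r, u) \<in> (adj_in E (U \<union> W))\<^sup>*"
      using adj_in_rtrancl_mono[of _ _ E] by (metis Un_upper1 Un_upper2 order_refl)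
  qed (use r in auto)
qed

lemma conn_edge: "{a, b} \<in> E \<Longrightarrow> conn E {a, b}"
proof (rule connI[of a])
  fix u assume e: "{a, b} \<in> E" and "u \<in> {a, b}"
  moreover have "(a, b) \<in> adj_in E {a, b}" using e by (auto simp: adj_in_def)
  ultimately show "(a, u) \<in> (adj_in E {a, b})\<^sup>*" by auto
qed simp

lemma conn_Un_edge:
  assumes "conn E U" "conn E W" "u \<in> U" "w \<in> W" "{u, w} \<in> E"
  shows "conn E (U \<union> W)"
proof -
  have "conn E (U \<union> {u, w})" by (rule conn_Un[OF assms(1) conn_edge[OF assms(5)]]) (use assms in auto)
  then have "conn E (U \<union> {u, w} \<union> W)" by (rule conn_Un[OF _ assms(2)]) (use assms in auto)
  moreover have "U \<union> {u, w} \<union> W = U \<union> W" using assms by auto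
  ultimately show ?thesis by simp
qed

lemma conn_insert: "conn E U \<Longrightarrow> u \<in> U \<Longrightarrow> {u, w} \<in> E \<Longrightarrow> conn E (insert w U)"
  using conn_Un_edge[of E U "{w}" u w] by simp

lemma conn_cut:
  assumes "conn E U" "P \<subseteq> U" "P \<noteq> {}" "P \<noteq> U"
  obtains a b where "a \<in> P" "b \<in> U - P" "{a, b} \<in> E"
proof -
  obtain u v where uv: "u \<in> P" "v \<in> U - P" using assms by blast
  have "(u, v) \<in> (adj_in E U)\<^sup>*" using assms uv unfolding conn_def by blast
  then have "v \<in> U - P \<longrightarrow> (\<exists>a b. a \<in> P \<and> b \<in> U - P \<and> {a, b} \<in> E)"
    using uv(1)
  proof (induction rule: rtrancl_induct)
    case (step y z)
    then show ?case by (cases "y \<in> P") (auto simp: adj_in_def)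
  qed simp
  then show ?thesis using that uv by blast
qed

text \<open>The cut form of connectivity lets it be transported through a contraction, or refuted by
  exhibiting one set, without following walks.\<close>

lemma conn_iff_cut:
  "conn E U \<longleftrightarrow> U \<noteq> {} \<and>
     (\<forall>P. P \<subseteq> U \<and> P \<noteq> {} \<and> P \<noteq> U \<longrightarrow> (\<exists>a\<in>P. \<exists>b\<in>U - P. {a, b} \<in> E))" (is "?L \<longleftrightarrow> ?R")
proof
  assume ?L
  then show ?R using conn_cut by (metis conn_def)
next
  assume R: ?R
  show ?L unfolding conn_def
  proof (intro conjI ballI)
    fix u v assume uv: "u \<in> U" "v \<in> U"
    let ?P = "comp_in E U u"
    have sub: "?P \<subseteq> U" using uv adj_in_rtrancl_in by (auto simp: comp_in_def)
    have "?P = U"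
    proof (rule ccontr)
      assume "?P \<noteq> U"
      moreover have "u \<in> ?P" by (simp add: comp_in_def)
      ultimately obtain a b where "a \<in> ?P" "b \<in> U - ?P" "{a, b} \<in> E" using R sub by blast
      moreover from this have "(a, b) \<in> adj_in E U" using sub by (auto simp: adj_in_def)
      ultimately show False by (auto simp: comp_in_def dest: rtrancl_into_rtrancl)
    qed
    then show "(u, v) \<in> (adj_in E U)\<^sup>*" using uv by (auto simp: comp_in_def)
  qed (use R in blast)
qed

lemma comp_in_subset: "v \<in> W \<Longrightarrow> comp_in E W v \<subseteq> W"
  using adj_in_rtrancl_in by (auto simp: comp_in_def)

lemma comp_in_self [simp]: "v \<in> comp_in E W v"
  by (simp add: comp_in_def)

lemma comp_in_closed: "a \<in> comp_in E W v \<Longrightarrow> a \<in> W \<Longrightarrow> b \<in> W \<Longrightarrow> {a, b} \<in> E \<Longrightarrow> b \<in> comp_in E W v"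
  by (auto simp: comp_in_def adj_in_def intro: rtrancl_into_rtrancl)

lemma conn_comp_in: "v \<in> W \<Longrightarrow> conn E (comp_in E W v)"
proof (rule connI[of v])
  fix u assume v: "v \<in> W" and u: "u \<in> comp_in E W v"
  then have "(v, u) \<in> (adj_in E W)\<^sup>*" by (simp add: comp_in_def)
  then show "(v, u) \<in> (adj_in E (comp_in E W v))\<^sup>*"
  proof (induction rule: rtrancl_induct)
    case (step y z)
    then have "y \<in> comp_in E W v" "z \<in> comp_in E W v" by (auto simp: comp_in_def)
    then have "(y, z) \<in> adj_in E (comp_in E W v)" using step by (auto simp: adj_in_def)
    then show ?case using step by auto
  qed simp
qed simp

lemma conn_subset_comp: "conn E U \<Longrightarrow> U \<subseteq> W \<Longrightarrow> v \<in> U \<Longrightarrow> U \<subseteq> comp_in E W v"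
  unfolding conn_def comp_in_def by (auto intro: adj_in_rtrancl_mono)

lemma comp_in_eq: "u \<in> comp_in E W v \<Longrightarrow> comp_in E W u = comp_in E W v"
  unfolding comp_in_def by (auto intro: rtrancl_trans dest: adj_in_rtrancl_sym)

text \<open>The component of \<open>s\<close> in \<open>U - T\<close> together with one edge leaving
  it: the counterpart for sets of following a path until it first meets \<open>T\<close>.\<close>

lemma conn_stop:
  assumes "conn E U" "s \<in> U" "U \<inter> T \<noteq> {}"
  obtains U' t where "U' \<subseteq> U" "conn E U'" "s \<in> U'" "U' \<inter> T = {t}"
proof (cases "s \<in> T")
  case True
  then show ?thesis using that[of "{s}" s] assms by auto
next
  case False
  let ?P = "comp_in E (U - T) s"
  have s: "s \<in> U - T" using False assms by auto
  have sub: "?P \<subseteq> U - T" using comp_in_subset[OF s] .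
  then have "?P \<noteq> U" using assms by blast
  then obtain a b where ab: "a \<in> ?P" "b \<in> U - ?P" "{a, b} \<in> E"
    using conn_cut[OF assms(1), of ?P] sub s by (metis Diff_subset comp_in_self empty_iff order_trans)
  then have "b \<in> T" using comp_in_closed[of a E "U - T" s b] sub by blast
  moreover have "conn E (insert b ?P)" using conn_insert[OF conn_comp_in[OF s] ab(1,3)] .
  ultimately show ?thesis using that[of "insert b ?P" b] sub ab by auto
qed

text \<open>Pigeonhole: \<open>card R\<close> disjoint sets that all meet \<open>R\<close> contain
  exactly one of its elements each. This labels the anonymous family from Menger's theorem by its
  ends.\<close>

lemma disjoint_transversal:
  assumes "finite R" "card F = card R" "finite F" "disjoint F" "\<And>C. C \<in> F \<Longrightarrow> C \<inter> R \<noteq> {}"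
  obtains h where "bij_betw h R F" "\<And>z. z \<in> R \<Longrightarrow> h z \<inter> R = {z}"
proof -
  have "\<forall>C\<in>F. \<exists>z. z \<in> C \<inter> R" using assms(5) by blast
  then obtain g where g: "\<And>C. C \<in> F \<Longrightarrow> g C \<in> C" "\<And>C. C \<in> F \<Longrightarrow> g C \<in> R" by (metis IntE)
  have dis: "C = D" if "C \<in> F" "D \<in> F" "x \<in> C" "x \<in> D" for C D x
    using assms(4) that unfolding disjoint_def by blast
  have inj: "inj_on g F"
    by (rule inj_onI) (metis dis g(1))
  have img: "g ` F = R"
    using g(2) inj assms by (intro card_subset_eq) (auto simp: card_image)
  have bij: "bij_betw g F R" using inj img by (simp add: bij_betw_def)
  have "the_inv_into F g z \<inter> R = {z}" if z: "z \<in> R" for z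
  proof -
    obtain C where C: "C \<in> F" "z = g C" using z img by blast
    have e: "the_inv_into F g z = C" using C inj by (simp add: the_inv_into_f_f)
    have "w = z" if w: "w \<in> C" "w \<in> R" for w
    proof -
      obtain D where D: "D \<in> F" "w = g D" using w(2) img by blast
      then have "D = C" using dis[OF D(1) C(1), of w] g(1)[OF D(1)] w(1) by simp
      then show ?thesis using D C by simp
    qed
    moreover have "z \<in> C" "z \<in> R" using g C by auto
    ultimately show ?thesis using e by blast
  qed
  then show ?thesis using that[OF bij_betw_the_inv_into[OF bij]] by blast
qed

text \<open>Induction on the edges. If deleting \<open>{x, y}\<close> creates a separation of order
  below \<open>k\<close>, its overlap has exactly \<open>k - 1\<close> vertices. Adding
  \<open>x\<close> to the overlap gives the target on one side, adding \<open>y\<close> the source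
  on the other, and the two families are glued at the overlap and along the deleted edge.\<close>

theorem menger:
  assumes "finite V" "S \<subseteq> V" "T \<subseteq> V"
    and "\<And>A B. sepn V E A B \<Longrightarrow> S \<subseteq> A \<Longrightarrow> T \<subseteq> B \<Longrightarrow> k \<le> card (A \<inter> B)"
  shows "\<exists>F. card F = k \<and> finite F \<and> disjoint F \<and>
    (\<forall>C\<in>F. C \<subseteq> V \<and> conn E C \<and> C \<inter> S \<noteq> {} \<and> C \<inter> T \<noteq> {})"
proof -
  have "finite {e\<in>E. e \<subseteq> V}" using assms(1) by (auto intro: finite_subset[of _ "Pow V"])
  then show ?thesis using assms
  proof (induction "card {e\<in>E. e \<subseteq> V}" arbitrary: E V S T rule: less_induct)
    case less
    show ?case
    proof (cases "\<exists>x\<in>V. \<exists>y\<in>V. x \<noteq> y \<and> {x, y} \<in> E")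
      case False
      then have "{a, b} \<notin> E" if "a \<in> S - (T \<union> (V - S))" "b \<in> T \<union> (V - S) - S" for a b
        using that less.prems(3,4) by (metis DiffE DiffI Un_iff subsetD)
      moreover have "S \<union> (T \<union> (V - S)) = V" using less.prems(3,4) by blast
      ultimately have "sepn V E S (T \<union> (V - S))" unfolding sepn_def by blast
      then have "k \<le> card (S \<inter> (T \<union> (V - S)))" using less.prems(5) by simp
      moreover have "S \<inter> (T \<union> (V - S)) = S \<inter> T" by blast
      ultimately have "k \<le> card (S \<inter> T)" by simp
      then obtain R where R: "R \<subseteq> S \<inter> T" "card R = k" "finite R"
        by (rule obtain_subset_with_card_n)
      let ?F = "(\<lambda>v. {v}) ` R"
      have "card ?F = k" using R by (subst card_image) auto
      moreover have "disjoint ?F" by (auto simp: disjoint_def)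
      ultimately show ?thesis using R less.prems(3,4) by (intro exI[of _ ?F]) auto
    next
      case True
      then obtain p q where pq: "p \<in> V" "q \<in> V" "p \<noteq> q" "{p, q} \<in> E" by blast
      let ?E = "E - {{p, q}}"
      have fin: "finite {e\<in>?E. e \<subseteq> W}" if "W \<subseteq> V" for W
        using that less.prems(2) by (auto intro: finite_subset[of _ "Pow V"])
      have lt: "card {e\<in>?E. e \<subseteq> W} < card {e\<in>E. e \<subseteq> V}" if "W \<subseteq> V" for W
      proof (rule psubset_card_mono[OF less.prems(1)])
        show "{e\<in>?E. e \<subseteq> W} \<subset> {e\<in>E. e \<subseteq> V}" using that pq by auto
      qed
      show ?thesis
      proof (cases "\<forall>A B. sepn V ?E A B \<longrightarrow> S \<subseteq> A \<longrightarrow> T \<subseteq> B \<longrightarrow> k \<le> card (A \<inter> B)")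
        case True
        then obtain F where "card F = k" "finite F" "disjoint F"
          "\<forall>C\<in>F. C \<subseteq> V \<and> conn ?E C \<and> C \<inter> S \<noteq> {} \<and> C \<inter> T \<noteq> {}"
          using less.hyps[OF lt[OF order_refl] fin[OF order_refl] less.prems(2,3,4)] by blast
        then show ?thesis using conn_mono[of ?E _ E] by (metis Diff_subset)
      next
        case False
        then obtain A B where AB: "sepn V ?E A B" "S \<subseteq> A" "T \<subseteq> B" "card (A \<inter> B) < k" by force
        have "\<exists>x y. {p, q} = {x, y} \<and> x \<in> A - B \<and> y \<in> B - A"
        proof (rule ccontr)
          assume no: "\<not> ?thesis"
          have "sepn V E A B"
            unfolding sepn_def
          proof (intro conjI ballI notI)
            show "A \<union> B = V" using AB unfolding sepn_def by blast
            fix a b assume ab: "a \<in> A - B" "b \<in> B - A" "{a, b} \<in> E"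
            then have "{a, b} \<notin> ?E" using AB(1) unfolding sepn_def by blast
            then have "{a, b} = {p, q}" using ab by simp
            then show False using no ab by metis
          qed
          then show False using less.prems(5)[OF _ AB(2,3)] AB(4) by simp
        qed
        then obtain x y where xy0: "{p, q} = {x, y}" "x \<in> A - B" "y \<in> B - A" by blast
        have xy: "{x, y} \<in> E" "\<And>a b. {a, b} \<in> E \<Longrightarrow> {a, b} \<notin> ?E \<Longrightarrow> {a, b} = {x, y}"
          "x \<in> A - B" "y \<in> B - A" using xy0 pq(4) by auto
        have finA: "finite A" "finite B" "A \<subseteq> V" "B \<subseteq> V"
          using AB less.prems(2) unfolding sepn_def by (auto intro: finite_subset)
        let ?Z = "A \<inter> B"
        let ?X = "insert x ?Z" and ?Y = "insert y ?Z"
        have sE: "{a, b} \<in> E \<Longrightarrow> a \<in> A - B \<Longrightarrow> b \<in> B - A \<Longrightarrow> a = x \<and> b = y" for a b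
        proof -
          assume a: "{a, b} \<in> E" "a \<in> A - B" "b \<in> B - A"
          then have "{a, b} \<notin> ?E" using AB(1) unfolding sepn_def by blast
          then have "{a, b} = {x, y}" using xy(2) a(1) by blast
          then show ?thesis using a xy(3,4) by (auto simp: doubleton_eq_iff)
        qed
        have AV: "A \<union> B = V" using AB unfolding sepn_def by blast
        \<comment> \<open>Moving \<open>x\<close> into \<open>B\<close> repairs the separation in
          the full graph at the price of one vertex in the overlap, so the order was exactly
          \<open>k - 1\<close>.\<close>
        have "{a, b} \<notin> E" if "a \<in> A - insert x B" "b \<in> insert x B - A" for a b
          using sE[of a b] that xy(3) by auto
        moreover have "A \<union> insert x B = V" using AV xy(3) by blast
        ultimately have "sepn V E A (insert x B)" unfolding sepn_def by blast
        then have "k \<le> card (A \<inter> insert x B)" by (rule less.prems(5)) (use AB in auto)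
        moreover have "A \<inter> insert x B = ?X" using xy(3,4) by blast
        moreover have "card ?X = Suc (card ?Z)" "card ?Y = Suc (card ?Z)" using xy(3,4) finA by auto
        ultimately have kX: "card ?X = k" "card ?Y = k" using AB(4) by auto
        \<comment> \<open>A separation of \<open>A\<close> becomes one of the whole graph when
          \<open>B\<close> joins its far side. The deleted edge cannot cross it, because
          \<open>x\<close> is on the far side too.\<close>
        have 1: "k \<le> card (A' \<inter> B')" if s: "sepn A ?E A' B'" "S \<subseteq> A'" "?X \<subseteq> B'" for A' B'
        proof -
          have "{a, b} \<notin> E" if ab: "a \<in> A' - (B' \<union> B)" "b \<in> B' \<union> B - A'" for a b
          proof
            assume e: "{a, b} \<in> E"
            have aA: "a \<in> A - B" "a \<in> A' - B'" using ab s unfolding sepn_def by auto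
            show False
            proof (cases "b \<in> B - A")
              case True
              then show False using sE[OF e aA(1)] ab s(3) by blast
            next
              case False
              then have b: "b \<in> B' - A'" using ab s(3) unfolding sepn_def by auto
              then have "{a, b} \<notin> ?E" using aA s(1) unfolding sepn_def by blast
              then have "{a, b} = {x, y}" using xy(2) e by blast
              then show False using aA s(3) xy(4) unfolding doubleton_eq_iff by auto
            qed
          qed
          moreover have "A' \<union> (B' \<union> B) = V" using s AV unfolding sepn_def by blast
          ultimately have "sepn V E A' (B' \<union> B)" unfolding sepn_def by blast
          then have "k \<le> card (A' \<inter> (B' \<union> B))" by (rule less.prems(5)) (use s AB in auto)
          moreover have "A' \<inter> (B' \<union> B) = A' \<inter> B'" using s unfolding sepn_def by blast
          ultimately show ?thesis by simp
        qed
        have 2: "k \<le> card (A' \<inter> B')" if s: "sepn B ?E A' B'" "?Y \<subseteq> A'" "T \<subseteq> B'" for A' B'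
        proof -
          have "{a, b} \<notin> E" if ab: "a \<in> A' \<union> A - B'" "b \<in> B' - (A' \<union> A)" for a b
          proof
            assume e: "{a, b} \<in> E"
            have bB: "b \<in> B - A" "b \<in> B' - A'" using ab s unfolding sepn_def by auto
            show False
            proof (cases "a \<in> A - B")
              case True
              then show False using sE[OF e _ bB(1)] ab s(2) by blast
            next
              case False
              then have a: "a \<in> A' - B'" using ab s(2) unfolding sepn_def by auto
              then have "{a, b} \<notin> ?E" using bB s(1) unfolding sepn_def by blast
              then have "{a, b} = {x, y}" using xy(2) e by blast
              then show False using bB s(2) xy(3) a unfolding doubleton_eq_iff by auto
            qed
          qed
          moreover have "(A' \<union> A) \<union> B' = V" using s AV unfolding sepn_def by blast
          ultimately have "sepn V E (A' \<union> A) B'" unfolding sepn_def by blast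
          then have "k \<le> card ((A' \<union> A) \<inter> B')" by (rule less.prems(5)) (use s AB in auto)
          moreover have "(A' \<union> A) \<inter> B' = A' \<inter> B'" using s unfolding sepn_def by blast
          ultimately show ?thesis by simp
        qed
        have XA: "?X \<subseteq> A" and YB: "?Y \<subseteq> B" using xy(3,4) by auto
        obtain F where F: "card F = k" "finite F" "disjoint F"
          "\<forall>C\<in>F. C \<subseteq> A \<and> conn ?E C \<and> C \<inter> S \<noteq> {} \<and> C \<inter> ?X \<noteq> {}"
          using less.hyps[OF lt[OF finA(3)] fin[OF finA(3)] finA(1) AB(2) XA 1] by blast
        obtain G where G: "card G = k" "finite G" "disjoint G"
          "\<forall>C\<in>G. C \<subseteq> B \<and> conn ?E C \<and> C \<inter> ?Y \<noteq> {} \<and> C \<inter> T \<noteq> {}"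
          using less.hyps[OF lt[OF finA(4)] fin[OF finA(4)] finA(2) YB AB(3) 2] by blast
        have cX: "card F = card ?X" "card G = card ?Y" using kX F(1) G(1) by auto
        have finX: "finite ?X" "finite ?Y" using finA by auto
        obtain f where f: "bij_betw f ?X F" "\<And>z. z \<in> ?X \<Longrightarrow> f z \<inter> ?X = {z}"
          by (rule disjoint_transversal[OF finX(1) cX(1) F(2,3)]) (use F(4) in auto)
        obtain g where g: "bij_betw g ?Y G" "\<And>z. z \<in> ?Y \<Longrightarrow> g z \<inter> ?Y = {z}"
          by (rule disjoint_transversal[OF finX(2) cX(2) G(2,3)]) (use G(4) in auto)
        \<comment> \<open>Matches the two cut sets: the deleted edge leads from \<open>x\<close> to
          \<open>y\<close>, every other cut vertex is common to both.\<close>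
        define \<phi> where "\<phi> z = (if z = x then y else z)" for z
        have \<phi>: "z \<in> ?X \<Longrightarrow> \<phi> z \<in> ?Y" for z by (auto simp: \<phi>_def)
        have \<phi>inj: "z \<in> ?X \<Longrightarrow> w \<in> ?X \<Longrightarrow> \<phi> z = \<phi> w \<Longrightarrow> z = w" for z w
          using xy(3,4) by (auto simp: \<phi>_def split: if_splits)
        define H where "H z = f z \<union> g (\<phi> z)" for z
        have fA: "z \<in> ?X \<Longrightarrow> f z \<in> F" for z using f(1) unfolding bij_betw_def by blast
        have gG: "z \<in> ?Y \<Longrightarrow> g z \<in> G" for z using g(1) unfolding bij_betw_def by blast
        have fz: "f z \<subseteq> A \<and> conn E (f z) \<and> f z \<inter> S \<noteq> {} \<and> z \<in> f z" if "z \<in> ?X" for z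
          using F(4)[rule_format, OF fA[OF that]] f(2)[OF that] conn_mono[of ?E "f z" E] by blast
        have gz: "g z \<subseteq> B \<and> conn E (g z) \<and> g z \<inter> T \<noteq> {} \<and> z \<in> g z" if "z \<in> ?Y" for z
          using G(4)[rule_format, OF gG[OF that]] g(2)[OF that] conn_mono[of ?E "g z" E] by blast
        have ff: "f z \<inter> f w = {}" if "z \<in> ?X" "w \<in> ?X" "z \<noteq> w" for z w
          using disjointD[OF F(3) fA[OF that(1)] fA[OF that(2)]] that f(1)
          unfolding bij_betw_def inj_on_def by metis
        have gg: "g z \<inter> g w = {}" if "z \<in> ?Y" "w \<in> ?Y" "z \<noteq> w" for z w
          using disjointD[OF G(3) gG[OF that(1)] gG[OF that(2)]] that g(1)
          unfolding bij_betw_def inj_on_def by metis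
        have fg: "f z \<inter> g w \<subseteq> {z} \<inter> {w}" if "z \<in> ?X" "w \<in> ?Y" for z w
        proof -
          have "f z \<inter> g w \<subseteq> ?Z" using fz[OF that(1)] gz[OF that(2)] by blast
          moreover have "f z \<inter> ?X = {z}" "g w \<inter> ?Y = {w}" using f(2)[OF that(1)] g(2)[OF that(2)] .
          ultimately show ?thesis by blast
        qed
        have dis: "H z \<inter> H w = {}" if zw: "z \<in> ?X" "w \<in> ?X" "z \<noteq> w" for z w
        proof -
          have "f z \<inter> f w = {}" using ff zw by blast
          moreover have "g (\<phi> z) \<inter> g (\<phi> w) = {}" using gg \<phi> \<phi>inj zw by metis
          moreover have "f z \<inter> g (\<phi> w) = {}"
          proof -
            have "f z \<inter> g (\<phi> w) \<subseteq> {z} \<inter> {\<phi> w}" using fg zw \<phi> by blast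
            moreover have "z \<noteq> \<phi> w" using zw xy(3,4) by (auto simp: \<phi>_def)
            ultimately show ?thesis by blast
          qed
          moreover have "f w \<inter> g (\<phi> z) = {}"
          proof -
            have "f w \<inter> g (\<phi> z) \<subseteq> {w} \<inter> {\<phi> z}" using fg zw \<phi> by blast
            moreover have "w \<noteq> \<phi> z" using zw xy(3,4) by (auto simp: \<phi>_def)
            ultimately show ?thesis by blast
          qed
          ultimately show ?thesis unfolding H_def by blast
        qed
        have phix: "\<phi> x = y" by (simp add: \<phi>_def)
        have Hprop: "H z \<subseteq> V \<and> conn E (H z) \<and> H z \<inter> S \<noteq> {} \<and> H z \<inter> T \<noteq> {}" if z: "z \<in> ?X" for z
        proof -
          have "conn E (H z)"
          proof (cases "z = x")
            case True
            have "conn E (f x \<union> g y)"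
              by (rule conn_Un_edge[of _ _ _ x y]) (use fz[of x] gz[of y] xy(1) in auto)
            then show ?thesis using True phix by (simp add: H_def)
          next
            case False
            then have zZ: "z \<in> ?Z" "\<phi> z = z" using z by (auto simp: \<phi>_def)
            have "conn E (f z \<union> g z)"
              by (rule conn_Un) (use zZ(1) fz[of z] gz[of z] in auto)
            then show ?thesis using zZ by (simp add: H_def)
          qed
          then show ?thesis unfolding H_def using fz[OF z] gz[OF \<phi>[OF z]] finA(3,4) by blast
        qed
        have inj: "inj_on H ?X"
        proof (rule inj_onI, rule ccontr)
          fix z w assume "z \<in> ?X" "w \<in> ?X" "H z = H w" "z \<noteq> w"
          then have "H z = {}" using dis by blast
          then show False using Hprop[OF \<open>z \<in> ?X\<close>] by blast
        qed
        have "card (H ` ?X) = k" by (simp only: card_image[OF inj] kX)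
        moreover have "disjoint (H ` ?X)" using dis unfolding disjoint_def by blast
        moreover have "finite (H ` ?X)" using finA by simp
        ultimately show ?thesis using Hprop by (intro exI[of _ "H ` ?X"]) blast
      qed
    qed
  qed
qed

text \<open>\<open>F\<close> is a set of maximal deficiency.\<close>

lemma hall_deficiency:
  fixes A :: "'i \<Rightarrow> 'a set"
  assumes fin: "finite I" "\<And>i. i \<in> I \<Longrightarrow> finite (A i)"
  obtains F I' \<phi> where "F \<subseteq> I" "I' \<subseteq> I" "inj_on \<phi> I'" "\<And>i. i \<in> I' \<Longrightarrow> \<phi> i \<in> A i"
    "I - I' \<subseteq> F" "\<phi> ` (I' \<inter> F) = \<Union> (A ` F)"
proof -
  define d where "d J = int (card J) - int (card (\<Union> (A ` J)))" for J
  have fp: "finite (d ` Pow I)" "d ` Pow I \<noteq> {}" using fin by auto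
  obtain F where F: "F \<subseteq> I" "d F = Max (d ` Pow I)" using Max_in[OF fp] by auto
  have dmax: "d J \<le> d F" if "J \<subseteq> I" for J using F(2) Max_ge[OF fp(1)] that by simp
  have d0: "0 \<le> d F" using dmax[of "{}"] by (simp add: d_def)
  \<comment> \<open>The size of a maximum matching predicted by the deficiency; Menger's theorem in
    the bipartite incidence graph supplies such a matching.\<close>
  define k where "k = nat (int (card I) - d F)"
  define V where "V = Inl ` I \<union> Inr ` (\<Union> (A ` I))"
  define E :: "('i + 'a) set set" where "E = {{Inl i, Inr a} |i a. i \<in> I \<and> a \<in> A i}"
  have finV: "finite V" using fin by (auto simp: V_def)
  have "k \<le> card (P \<inter> Q)" if PQ: "sepn V E P Q" "Inl ` I \<subseteq> P" "Inr ` (\<Union> (A ` I)) \<subseteq> Q" for P Q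
  proof -
    \<comment> \<open>Indices strictly on the left force all their elements into the overlap, and
      the remaining indices lie in it themselves; both parts together have at least \<open>k\<close>
      members.\<close>
    define J where "J = {i\<in>I. Inl i \<notin> Q}"
    have JI: "J \<subseteq> I" by (auto simp: J_def)
    have nb: "Inr a \<in> P" if "i \<in> J" "a \<in> A i" for i a
    proof (rule ccontr)
      assume "Inr a \<notin> P"
      then have "Inr a \<in> Q - P" "Inl i \<in> P - Q" using that PQ by (auto simp: J_def)
      then have "{Inl i, Inr a} \<notin> E" using PQ(1) unfolding sepn_def by blast
      then show False using that by (auto simp: E_def J_def)
    qed
    have "Inl ` (I - J) \<union> Inr ` (\<Union> (A ` J)) \<subseteq> P \<inter> Q"
      using PQ(2,3) nb by (auto simp: J_def)
    moreover have "finite (P \<inter> Q)"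
      using PQ(1) finV unfolding sepn_def by (metis finite_Int finite_Un)
    ultimately have "card (Inl ` (I - J) \<union> Inr ` (\<Union> (A ` J)) :: ('i + 'a) set) \<le> card (P \<inter> Q)"
      by (simp add: card_mono)
    moreover have "finite J" "finite (\<Union> (A ` J))" using fin JI by (auto intro: finite_subset)
    then have "card (Inl ` (I - J) \<union> Inr ` (\<Union> (A ` J)) :: ('i + 'a) set) = card (I - J) + card (\<Union> (A ` J))"
      using fin(1) by (subst card_Un_disjoint) (auto simp: card_image)
    moreover have "card (I - J) = card I - card J" "card J \<le> card I"
      using JI fin(1) by (auto intro: card_Diff_subset card_mono finite_subset)
    ultimately show ?thesis using dmax[OF JI] unfolding k_def d_def by linarith
  qed
  then obtain \<C> where C: "card \<C> = k" "finite \<C>" "disjoint \<C>"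
    "\<forall>C\<in>\<C>. C \<subseteq> V \<and> conn E C \<and> C \<inter> Inl ` I \<noteq> {} \<and> C \<inter> Inr ` (\<Union> (A ` I)) \<noteq> {}"
    using menger[OF finV, of "Inl ` I" "Inr ` (\<Union> (A ` I))" E k] by (auto simp: V_def)
  have "\<forall>C\<in>\<C>. \<exists>i a. i \<in> I \<and> a \<in> A i \<and> Inl i \<in> C \<and> Inr a \<in> C"
  proof
    fix C assume "C \<in> \<C>"
    then have c: "conn E C" "C \<inter> Inl ` I \<noteq> {}" "C \<inter> Inr ` (\<Union> (A ` I)) \<noteq> {}" using C(4) by auto
    then have ne: "C \<inter> Inl ` I \<noteq> C" by blast
    obtain u v where "u \<in> C \<inter> Inl ` I" "v \<in> C - C \<inter> Inl ` I" "{u, v} \<in> E"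
      using conn_cut[OF c(1) _ c(2) ne] by blast
    then show "\<exists>i a. i \<in> I \<and> a \<in> A i \<and> Inl i \<in> C \<and> Inr a \<in> C"
      unfolding E_def by (auto simp: doubleton_eq_iff)
  qed
  then obtain i a where ia: "\<And>C. C \<in> \<C> \<Longrightarrow> i C \<in> I \<and> a C \<in> A (i C) \<and> Inl (i C) \<in> C \<and> Inr (a C) \<in> C"
    by metis
  have dis: "C = D" if "C \<in> \<C>" "D \<in> \<C>" "x \<in> C" "x \<in> D" for C D x
    using disjointD[OF C(3)] that by blast
  have inji: "inj_on i \<C>" by (rule inj_onI) (metis dis ia)
  have inja: "inj_on a \<C>" by (rule inj_onI) (metis dis ia)
  define \<phi> where "\<phi> j = a (the_inv_into \<C> i j)" for j
  have phi: "\<phi> (i C) = a C" if "C \<in> \<C>" for C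
    using that inji by (simp add: \<phi>_def the_inv_into_f_f)
  let ?I = "i ` \<C>"
  have I': "?I \<subseteq> I" using ia by auto
  have injphi: "inj_on \<phi> ?I" using phi inja inji by (auto simp: inj_on_def)
  have phiA: "\<phi> j \<in> A j" if "j \<in> ?I" for j using that phi ia by auto
  have cI: "card ?I = k" using inji C by (simp add: card_image)
  have finF: "finite F" "finite ?I" "finite (\<Union> (A ` F))" using F fin C by (auto intro: finite_subset)
  have sub: "\<phi> ` (?I \<inter> F) \<subseteq> \<Union> (A ` F)" using phiA by auto
  have c1: "card (?I \<inter> F) \<le> card (\<Union> (A ` F))"
    using card_mono[OF finF(3) sub] card_image[OF inj_on_subset[OF injphi, of "?I \<inter> F"]] by auto
  have c2: "card (I - ?I) = card I - k" "k \<le> card I"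
    using I' cI fin(1) finF by (auto simp: card_Diff_subset intro: card_mono)
  have c3: "card F = card (?I \<inter> F) + card (F - ?I)"
    using finF by (metis card_Diff_subset_Int card_Int_Diff inf_commute finite_Int)
  have c4: "F - ?I \<subseteq> I - ?I" using F by auto
  then have c5: "card (F - ?I) \<le> card (I - ?I)" using fin by (auto intro: card_mono)
  have dF: "d F = int (card F) - int (card (\<Union> (A ` F)))" by (simp add: d_def)
  \<comment> \<open>The counts leave no slack: every unmatched index lies in \<open>F\<close>, and
    the matched indices of \<open>F\<close> use up the whole union of its sets.\<close>
  have "card (I - ?I) \<le> nat (d F)" using c2 d0 unfolding k_def by linarith
  then have e: "card (F - ?I) = card (I - ?I)" "card (?I \<inter> F) = card (\<Union> (A ` F))"
    using c1 c3 c5 dF d0 by linarith+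
  have "F - ?I = I - ?I" using c4 e(1) fin by (intro card_subset_eq) auto
  then have "I - ?I \<subseteq> F" by auto
  moreover have "\<phi> ` (?I \<inter> F) = \<Union> (A ` F)"
    using sub e(2) finF card_image[OF inj_on_subset[OF injphi, of "?I \<inter> F"]]
    by (intro card_subset_eq) auto
  ultimately show ?thesis using that[OF F(1) I' injphi phiA] by blast
qed

section \<open>Linkages in dense graphs\<close>

definition nbrs :: "'a set set \<Rightarrow> 'a set \<Rightarrow> 'a \<Rightarrow> 'a set" where
  "nbrs E W v = {w \<in> W. {v, w} \<in> E}"

definition terminals :: "'i set \<Rightarrow> ('i \<Rightarrow> 'a) \<Rightarrow> ('i \<Rightarrow> 'a) \<Rightarrow> bool" where
  "terminals I s t \<longleftrightarrow> inj_on s I \<and> inj_on t I \<and> s ` I \<inter> t ` I = {}"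

text \<open>Connected sets in place of paths. Each of them avoids the terminals of the other pairs,
  because those lie in sets disjoint from it.\<close>

definition linkable :: "'a set \<Rightarrow> 'a set set \<Rightarrow> 'i set \<Rightarrow> ('i \<Rightarrow> 'a) \<Rightarrow> ('i \<Rightarrow> 'a) \<Rightarrow> bool" where
  "linkable W E I s t \<longleftrightarrow> (\<exists>U. (\<forall>i\<in>I. U i \<subseteq> W \<and> conn E (U i) \<and> s i \<in> U i \<and> t i \<in> U i) \<and>
     (\<forall>i\<in>I. \<forall>j\<in>I. i \<noteq> j \<longrightarrow> U i \<inter> U j = {}))"

lemma nbrs_sub: "nbrs E W v \<subseteq> W"
  by (auto simp: nbrs_def)

lemma nbrs_iff: "w \<in> nbrs E W v \<longleftrightarrow> w \<in> W \<and> {v, w} \<in> E"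
  by (simp add: nbrs_def)

lemma no_loop: "\<forall>e\<in>E. card e = 2 \<Longrightarrow> {v, w} \<in> E \<Longrightarrow> v \<noteq> w"
  by force

lemma terminals_distinct:
  assumes "terminals I s t" "i \<in> I" "j \<in> I"
  shows "s i \<noteq> t j" "i \<noteq> j \<Longrightarrow> s i \<noteq> s j" "i \<noteq> j \<Longrightarrow> t i \<noteq> t j"
  using assms unfolding terminals_def inj_on_def by auto

lemma card_terminals: "terminals I s t \<Longrightarrow> finite I \<Longrightarrow> card (s ` I \<union> t ` I) = 2 * card I"
  unfolding terminals_def by (subst card_Un_disjoint) (auto simp: card_image)

lemma linkableI:
  assumes "terminals I s t"
    and "\<And>i. i \<in> I \<Longrightarrow> s i \<in> W \<and> t i \<in> W \<and> Q i \<subseteq> W - (s ` I \<union> t ` I) \<and> conn E ({s i, t i} \<union> Q i)"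
    and "\<And>i j. i \<in> I \<Longrightarrow> j \<in> I \<Longrightarrow> i \<noteq> j \<Longrightarrow> Q i \<inter> Q j = {}"
  shows "linkable W E I s t"
  unfolding linkable_def
proof (intro exI[of _ "\<lambda>i. {s i, t i} \<union> Q i"] conjI ballI impI)
  fix i j assume ij: "i \<in> I" "j \<in> I" "i \<noteq> j"
  have "s i \<notin> Q j" "t i \<notin> Q j" "s j \<notin> Q i" "t j \<notin> Q i" using assms(2) ij by auto
  then show "({s i, t i} \<union> Q i) \<inter> ({s j, t j} \<union> Q j) = {}"
    using assms(3)[OF ij] terminals_distinct[OF assms(1) ij(1,2)] terminals_distinct[OF assms(1) ij(2,1)] ij(3)
    by auto
qed (use assms(2) in auto)

text \<open>Pairs without a private common neighbour form a deficient set \<open>F\<close>; its common neighbours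
  \<open>AF\<close> are used up by other pairs of \<open>F\<close>, and the remaining pairs of \<open>F\<close> are joined by paths of
  length three outside \<open>AF\<close>, every vertex of which misses a terminal of each pair in \<open>F\<close>.\<close>

lemma dense_linkable:
  fixes s t :: "'i \<Rightarrow> 'a"
  assumes fin: "finite C" "finite I" and loop: "\<forall>e\<in>E. card e = 2"
    and trm: "terminals I s t" "s ` I \<union> t ` I \<subseteq> C"
    and deg: "\<And>v. v \<in> C \<Longrightarrow> card C + q \<le> 2 * card (nbrs E C v)"
    and q: "5 * card I \<le> 2 * q + 8" and size: "3 * card I \<le> card C"
  shows "linkable C E I s t"
proof -
  define X where "X = s ` I \<union> t ` I"
  define l where "l = card I"
  define \<Omega> where "\<Omega> = {i\<in>I. {s i, t i} \<notin> E}"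
  define A where "A i = nbrs E C (s i) \<inter> nbrs E C (t i) - X" for i
  have XC: "X \<subseteq> C" "finite X" "card X = 2 * l"
    using trm fin card_terminals[OF trm(1)] by (auto simp: X_def l_def)
  have fO: "finite \<Omega>" "\<Omega> \<subseteq> I" using fin by (auto simp: \<Omega>_def)
  have finA: "finite (A i)" for i
    unfolding A_def by (rule finite_subset[OF _ fin(1)]) (auto simp: nbrs_def)
  obtain F \<Omega>' \<phi> where F: "F \<subseteq> \<Omega>" "\<Omega>' \<subseteq> \<Omega>" "inj_on \<phi> \<Omega>'" "\<And>i. i \<in> \<Omega>' \<Longrightarrow> \<phi> i \<in> A i"
    "\<Omega> - \<Omega>' \<subseteq> F" "\<phi> ` (\<Omega>' \<inter> F) = \<Union> (A ` F)"
    by (rule hall_deficiency[OF fO(1), where A = A]) (use finA in auto)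
  define AF where "AF = \<Union> (A ` F)"
  define W where "W = C - X - AF"
  define L where "L = \<Omega> - \<Omega>'"
  define f a where "f = card F" and "a = card AF"
  have finF: "finite F" "finite \<Omega>'" "finite L" using F fO by (auto simp: L_def intro: finite_subset)
  have AFC: "AF \<subseteq> C - X" by (auto simp: AF_def A_def nbrs_def)
  have AFf: "finite AF" unfolding AF_def by (rule finite_UN_I[OF finF(1) finA])
  have a_eq: "a = card (\<Omega>' \<inter> F)"
    using F(6) card_image[OF inj_on_subset[OF F(3), of "\<Omega>' \<inter> F"]] by (simp add: a_def AF_def)
  have LF: "L \<subseteq> F" "L = F - \<Omega>'" using F(1,5) by (auto simp: L_def)
  have cL: "f = a + card L" unfolding f_def a_eq LF(2)
    using card_Int_Diff[OF finF(1), of \<Omega>'] by (simp add: inf_commute)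
  have fl: "f \<le> l" unfolding f_def l_def using F(1) fO fin by (intro card_mono) auto
  have cW: "card W + 2 * l + a = card C"
  proof -
    have "card (C - X) = card C - card X" "card X \<le> card C"
      using card_Diff_subset[OF XC(2,1)] card_mono[OF fin(1) XC(1)] by auto
    moreover have "card W = card (C - X) - card AF" "card AF \<le> card (C - X)"
      using card_Diff_subset[OF AFf AFC] card_mono[OF _ AFC] fin(1) unfolding W_def by auto
    ultimately show ?thesis using XC by (simp add: a_def)
  qed
  have finW: "finite W" using fin by (simp add: W_def)
  have nb_s: "card (nbrs E C (s i)) + 2 \<le> card (nbrs E W (s i)) + a + 2 * l"
    and nb_t: "card (nbrs E C (t i)) + 2 \<le> card (nbrs E W (t i)) + a + 2 * l"
    if i: "i \<in> \<Omega>" for i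
  proof -
    have iI: "i \<in> I" "{s i, t i} \<notin> E" "{t i, s i} \<notin> E" using i by (auto simp: \<Omega>_def insert_commute)
    have st: "s i \<noteq> t i" "s i \<in> X" "t i \<in> X"
      using terminals_distinct(1)[OF trm(1) iI(1) iI(1)] iI by (auto simp: X_def)
    have X2: "card (X - {s i, t i}) + 2 = 2 * l"
    proof -
      have "card (X - {s i, t i}) = card X - card {s i, t i}"
        by (rule card_Diff_subset) (use st in auto)
      moreover have "card {s i, t i} \<le> card X" by (rule card_mono) (use st XC in auto)
      ultimately show ?thesis using st XC(3) by simp
    qed
    have gen: "card (nbrs E C v) + 2 \<le> card (nbrs E W v) + a + 2 * l"
      if "nbrs E C v \<inter> X \<subseteq> X - {s i, t i}" for v
    proof -
      have "nbrs E C v \<subseteq> nbrs E W v \<union> AF \<union> (X - {s i, t i})"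
        using that by (auto simp: nbrs_def W_def)
      then have "card (nbrs E C v) \<le> card (nbrs E W v \<union> AF \<union> (X - {s i, t i}))"
        using AFf XC finW by (intro card_mono) (auto simp: nbrs_def)
      also have "\<dots> \<le> card (nbrs E W v) + card AF + card (X - {s i, t i})"
        by (meson card_Un_le add_le_mono1 order_trans)
      finally show ?thesis using X2 by (simp add: a_def)
    qed
    show "card (nbrs E C (s i)) + 2 \<le> card (nbrs E W (s i)) + a + 2 * l"
      by (rule gen) (use iI(2) no_loop[OF loop, of "s i" "s i"] in \<open>auto simp: nbrs_def\<close>)
    show "card (nbrs E C (t i)) + 2 \<le> card (nbrs E W (t i)) + a + 2 * l"
      by (rule gen) (use iI(3) no_loop[OF loop, of "t i" "t i"] in \<open>auto simp: nbrs_def\<close>)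
  qed
  have sep: "nbrs E W (s i) \<inter> nbrs E W (t i) = {}" if "i \<in> F" for i
    using that by (auto simp: W_def AF_def A_def nbrs_def)
  have sC: "s i \<in> C" "t i \<in> C" if "i \<in> \<Omega>" for i using that trm(2) by (auto simp: \<Omega>_def)
  \<comment> \<open>The two terminals of a pair in \<open>F\<close> have disjoint neighbourhoods in
    \<open>W\<close>, although together they see at least \<open>card C + q\<close> vertices of
    \<open>C\<close>; the surplus must be absorbed by \<open>AF\<close> and the other
    terminals.\<close>
  have a_ge: "q + 4 \<le> a + 2 * l" if "i \<in> F" for i
  proof -
    have i: "i \<in> \<Omega>" using that F(1) by blast
    have "card (nbrs E W (s i)) + card (nbrs E W (t i)) \<le> card W"
      using sep[OF that] finW
      by (subst card_Un_disjoint[symmetric]) (auto simp: nbrs_def intro!: card_mono)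
    then show ?thesis using nb_s[OF i] nb_t[OF i] deg[OF sC(1)[OF i]] deg[OF sC(2)[OF i]] cW by linarith
  qed
  \<comment> \<open>The map \<open>z\<close> picks from every pair of \<open>F\<close> a terminal
    not adjacent to \<open>w\<close>. It is injective because the pairs are disjoint.\<close>
  have miss: "card (nbrs E X w) + f \<le> 2 * l" if w: "w \<in> W" for w
  proof -
    define z where "z j = (if {w, s j} \<in> E then t j else s j)" for j
    have z: "z j \<in> X - nbrs E X w" if "j \<in> F" for j
      using sep[OF that] w that F(1) fO(2) by (auto simp: z_def nbrs_def X_def insert_commute)
    have "inj_on z F"
    proof (rule inj_onI)
      fix i j assume ij: "i \<in> F" "j \<in> F" "z i = z j"
      then have I: "i \<in> I" "j \<in> I" using F(1) fO(2) by auto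
      show "i = j"
        using ij(3) terminals_distinct[OF trm(1) I] terminals_distinct[OF trm(1) I(2,1)]
        unfolding z_def by (metis (full_types))
    qed
    then have "f = card (z ` F)" by (simp add: f_def card_image)
    also have "\<dots> \<le> card (X - nbrs E X w)" using z XC(2) by (intro card_mono) auto
    also have "\<dots> = 2 * l - card (nbrs E X w)"
      using XC nbrs_sub[of E X w] by (simp add: card_Diff_subset finite_subset)
    finally show ?thesis using card_mono[OF XC(2) nbrs_sub[of E X w]] XC(3) by linarith
  qed
  have split: "card (nbrs E C w) \<le> card (nbrs E W w) + a + card (nbrs E X w)" for w
  proof -
    have "nbrs E C w \<subseteq> nbrs E W w \<union> AF \<union> nbrs E X w" by (auto simp: nbrs_def W_def)
    then have "card (nbrs E C w) \<le> card (nbrs E W w \<union> AF \<union> nbrs E X w)"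
      using AFf XC finW by (intro card_mono) (auto simp: nbrs_def)
    also have "\<dots> \<le> card (nbrs E W w) + card AF + card (nbrs E X w)"
      by (meson card_Un_le add_le_mono1 order_trans)
    finally show ?thesis by (simp add: a_def)
  qed
  have nW: "card (nbrs E W w) + 1 \<le> card W" if "w \<in> W" for w
  proof -
    have "nbrs E W w \<subseteq> W - {w}" using no_loop[OF loop, of w w] by (auto simp: nbrs_def)
    then have "card (nbrs E W w) \<le> card (W - {w})" using finW by (intro card_mono) auto
    then show ?thesis using card_Suc_Diff1[OF finW that] by linarith
  qed
  have n_ge: "q + 2 + 2 * f \<le> card C" if "L \<noteq> {}"
  proof -
    have "0 < card L" using that finF by (simp add: card_gt_0_iff)
    then have "a < l" using cL fl by linarith
    then have "0 < card W" using cW size by (simp add: l_def)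
    then obtain w where w: "w \<in> W" by fastforce
    have "w \<in> C" using w by (simp add: W_def)
    then show ?thesis using deg[of w] miss[OF w] split[of w] nW[OF w] cW by linarith
  qed
  have cO: "card (\<phi> ` (\<Omega>' - F)) + f \<le> l"
  proof -
    have "card (\<phi> ` (\<Omega>' - F)) \<le> card (\<Omega>' - F)" using finF by (intro card_image_le) auto
    also have "\<dots> \<le> card (I - F)" using F(2) fO fin by (intro card_mono) auto
    also have "\<dots> = l - f" using F(1) fO(2) fin(2) by (auto simp: f_def l_def card_Diff_subset finite_subset)
    finally show ?thesis using fl by linarith
  qed
  \<comment> \<open>Greedy choice of the middle edges of the paths of length three, avoiding earlier
    ones and the vertices reserved for pairs outside \<open>F\<close>. The vertices reserved inside
    \<open>F\<close> form \<open>AF\<close> and are not in \<open>W\<close>.\<close>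
  have "\<exists>R. (\<forall>i\<in>K. R i \<subseteq> W - \<phi> ` (\<Omega>' - F) \<and> card (R i) \<le> 2 \<and> conn E ({s i, t i} \<union> R i)) \<and>
      (\<forall>i\<in>K. \<forall>j\<in>K. i \<noteq> j \<longrightarrow> R i \<inter> R j = {})" if "K \<subseteq> L" for K
    using finite_subset[OF that finF(3)] that
  proof (induction K rule: finite_induct)
    case (insert i K)
    have KL: "K \<subseteq> L" using insert.prems by blast
    obtain R where R0: "\<forall>j\<in>K. R j \<subseteq> W - \<phi> ` (\<Omega>' - F) \<and> card (R j) \<le> 2 \<and> conn E ({s j, t j} \<union> R j)"
      "\<forall>j\<in>K. \<forall>j'\<in>K. j \<noteq> j' \<longrightarrow> R j \<inter> R j' = {}"
      using insert.IH[OF KL] by (elim exE conjE)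
    note R = R0(1)[rule_format] R0(2)[rule_format]
    have iF: "i \<in> F" "i \<in> \<Omega>" "L \<noteq> {}" using insert LF F(1) by auto
    define U where "U = \<phi> ` (\<Omega>' - F) \<union> \<Union> (R ` K)"
    have finR: "finite (R j)" if "j \<in> K" for j using R(1)[OF that] finW by (meson finite_Diff finite_subset)
    have finU: "finite U" using finF insert finR by (auto simp: U_def)
    have "card (\<Union> (R ` K)) \<le> (\<Sum>j\<in>K. card (R j))" using insert by (intro card_UN_le)
    also have "\<dots> \<le> (\<Sum>j\<in>K. 2)" using R by (intro sum_mono) auto
    finally have "card (\<Union> (R ` K)) \<le> 2 * card K" by simp
    moreover have "card (insert i K) \<le> card L" using insert finF by (intro card_mono) auto
    then have "card K + 1 \<le> card L" using insert by simp
    moreover have "card U \<le> card (\<phi> ` (\<Omega>' - F)) + card (\<Union> (R ` K))" unfolding U_def by (rule card_Un_le)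
    ultimately have cU: "card U + f + 2 \<le> l + 2 * card L" using cO by linarith
    have "card U < card (nbrs E W (s i))"
      using cU n_ge[OF iF(3)] a_ge[OF iF(1)] nb_s[OF iF(2)] deg[OF sC(1)[OF iF(2)]] q cL
      unfolding l_def[symmetric] by linarith
    then have "\<not> nbrs E W (s i) \<subseteq> U" using card_mono[OF finU, of "nbrs E W (s i)"] by linarith
    then obtain w where w: "w \<in> nbrs E W (s i)" "w \<notin> U" by blast
    have wW: "w \<in> W" "w \<in> C" using w by (auto simp: nbrs_def W_def)
    \<comment> \<open>Inclusion and exclusion inside \<open>W - {w}\<close>: \<open>t i\<close> and
      \<open>w\<close> have more common neighbours than there are blocked vertices, so the path from
      \<open>s i\<close> through \<open>w\<close> can be closed.\<close>
    have "nbrs E W (t i) \<union> nbrs E W w \<subseteq> W - {w}"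
      using sep[OF iF(1)] w no_loop[OF loop, of w w] by (auto simp: nbrs_def)
    then have "card (nbrs E W (t i) \<union> nbrs E W w) \<le> card (W - {w})" using finW by (intro card_mono) auto
    moreover have "card (W - {w}) + 1 = card W" using card_Suc_Diff1[OF finW wW(1)] by linarith
    moreover have "card (nbrs E W (t i)) + card (nbrs E W w) =
        card (nbrs E W (t i) \<union> nbrs E W w) + card (nbrs E W (t i) \<inter> nbrs E W w)"
      using finW by (intro card_Un_Int) (auto simp: nbrs_def)
    ultimately have "card U < card (nbrs E W (t i) \<inter> nbrs E W w)"
      using cU a_ge[OF iF(1)] nb_t[OF iF(2)] deg[OF sC(2)[OF iF(2)]] deg[OF wW(2)] q cL
        miss[OF wW(1)] split[of w] cW
      unfolding l_def[symmetric] by linarith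
    then have "\<not> nbrs E W (t i) \<inter> nbrs E W w \<subseteq> U" using card_mono[OF finU, of "nbrs E W (t i) \<inter> nbrs E W w"] by linarith
    then obtain w' where w': "w' \<in> nbrs E W (t i)" "w' \<in> nbrs E W w" "w' \<notin> U" by blast
    have c1: "conn E {s i, w}" "conn E {t i, w'}" using w w' by (auto simp: nbrs_def intro: conn_edge)
    have "conn E ({s i, w} \<union> {t i, w'})"
      by (rule conn_Un_edge[OF c1, of w w']) (use w' in \<open>auto simp: nbrs_def\<close>)
    then have c: "conn E ({s i, t i} \<union> {w, w'})" by (simp add: insert_commute)
    define R' where "R' = R(i := {w, w'})"
    have R'i: "R' i = {w, w'}" and R'j: "\<And>j. j \<in> K \<Longrightarrow> R' j = R j" using insert(2) by (auto simp: R'_def)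
    have dU: "{w, w'} \<inter> U = {}" "{w, w'} \<subseteq> W" using w w' by (auto simp: nbrs_def)
    have one: "R' j \<subseteq> W - \<phi> ` (\<Omega>' - F) \<and> card (R' j) \<le> 2 \<and> conn E ({s j, t j} \<union> R' j)" if "j \<in> insert i K" for j
    proof (cases "j = i")
      case True
      have "card {w, w'} \<le> 2" by (simp add: card_insert_if)
      then show ?thesis using True R'i c dU by (auto simp: U_def)
    qed (use that R(1) R'j in auto)
    have two: "R' j \<inter> R' j' = {}" if "j \<in> insert i K" "j' \<in> insert i K" "j \<noteq> j'" for j j'
    proof -
      have "{w, w'} \<inter> R j = {}" if "j \<in> K" for j using dU(1) that by (auto simp: U_def)
      then show ?thesis using that R(2) R'i R'j by (metis inf_commute insertE)
    qed
    show ?case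
      by (rule exI[of _ R'], rule conjI) (intro ballI one, assumption, intro ballI impI two)
  qed auto
  from this[OF order_refl] obtain R where
    R0: "\<forall>i\<in>L. R i \<subseteq> W - \<phi> ` (\<Omega>' - F) \<and> card (R i) \<le> 2 \<and> conn E ({s i, t i} \<union> R i)"
      "\<forall>i\<in>L. \<forall>j\<in>L. i \<noteq> j \<longrightarrow> R i \<inter> R j = {}" by (elim exE conjE)
  note R = R0(1)[rule_format] R0(2)[rule_format]
  define Q where "Q i = (if i \<in> L then R i else if i \<in> \<Omega>' then {\<phi> i} else {})" for i
  have phiA: "\<phi> i \<in> C - X \<and> conn E ({s i, t i} \<union> {\<phi> i})" if "i \<in> \<Omega>'" for i
  proof -
    have "\<phi> i \<in> A i" using F(4) that by blast
    then have "{s i, \<phi> i} \<in> E" "{\<phi> i, t i} \<in> E" "\<phi> i \<in> C - X" by (auto simp: A_def nbrs_def insert_commute)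
    moreover from this have "conn E (insert (t i) {s i, \<phi> i})" by (intro conn_insert[of _ _ "\<phi> i"] conn_edge) auto
    ultimately show ?thesis by (simp add: insert_commute)
  qed
  show ?thesis
  proof (rule linkableI[OF trm(1), of _ Q])
    fix i assume i: "i \<in> I"
    have "conn E ({s i, t i} \<union> Q i) \<and> Q i \<subseteq> C - X"
    proof (cases "i \<in> L")
      case True
      then show ?thesis using R(1)[OF True] by (auto simp: Q_def W_def)
    next
      case False
      then show ?thesis using phiA[of i] i conn_edge[of "s i" "t i" E]
        by (cases "i \<in> \<Omega>'") (auto simp: Q_def L_def \<Omega>_def)
    qed
    then show "s i \<in> C \<and> t i \<in> C \<and> Q i \<subseteq> C - (s ` I \<union> t ` I) \<and> conn E ({s i, t i} \<union> Q i)"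
      using trm(2) i by (auto simp: X_def)
  next
    fix i j assume ij: "i \<in> I" "j \<in> I" "i \<noteq> j"
    have RL: "\<phi> j \<notin> R i" if "i \<in> L" "j \<in> \<Omega>'" for i j
    proof (cases "j \<in> F")
      case True
      then have "\<phi> j \<in> AF" using F(6) that by (auto simp: AF_def)
      then show ?thesis using R(1)[OF that(1)] by (auto simp: W_def)
    next
      case False
      then show ?thesis using R(1)[OF that(1)] that by auto
    qed
    show "Q i \<inter> Q j = {}"
      using ij R(2)[of i j] RL[of i j] RL[of j i] inj_onD[OF F(3), of i j]
      by (auto simp: Q_def)
  qed
qed

section \<open>Paths, bypasses and shortest walks\<close>

lemma is_path_alt:
  "is_path V E P \<longleftrightarrow> P \<noteq> [] \<and> distinct P \<and> set P \<subseteq> V \<and> successively (\<lambda>x y. {x, y} \<in> E) P"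
  by (auto simp: is_path_def successively_conv_nth)

lemma is_path_append:
  assumes "p \<noteq> []" "q \<noteq> []"
  shows "is_path V E (p @ q) \<longleftrightarrow>
    is_path V E p \<and> is_path V E q \<and> set p \<inter> set q = {} \<and> {last p, hd q} \<in> E"
  using assms by (auto simp: is_path_alt successively_append_iff)

lemma is_path_single [simp]: "is_path V E [v] \<longleftrightarrow> v \<in> V"
  by (auto simp: is_path_alt)

lemma is_path_take: "is_path V E p \<Longrightarrow> 0 < n \<Longrightarrow> is_path V E (take n p)"
  by (auto simp: is_path_def dest: in_set_takeD)

lemma is_path_drop: "is_path V E p \<Longrightarrow> n < length p \<Longrightarrow> is_path V E (drop n p)"
  by (auto simp: is_path_def dest: in_set_dropD)

lemma is_path_rev: "is_path V E p \<Longrightarrow> is_path V E (rev p)"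
  by (auto simp: is_path_alt successively_rev insert_commute)

lemma is_path_mono: "is_path V E p \<Longrightarrow> V \<subseteq> W \<Longrightarrow> E \<subseteq> F \<Longrightarrow> is_path W F p"
  by (auto simp: is_path_def)

lemma conn_set_path: "successively (\<lambda>x y. {x, y} \<in> E) p \<Longrightarrow> p \<noteq> [] \<Longrightarrow> conn E (set p)"
proof (induction p rule: induct_list012)
  case (3 x y zs)
  then have c: "conn E (set (y # zs))" by simp
  have "conn E ({x} \<union> set (y # zs))"
    by (rule conn_Un_edge[OF conn_singleton c, where u = x and w = y]) (use 3 in auto)
  then show ?case by (simp add: insert_commute)
qed auto

text \<open>The length equation measures what a bypass gains, and the last claim names the vertices
  that it frees; the exchange arguments below need both.\<close>

lemma take_drop_bypass:
  assumes p: "is_path V E p" and q: "is_path V E q" "set q \<inter> set p = {}"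
    and ab: "a < b" "b < length p" and e: "{p ! a, hd q} \<in> E" "{last q, p ! b} \<in> E"
  defines "r \<equiv> take (Suc a) p @ q @ drop b p"
  shows "is_path V E r" "hd r = hd p" "last r = last p"
    "length r + b = Suc a + length q + length p"
    "set r \<subseteq> set p \<union> set q" "\<And>k. a < k \<Longrightarrow> k < b \<Longrightarrow> p ! k \<notin> set r"
proof -
  have ne: "take (Suc a) p \<noteq> []" "drop b p \<noteq> []" "q \<noteq> []" "p \<noteq> []" using ab q by (auto simp: is_path_def)
  have d: "distinct p" using p by (simp add: is_path_def)
  have l: "last (take (Suc a) p) = p ! a" "hd (drop b p) = p ! b"
    using ab by (auto simp: take_Suc_conv_app_nth hd_drop_conv_nth)
  have dis: "set (take (Suc a) p) \<inter> set (drop b p) = {}"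
    using d ab by (metis Suc_leI set_take_disj_set_drop_if_distinct)
  have sub: "set (take (Suc a) p) \<subseteq> set p" "set (drop b p) \<subseteq> set p"
    by (auto dest: in_set_takeD in_set_dropD)
  have "is_path V E (q @ drop b p)"
    using q is_path_drop[OF p ab(2)] e(2) l ne sub by (subst is_path_append) auto
  then show "is_path V E r"
    unfolding r_def using is_path_take[OF p, of "Suc a"] e(1) l ne sub dis q(2)
    by (subst is_path_append) auto
  show "hd r = hd p" using ne by (simp add: r_def hd_append)
  show "last r = last p" using ne ab by (simp add: r_def)
  show "length r + b = Suc a + length q + length p" using ab by (simp add: r_def)
  show "set r \<subseteq> set p \<union> set q" using sub by (auto simp: r_def)
  fix k assume k: "a < k" "k < b"
  then have "p ! k \<notin> set (take (Suc a) p)" "p ! k \<notin> set (drop b p)"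
    using d ab by (auto simp: in_set_conv_nth distinct_conv_nth nth_eq_iff_index_eq)
  moreover have "p ! k \<notin> set q" using q(2) k ab nth_mem[of k p] by force
  ultimately show "p ! k \<notin> set r" by (simp add: r_def)
qed

text \<open>Repetitions are allowed so that a shortcut in a walk is again a walk with nothing
  further to check.\<close>

definition is_walk :: "'a set \<Rightarrow> 'a set set \<Rightarrow> 'a list \<Rightarrow> bool" where
  "is_walk V E p \<longleftrightarrow> p \<noteq> [] \<and> set p \<subseteq> V \<and> successively (\<lambda>x y. {x, y} \<in> E) p"

lemma walk_append:
  "p \<noteq> [] \<Longrightarrow> q \<noteq> [] \<Longrightarrow> is_walk V E (p @ q) \<longleftrightarrow> is_walk V E p \<and> is_walk V E q \<and> {last p, hd q} \<in> E"
  by (auto simp: is_walk_def successively_append_iff)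

lemma walk_exists:
  assumes "(u, v) \<in> (adj_in E W)\<^sup>*" "u \<in> W"
  shows "\<exists>p. is_walk W E p \<and> hd p = u \<and> last p = v"
  using assms
proof (induction rule: rtrancl_induct)
  case base
  then show ?case by (intro exI[of _ "[u]"]) (auto simp: is_walk_def)
next
  case (step y z)
  then obtain p where p: "is_walk W E p" "hd p = u" "last p = y" by blast
  have pn: "p \<noteq> []" using p by (simp add: is_walk_def)
  have "is_walk W E (p @ [z])"
    using p step(2) pn by (subst walk_append) (auto simp: is_walk_def adj_in_def)
  then show ?case using p pn by (intro exI[of _ "p @ [z]"]) auto
qed

lemma walk_take: "is_walk V E p \<Longrightarrow> is_walk V E (take (Suc a) p)"
  unfolding is_walk_def by (auto simp: successively_conv_nth dest: in_set_takeD)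

lemma walk_drop: "is_walk V E p \<Longrightarrow> b < length p \<Longrightarrow> is_walk V E (drop b p)"
  unfolding is_walk_def by (auto simp: successively_conv_nth dest: in_set_dropD)

text \<open>Minimal length among walks already forces distinct vertices, and excludes both chords
  and detours of two edges across three or more steps. Vertices three positions apart are therefore
  at distance at least three.\<close>

lemma shortest_walk:
  assumes "(u, v) \<in> (adj_in E W)\<^sup>*" "u \<in> W"
  obtains p where "is_path W E p" "hd p = u" "last p = v"
    "\<And>a b. a + 2 \<le> b \<Longrightarrow> b < length p \<Longrightarrow> {p ! a, p ! b} \<notin> E"
    "\<And>a b c. a + 3 \<le> b \<Longrightarrow> b < length p \<Longrightarrow> c \<in> W \<Longrightarrow> {p ! a, c} \<in> E \<Longrightarrow> {c, p ! b} \<in> E \<Longrightarrow> False"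
proof -
  define Q where "Q p \<longleftrightarrow> is_walk W E p \<and> hd p = u \<and> last p = v" for p
  obtain p where p: "Q p" "\<And>q. Q q \<Longrightarrow> length p \<le> length q"
    using walk_exists[OF assms] ex_has_least_nat[of Q _ length] unfolding Q_def by metis
  have w: "is_walk W E p" "hd p = u" "last p = v" "p \<noteq> []" using p(1) by (auto simp: Q_def is_walk_def)
  have l: "last (take (Suc a) p) = p ! a" "hd (drop b p) = p ! b" if "a < length p" "b < length p" for a b
    using that by (auto simp: take_Suc_conv_app_nth hd_drop_conv_nth)
  have QI: "Q (take (Suc a) p @ q)"
    if "is_walk W E q" "{p ! a, hd q} \<in> E" "last q = v" "a < length p" for a q
  proof -
    have ne: "take (Suc a) p \<noteq> []" "q \<noteq> []" using that w(4) by (auto simp: is_walk_def)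
    then have "is_walk W E (take (Suc a) p @ q)"
      using walk_append[OF ne] walk_take[OF w(1)] that l(1)[of a a] by simp
    then show ?thesis using ne that w by (simp add: Q_def hd_append)
  qed
  have short: "length p \<le> length q + a + 1"
    if "is_walk W E q" "{p ! a, hd q} \<in> E" "last q = v" "a < length p" for a q
    using p(2)[OF QI[OF that]] that(4) by simp
  have lastd: "last (drop b p) = v" if "b < length p" for b using that w by simp
  have dist: "distinct p"
  proof (rule ccontr)
    assume "\<not> distinct p"
    then obtain a b where ab: "a < b" "b < length p" "p ! a = p ! b"
      unfolding distinct_conv_nth by (metis linorder_neqE_nat)
    show False
    proof (cases "Suc b < length p")
      case True
      have "{p ! b, p ! Suc b} \<in> E" using w(1) True by (simp add: is_walk_def successively_conv_nth)
      then show False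
        using short[of "drop (Suc b) p" a] walk_drop[OF w(1) True] lastd[OF True] l(2)[of "Suc b" "Suc b"] True ab by simp
    next
      case False
      then have "b = length p - 1" using ab by simp
      then have "p ! a = v" using ab w by (simp add: last_conv_nth)
      then have "Q (take (Suc a) p)" using walk_take[OF w(1), of a] l(1)[of a a] ab w by (simp add: Q_def)
      then show False using p(2)[of "take (Suc a) p"] ab False by auto
    qed
  qed
  have path: "is_path W E p" using w dist by (simp add: is_path_alt is_walk_def)
  have e1: "{p ! a, p ! b} \<notin> E" if "a + 2 \<le> b" "b < length p" for a b
  proof
    assume "{p ! a, p ! b} \<in> E"
    then show False using short[of "drop b p" a] walk_drop[OF w(1) that(2)] lastd[OF that(2)] l(2)[of b b] that by simp
  qed
  have e2: False if "a + 3 \<le> b" "b < length p" "c \<in> W" "{p ! a, c} \<in> E" "{c, p ! b} \<in> E" for a b c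
  proof -
    have "is_walk W E ([c] @ drop b p)"
      using walk_drop[OF w(1) that(2)] l(2)[of b b] that by (subst walk_append) (auto simp: is_walk_def)
    then show False using short[of "[c] @ drop b p" a] lastd[OF that(2)] that by simp
  qed
  show ?thesis using that[OF path w(2,3) e1 e2] .
qed

lemma conn_path:
  assumes "conn E U" "u \<in> U" "v \<in> U"
  obtains p where "is_path U E p" "hd p = u" "last p = v"
proof -
  have "(u, v) \<in> (adj_in E U)\<^sup>*" using assms by (auto simp: conn_def)
  from shortest_walk[OF this assms(2)] that show ?thesis by blast
qed

text \<open>The small dense graph in the proof of Thomas and Wollan, together with \<open>l\<close>
  pairs that cannot be linked in it. The \<open>4 * l + 2\<close> in \<open>tdeg\<close> is what
  remains of \<open>6 * l + 1\<close> neighbours when the other \<open>2 * l - 1\<close> terminals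
  are discounted. The failure to link is exploited to find a much denser piece.\<close>

locale dense_pairs =
  fixes L :: "'a set" and E :: "'a set set" and I :: "'i set" and s t :: "'i \<Rightarrow> 'a" and l :: nat
  assumes finL: "finite L" and finI: "finite I" and l_def: "l = card I"
    and loop: "\<forall>e\<in>E. card e = 2"
    and trm: "terminals I s t" and trmL: "s ` I \<union> t ` I \<subseteq> L"
    and size: "card L \<le> 12 * l + 1"
    and deg: "\<And>v. v \<in> L - (s ` I \<union> t ` I) \<Longrightarrow> 6 * l + 1 \<le> card (nbrs E L v)"
    and tdeg: "\<And>i. i \<in> I \<Longrightarrow> {s i, t i} \<notin> E \<Longrightarrow>
        4 * l + 2 \<le> card (nbrs E (L - (s ` I \<union> t ` I)) (s i)) \<and>
        4 * l + 2 \<le> card (nbrs E (L - (s ` I \<union> t ` I)) (t i))"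
    and unlinkable: "\<not> linkable L E I s t"
begin

definition T where "T = s ` I \<union> t ` I"

definition route :: "'i \<Rightarrow> 'a list \<Rightarrow> bool" where
  "route i p \<longleftrightarrow> is_path L E p \<and> hd p = s i \<and> last p = t i \<and> set p \<inter> T = {s i, t i}"

text \<open>A pair not yet linked still occupies its two terminals, so one sum over all of
  \<open>I\<close> counts the used vertices.\<close>

definition block :: "'i set \<Rightarrow> ('i \<Rightarrow> 'a list) \<Rightarrow> 'i \<Rightarrow> 'a set" where
  "block I' P i = (if i \<in> I' then set (P i) else {s i, t i})"

definition used :: "'i set \<Rightarrow> ('i \<Rightarrow> 'a list) \<Rightarrow> 'a set" where
  "used I' P = (\<Union>i\<in>I. block I' P i)"

text \<open>A partial linkage. The cap \<open>6 * l + 1\<close> leaves at most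
  \<open>4 * l + 1\<close> used vertices besides the terminals, one fewer than the neighbours
  granted by \<open>tdeg\<close>; hence a terminal of a nonadjacent pair always has a free
  neighbour.\<close>

definition cfg :: "'i set \<Rightarrow> ('i \<Rightarrow> 'a list) \<Rightarrow> bool" where
  "cfg I' P \<longleftrightarrow> I' \<subseteq> I \<and> (\<forall>i\<in>I'. route i (P i)) \<and>
     (\<forall>i\<in>I. \<forall>j\<in>I. i \<noteq> j \<longrightarrow> block I' P i \<inter> block I' P j = {}) \<and> card (used I' P) \<le> 6 * l + 1"

text \<open>The first criterion turns every unlinked pair into an obstruction; the second keeps the
  linked paths so tight that a free vertex sees few of their vertices.\<close>

definition opt :: "'i set \<Rightarrow> ('i \<Rightarrow> 'a list) \<Rightarrow> bool" where
  "opt I' P \<longleftrightarrow> cfg I' P \<and> (\<forall>I'' P''. cfg I'' P'' \<longrightarrow> card I'' \<le> card I' \<and>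
     (card I'' = card I' \<longrightarrow> card (used I' P) \<le> card (used I'' P'')))"

abbreviation free :: "'i set \<Rightarrow> ('i \<Rightarrow> 'a list) \<Rightarrow> 'a set" where
  "free I' P \<equiv> L - used I' P"

text \<open>For vertices of \<open>K\<close> this is distance at most two inside \<open>K\<close>,
  equivalently that their closed neighbourhoods in \<open>K\<close> meet.\<close>

definition near :: "'a set \<Rightarrow> 'a \<Rightarrow> 'a \<Rightarrow> bool" where
  "near K a b \<longleftrightarrow> a = b \<or> {a, b} \<in> E \<or> (\<exists>c\<in>K. {a, c} \<in> E \<and> {c, b} \<in> E)"

lemma TL: "T \<subseteq> L" "finite T" "card T = 2 * l"
  using trmL finI card_terminals[OF trm finI] by (auto simp: T_def l_def)

lemma st: "i \<in> I \<Longrightarrow> s i \<in> T \<and> t i \<in> T \<and> s i \<noteq> t i"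
  using terminals_distinct(1)[OF trm, of i i] by (auto simp: T_def)

lemma route_path: "route i p \<Longrightarrow> distinct p \<and> p \<noteq> [] \<and> set p \<subseteq> L \<and> s i \<in> set p \<and> t i \<in> set p"
  by (auto simp: route_def is_path_def)

lemma route_edge: "i \<in> I \<Longrightarrow> {s i, t i} \<in> E \<Longrightarrow> route i [s i, t i]"
  using st[of i] TL by (auto simp: route_def is_path_alt)

lemma block_sub: "cfg I' P \<Longrightarrow> i \<in> I \<Longrightarrow> block I' P i \<subseteq> L \<and> finite (block I' P i) \<and> {s i, t i} \<subseteq> block I' P i"
  using st[of i] TL route_path[of i "P i"] by (auto simp: block_def cfg_def)

lemma card_block: "cfg I' P \<Longrightarrow> i \<in> I' \<Longrightarrow> card (block I' P i) = length (P i)"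
  using route_path[of i "P i"] by (auto simp: block_def cfg_def distinct_card)

lemma card_block2: "i \<in> I - I' \<Longrightarrow> card (block I' P i) = 2"
  using st[of i] by (auto simp: block_def)

lemma used_sub: "cfg I' P \<Longrightarrow> used I' P \<subseteq> L \<and> finite (used I' P) \<and> T \<subseteq> used I' P"
  unfolding used_def using block_sub[of I' P] finI by (fastforce simp: T_def)

lemma card_used: "cfg I' P \<Longrightarrow> card (used I' P) = (\<Sum>i\<in>I. card (block I' P i))"
  unfolding used_def using block_sub[of I' P] finI
  by (intro card_UN_disjoint) (auto simp: cfg_def)

lemma card_replace:
  assumes "cfg I' P" "i \<in> I" "cfg (insert i I') (P(i := q))"
  shows "card (used (insert i I') (P(i := q))) + card (block I' P i) = card (used I' P) + length q"
proof -
  have "card (block (insert i I') (P(i := q)) j) = card (block I' P j)" if "j \<in> I - {i}" for j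
    using that by (auto simp: block_def)
  then have "(\<Sum>j\<in>I-{i}. card (block (insert i I') (P(i := q)) j)) = (\<Sum>j\<in>I-{i}. card (block I' P j))"
    by (intro sum.cong) auto
  moreover have "card (block (insert i I') (P(i := q)) i) = length q"
    using card_block[OF assms(3), of i] by simp
  ultimately show ?thesis
    unfolding card_used[OF assms(1)] card_used[OF assms(3)] by (simp add: sum.remove[OF finI assms(2)])
qed

lemma cfg_replace:
  assumes c: "cfg I' P" and i: "i \<in> I" and r: "route i q"
    and d: "set q \<subseteq> free I' P \<union> block I' P i"
    and sz: "card (used I' P) + length q \<le> 6 * l + 1 + card (block I' P i)"
  shows "cfg (insert i I') (P(i := q))"
proof -
  let ?I = "insert i I'" and ?P = "P(i := q)"
  have bi: "block ?I ?P i = set q" by (simp add: block_def)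
  have bj: "block ?I ?P j = block I' P j" if "j \<noteq> i" for j using that by (auto simp: block_def)
  have dis: "block I' P j \<inter> set q = {}" if "j \<in> I" "j \<noteq> i" for j
  proof -
    have "block I' P j \<inter> block I' P i = {}" using c that i by (auto simp: cfg_def)
    moreover have "block I' P j \<subseteq> used I' P" using that by (auto simp: used_def)
    ultimately show ?thesis using d by blast
  qed
  have disj: "block ?I ?P j \<inter> block ?I ?P k = {}" if "j \<in> I" "k \<in> I" "j \<noteq> k" for j k
    using that dis[of j] dis[of k] bi bj[of j] bj[of k] c unfolding cfg_def
    by (cases "j = i"; cases "k = i") auto
  have "card (used ?I ?P) \<le> card ((used I' P - block I' P i) \<union> set q)"
  proof (rule card_mono)
    show "used ?I ?P \<subseteq> (used I' P - block I' P i) \<union> set q"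
    proof
      fix x assume "x \<in> used ?I ?P"
      then obtain j where j: "j \<in> I" "x \<in> block ?I ?P j" by (auto simp: used_def)
      show "x \<in> (used I' P - block I' P i) \<union> set q"
      proof (cases "j = i")
        case False
        then have "x \<in> block I' P j" "block I' P j \<inter> block I' P i = {}"
          using j bj c i by (auto simp: cfg_def)
        then show ?thesis using j(1) by (auto simp: used_def)
      qed (use j bi in auto)
    qed
  qed (use used_sub[OF c] in auto)
  also have "\<dots> \<le> card (used I' P - block I' P i) + card (set q)" by (rule card_Un_le)
  also have "card (used I' P - block I' P i) = card (used I' P) - card (block I' P i)"
    using block_sub[OF c i] i by (intro card_Diff_subset) (auto simp: used_def)
  also have "card (set q) \<le> length q" by (rule card_length)
  finally have le: "card (used ?I ?P) \<le> card (used I' P) - card (block I' P i) + length q"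
    by (simp del: fun_upd_apply)
  have "card (block I' P i) \<le> card (used I' P)"
    by (rule card_mono) (use used_sub[OF c] i in \<open>auto simp: used_def\<close>)
  then have u: "card (used ?I ?P) \<le> 6 * l + 1" using sz le by linarith
  have rt: "route j (?P j)" if "j \<in> ?I" for j using that r c by (auto simp: cfg_def)
  have "?I \<subseteq> I" using c i by (auto simp: cfg_def)
  then show ?thesis unfolding cfg_def by (intro conjI ballI impI u rt disj)
qed

lemma opt_ex: "\<exists>I' P. opt I' P"
proof -
  define Z where "Z = {I'. \<exists>P. cfg I' P}"
  have "used {} (\<lambda>_. []) = T" by (auto simp: used_def block_def T_def)
  moreover have "block {} (\<lambda>_. []) i \<inter> block {} (\<lambda>_. []) j = {}" if "i \<in> I" "j \<in> I" "i \<noteq> j" for i j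
    using terminals_distinct[OF trm that(1,2)] terminals_distinct[OF trm that(2,1)] that(3)
    by (auto simp: block_def)
  ultimately have "cfg {} (\<lambda>_. [])" using TL by (auto simp: cfg_def)
  then have Z: "Z \<noteq> {}" by (auto simp: Z_def)
  have "Z \<subseteq> Pow I" by (auto simp: Z_def cfg_def)
  then have finZ: "finite (card ` Z)" using finI by (meson finite_Pow_iff finite_imageI finite_subset)
  have "Max (card ` Z) \<in> card ` Z" by (rule Max_in[OF finZ]) (use Z in simp)
  then obtain I1 where I1: "I1 \<in> Z" "card I1 = Max (card ` Z)" by (metis imageE)
  define Q where "Q x \<longleftrightarrow> cfg (fst x) (snd x) \<and> card (fst x) = card I1" for x
  have "\<exists>x. Q x" using I1(1) unfolding Q_def Z_def by auto
  then obtain x where x: "Q x" "\<And>y. Q y \<Longrightarrow> card (used (fst x) (snd x)) \<le> card (used (fst y) (snd y))"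
    using ex_has_least_nat[of Q _ "\<lambda>x. card (used (fst x) (snd x))"] by metis
  have "card I'' \<le> card I1" if "cfg I'' P''" for I'' P''
    using Max_ge[OF finZ, of "card I''"] that I1(2) by (auto simp: Z_def)
  then have "opt (fst x) (snd x)" using x unfolding opt_def Q_def by (metis fst_conv snd_conv)
  then show ?thesis by blast
qed

lemma not_all: "cfg I' P \<Longrightarrow> I' \<noteq> I"
proof
  assume c: "cfg I' P" "I' = I"
  have "linkable L E I s t" unfolding linkable_def
  proof (intro exI[of _ "\<lambda>i. set (P i)"] conjI ballI impI)
    fix i assume i: "i \<in> I"
    then have r: "route i (P i)" using c by (auto simp: cfg_def)
    show "set (P i) \<subseteq> L" "s i \<in> set (P i)" "t i \<in> set (P i)" using route_path[OF r] by auto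
    show "conn E (set (P i))" using r by (intro conn_set_path) (auto simp: route_def is_path_alt)
  next
    fix i j assume ij: "i \<in> I" "j \<in> I" "i \<noteq> j"
    then have "block I' P i \<inter> block I' P j = {}" using c by (auto simp: cfg_def)
    then show "set (P i) \<inter> set (P j) = {}" using ij c by (simp add: block_def)
  qed
  then show False using unlinkable by simp
qed

text \<open>The route would replace a block of two terminals, so only the cap
  \<open>6 * l + 1\<close> can forbid it; hence the offset \<open>6 * l + 3\<close>.\<close>

lemma opt_max:
  assumes o: "opt I' P" and i: "i \<in> I - I'" and r: "route i q" and d: "set q \<subseteq> free I' P \<union> {s i, t i}"
  shows "6 * l + 3 < card (used I' P) + length q"
proof (rule ccontr)
  assume a: "\<not> ?thesis"
  have c: "cfg I' P" using o by (simp add: opt_def)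
  have "cfg (insert i I') (P(i := q))"
    using a d card_block2[OF i, of P] i by (intro cfg_replace[OF c _ r]) (auto simp: block_def)
  then have "card (insert i I') \<le> card I'" using o unfolding opt_def by blast
  moreover have "finite I'" using c finI by (auto simp: cfg_def intro: finite_subset)
  ultimately show False using i by simp
qed

text \<open>Equal length matters as much as the inequality: it allows moving sideways between
  optimal configurations, which \<open>swap_smaller\<close> exploits.\<close>

lemma opt_min:
  assumes o: "opt I' P" and i: "i \<in> I'" and r: "route i q" and d: "set q \<subseteq> free I' P \<union> set (P i)"
  shows "length (P i) \<le> length q" "length q = length (P i) \<Longrightarrow> opt I' (P(i := q))"
proof -
  have c: "cfg I' P" using o by (simp add: opt_def)
  have iI: "i \<in> I" using c i by (auto simp: cfg_def)
  have cb: "card (block I' P i) = length (P i)" using card_block[OF c i] .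
  have 1: "cfg I' (P(i := q)) \<and> card (used I' (P(i := q))) + length (P i) = card (used I' P) + length q"
    if "length q \<le> length (P i)"
  proof -
    have "cfg (insert i I') (P(i := q))"
      by (rule cfg_replace[OF c iI r]) (use d cb that i c in \<open>auto simp: block_def cfg_def\<close>)
    then show ?thesis using card_replace[OF c iI] cb i by (simp add: insert_absorb)
  qed
  show "length (P i) \<le> length q"
  proof (rule ccontr)
    assume a: "\<not> ?thesis"
    then have 2: "cfg I' (P(i := q))" "card (used I' (P(i := q))) + length (P i) = card (used I' P) + length q"
      using 1 by auto
    have "card (used I' P) \<le> card (used I' (P(i := q)))" using 2(1) o unfolding opt_def by blast
    then show False using 2(2) a by linarith
  qed
  show "opt I' (P(i := q))" if "length q = length (P i)" using 1 that o unfolding opt_def by simp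
qed

lemma terminal_nbr:
  assumes c: "cfg I' P" and i: "i \<in> I" "{s i, t i} \<notin> E"
  shows "nbrs E (free I' P) (s i) \<noteq> {}" "nbrs E (free I' P) (t i) \<noteq> {}"
proof -
  have "card (used I' P - T) = card (used I' P) - 2 * l"
    using used_sub[OF c] TL by (metis card_Diff_subset)
  then have b: "card (used I' P - T) < 4 * l + 2" using c by (auto simp: cfg_def)
  have gen: "nbrs E (free I' P) v \<noteq> {}" if "4 * l + 2 \<le> card (nbrs E (L - T) v)" for v
  proof
    assume "nbrs E (free I' P) v = {}"
    then have "nbrs E (L - T) v \<subseteq> used I' P - T" by (auto simp: nbrs_def)
    then have "card (nbrs E (L - T) v) \<le> card (used I' P - T)" using used_sub[OF c] by (intro card_mono) auto
    then show False using b that by linarith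
  qed
  show "nbrs E (free I' P) (s i) \<noteq> {}" "nbrs E (free I' P) (t i) \<noteq> {}"
    using gen tdeg[OF i] by (auto simp: T_def)
qed

text \<open>The path consisting of the single edge costs no vertex beyond the two terminals, so
  nothing optimal does without it or uses a longer one.\<close>

lemma adjacent_linked:
  assumes o: "opt I' P" and i: "i \<in> I" "{s i, t i} \<in> E"
  shows "i \<in> I'" "length (P i) \<le> 2"
proof -
  have c: "cfg I' P" using o by (simp add: opt_def)
  show i': "i \<in> I'"
  proof (rule ccontr)
    assume "i \<notin> I'"
    then show False using opt_max[OF o _ route_edge[OF i]] i c by (auto simp: cfg_def)
  qed
  have "set [s i, t i] \<subseteq> set (P i)" using route_path[of i "P i"] c i' by (auto simp: cfg_def)
  then show "length (P i) \<le> 2" using opt_min(1)[OF o i' route_edge[OF i]] by auto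
qed

lemma route_via:
  assumes c: "cfg I' P" and i: "i \<in> I" and q: "is_path (free I' P) E q"
    and e: "{s i, hd q} \<in> E" "{last q, t i} \<in> E"
  shows "route i (s i # q @ [t i])" "set (s i # q @ [t i]) \<subseteq> free I' P \<union> {s i, t i}"
proof -
  have T: "T \<subseteq> used I' P" "used I' P \<subseteq> L" using used_sub[OF c] by auto
  have qn: "q \<noteq> []" "set q \<subseteq> free I' P" using q by (auto simp: is_path_def)
  have sti: "s i \<in> T" "t i \<in> T" "s i \<noteq> t i" using st[OF i] by auto
  have qL: "is_path L E q" using is_path_mono[OF q] by blast
  have "is_path L E (q @ [t i])" using qL e(2) sti T qn by (subst is_path_append) auto
  then have "is_path L E ([s i] @ q @ [t i])" using e(1) sti T qn by (subst is_path_append) auto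
  moreover have "set (s i # q @ [t i]) \<inter> T = {s i, t i}" using sti T qn by auto
  ultimately show "route i (s i # q @ [t i])" by (simp add: route_def)
  show "set (s i # q @ [t i]) \<subseteq> free I' P \<union> {s i, t i}" using qn by auto
qed

end

section \<open>Neighbours of a free vertex on an optimal partial linkage\<close>

lemma successive_triple:
  assumes "A \<subseteq> {..<n::nat}" "\<And>a b. a \<in> A \<Longrightarrow> b \<in> A \<Longrightarrow> a < b \<Longrightarrow> b \<le> a + 2"
  shows "card A \<le> 3" "card A = 3 \<Longrightarrow> \<exists>a. A = {a, a + 1, a + 2}"
proof -
  have *: "A = {} \<or> (\<exists>a. A \<subseteq> {a, a + 1, a + 2})"
  proof (cases "A = {}")
    case False
    have fin: "finite A" using assms(1) finite_subset by blast
    have "A \<subseteq> {Min A, Min A + 1, Min A + 2}"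
    proof
      fix b assume b: "b \<in> A"
      then have "Min A \<le> b" "Min A \<in> A" using fin False by auto
      then show "b \<in> {Min A, Min A + 1, Min A + 2}" using assms(2)[of "Min A" b] b by (cases "Min A = b") auto
    qed
    then show ?thesis by blast
  qed simp
  have c3: "card {a, a + 1, a + 2 :: nat} = 3" for a by simp
  show "card A \<le> 3" using * c3 by (metis card.empty card_mono finite.emptyI finite_insert le0)
  assume "card A = 3"
  then show "\<exists>a. A = {a, a + 1, a + 2}" using * c3
    by (metis card.empty card_subset_eq finite.emptyI finite_insert zero_neq_numeral)
qed

context dense_pairs
begin

lemma near_path:
  assumes "near K a b" "a \<in> K" "b \<in> K"
  shows "\<exists>q. is_path K E q \<and> hd q = a \<and> last q = b \<and> length q \<le> 3"
proof -
  consider "a = b" | "a \<noteq> b" "{a, b} \<in> E" | c where "a \<noteq> b" "c \<in> K" "{a, c} \<in> E" "{c, b} \<in> E"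
    using assms(1) by (auto simp: near_def)
  then show ?thesis
  proof cases
    case 1
    then show ?thesis using assms by (intro exI[of _ "[a]"]) auto
  next
    case 2
    then show ?thesis using assms by (intro exI[of _ "[a, b]"]) (auto simp: is_path_alt)
  next
    case 3
    then have "a \<noteq> c" "c \<noteq> b" using no_loop[OF loop] by auto
    then show ?thesis using assms 3 by (intro exI[of _ "[a, c, b]"]) (auto simp: is_path_alt)
  qed
qed

text \<open>A detour through \<open>w\<close> between two of its neighbours on \<open>P i\<close> is
  again a route. It may not be shorter, so these neighbours are at most two positions apart, and at
  exactly two the exchange costs nothing.\<close>

lemma block_nbr_gap:
  assumes o: "opt I' P" and i: "i \<in> I'" and w: "w \<in> free I' P"
    and ab: "a < b" "b < length (P i)" "{w, P i ! a} \<in> E" "{w, P i ! b} \<in> E"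
  shows "b \<le> a + 2"
    "b = a + 2 \<Longrightarrow> opt I' (P(i := take (Suc a) (P i) @ [w] @ drop b (P i)))"
proof -
  have c: "cfg I' P" using o by (simp add: opt_def)
  have r: "route i (P i)" "i \<in> I" using c i by (auto simp: cfg_def)
  have wu: "w \<in> L" "w \<notin> T" "w \<notin> set (P i)"
    using w used_sub[OF c] r(2) i by (auto simp: used_def block_def)
  define q where "q = take (Suc a) (P i) @ [w] @ drop b (P i)"
  have p: "is_path L E (P i)" using r by (simp add: route_def)
  have w1: "is_path L E [w]" using wu by simp
  have w2: "set [w] \<inter> set (P i) = {}" using wu by simp
  have w3: "{P i ! a, hd [w]} \<in> E" "{last [w], P i ! b} \<in> E" using ab by (auto simp: insert_commute)
  have q: "is_path L E q" "hd q = hd (P i)" "last q = last (P i)" "length q + b = Suc a + 1 + length (P i)"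
    "set q \<subseteq> set (P i) \<union> {w}"
    using take_drop_bypass(1-5)[OF p w1 w2 ab(1,2) w3] unfolding q_def by auto
  have qn: "q \<noteq> []" by (simp add: q_def)
  then have "s i \<in> set q" "t i \<in> set q"
    using q(2,3) r(1) unfolding route_def by (metis hd_in_set, metis last_in_set)
  then have "set q \<inter> T = {s i, t i}" using q(5) r(1) wu(2) st[OF r(2)] unfolding route_def by blast
  then have rq: "route i q" using q r(1) by (simp add: route_def)
  have d: "set q \<subseteq> free I' P \<union> set (P i)" using q(5) w by auto
  show "b \<le> a + 2" using opt_min(1)[OF o i rq d] q(4) by linarith
  show "opt I' (P(i := take (Suc a) (P i) @ [w] @ drop b (P i)))" if "b = a + 2"
    using opt_min(2)[OF o i rq d] q(4) that by (simp add: q_def)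
qed

lemma nbr_index_set:
  assumes o: "opt I' P" and i: "i \<in> I'" and w: "w \<in> free I' P"
  defines "A \<equiv> {a. a < length (P i) \<and> {w, P i ! a} \<in> E}"
  shows "card (nbrs E (block I' P i) w) = card A" "card A \<le> 3" "card A = 3 \<Longrightarrow> \<exists>a. A = {a, a + 1, a + 2}"
proof -
  have c: "cfg I' P" using o by (simp add: opt_def)
  have d: "distinct (P i)" using c i route_path by (auto simp: cfg_def)
  have "nbrs E (block I' P i) w = (!) (P i) ` A"
    using i by (auto simp: nbrs_def block_def A_def in_set_conv_nth)
  moreover have "inj_on ((!) (P i)) A" using d by (auto simp: inj_on_def A_def nth_eq_iff_index_eq)
  ultimately show "card (nbrs E (block I' P i) w) = card A" by (simp add: card_image)
  have sub: "A \<subseteq> {..<length (P i)}" by (auto simp: A_def)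
  have gap: "\<And>a b. a \<in> A \<Longrightarrow> b \<in> A \<Longrightarrow> a < b \<Longrightarrow> b \<le> a + 2"
    using block_nbr_gap(1)[OF o i w] by (auto simp: A_def)
  show "card A \<le> 3" "card A = 3 \<Longrightarrow> \<exists>a. A = {a, a + 1, a + 2}" using successive_triple[OF sub gap] by auto
qed

lemma block_nbrs:
  assumes o: "opt I' P" and i: "i \<in> I" and w: "w \<in> free I' P"
  shows "card (nbrs E (block I' P i) w) \<le> min 3 (card (block I' P i))"
proof -
  have c: "cfg I' P" using o by (simp add: opt_def)
  have "card (nbrs E (block I' P i) w) \<le> card (block I' P i)"
    using block_sub[OF c i] by (intro card_mono) (auto simp: nbrs_def)
  moreover have "card (nbrs E (block I' P i) w) \<le> 3"
    using nbr_index_set(1,2)[OF o _ w, of i] calculation card_block2[of i I' P] i by (cases "i \<in> I'") auto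
  ultimately show ?thesis by simp
qed

lemma free_degree:
  assumes c: "cfg I' P" and w: "w \<in> free I' P"
  shows "6 * l + 1 \<le> card (nbrs E (free I' P) w) + (\<Sum>i\<in>I. card (nbrs E (block I' P i) w))"
proof -
  have wT: "w \<in> L - (s ` I \<union> t ` I)" using w used_sub[OF c] by (auto simp: T_def)
  have fin: "finite (nbrs E (block I' P i) w)" if "i \<in> I" for i
    using block_sub[OF c that] by (auto simp: nbrs_def)
  have "nbrs E L w \<subseteq> nbrs E (free I' P) w \<union> (\<Union>i\<in>I. nbrs E (block I' P i) w)"
    by (auto simp: nbrs_def used_def)
  then have "card (nbrs E L w) \<le> card (nbrs E (free I' P) w \<union> (\<Union>i\<in>I. nbrs E (block I' P i) w))"
    using fin finI finL by (intro card_mono) (auto simp: nbrs_def)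
  also have "\<dots> \<le> card (nbrs E (free I' P) w) + card (\<Union>i\<in>I. nbrs E (block I' P i) w)" by (rule card_Un_le)
  also have "card (\<Union>i\<in>I. nbrs E (block I' P i) w) \<le> (\<Sum>i\<in>I. card (nbrs E (block I' P i) w))"
    by (rule card_UN_le[OF finI])
  finally show ?thesis using deg[OF wT] by linarith
qed

text \<open>An upper bound, the same for all free vertices, on the number of used neighbours: at
  most three on each block, and no more than the block contains.\<close>

definition mu :: "'i set \<Rightarrow> ('i \<Rightarrow> 'a list) \<Rightarrow> nat" where
  "mu I' P = (\<Sum>i\<in>I. min 3 (card (block I' P i)))"

lemma free_degree_mu:
  assumes o: "opt I' P" and w: "w \<in> free I' P"
  shows "6 * l + 1 \<le> card (nbrs E (free I' P) w) + mu I' P"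
proof -
  have "(\<Sum>i\<in>I. card (nbrs E (block I' P i) w)) \<le> mu I' P"
    unfolding mu_def using block_nbrs[OF o _ w] by (intro sum_mono) auto
  then show ?thesis using free_degree[OF _ w] o unfolding opt_def by fastforce
qed

text \<open>Some pair is unlinked and contributes two instead of three, which saves one against
  \<open>3 * l\<close>.\<close>

lemma mu_bound:
  assumes o: "opt I' P"
  shows "mu I' P + 1 \<le> 3 * l" "mu I' P \<le> card (used I' P)"
proof -
  have c: "cfg I' P" using o by (simp add: opt_def)
  obtain i where i: "i \<in> I - I'" using not_all[OF c] c by (auto simp: cfg_def)
  have "mu I' P = min 3 (card (block I' P i)) + (\<Sum>j\<in>I-{i}. min 3 (card (block I' P j)))"
    unfolding mu_def by (rule sum.remove[OF finI]) (use i in simp)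
  also have "\<dots> \<le> 2 + (\<Sum>j\<in>I-{i}. 3)"
    using card_block2[OF i, of P] by (intro add_mono sum_mono) auto
  finally have "mu I' P \<le> 2 + 3 * card (I - {i})" by simp
  moreover have "card (I - {i}) + 1 = l" using card_Suc_Diff1[OF finI, of i] i by (simp add: l_def)
  ultimately show "mu I' P + 1 \<le> 3 * l" by linarith
  show "mu I' P \<le> card (used I' P)"
    unfolding mu_def card_used[OF c] by (intro sum_mono) auto
qed

lemma card_free: "cfg I' P \<Longrightarrow> card (free I' P) + card (used I' P) \<le> 12 * l + 1"
  using used_sub[of I' P] finL size card_Diff_subset[of "used I' P" L] card_mono[of L "used I' P"] by auto

lemma far_disjoint:
  assumes "a \<in> K" "b \<in> K" "\<not> near K a b"
  shows "insert a (nbrs E K a) \<inter> insert b (nbrs E K b) = {}"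
  using assms by (auto simp: near_def nbrs_def insert_commute)

lemma card_closed_nbrs:
  assumes o: "opt I' P" and w: "w \<in> free I' P"
  shows "6 * l + 2 \<le> card (insert w (nbrs E (free I' P) w)) + mu I' P"
proof -
  have "w \<notin> nbrs E (free I' P) w" using no_loop[OF loop, of w w] by (auto simp: nbrs_def)
  then show ?thesis using free_degree_mu[OF o w] finL by (simp add: nbrs_def)
qed

text \<open>Two disjoint closed neighbourhoods, each of at least \<open>6 * l + 2\<close> minus
  \<open>mu I' P\<close> vertices, must fit among the free vertices, of which there are at most
  \<open>12 * l + 1\<close> minus the used ones. Since \<open>mu I' P\<close> is below
  \<open>3 * l\<close>, few vertices can be used.\<close>

lemma far_pair:
  assumes o: "opt I' P" and ab: "a \<in> free I' P" "b \<in> free I' P" "\<not> near (free I' P) a b"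
  shows "card (used I' P) + 5 \<le> 6 * l"
proof -
  let ?K = "free I' P"
  have c: "cfg I' P" using o by (simp add: opt_def)
  have "card (insert a (nbrs E ?K a) \<union> insert b (nbrs E ?K b)) \<le> card ?K"
    using ab finL by (intro card_mono) (auto simp: nbrs_def)
  moreover have "card (insert a (nbrs E ?K a) \<union> insert b (nbrs E ?K b)) =
      card (insert a (nbrs E ?K a)) + card (insert b (nbrs E ?K b))"
    using far_disjoint[OF ab] finL by (intro card_Un_disjoint) (auto simp: nbrs_def)
  ultimately show ?thesis
    using card_closed_nbrs[OF o ab(1)] card_closed_nbrs[OF o ab(2)] card_free[OF c] mu_bound[OF o] by linarith
qed

text \<open>Three disjoint closed neighbourhoods of that size exceed the free vertices outright,
  because \<open>mu I' P\<close> is bounded both by \<open>3 * l - 1\<close> and by the number of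
  used vertices.\<close>

lemma no_far_triple:
  assumes o: "opt I' P" and abc: "a \<in> free I' P" "b \<in> free I' P" "d \<in> free I' P"
    and far: "\<not> near (free I' P) a b" "\<not> near (free I' P) a d" "\<not> near (free I' P) b d"
  shows False
proof -
  let ?K = "free I' P"
  let ?N = "\<lambda>w. insert w (nbrs E ?K w)"
  have c: "cfg I' P" using o by (simp add: opt_def)
  have fin: "finite (?N w)" for w using finL by (auto simp: nbrs_def)
  have "card (?N a \<union> ?N b \<union> ?N d) \<le> card ?K"
    using abc finL by (intro card_mono) (auto simp: nbrs_def)
  moreover have "?N a \<inter> ?N b = {}" "(?N a \<union> ?N b) \<inter> ?N d = {}"
    using far_disjoint[OF abc(1,2) far(1)] far_disjoint[OF abc(1,3) far(2)] far_disjoint[OF abc(2,3) far(3)] by blast+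
  then have "card (?N a \<union> ?N b \<union> ?N d) = card (?N a) + card (?N b) + card (?N d)"
    using fin by (metis card_Un_disjoint finite_UnI)
  ultimately show False
    using card_closed_nbrs[OF o abc(1)] card_closed_nbrs[OF o abc(2)] card_closed_nbrs[OF o abc(3)]
      card_free[OF c] mu_bound[OF o] by linarith
qed

text \<open>Otherwise any two free vertices are near, so each linked path could be rerouted with at
  most five vertices. Then at most \<open>5 * l - 3\<close> vertices are used, and an unlinked pair
  could be joined by another route of at most five.\<close>

lemma opt_used_bound:
  assumes o: "opt I' P"
  shows "card (used I' P) + 5 \<le> 6 * l"
proof (rule ccontr)
  assume a: "\<not> ?thesis"
  let ?K = "free I' P"
  have c: "cfg I' P" using o by (simp add: opt_def)
  have near: "near ?K x y" if "x \<in> ?K" "y \<in> ?K" for x y using far_pair[OF o that] a by blast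
  have via: "\<exists>q. is_path ?K E q \<and> {s i, hd q} \<in> E \<and> {last q, t i} \<in> E \<and> length q \<le> 3"
    if i: "i \<in> I" "{s i, t i} \<notin> E" for i
  proof -
    obtain x y where xy: "x \<in> nbrs E ?K (s i)" "y \<in> nbrs E ?K (t i)" using terminal_nbr[OF c i] by blast
    then have "x \<in> ?K" "y \<in> ?K" by (auto simp: nbrs_def)
    from near_path[OF near[OF this] this] xy show ?thesis by (auto simp: nbrs_def insert_commute)
  qed
  have len: "length (P i) \<le> 5" if i: "i \<in> I'" for i
  proof -
    have iI: "i \<in> I" using i c by (auto simp: cfg_def)
    show ?thesis
    proof (cases "{s i, t i} \<in> E")
      case True
      then show ?thesis using adjacent_linked(2)[OF o iI] by simp
    next
      case False
      then obtain q where q: "is_path ?K E q" "{s i, hd q} \<in> E" "{last q, t i} \<in> E" "length q \<le> 3"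
        using via[OF iI] by blast
      note r = route_via[OF c iI q(1-3)]
      have "s i \<in> set (P i)" "t i \<in> set (P i)" using route_path[of i "P i"] c i by (auto simp: cfg_def)
      then have "length (P i) \<le> length (s i # q @ [t i])" using opt_min(1)[OF o i r(1)] r(2) by auto
      then show ?thesis using q(4) by simp
    qed
  qed
  obtain i where i: "i \<in> I - I'" using not_all[OF c] c by (auto simp: cfg_def)
  have nadj: "{s i, t i} \<notin> E" using adjacent_linked(1)[OF o] i by blast
  obtain q where q: "is_path ?K E q" "{s i, hd q} \<in> E" "{last q, t i} \<in> E" "length q \<le> 3"
    using via[OF _ nadj] i by blast
  have iI: "i \<in> I" using i by simp
  note r = route_via[OF c iI q(1-3)]
  have big: "6 * l + 3 < card (used I' P) + length (s i # q @ [t i])" using opt_max[OF o i r] .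
  have "card (used I' P) = card (block I' P i) + (\<Sum>j\<in>I-{i}. card (block I' P j))"
    unfolding card_used[OF c] by (rule sum.remove[OF finI iI])
  also have "\<dots> \<le> 2 + (\<Sum>j\<in>I-{i}. 5)"
  proof (intro add_mono sum_mono)
    fix j assume j: "j \<in> I - {i}"
    show "card (block I' P j) \<le> 5"
      using len[of j] card_block[OF c, of j] card_block2[of j I' P] j by (cases "j \<in> I'") auto
  qed (use card_block2[OF i, of P] in simp)
  finally have "card (used I' P) \<le> 2 + 5 * card (I - {i})" by simp
  moreover have "card (I - {i}) + 1 = l" using card_Suc_Diff1[OF finI, of i] i by (simp add: l_def)
  ultimately show False using big q(4) by simp
qed

text \<open>On a shortest free path with seven or more vertices, positions 0, 3 and 6 would form a
  forbidden triple. A path with at most six gives a route with at most eight, and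
  \<open>6 * l - 5 + 8\<close> is exactly the \<open>6 * l + 3\<close> that \<open>opt_max\<close>
  excludes.\<close>

lemma separated:
  assumes o: "opt I' P" and i: "i \<in> I - I'"
    and x: "x \<in> nbrs E (free I' P) (s i)" and y: "y \<in> nbrs E (free I' P) (t i)"
  shows "y \<notin> comp_in E (free I' P) x"
proof
  let ?K = "free I' P"
  have c: "cfg I' P" using o by (simp add: opt_def)
  have xy: "x \<in> ?K" "y \<in> ?K" using x y by (auto simp: nbrs_def)
  assume "y \<in> comp_in E ?K x"
  then have "(x, y) \<in> (adj_in E ?K)\<^sup>*" by (simp add: comp_in_def)
  then obtain p where p: "is_path ?K E p" "hd p = x" "last p = y"
    "\<And>a b. a + 2 \<le> b \<Longrightarrow> b < length p \<Longrightarrow> {p ! a, p ! b} \<notin> E"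
    "\<And>a b c. a + 3 \<le> b \<Longrightarrow> b < length p \<Longrightarrow> c \<in> ?K \<Longrightarrow> {p ! a, c} \<in> E \<Longrightarrow> {c, p ! b} \<in> E \<Longrightarrow> False"
    using shortest_walk[OF _ xy(1)] by metis
  have "length p \<le> 6"
  proof (rule ccontr)
    assume "\<not> length p \<le> 6"
    then have len: "6 < length p" by simp
    have far: "\<not> near ?K (p ! a) (p ! b)" if "a + 3 \<le> b" "b \<le> 6" for a b
    proof -
      have "p ! a \<noteq> p ! b" using p(1) that len by (simp add: is_path_def nth_eq_iff_index_eq)
      then show ?thesis using p(4)[of a b] p(5)[of a b] that len unfolding near_def by auto
    qed
    have "p ! a \<in> ?K" if "a \<le> 6" for a using p(1) that len nth_mem[of a p] unfolding is_path_def by fastforce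
    then show False using no_far_triple[OF o, of "p ! 0" "p ! 3" "p ! 6"] far by simp
  qed
  have iI: "i \<in> I" using i by simp
  have e: "{s i, hd p} \<in> E" "{last p, t i} \<in> E" using p(2,3) x y by (auto simp: nbrs_def insert_commute)
  note r = route_via[OF c iI p(1) e]
  show False using opt_max[OF o i r] opt_used_bound[OF o] \<open>length p \<le> 6\<close> by simp
qed

section \<open>The two sides of an unlinked pair\<close>

definition side :: "'i set \<Rightarrow> ('i \<Rightarrow> 'a list) \<Rightarrow> 'a \<Rightarrow> 'a set" where
  "side I' P v = (\<Union>u\<in>nbrs E (free I' P) v. comp_in E (free I' P) u)"

lemma side_sub: "side I' P v \<subseteq> free I' P"
proof
  fix x assume "x \<in> side I' P v"
  then obtain u where "u \<in> nbrs E (free I' P) v" "x \<in> comp_in E (free I' P) u" by (auto simp: side_def)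
  moreover from this have "u \<in> free I' P" by (simp add: nbrs_iff)
  ultimately show "x \<in> free I' P" using subsetD[OF comp_in_subset] by metis
qed

lemma side_closed: "x \<in> side I' P v \<Longrightarrow> nbrs E (free I' P) x \<subseteq> side I' P v"
proof
  fix z assume x: "x \<in> side I' P v" and z: "z \<in> nbrs E (free I' P) x"
  then obtain u where u: "u \<in> nbrs E (free I' P) v" "x \<in> comp_in E (free I' P) u" by (auto simp: side_def)
  have "x \<in> free I' P" using x side_sub[of I' P v] by blast
  then have "z \<in> comp_in E (free I' P) u" using comp_in_closed[OF u(2)] z by (simp add: nbrs_iff)
  then show "z \<in> side I' P v" using u(1) by (auto simp: side_def)
qed

lemma sides_disjoint:
  assumes o: "opt I' P" and i: "i \<in> I - I'"
  shows "side I' P (s i) \<inter> side I' P (t i) = {}"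
proof (rule ccontr)
  assume "\<not> ?thesis"
  then obtain x y z where xy: "x \<in> nbrs E (free I' P) (s i)" "y \<in> nbrs E (free I' P) (t i)"
    "z \<in> comp_in E (free I' P) x" "z \<in> comp_in E (free I' P) y" by (auto simp: side_def)
  then have "comp_in E (free I' P) x = comp_in E (free I' P) y" using comp_in_eq by metis
  then show False using separated[OF o i xy(1,2)] by simp
qed

lemma near_comp: "near K a b \<Longrightarrow> a \<in> K \<Longrightarrow> b \<in> K \<Longrightarrow> b \<in> comp_in E K a"
  unfolding near_def by (auto intro: comp_in_closed[OF comp_in_self] comp_in_closed[OF comp_in_closed[OF comp_in_self]])

text \<open>A free vertex outside both sides would be far from a neighbour of \<open>s i\<close> and
  from a neighbour of \<open>t i\<close>, which are far from each other: a forbidden triple.\<close>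

lemma sides_cover:
  assumes o: "opt I' P" and i: "i \<in> I - I'"
  shows "free I' P = side I' P (s i) \<union> side I' P (t i)"
proof
  let ?K = "free I' P"
  have c: "cfg I' P" using o by (simp add: opt_def)
  have "{s i, t i} \<notin> E" using adjacent_linked(1)[OF o] i by blast
  then obtain x y where xy: "x \<in> nbrs E ?K (s i)" "y \<in> nbrs E ?K (t i)"
    using terminal_nbr[OF c] i by blast
  then have K: "x \<in> ?K" "y \<in> ?K" by (auto simp: nbrs_iff)
  show "?K \<subseteq> side I' P (s i) \<union> side I' P (t i)"
  proof
    fix w assume w: "w \<in> ?K"
    have "near ?K x y \<or> near ?K x w \<or> near ?K y w" using no_far_triple[OF o K w] by blast
    moreover have "\<not> near ?K x y" using near_comp[of ?K x y] K separated[OF o i xy] by blast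
    ultimately have "w \<in> comp_in E ?K x \<or> w \<in> comp_in E ?K y"
      using near_comp[of ?K x w] near_comp[of ?K y w] K w by blast
    then show "w \<in> side I' P (s i) \<union> side I' P (t i)" using xy by (auto simp: side_def)
  qed
qed (use side_sub[of I' P] in blast)

text \<open>Replacing the middle vertex \<open>p\<close> of three consecutive neighbours of \<open>w\<close> by \<open>w\<close> frees \<open>p\<close>; if
  \<open>p\<close> has a neighbour on the other side, the side of \<open>w\<close> shrinks.\<close>

lemma swap_smaller:
  assumes o: "opt I' P" and i: "i \<in> I - I'" and j: "j \<in> I'"
    and w: "w \<in> side I' P (s i)" and w': "w' \<in> side I' P (t i)"
    and a: "a + 2 < length (P j)" "{w, P j ! a} \<in> E" "{w, P j ! (a + 2)} \<in> E" "{w', P j ! (a + 1)} \<in> E"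
  shows "\<exists>P'. opt I' P' \<and> card (side I' P' (s i)) < card (side I' P (s i))"
proof -
  let ?K = "free I' P" and ?p = "P j ! (a + 1)"
  define q where "q = take (Suc a) (P j) @ [w] @ drop (a + 2) (P j)"
  let ?P = "P(j := q)"
  let ?K' = "free I' ?P"
  have c: "cfg I' P" using o by (simp add: opt_def)
  have wK: "w \<in> ?K" "w' \<in> ?K" using w w' side_sub[of I' P] by auto
  have o': "opt I' ?P" unfolding q_def
    by (rule block_nbr_gap(2)[OF o j wK(1), of a "a + 2"]) (use a in auto)
  have c': "cfg I' ?P" using o' by (simp add: opt_def)
  have r: "route j (P j)" "j \<in> I" using c j by (auto simp: cfg_def)
  have wu: "w \<in> L" "w \<notin> set (P j)" using wK(1) r(2) j by (auto simp: used_def block_def)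
  have path: "is_path L E (P j)" using r by (simp add: route_def)
  have w1: "is_path L E [w]" "set [w] \<inter> set (P j) = {}" using wu by auto
  have w3: "{P j ! a, hd [w]} \<in> E" "{last [w], P j ! (a + 2)} \<in> E" using a by (auto simp: insert_commute)
  have "a < a + 2" by simp
  note bp = take_drop_bypass[OF path w1 this a(1) w3, folded q_def]
  have pq: "?p \<notin> set q" using bp(6)[of "a + 1"] by simp
  have wq: "w \<in> set q" by (simp add: q_def)
  have bl: "block I' ?P k = (if k = j then set q else block I' P k)" for k using j by (auto simp: block_def)
  have bj: "block I' P j = set (P j)" using j by (simp add: block_def)
  have pj: "?p \<in> set (P j)" using a by simp
  have used_in: "used I' ?P \<subseteq> insert w (used I' P)"
  proof
    fix x assume "x \<in> used I' ?P"
    then obtain k where k: "k \<in> I" "x \<in> block I' ?P k" by (auto simp: used_def)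
    show "x \<in> insert w (used I' P)"
    proof (cases "k = j")
      case True
      then have "x \<in> set (P j) \<or> x = w" using k bl bp(5) by auto
      then show ?thesis using bj r(2) by (auto simp: used_def)
    next
      case False
      then show ?thesis using k bl by (auto simp: used_def)
    qed
  qed
  have p_free: "?p \<in> ?K'"
  proof -
    have "?p \<notin> block I' ?P k" if "k \<in> I" for k
    proof (cases "k = j")
      case False
      then have "block I' P k \<inter> block I' P j = {}" using c r(2) that by (auto simp: cfg_def)
      then show ?thesis using False bl bj pj by auto
    qed (use bl pq in simp)
    then show ?thesis using pj path by (auto simp: used_def is_path_def)
  qed
  have w_used: "w \<notin> ?K'" using wq bl r(2) by (auto simp: used_def)
  \<comment> \<open>The exchange puts \<open>w\<close> on the path and releases no vertex other than
    the middle one.\<close>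
  have K'sub: "?K' \<subseteq> insert ?p (?K - {w})"
  proof
    fix x assume x: "x \<in> ?K'"
    show "x \<in> insert ?p (?K - {w})"
    proof (rule ccontr)
      assume n: "x \<notin> insert ?p (?K - {w})"
      then have "x \<in> used I' P" using x w_used by auto
      then obtain k where k: "k \<in> I" "x \<in> block I' P k" by (auto simp: used_def)
      have "x \<in> used I' ?P"
      proof (cases "k = j")
        case True
        then obtain b where b: "b < length (P j)" "x = P j ! b" using k bj by (auto simp: in_set_conv_nth)
        then have ne: "b \<noteq> a + 1" using n by auto
        have "x \<in> set q"
        proof (cases "b < Suc a")
          case True
          then have "take (Suc a) (P j) ! b \<in> set (take (Suc a) (P j))" using b by (intro nth_mem) simp
          then show ?thesis using True b by (simp add: q_def)
        next
          case False
          then have d: "(a + 2) + (b - (a + 2)) = b" using ne by linarith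
          have "drop (a + 2) (P j) ! (b - (a + 2)) \<in> set (drop (a + 2) (P j))"
            using b d by (intro nth_mem) simp
          then have "P j ! ((a + 2) + (b - (a + 2))) \<in> set (drop (a + 2) (P j))"
            using a(1) by (subst (asm) nth_drop) auto
          then show ?thesis unfolding d b(2) q_def by auto
        qed
        then show ?thesis using bl r(2) by (auto simp: used_def)
      next
        case False
        then show ?thesis using k bl by (auto simp: used_def)
      qed
      then show False using x by simp
    qed
  qed
  have TK': "side I' P (t i) \<subseteq> ?K'"
  proof -
    have "side I' P (t i) \<subseteq> ?K - {w}" using side_sub[of I' P "t i"] sides_disjoint[OF o i] w by blast
    then show ?thesis using used_in by blast
  qed
  \<comment> \<open>The side of \<open>t i\<close> loses nothing, since \<open>w\<close> was not in
    it, and gains the released vertex through \<open>w'\<close>.\<close>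
  have sub: "insert ?p (side I' P (t i)) \<subseteq> side I' ?P (t i)"
  proof -
    have *: "x \<in> side I' ?P (t i)" if x: "x \<in> side I' P (t i)" for x
    proof -
      obtain u where u: "u \<in> nbrs E ?K (t i)" "x \<in> comp_in E ?K u" using x by (auto simp: side_def)
      have uK: "u \<in> ?K" using u(1) by (simp add: nbrs_iff)
      have cs: "comp_in E ?K u \<subseteq> side I' P (t i)" using u(1) by (auto simp: side_def)
      have "comp_in E ?K u \<subseteq> comp_in E ?K' u"
        using conn_subset_comp[OF conn_comp_in[OF uK] order_trans[OF cs TK'] comp_in_self] .
      moreover have "u \<in> side I' P (t i)" using cs comp_in_self[of u E ?K] by (rule subsetD)
      then have "u \<in> nbrs E ?K' (t i)" using TK' u(1) by (auto simp: nbrs_iff)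
      ultimately show ?thesis using u(2) unfolding side_def by blast
    qed
    have "?p \<in> nbrs E ?K' w'" using p_free a(4) by (simp add: nbrs_iff)
    then have "?p \<in> side I' ?P (t i)" using side_closed[OF *[OF w']] by blast
    then show ?thesis using * by blast
  qed
  \<comment> \<open>The new sides are disjoint again, so the released vertex cannot make up for the
    loss of \<open>w\<close>.\<close>
  have "side I' ?P (s i) \<subseteq> side I' P (s i) - {w}"
  proof
    fix x assume x: "x \<in> side I' ?P (s i)"
    then have n: "x \<notin> insert ?p (side I' P (t i))" using sub sides_disjoint[OF o' i] by blast
    then have "x \<in> ?K - {w}" using x K'sub side_sub[of I' ?P "s i"] by blast
    then show "x \<in> side I' P (s i) - {w}" using n sides_cover[OF o i] by blast
  qed
  moreover have "finite (side I' P (s i))" using finite_subset[OF side_sub, of I' P "s i"] finL by simp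
  ultimately have "card (side I' ?P (s i)) < card (side I' P (s i))"
    using w by (intro psubset_card_mono) auto
  then show ?thesis using o' by blast
qed

text \<open>\<open>I'\<close> and \<open>i\<close> are fixed before minimising; only the paths vary,
  as in the exchange of \<open>swap_smaller\<close>.\<close>

lemma exists_minimal_side:
  "\<exists>I' P i. opt I' P \<and> i \<in> I - I' \<and>
     (\<forall>P'. opt I' P' \<longrightarrow> card (side I' P (s i)) \<le> card (side I' P' (s i)))"
proof -
  obtain I' P0 where o: "opt I' P0" using opt_ex by blast
  then have "cfg I' P0" by (simp add: opt_def)
  then obtain i where i: "i \<in> I - I'" using not_all[of I' P0] by (auto simp: cfg_def)
  obtain P where "opt I' P" "\<And>P'. opt I' P' \<Longrightarrow> card (side I' P (s i)) \<le> card (side I' P' (s i))"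
    using ex_has_least_nat[of "opt I'" P0 "\<lambda>P. card (side I' P (s i))"] o by blast
  then show ?thesis using i by blast
qed

text \<open>Three neighbours each make the left side 12, which exceeds the bound only for blocks of
  three or four vertices among those that have three at all. On so short a path the triples of
  \<open>w\<close> and \<open>w'\<close> overlap enough that \<open>w'\<close> sees the middle
  vertex of the triple of \<open>w\<close>, and \<open>swap_smaller\<close> contradicts the minimal
  side.\<close>

lemma nbrs_triple_sum:
  assumes o: "opt I' P" and i: "i \<in> I - I'" and j: "j \<in> I"
    and min: "\<And>P'. opt I' P' \<Longrightarrow> card (side I' P (s i)) \<le> card (side I' P' (s i))"
    and w: "w \<in> side I' P (s i)" and w': "w' \<in> side I' P (t i)"
  shows "2 * (card (nbrs E (block I' P j) w) + card (nbrs E (block I' P j) w')) \<le> card (block I' P j) + 7"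
proof -
  have c: "cfg I' P" using o by (simp add: opt_def)
  have wK: "w \<in> free I' P" "w' \<in> free I' P" using w w' side_sub[of I' P] by auto
  let ?m = "card (block I' P j)"
  have b: "card (nbrs E (block I' P j) w) \<le> min 3 ?m" "card (nbrs E (block I' P j) w') \<le> min 3 ?m"
    using block_nbrs[OF o j] wK by auto
  have "\<not> (card (nbrs E (block I' P j) w) = 3 \<and> card (nbrs E (block I' P j) w') = 3)" if m: "?m \<in> {3, 4}"
  proof
    assume eq: "card (nbrs E (block I' P j) w) = 3 \<and> card (nbrs E (block I' P j) w') = 3"
    have j': "j \<in> I'" using card_block2[of j I' P] j m by force
    have len: "length (P j) \<le> 4" using card_block[OF c j'] m by auto
    define A where "A v = {a. a < length (P j) \<and> {v, P j ! a} \<in> E}" for v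
    obtain a where a: "A w = {a, a + 1, a + 2}"
      using nbr_index_set(1,3)[OF o j' wK(1)] eq by (auto simp: A_def)
    obtain a' where a': "A w' = {a', a' + 1, a' + 2}"
      using nbr_index_set(1,3)[OF o j' wK(2)] eq by (auto simp: A_def)
    have mem: "a \<in> A w" "a + 2 \<in> A w" "a' + 2 \<in> A w'" by (simp_all add: a a')
    then have l: "a + 2 < length (P j)" "a' + 2 < length (P j)" by (simp_all add: A_def)
    then have "a + 1 \<in> A w'" using len by (auto simp: a')
    then have e: "{w, P j ! a} \<in> E" "{w, P j ! (a + 2)} \<in> E" "{w', P j ! (a + 1)} \<in> E"
      using mem by (simp_all add: A_def)
    obtain P' where "opt I' P'" "card (side I' P' (s i)) < card (side I' P (s i))"
      using swap_smaller[OF o i j' w w' l(1) e] by blast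
    then show False using min[of P'] by simp
  qed
  moreover have "?m = 3 \<or> ?m = 4 \<or> ?m \<le> 2 \<or> 5 \<le> ?m" by linarith
  ultimately show ?thesis using b by (auto split: if_splits simp: min_def)
qed

text \<open>If both sides contained a vertex of too small degree, adding up the neighbours of these
  two vertices would give at most \<open>24 * l + 3\<close> where \<open>24 * l + 4\<close> is
  required. The excess \<open>(5 * l + 9) div 2\<close> is the largest that this count
  allows.\<close>

lemma dense_side:
  obtains C where "C \<subseteq> L - T" "3 * l \<le> card C" "\<And>v. v \<in> C \<Longrightarrow> card C + (5 * l + 9) div 2 \<le> 2 * card (nbrs E C v)"
proof -
  obtain I' P i where o: "opt I' P" and i: "i \<in> I - I'"
    and min: "\<And>P'. opt I' P' \<Longrightarrow> card (side I' P (s i)) \<le> card (side I' P' (s i))"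
    using exists_minimal_side by blast
  let ?K = "free I' P" and ?S = "side I' P (s i)" and ?R = "side I' P (t i)" and ?q = "(5 * l + 9) div 2"
  have c: "cfg I' P" using o by (simp add: opt_def)
  have iI: "i \<in> I" using i by simp
  have nadj: "{s i, t i} \<notin> E" using adjacent_linked(1)[OF o] i by blast
  have KT: "?K \<subseteq> L - T" using used_sub[OF c] by auto
  have fin: "finite ?S" "finite ?R"
    using finite_subset[OF side_sub, of I' P] finL by simp_all
  have nb: "nbrs E ?K x = nbrs E (side I' P v) x" if "x \<in> side I' P v" for x v
    using side_closed[OF that] side_sub[of I' P v] by (auto simp: nbrs_def)
  have ne: "?S \<noteq> {}" "?R \<noteq> {}"
    using terminal_nbr[OF c iI nadj] by (auto simp: side_def intro: comp_in_self)
  have big: "3 * l \<le> card (side I' P v)" if ne: "side I' P v \<noteq> {}" and fin: "finite (side I' P v)" for v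
  proof -
    obtain x where x: "x \<in> side I' P v" using ne by blast
    then have "x \<in> ?K" using side_sub[of I' P v] by blast
    then have "6 * l + 1 \<le> card (nbrs E (side I' P v) x) + mu I' P" using free_degree_mu[OF o] nb[OF x] by metis
    moreover have "card (nbrs E (side I' P v) x) \<le> card (side I' P v)"
      using fin by (intro card_mono) (auto simp: nbrs_def)
    ultimately show ?thesis using mu_bound(1)[OF o] by linarith
  qed
  have "(\<forall>w\<in>?S. card ?S + ?q \<le> 2 * card (nbrs E ?S w)) \<or> (\<forall>w\<in>?R. card ?R + ?q \<le> 2 * card (nbrs E ?R w))"
  proof (rule ccontr)
    assume "\<not> ?thesis"
    then obtain w w' where w: "w \<in> ?S" "2 * card (nbrs E ?S w) < card ?S + ?q"
      and w': "w' \<in> ?R" "2 * card (nbrs E ?R w') < card ?R + ?q" by (auto simp: not_le)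
    have wK: "w \<in> ?K" "w' \<in> ?K" using w(1) w'(1) side_sub[of I' P] by auto
    define \<beta> where "\<beta> j = card (nbrs E (block I' P j) w) + card (nbrs E (block I' P j) w')" for j
    have d: "12 * l + 2 \<le> card (nbrs E ?S w) + card (nbrs E ?R w') + (\<Sum>j\<in>I. \<beta> j)"
      using free_degree[OF c wK(1)] free_degree[OF c wK(2)] nb[OF w(1)] nb[OF w'(1)]
      by (simp add: \<beta>_def sum.distrib)
    have bi: "block I' P i = {s i, t i}" using i by (simp add: block_def)
    \<comment> \<open>The unlinked pair contributes little: as the sides are disjoint,
      \<open>w\<close> does not see \<open>t i\<close> and \<open>w'\<close> does not see
      \<open>s i\<close>.\<close>
    have "w \<notin> ?R" "w' \<notin> ?S" using sides_disjoint[OF o i] w(1) w'(1) by auto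
    then have "{t i, w} \<notin> E" "{s i, w'} \<notin> E"
      using wK by (auto simp: side_def nbrs_iff intro: comp_in_self)
    then have "nbrs E (block I' P i) w \<subseteq> {s i}" "nbrs E (block I' P i) w' \<subseteq> {t i}"
      by (auto simp: bi nbrs_def insert_commute)
    then have "card (nbrs E (block I' P i) w) \<le> card {s i}" "card (nbrs E (block I' P i) w') \<le> card {t i}"
      by (auto intro!: card_mono simp del: card_insert_disjoint)
    then have bi2: "2 * \<beta> i \<le> card (block I' P i) + 2"
      using card_block2[OF i, of P] by (simp add: \<beta>_def)
    have "2 * (\<Sum>j\<in>I. \<beta> j) = 2 * \<beta> i + (\<Sum>j\<in>I-{i}. 2 * \<beta> j)"
      by (simp add: sum.remove[OF finI iI] sum_distrib_left)
    also have "\<dots> \<le> (card (block I' P i) + 2) + (\<Sum>j\<in>I-{i}. card (block I' P j) + 7)"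
      using nbrs_triple_sum[OF o i _ min w(1) w'(1)] unfolding \<beta>_def[symmetric]
      by (intro add_mono sum_mono bi2) auto
    also have "\<dots> = card (used I' P) + 2 + 7 * card (I - {i})"
      unfolding card_used[OF c] by (simp add: sum.remove[OF finI iI] sum.distrib)
    finally have sb: "2 * (\<Sum>j\<in>I. \<beta> j) \<le> card (used I' P) + 2 + 7 * card (I - {i})" .
    have "card (I - {i}) + 1 = l" using card_Suc_Diff1[OF finI iI] by (simp add: l_def)
    moreover have "card ?K = card ?S + card ?R"
      unfolding sides_cover[OF o i] using sides_disjoint[OF o i] fin by (intro card_Un_disjoint) auto
    ultimately show False using d sb w(2) w'(2) card_free[OF c] by linarith
  qed
  then show ?thesis
  proof
    assume "\<forall>w\<in>?S. card ?S + ?q \<le> 2 * card (nbrs E ?S w)"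
    then show ?thesis using that[of ?S] big[OF ne(1) fin(1)] side_sub[of I' P "s i"] KT by blast
  next
    assume "\<forall>w\<in>?R. card ?R + ?q \<le> 2 * card (nbrs E ?R w)"
    then show ?thesis using that[of ?R] big[OF ne(2) fin(2)] side_sub[of I' P "t i"] KT by blast
  qed
qed

end

text \<open>The dense side satisfies the degree condition of \<open>dense_linkable\<close> whatever
  the pairs in it. It avoids all given terminals, so it can serve as a place to which they are
  routed.\<close>

lemma dense_or_linkable:
  fixes s t :: "'i \<Rightarrow> 'a"
  assumes "finite L" "finite I" "l = card I" "\<forall>e\<in>E. card e = 2"
    and "terminals I s t" "s ` I \<union> t ` I \<subseteq> L" "card L \<le> 12 * l + 1"
    and "\<And>v. v \<in> L - (s ` I \<union> t ` I) \<Longrightarrow> 6 * l + 1 \<le> card (nbrs E L v)"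
    and "\<And>i. i \<in> I \<Longrightarrow> {s i, t i} \<notin> E \<Longrightarrow>
        4 * l + 2 \<le> card (nbrs E (L - (s ` I \<union> t ` I)) (s i)) \<and>
        4 * l + 2 \<le> card (nbrs E (L - (s ` I \<union> t ` I)) (t i))"
    and "\<not> linkable L E I s t"
  obtains C where "C \<subseteq> L - (s ` I \<union> t ` I)" "3 * l \<le> card C"
    "\<And>(J :: 'j set) u v. finite J \<Longrightarrow> card J = l \<Longrightarrow> terminals J u v \<Longrightarrow> u ` J \<union> v ` J \<subseteq> C \<Longrightarrow> linkable C E J u v"
proof -
  interpret dense_pairs L E I s t l using assms by unfold_locales auto
  obtain C where C: "C \<subseteq> L - T" "3 * l \<le> card C"
    "\<And>v. v \<in> C \<Longrightarrow> card C + (5 * l + 9) div 2 \<le> 2 * card (nbrs E C v)" using dense_side by blast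
  have "linkable C E J u v"
    if "finite J" "card J = l" "terminals J u v" "u ` J \<union> v ` J \<subseteq> C" for J :: "'j set" and u v
    by (rule dense_linkable[of C J E u v "(5 * l + 9) div 2"])
      (use C that assms(1,4) finite_subset[of C L] in auto)
  then show ?thesis using that[of C] C by (auto simp: T_def)
qed

section \<open>Linked sets\<close>

definition pairing :: "'a set \<Rightarrow> 'a set set \<Rightarrow> bool" where
  "pairing X M \<longleftrightarrow> (\<forall>e\<in>M. e \<subseteq> X \<and> card e = 2) \<and> disjoint M"

text \<open>The condition \<open>U e \<inter> X = e\<close> keeps a link away from members of
  \<open>X\<close> that the pairing leaves out. This makes the notion pass to subsets and lets links
  be continued beyond \<open>X\<close> without collisions.\<close>

definition linked :: "'a set \<Rightarrow> 'a set set \<Rightarrow> 'a set \<Rightarrow> bool" where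
  "linked W E X \<longleftrightarrow> (\<forall>M. pairing X M \<longrightarrow> (\<exists>U. (\<forall>e\<in>M. U e \<subseteq> W \<and> conn E (U e) \<and> U e \<inter> X = e) \<and>
     (\<forall>e\<in>M. \<forall>f\<in>M. e \<noteq> f \<longrightarrow> U e \<inter> U f = {})))"

lemma linkedD:
  assumes "linked W E X" "pairing X M"
  obtains U where "\<forall>e\<in>M. U e \<subseteq> W \<and> conn E (U e) \<and> U e \<inter> X = e"
    "\<forall>e\<in>M. \<forall>f\<in>M. e \<noteq> f \<longrightarrow> U e \<inter> U f = {}"
  using assms(1)[unfolded linked_def, THEN spec, THEN mp, OF assms(2)] by (elim exE conjE)

lemma linkedI:
  assumes "\<And>M. pairing X M \<Longrightarrow> \<exists>U. (\<forall>e\<in>M. U e \<subseteq> W \<and> conn E (U e) \<and> U e \<inter> X = e) \<and>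
     (\<forall>e\<in>M. \<forall>f\<in>M. e \<noteq> f \<longrightarrow> U e \<inter> U f = {})"
  shows "linked W E X"
  unfolding linked_def by (intro allI impI assms)

lemma pairing_mono: "pairing X M \<Longrightarrow> X \<subseteq> Y \<Longrightarrow> pairing Y M"
  unfolding pairing_def by blast

lemma pairing_disjoint: "pairing X M \<Longrightarrow> e \<in> M \<Longrightarrow> f \<in> M \<Longrightarrow> x \<in> e \<Longrightarrow> x \<in> f \<Longrightarrow> e = f"
  unfolding pairing_def disjoint_def by blast

lemma linked_subset:
  assumes "linked W E X" "Y \<subseteq> X"
  shows "linked W E Y"
proof (rule linkedI)
  fix M assume M: "pairing Y M"
  obtain U where U0: "\<forall>e\<in>M. U e \<subseteq> W \<and> conn E (U e) \<and> U e \<inter> X = e"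
    "\<forall>e\<in>M. \<forall>f\<in>M. e \<noteq> f \<longrightarrow> U e \<inter> U f = {}"
    by (rule linkedD[OF assms(1) pairing_mono[OF M assms(2)]])
  note U = U0(1)[rule_format, THEN conjunct1] U0(1)[rule_format, THEN conjunct2, THEN conjunct1]
    U0(1)[rule_format, THEN conjunct2, THEN conjunct2] U0(2)[rule_format]
  have "U e \<inter> Y = e" if "e \<in> M" for e using U(3)[OF that] assms(2) M that unfolding pairing_def by blast
  then show "\<exists>U. (\<forall>e\<in>M. U e \<subseteq> W \<and> conn E (U e) \<and> U e \<inter> Y = e) \<and>
     (\<forall>e\<in>M. \<forall>f\<in>M. e \<noteq> f \<longrightarrow> U e \<inter> U f = {})" using U(1,2,4) by (intro exI[of _ U]) auto
qed

lemma linked_mono: "linked W E X \<Longrightarrow> W \<subseteq> W' \<Longrightarrow> E \<subseteq> E' \<Longrightarrow> linked W' E' X"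
proof (rule linkedI)
  fix M assume l: "linked W E X" "W \<subseteq> W'" "E \<subseteq> E'" and M: "pairing X M"
  obtain U where U0: "\<forall>e\<in>M. U e \<subseteq> W \<and> conn E (U e) \<and> U e \<inter> X = e"
    "\<forall>e\<in>M. \<forall>f\<in>M. e \<noteq> f \<longrightarrow> U e \<inter> U f = {}"
    by (rule linkedD[OF l(1) M])
  note U = U0(1)[rule_format, THEN conjunct1] U0(1)[rule_format, THEN conjunct2, THEN conjunct1]
    U0(1)[rule_format, THEN conjunct2, THEN conjunct2] U0(2)[rule_format]
  then show "\<exists>U. (\<forall>e\<in>M. U e \<subseteq> W' \<and> conn E' (U e) \<and> U e \<inter> X = e) \<and>
     (\<forall>e\<in>M. \<forall>f\<in>M. e \<noteq> f \<longrightarrow> U e \<inter> U f = {})"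
    by (intro exI[of _ U] conjI ballI impI order_trans[OF U(1) l(2)] conn_mono[OF U(2) l(3)] U(3,4))
qed

lemma perfect_pairing:
  assumes "finite R" "even (card R)"
  shows "\<exists>M. pairing R M \<and> \<Union> M = R"
  using assms
proof (induction "card R" arbitrary: R rule: less_induct)
  case less
  show ?case
  proof (cases "R = {}")
    case False
    then obtain x where x: "x \<in> R" by blast
    then have "card (R - {x}) + 1 = card R" using less.prems(1) card_Suc_Diff1 by fastforce
    then have "R - {x} \<noteq> {}" using less.prems(2) by (metis One_nat_def add_0 card.empty odd_one)
    then obtain y where y: "y \<in> R" "y \<noteq> x" by blast
    have c: "card (R - {x, y}) + 2 = card R"
    proof -
      have "R - {x, y} = R - {x} - {y}" by auto
      then have "card (R - {x, y}) = card (R - {x} - {y})" by (rule arg_cong)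
      moreover have "Suc (card (R - {x} - {y})) = card (R - {x})"
        by (rule card_Suc_Diff1) (use less.prems(1) y in auto)
      ultimately show ?thesis using card_Suc_Diff1[OF less.prems(1) x] by linarith
    qed
    then have "even (card (R - {x, y}))" using less.prems(2) by (metis even_add even_numeral)
    then obtain M where M: "pairing (R - {x, y}) M" "\<Union> M = R - {x, y}"
      using less.hyps[of "R - {x, y}"] c less.prems(1) by auto
    have 1: "e \<subseteq> R - {x, y}" "card e = 2" if "e \<in> M" for e using M(1) that by (auto simp: pairing_def)
    have "disjoint (insert {x, y} M)"
    proof (rule disjointI)
      fix e f assume ef: "e \<in> insert {x, y} M" "f \<in> insert {x, y} M" "e \<noteq> f"
      have "disjoint M" using M(1) by (simp add: pairing_def)
      then show "e \<inter> f = {}" using ef 1(1)[of e] 1(1)[of f] disjointD[of M e f] by auto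
    qed
    moreover have "card {x, y} = 2" "{x, y} \<subseteq> R" using x y by auto
    ultimately have "pairing R (insert {x, y} M)"
      using 1 unfolding pairing_def by blast
    moreover have "\<Union> (insert {x, y} M) = R" using M(2) x y by auto
    ultimately show ?thesis by blast
  qed (auto simp: pairing_def disjoint_def)
qed

lemma card_Union_pairing:
  assumes "pairing X M" "finite X"
  shows "finite M" "card (\<Union> M) = 2 * card M"
proof -
  have "M \<subseteq> Pow X" using assms(1) by (auto simp: pairing_def)
  then show fin: "finite M" using assms(2) by (meson finite_Pow_iff finite_subset)
  have "card (\<Union> M) = (\<Sum>e\<in>M. card e)"
    by (rule card_Union_disjoint) (use assms in \<open>auto simp: pairing_def disjoint_def pairwise_def disjnt_def intro: finite_subset\<close>)
  also have "\<dots> = (\<Sum>e\<in>M. 2)" using assms(1) by (intro sum.cong) (auto simp: pairing_def)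
  finally show "card (\<Union> M) = 2 * card M" by simp
qed

text \<open>Padding: once the unpaired members of \<open>Z\<close> are paired as well, the links of
  the old pairs are forced to avoid them.\<close>

lemma extend_pairing:
  assumes C: "finite C" "Z \<subseteq> C" "card Z \<le> 2 * l" "2 * l \<le> card C" and M: "pairing Z M"
  obtains N where "pairing C N" "M \<subseteq> N" "Z \<subseteq> \<Union> N" "card N = l"
proof -
  obtain T where T: "Z \<subseteq> T" "T \<subseteq> C" "card T = 2 * l"
    using exists_subset_between[of Z "2 * l" C] C by metis
  have finT: "finite T" using T C finite_subset by blast
  have MZ: "\<Union> M \<subseteq> Z" using M by (auto simp: pairing_def)
  have finZ: "finite Z" using C finite_subset by blast
  have "card (T - \<Union> M) = card T - card (\<Union> M)" using MZ T finZ by (intro card_Diff_subset) (auto intro: finite_subset)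
  then have "even (card (T - \<Union> M))" using T card_Union_pairing[OF M finZ] by simp
  then obtain R where R: "pairing (T - \<Union> M) R" "\<Union> R = T - \<Union> M" using perfect_pairing[of "T - \<Union> M"] finT by auto
  have p: "pairing T (M \<union> R)"
    unfolding pairing_def
  proof (intro conjI ballI)
    show "e \<subseteq> T" "card e = 2" if "e \<in> M \<union> R" for e
      using that M R(1) T(1) unfolding pairing_def by blast+
    show "disjoint (M \<union> R)"
    proof (rule disjointI)
      fix e f assume ef: "e \<in> M \<union> R" "f \<in> M \<union> R" "e \<noteq> f"
      show "e \<inter> f = {}"
      proof (rule ccontr)
        assume "e \<inter> f \<noteq> {}"
        then obtain x where x: "x \<in> e" "x \<in> f" by blast
        have "x \<in> \<Union> M \<Longrightarrow> e \<in> M \<and> f \<in> M" "x \<notin> \<Union> M \<Longrightarrow> e \<in> R \<and> f \<in> R"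
          using ef x R(2) by auto
        then show False using pairing_disjoint[OF M _ _ x] pairing_disjoint[OF R(1) _ _ x] ef(3) by blast
      qed
    qed
  qed
  have U: "\<Union> (M \<union> R) = T" using R(2) MZ T by auto
  then have "card (M \<union> R) = l" using card_Union_pairing(2)[OF p finT] T by simp
  then show ?thesis using that[of "M \<union> R"] pairing_mono[OF p T(2)] U T(1) by auto
qed

text \<open>The padded pairing covers \<open>Z\<close>, so disjointness of its links yields the
  exactness that \<open>linked\<close> demands. \<open>X0\<close> records that only terminal sets
  containing it have to be linkable.\<close>

lemma linked_of_linkable:
  fixes C :: "'a set"
  assumes C: "finite C" "Z \<subseteq> C" "X0 \<subseteq> Z" "card Z \<le> 2 * l" "2 * l \<le> card C"
    and L: "\<And>(J :: 'a set set) u v. finite J \<Longrightarrow> card J = l \<Longrightarrow> terminals J u v \<Longrightarrow> u ` J \<union> v ` J \<subseteq> C \<Longrightarrow>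
        X0 \<subseteq> u ` J \<union> v ` J \<Longrightarrow> linkable C E J u v"
  shows "linked C E Z"
proof (rule linkedI)
  fix M assume M: "pairing Z M"
  obtain N where N: "pairing C N" "M \<subseteq> N" "Z \<subseteq> \<Union> N" "card N = l"
    using extend_pairing[OF C(1,2,4,5) M] by blast
  have finN: "finite N" using card_Union_pairing(1)[OF N(1) C(1)] .
  have "\<forall>e\<in>N. \<exists>a b. e = {a, b} \<and> a \<noteq> b" using N(1) by (auto simp: pairing_def card_2_iff)
  then obtain u v where uv: "\<And>e. e \<in> N \<Longrightarrow> e = {u e, v e} \<and> u e \<noteq> v e" by metis
  have ue: "u e \<in> e" "v e \<in> e" if "e \<in> N" for e using uv[OF that] by auto
  have eq: "e = f" if "e \<in> N" "f \<in> N" "x \<in> e" "x \<in> f" for e f x using pairing_disjoint[OF N(1) that] .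
  have "terminals N u v"
    unfolding terminals_def
  proof (intro conjI)
    show "inj_on u N" by (rule inj_onI) (metis eq ue(1))
    show "inj_on v N" by (rule inj_onI) (metis eq ue(2))
    show "u ` N \<inter> v ` N = {}"
    proof (rule ccontr)
      assume "\<not> ?thesis"
      then obtain e f where ef: "e \<in> N" "f \<in> N" "u e = v f" by auto
      then have "e = f" using eq[of e f "u e"] ue by metis
      then show False using ef uv by metis
    qed
  qed
  moreover have un: "u ` N \<union> v ` N = \<Union> N" using uv by blast
  moreover have "\<Union> N \<subseteq> C" using N(1) by (auto simp: pairing_def)
  ultimately have "linkable C E N u v" using L[of N u v] finN N(4) C(3) N(3) by auto
  then obtain U where U: "\<forall>i\<in>N. U i \<subseteq> C \<and> conn E (U i) \<and> u i \<in> U i \<and> v i \<in> U i"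
    "\<forall>i\<in>N. \<forall>j\<in>N. i \<noteq> j \<longrightarrow> U i \<inter> U j = {}" unfolding linkable_def by blast
  have sub: "e \<subseteq> U e" if "e \<in> N" for e using U(1) uv[OF that] that by (metis empty_subsetI insert_subset)
  have "U e \<inter> Z = e" if e: "e \<in> M" for e
  proof
    have eN: "e \<in> N" using e N(2) by blast
    show "e \<subseteq> U e \<inter> Z" using sub[OF eN] M e by (auto simp: pairing_def)
    show "U e \<inter> Z \<subseteq> e"
    proof
      fix z assume z: "z \<in> U e \<inter> Z"
      then obtain f where f: "f \<in> N" "z \<in> f" using N(3) by blast
      then have "U e \<inter> U f \<noteq> {}" using sub[OF f(1)] z by blast
      then show "z \<in> e" using U(2) eN f by blast
    qed
  qed
  then show "\<exists>U. (\<forall>e\<in>M. U e \<subseteq> C \<and> conn E (U e) \<and> U e \<inter> Z = e) \<and>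
     (\<forall>e\<in>M. \<forall>f\<in>M. e \<noteq> f \<longrightarrow> U e \<inter> U f = {})"
    using U N(2) by (intro exI[of _ U] conjI ballI impI) (meson subsetD)+
qed

text \<open>A clique on \<open>A \<inter> B\<close> stands in for the links through \<open>B\<close>.\<close>

definition clique :: "'a set \<Rightarrow> 'a set set" where
  "clique Z = {{a, b} |a b. a \<in> Z \<and> b \<in> Z \<and> a \<noteq> b}"

text \<open>A link may use clique edges many times. But if its ends lie in different components with
  respect to \<open>E\<close>, both components reach \<open>Z\<close>, and one link through
  \<open>B\<close> between them replaces everything else.\<close>

lemma linked_replace:
  assumes l1: "linked A (E \<union> clique Z) X" and Z: "Z = A \<inter> B" and X: "X \<subseteq> A" and l2: "linked B E Z"
  shows "linked (A \<union> B) E X"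
proof (rule linkedI)
  fix M assume M: "pairing X M"
  obtain U where U0: "\<forall>e\<in>M. U e \<subseteq> A \<and> conn (E \<union> clique Z) (U e) \<and> U e \<inter> X = e"
    "\<forall>e\<in>M. \<forall>f\<in>M. e \<noteq> f \<longrightarrow> U e \<inter> U f = {}"
    by (rule linkedD[OF l1 M])
  note U = U0(1)[rule_format, THEN conjunct1] U0(1)[rule_format, THEN conjunct2, THEN conjunct1]
    U0(1)[rule_format, THEN conjunct2, THEN conjunct2] U0(2)[rule_format]
  have "\<forall>e\<in>M. \<exists>a b. e = {a, b} \<and> a \<noteq> b" using M by (auto simp: pairing_def card_2_iff)
  then obtain a b where ab: "\<And>e. e \<in> M \<Longrightarrow> e = {a e, b e} \<and> a e \<noteq> b e" by metis
  have abU: "a e \<in> U e" "b e \<in> U e" if "e \<in> M" for e using U(3)[OF that] ab[OF that] by blast+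
  define D where "D = {e\<in>M. b e \<notin> comp_in E (U e) (a e)}"
  have hit: "comp_in E (U e) v \<inter> Z \<noteq> {}" if e: "e \<in> D" "v \<in> {a e, b e}" for e v
  proof -
    have eM: "e \<in> M" using e by (simp add: D_def)
    have v: "v \<in> U e" using e(2) abU[OF eM] by auto
    have "comp_in E (U e) v \<noteq> U e"
      using e abU[OF eM] comp_in_eq[of "b e" E "U e" "a e"] comp_in_eq[of "a e" E "U e" "b e"]
      by (auto simp: D_def)
    moreover have sub: "comp_in E (U e) v \<subseteq> U e" by (rule comp_in_subset[OF v])
    moreover have "comp_in E (U e) v \<noteq> {}" using comp_in_self by fast
    ultimately obtain p q where pq: "p \<in> comp_in E (U e) v" "q \<in> U e - comp_in E (U e) v" "{p, q} \<in> E \<union> clique Z"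
      using conn_cut[OF U(2)[OF eM]] by metis
    then have "{p, q} \<notin> E" using comp_in_closed[of p E "U e" v q] sub by blast
    then have "p \<in> Z" using pq(3) by (auto simp: clique_def doubleton_eq_iff)
    then show ?thesis using pq(1) by blast
  qed
  then have "\<forall>e\<in>D. \<exists>z. z \<in> comp_in E (U e) (a e) \<inter> Z" "\<forall>e\<in>D. \<exists>z. z \<in> comp_in E (U e) (b e) \<inter> Z" by blast+
  then obtain y z where yz: "\<And>e. e \<in> D \<Longrightarrow> y e \<in> comp_in E (U e) (a e) \<inter> Z"
    "\<And>e. e \<in> D \<Longrightarrow> z e \<in> comp_in E (U e) (b e) \<inter> Z" by metis
  have DM: "e \<in> M" if "e \<in> D" for e using that by (simp add: D_def)
  have yzU: "y e \<in> U e" "z e \<in> U e" "y e \<in> Z" "z e \<in> Z" if "e \<in> D" for e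
    using yz[OF that] comp_in_subset[OF abU(1)[OF DM[OF that]]] comp_in_subset[OF abU(2)[OF DM[OF that]]] by auto
  have ne: "y e \<noteq> z e" if "e \<in> D" for e
  proof
    assume "y e = z e"
    then have "comp_in E (U e) (a e) = comp_in E (U e) (b e)" using yz[OF that] comp_in_eq by (metis IntD1)
    then show False using that comp_in_self unfolding D_def by fastforce
  qed
  define \<pi> where "\<pi> e = {y e, z e}" for e
  have piU: "\<pi> e \<subseteq> U e" "\<pi> e \<subseteq> Z" "card (\<pi> e) = 2" if "e \<in> D" for e
    using yzU[OF that] ne[OF that] by (auto simp: \<pi>_def)
  have pid: "\<pi> e \<inter> \<pi> f = {}" if "e \<in> D" "f \<in> D" "e \<noteq> f" for e f
    using piU(1)[OF that(1)] piU(1)[OF that(2)] U(4)[OF DM[OF that(1)] DM[OF that(2)] that(3)] by blast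
  have "pairing Z (\<pi> ` D)"
    unfolding pairing_def disjoint_def using piU pid by blast
  then obtain W where W0: "\<forall>e\<in>\<pi> ` D. W e \<subseteq> B \<and> conn E (W e) \<and> W e \<inter> Z = e"
    "\<forall>e\<in>\<pi> ` D. \<forall>f\<in>\<pi> ` D. e \<noteq> f \<longrightarrow> W e \<inter> W f = {}"
    by (rule linkedD[OF l2])
  note W = W0(1)[rule_format, THEN conjunct1] W0(1)[rule_format, THEN conjunct2, THEN conjunct1]
    W0(1)[rule_format, THEN conjunct2, THEN conjunct2] W0(2)[rule_format]
  have WA: "W (\<pi> e) \<inter> A = \<pi> e" if "e \<in> D" for e
  proof -
    have "W (\<pi> e) \<inter> A = W (\<pi> e) \<inter> Z" using W(1)[of "\<pi> e"] that Z by auto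
    then show ?thesis using W(3)[of "\<pi> e"] that by auto
  qed
  define Q where "Q e = (if e \<in> D then comp_in E (U e) (a e) \<union> W (\<pi> e) \<union> comp_in E (U e) (b e)
      else comp_in E (U e) (a e))" for e
  have QA: "Q e \<inter> A \<subseteq> U e" if e: "e \<in> M" for e
  proof -
    have c: "comp_in E (U e) (a e) \<subseteq> U e" "comp_in E (U e) (b e) \<subseteq> U e"
      using comp_in_subset abU[OF e] by metis+
    show ?thesis
    proof (cases "e \<in> D")
      case True
      then show ?thesis using c WA[OF True] piU(1)[OF True] unfolding Q_def by auto
    qed (use c in \<open>auto simp: Q_def\<close>)
  qed
  have QB: "Q e - A \<subseteq> (if e \<in> D then W (\<pi> e) else {})" if e: "e \<in> M" for e
  proof -
    have "comp_in E (U e) (a e) \<subseteq> A" "comp_in E (U e) (b e) \<subseteq> A"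
      using comp_in_subset abU[OF e] U(1)[OF e] by (metis order_trans)+
    then show ?thesis unfolding Q_def by auto
  qed
  have Qab: "{a e, b e} \<subseteq> Q e" if "e \<in> M" for e using that by (auto simp: Q_def D_def)
  have Qc: "conn E (Q e)" if e: "e \<in> M" for e
  proof (cases "e \<in> D")
    case True
    have pM: "\<pi> e \<in> \<pi> ` D" using True by (rule imageI)
    have yW: "y e \<in> W (\<pi> e)" "z e \<in> W (\<pi> e)" using W(3)[OF pM] by (auto simp: \<pi>_def)
    have "conn E (comp_in E (U e) (a e) \<union> W (\<pi> e))"
      by (rule conn_Un[OF conn_comp_in[OF abU(1)[OF e]] W(2)[OF pM]]) (use yW yz(1)[OF True] in blast)
    then have "conn E (comp_in E (U e) (a e) \<union> W (\<pi> e) \<union> comp_in E (U e) (b e))"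
      by (rule conn_Un[OF _ conn_comp_in[OF abU(2)[OF e]]]) (use yW yz(2)[OF True] in blast)
    then show ?thesis using True by (simp add: Q_def)
  next
    case False
    then show ?thesis using conn_comp_in[OF abU(1)[OF e]] by (simp add: Q_def)
  qed
  have Qsub: "Q e \<subseteq> A \<union> B" if e: "e \<in> M" for e
    using QB[OF e] W(1)[of "\<pi> e"] by (cases "e \<in> D") auto
  have QX: "Q e \<inter> X = e" if e: "e \<in> M" for e
  proof
    show "Q e \<inter> X \<subseteq> e" using QA[OF e] U(3)[OF e] X by blast
    show "e \<subseteq> Q e \<inter> X" using Qab[OF e] ab[OF e] U(3)[OF e] by blast
  qed
  have Qd: "Q e \<inter> Q f = {}" if ef: "e \<in> M" "f \<in> M" "e \<noteq> f" for e f
  proof -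
    have "Q e \<inter> Q f \<inter> A = {}" using QA[OF ef(1)] QA[OF ef(2)] U(4)[OF ef] by blast
    moreover have "(Q e - A) \<inter> (Q f - A) = {}"
    proof (cases "e \<in> D \<and> f \<in> D")
      case True
      then have "\<pi> e \<noteq> \<pi> f" using pid[of e f] ef(3) piU(3)[of e] by force
      then have "W (\<pi> e) \<inter> W (\<pi> f) = {}" using W(4) True by blast
      then show ?thesis using QB[OF ef(1)] QB[OF ef(2)] True by auto
    next
      case False
      then show ?thesis using QB[OF ef(1)] QB[OF ef(2)] by auto
    qed
    ultimately show ?thesis by blast
  qed
  show "\<exists>U. (\<forall>e\<in>M. U e \<subseteq> A \<union> B \<and> conn E (U e) \<and> U e \<inter> X = e) \<and>
     (\<forall>e\<in>M. \<forall>f\<in>M. e \<noteq> f \<longrightarrow> U e \<inter> U f = {})"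
    using Qc Qsub QX Qd by (intro exI[of _ Q]) auto
qed

lemma linked_connect:
  assumes h: "\<And>z. z \<in> Z \<Longrightarrow> h z \<subseteq> W \<and> conn E (h z) \<and> z \<in> h z \<and> h z \<inter> C = {g z}"
    and hd: "\<And>z z'. z \<in> Z \<Longrightarrow> z' \<in> Z \<Longrightarrow> z \<noteq> z' \<Longrightarrow> h z \<inter> h z' = {}"
    and l: "linked C E (g ` Z)" and CW: "C \<subseteq> W"
  shows "linked W E Z"
proof (rule linkedI)
  fix M assume M: "pairing Z M"
  have inj: "inj_on g Z"
  proof (rule inj_onI, rule ccontr)
    fix z z' assume z: "z \<in> Z" "z' \<in> Z" "g z = g z'" "z \<noteq> z'"
    have "g z \<in> h z" "g z' \<in> h z'" using h[OF z(1)] h[OF z(2)] by auto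
    then show False using hd[OF z(1,2,4)] z(3) by auto
  qed
  have MZ: "e \<subseteq> Z" "card e = 2" if "e \<in> M" for e using M that by (auto simp: pairing_def)
  have gd: "g ` e \<inter> g ` f = {}" if "e \<in> M" "f \<in> M" "e \<noteq> f" for e f
  proof -
    have "e \<inter> f = {}" using M that by (auto simp: pairing_def disjoint_def)
    then show ?thesis using inj_on_image_Int[OF inj MZ(1)[OF that(1)] MZ(1)[OF that(2)]] by simp
  qed
  have "pairing (g ` Z) ((`) g ` M)"
    unfolding pairing_def disjoint_def
  proof (intro conjI ballI impI)
    fix e assume "e \<in> (`) g ` M"
    then show "e \<subseteq> g ` Z" "card e = 2" using MZ card_image[OF inj_on_subset[OF inj]] by auto
  next
    fix e f assume "e \<in> (`) g ` M" "f \<in> (`) g ` M" "e \<noteq> f"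
    then show "e \<inter> f = {}" using gd by blast
  qed
  then obtain U where U0: "\<forall>e\<in>(`) g ` M. U e \<subseteq> C \<and> conn E (U e) \<and> U e \<inter> g ` Z = e"
    "\<forall>e\<in>(`) g ` M. \<forall>f\<in>(`) g ` M. e \<noteq> f \<longrightarrow> U e \<inter> U f = {}"
    by (rule linkedD[OF l])
  note U = U0(1)[rule_format, THEN conjunct1] U0(1)[rule_format, THEN conjunct2, THEN conjunct1]
    U0(1)[rule_format, THEN conjunct2, THEN conjunct2] U0(2)[rule_format]
  define Q where "Q e = U (g ` e) \<union> (\<Union>z\<in>e. h z)" for e
  have gM: "g ` e \<in> (`) g ` M" if "e \<in> M" for e using that by (rule imageI)
  have gU: "g z \<in> U (g ` e)" if "e \<in> M" "z \<in> e" for e z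
    using U(3)[OF gM[OF that(1)]] imageI[OF that(2), of g] by blast
  have Uh: "U (g ` e) \<inter> h z \<subseteq> (if z \<in> e then {g z} else {})" if "e \<in> M" "z \<in> Z" for e z
  proof -
    have "U (g ` e) \<inter> h z \<subseteq> {g z}" using U(1)[OF gM[OF that(1)]] h[OF that(2)] by blast
    moreover have "z \<in> e" if g: "g z \<in> U (g ` e)"
    proof -
      have "g z \<in> g ` e" using U(3)[OF gM[OF \<open>e \<in> M\<close>]] g \<open>z \<in> Z\<close> by blast
      then show ?thesis using inj_on_image_mem_iff[OF inj \<open>z \<in> Z\<close> MZ(1)[OF \<open>e \<in> M\<close>]] by simp
    qed
    ultimately show ?thesis by auto
  qed
  have hz: "z \<in> Z \<Longrightarrow> z' \<in> Z \<Longrightarrow> z' \<in> h z \<Longrightarrow> z' = z" for z z' using hd[of z z'] h[of z'] by blast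
  have "Q e \<subseteq> W \<and> conn E (Q e) \<and> Q e \<inter> Z = e" if e: "e \<in> M" for e
  proof (intro conjI)
    obtain x y where xy: "e = {x, y}" using MZ(2)[OF e] by (meson card_2_iff)
    have xyZ: "x \<in> Z" "y \<in> Z" using MZ(1)[OF e] xy by auto
    show "Q e \<subseteq> W" using U(1)[OF gM[OF e]] h MZ(1)[OF e] CW unfolding Q_def by blast
    have "conn E (U (g ` e) \<union> h x)"
    proof (rule conn_Un[OF U(2)[OF gM[OF e]]])
      have "g x \<in> U (g ` e)" using gU[OF e, of x] xy by blast
      moreover have "g x \<in> h x" using h[OF xyZ(1)] by blast
      ultimately show "U (g ` e) \<inter> h x \<noteq> {}" by blast
    qed (use h[OF xyZ(1)] in blast)
    then have "conn E (U (g ` e) \<union> h x \<union> h y)"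
    proof (rule conn_Un)
      have "g y \<in> U (g ` e)" using gU[OF e, of y] xy by blast
      moreover have "g y \<in> h y" using h[OF xyZ(2)] by blast
      ultimately show "(U (g ` e) \<union> h x) \<inter> h y \<noteq> {}" by blast
    qed (use h[OF xyZ(2)] in blast)
    then show "conn E (Q e)" by (simp add: Q_def xy Un_assoc)
    show "Q e \<inter> Z = e"
    proof
      show "e \<subseteq> Q e \<inter> Z" using h MZ(1)[OF e] unfolding Q_def by blast
      show "Q e \<inter> Z \<subseteq> e"
      proof
        fix z assume z: "z \<in> Q e \<inter> Z"
        show "z \<in> e"
        proof (cases "z \<in> U (g ` e)")
          case True
          then show ?thesis using Uh[OF e, of z] h[of z] z by (auto split: if_splits)
        next
          case False
          then obtain x where "x \<in> e" "z \<in> h x" using z by (auto simp: Q_def)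
          then show ?thesis using hz[of x z] MZ(1)[OF e] z by blast
        qed
      qed
    qed
  qed
  moreover have "Q e \<inter> Q f = {}" if ef: "e \<in> M" "f \<in> M" "e \<noteq> f" for e f
  proof -
    have d: "e \<inter> f = {}" using M ef by (auto simp: pairing_def disjoint_def)
    have "g ` e \<noteq> g ` f" using gd[OF ef] MZ(2)[OF ef(1)] by force
    then have "U (g ` e) \<inter> U (g ` f) = {}" using U(4)[OF gM[OF ef(1)] gM[OF ef(2)]] by blast
    moreover have "U (g ` e) \<inter> h z = {}" if "z \<in> f" for z
    proof -
      have "z \<in> Z" "z \<notin> e" using that d MZ(1)[OF ef(2)] by auto
      then show ?thesis using Uh[OF ef(1), of z] by simp
    qed
    moreover have "U (g ` f) \<inter> h z = {}" if "z \<in> e" for z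
    proof -
      have "z \<in> Z" "z \<notin> f" using that d MZ(1)[OF ef(1)] by auto
      then show ?thesis using Uh[OF ef(2), of z] by simp
    qed
    moreover have "h x \<inter> h z = {}" if "x \<in> e" "z \<in> f" for x z
      using hd[of x z] that d MZ(1)[OF ef(1)] MZ(1)[OF ef(2)] by blast
    ultimately show ?thesis unfolding Q_def by blast
  qed
  ultimately show "\<exists>U. (\<forall>e\<in>M. U e \<subseteq> W \<and> conn E (U e) \<and> U e \<inter> Z = e) \<and>
     (\<forall>e\<in>M. \<forall>f\<in>M. e \<noteq> f \<longrightarrow> U e \<inter> U f = {})" by (intro exI[of _ Q]) blast
qed

section \<open>The linkage theorem of Thomas and Wollan\<close>

definition rho :: "'a set \<Rightarrow> 'a set set \<Rightarrow> 'a set \<Rightarrow> nat" where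
  "rho V E U = card {e\<in>E. e \<subseteq> V \<and> e \<inter> U \<noteq> {}}"

text \<open>The far side alone already has the density in question; \<open>massed\<close> forbids
  this behind fewer than \<open>card X\<close> vertices. As the inequality is strict, the far side
  is not empty.\<close>

definition msep :: "nat \<Rightarrow> 'a set \<Rightarrow> 'a set set \<Rightarrow> 'a set \<Rightarrow> 'a set \<Rightarrow> 'a set \<Rightarrow> bool" where
  "msep a V E X A B \<longleftrightarrow> sepn V E A B \<and> X \<subseteq> A \<and> a * card (B - A) < rho V E (B - A)"

text \<open>The induction hypothesis of Thomas and Wollan's linkage theorem.\<close>

definition massed :: "nat \<Rightarrow> 'a set \<Rightarrow> 'a set set \<Rightarrow> 'a set \<Rightarrow> bool" where
  "massed a V E X \<longleftrightarrow> X \<subseteq> V \<and> a * card (V - X) < rho V E (V - X) \<and>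
     (\<forall>A B. msep a V E X A B \<longrightarrow> card X \<le> card (A \<inter> B))"

lemma finite_edges: "finite V \<Longrightarrow> finite {e\<in>E. e \<subseteq> V \<and> P e}"
  by (rule finite_subset[of _ "Pow V"]) auto

lemma sepn_subset: "sepn V E A B \<Longrightarrow> A \<subseteq> V \<and> B \<subseteq> V"
  by (auto simp: sepn_def)

lemma sepn_edge:
  assumes "sepn V E A B" "\<forall>e\<in>E. card e = 2" "e \<in> E" "e \<subseteq> V" "e \<inter> (B - A) \<noteq> {}"
  shows "e \<subseteq> B"
proof -
  obtain p q where e: "e = {p, q}" using assms(2,3) by (metis card_2_iff)
  have pq: "p \<in> A \<union> B" "q \<in> A \<union> B" using e assms(1,4) by (auto simp: sepn_def)
  have no: "{x, y} \<notin> E" if "x \<in> A - B" "y \<in> B - A" for x y using assms(1) that by (auto simp: sepn_def)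
  have "\<not> (p \<in> A - B \<and> q \<in> B - A)" "\<not> (q \<in> A - B \<and> p \<in> B - A)"
    using no[of p q] no[of q p] assms(3) e by (auto simp: insert_commute)
  then show ?thesis using assms(5) e pq by auto
qed

lemma rho_sepn:
  assumes "sepn V E A B" "\<forall>e\<in>E. card e = 2" "U \<subseteq> B - A"
  shows "rho V E U = rho B E U"
proof -
  have "{e\<in>E. e \<subseteq> V \<and> e \<inter> U \<noteq> {}} = {e\<in>E. e \<subseteq> B \<and> e \<inter> U \<noteq> {}}"
  proof (intro Collect_cong iffI conjI; elim conjE)
    fix e assume e: "e \<in> E" "e \<subseteq> V" "e \<inter> U \<noteq> {}"
    then have "e \<inter> (B - A) \<noteq> {}" using assms(3) by blast
    then show "e \<subseteq> B" by (rule sepn_edge[OF assms(1,2) e(1,2)])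
  next
    fix e assume "e \<subseteq> B"
    then show "e \<subseteq> V" using sepn_subset[OF assms(1)] by blast
  qed
  then show ?thesis by (simp add: rho_def)
qed

lemma rho_empty [simp]: "rho V E {} = 0"
  by (simp add: rho_def)

lemma rho_mono:
  assumes "finite V" "\<And>e. e \<in> E \<Longrightarrow> e \<subseteq> V \<Longrightarrow> e \<inter> U \<noteq> {} \<Longrightarrow> e \<in> E' \<and> e \<subseteq> V' \<and> e \<inter> U' \<noteq> {}" "finite V'"
  shows "rho V E U \<le> rho V' E' U'"
  unfolding rho_def by (rule card_mono[OF finite_edges[OF assms(3)]]) (use assms(2) in auto)

text \<open>A massive separation of \<open>B\<close> of smaller order lifts to the whole graph by
  adding \<open>A\<close> to its near side. By the choice of \<open>B\<close> its far part is all of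
  \<open>B\<close>, so its overlap contains \<open>A \<inter> B\<close>, a contradiction. Thus
  \<open>B\<close> inherits the hypothesis with \<open>A \<inter> B\<close> as the set to be
  linked.\<close>

lemma msep_massed:
  assumes fin: "finite V" and loop: "\<forall>e\<in>E. card e = 2" and m: "msep a V E X A B"
    and min: "\<And>A2 B2. msep a V E X A2 B2 \<Longrightarrow> card (A2 \<inter> B2) < card (A \<inter> B) \<Longrightarrow> card B \<le> card B2"
  shows "massed a B E (A \<inter> B)"
proof -
  have s: "sepn V E A B" "X \<subseteq> A" "a * card (B - A) < rho V E (B - A)" using m by (auto simp: msep_def)
  have fB: "finite B" using sepn_subset[OF s(1)] fin finite_subset by blast
  have BA: "B - A \<inter> B = B - A" by blast
  have "card (A \<inter> B) \<le> card (A2 \<inter> B2)" if m2: "msep a B E (A \<inter> B) A2 B2" for A2 B2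
  proof (rule ccontr)
    assume lt: "\<not> ?thesis"
    have s2: "sepn B E A2 B2" "A \<inter> B \<subseteq> A2" "a * card (B2 - A2) < rho B E (B2 - A2)" using m2 by (auto simp: msep_def)
    have sub: "A2 \<subseteq> B" "B2 \<subseteq> B" "A2 \<union> B2 = B" using s2(1) by (auto simp: sepn_def)
    have "{x, y} \<notin> E" if xy: "x \<in> (A \<union> A2) - B2" "y \<in> B2 - (A \<union> A2)" for x y
    proof (cases "x \<in> A2")
      case True
      then show ?thesis using s2(1) xy by (auto simp: sepn_def)
    next
      case False
      then have "x \<in> A - B" "y \<in> B - A" using xy s2(2) sub by auto
      then show ?thesis using s(1) by (auto simp: sepn_def)
    qed
    moreover have "(A \<union> A2) \<union> B2 = V" using s(1) sub(3) by (auto simp: sepn_def)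
    ultimately have sV: "sepn V E (A \<union> A2) B2" by (auto simp: sepn_def)
    have d: "B2 - (A \<union> A2) = B2 - A2" "(A \<union> A2) \<inter> B2 = A2 \<inter> B2" using s2(2) sub by auto
    have "rho V E (B2 - A2) = rho B E (B2 - A2)" by (rule rho_sepn[OF s(1) loop]) (use s2(2) sub in auto)
    then have "msep a V E X (A \<union> A2) B2" using sV s(2) s2(3) d by (auto simp: msep_def)
    then have "card B \<le> card B2" using min[of "A \<union> A2" B2] lt d by simp
    then have "B2 = B" using sub(2) fB by (simp add: card_seteq)
    then have "A2 \<inter> B2 = A2" using sub by blast
    then show False using lt s2(2) card_mono[of A2 "A \<inter> B"] sub fB finite_subset by metis
  qed
  then show ?thesis using s(3) rho_sepn[OF s(1) loop order_refl] BA by (auto simp: massed_def)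
qed

text \<open>The induction step in the form of a locale. \<open>IH\<close> must allow arbitrary edge
  sets, because clique replacement and contraction create edges that were not there.\<close>

locale minimal_massed =
  fixes l :: nat and V :: "'a set" and E :: "'a set set" and X :: "'a set"
  assumes fin: "finite V" and loop: "\<forall>e\<in>E. card e = 2" and mas: "massed (6 * l) V E X" and cX: "card X \<le> 2 * l"
    and IH: "\<And>(V' :: 'a set) E' X'. finite V' \<Longrightarrow> \<forall>e\<in>E'. card e = 2 \<Longrightarrow> massed (6 * l) V' E' X' \<Longrightarrow> card X' \<le> 2 * l \<Longrightarrow>
        card V' < card V \<or> card V' = card V \<and> card {e\<in>E'. e \<subseteq> V'} < card {e\<in>E. e \<subseteq> V} \<Longrightarrow> linked V' E' X'"
begin

lemma XV: "X \<subseteq> V" and finX: "finite X"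
  using mas fin finite_subset by (auto simp: massed_def)

lemma no_msep: "msep (6 * l) V E X A B \<Longrightarrow> card X \<le> card (A \<inter> B)"
  using mas by (auto simp: massed_def)

text \<open>Replacing \<open>B\<close> by a clique on the overlap keeps the density, since
  \<open>B - A\<close> was not massive, and leaves fewer vertices. Either induction applies to
  \<open>A\<close>, or a new massive separation appears, and the argument is repeated with a smaller
  near side.\<close>

lemma rigid_small:
  assumes "sepn V E A B" "X \<subseteq> A" "linked B E (A \<inter> B)" "card (A \<inter> B) < card X" "B - A \<noteq> {}"
  shows "linked V E X"
  using assms
proof (induction "card A" arbitrary: A B rule: less_induct)
  case less
  note s = less.prems(1) and XA = less.prems(2) and lB = less.prems(3) and ord = less.prems(4) and ne = less.prems(5)
  let ?Z = "A \<inter> B"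
  let ?E = "E \<union> clique ?Z"
  have AB: "A \<subseteq> V" "B \<subseteq> V" "A \<union> B = V" using s by (auto simp: sepn_def)
  have finA: "finite A" "finite B" using AB fin finite_subset by auto
  have loop': "\<forall>e\<in>?E. card e = 2" using loop by (auto simp: clique_def)
  have cA: "card A < card V" using AB ne fin by (intro psubset_card_mono) auto
  have "\<not> msep (6 * l) V E X A B" using no_msep ord by force
  then have rB: "rho V E (B - A) \<le> 6 * l * card (B - A)" using s XA by (auto simp: msep_def)
  have "rho V E (V - X) \<le> card ({e\<in>?E. e \<subseteq> A \<and> e \<inter> (A - X) \<noteq> {}} \<union> {e\<in>E. e \<subseteq> V \<and> e \<inter> (B - A) \<noteq> {}})"
    unfolding rho_def
  proof (rule card_mono)
    show "finite ({e\<in>?E. e \<subseteq> A \<and> e \<inter> (A - X) \<noteq> {}} \<union> {e\<in>E. e \<subseteq> V \<and> e \<inter> (B - A) \<noteq> {}})"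
      by (intro finite_UnI finite_edges finA fin)
    show "{e\<in>E. e \<subseteq> V \<and> e \<inter> (V - X) \<noteq> {}} \<subseteq> {e\<in>?E. e \<subseteq> A \<and> e \<inter> (A - X) \<noteq> {}} \<union> {e\<in>E. e \<subseteq> V \<and> e \<inter> (B - A) \<noteq> {}}"
      using AB by blast
  qed
  also have "\<dots> \<le> rho A ?E (A - X) + rho V E (B - A)" unfolding rho_def by (rule card_Un_le)
  finally have r1: "rho V E (V - X) \<le> rho A ?E (A - X) + rho V E (B - A)" .
  have "V - X = (A - X) \<union> (B - A)" using AB XA by auto
  then have cVX: "card (V - X) = card (A - X) + card (B - A)"
    using finA by (simp only:) (rule card_Un_disjoint, auto)
  have m1: "6 * l * card (A - X) < rho A ?E (A - X)"
    using r1 rB cVX mas by (simp add: massed_def algebra_simps)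
  show ?case
  proof (cases "massed (6 * l) A ?E X")
    case True
    have "linked A ?E X" using IH[OF finA(1) loop' True cX] cA by blast
    then show ?thesis using linked_replace[OF _ refl XA lB] AB(3) by simp
  next
    case False
    \<comment> \<open>Among the offending separations the one with the smallest far part is taken,
      which is the minimality that \<open>msep_massed\<close> asks for.\<close>
    define S where "S A1B1 \<longleftrightarrow> msep (6 * l) A ?E X (fst A1B1) (snd A1B1) \<and> card (fst A1B1 \<inter> snd A1B1) < card X" for A1B1
    have "\<exists>x. S x" using False m1 XA by (auto simp: massed_def S_def not_le)
    then obtain x where x: "S x" "\<And>y. S y \<Longrightarrow> card (snd x) \<le> card (snd y)"
      using ex_has_least_nat[of S _ "\<lambda>x. card (snd x)"] by metis
    obtain A1 B1 where x_eq: "x = (A1, B1)" by force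
    have m: "msep (6 * l) A ?E X A1 B1" and o1: "card (A1 \<inter> B1) < card X" using x(1) x_eq by (auto simp: S_def)
    have min: "card B1 \<le> card B2" if "msep (6 * l) A ?E X A2 B2" "card (A2 \<inter> B2) < card X" for A2 B2
      using x(2)[of "(A2, B2)"] that x_eq by (simp add: S_def)
    have s1: "sepn A ?E A1 B1" "X \<subseteq> A1" "6 * l * card (B1 - A1) < rho A ?E (B1 - A1)" using m by (auto simp: msep_def)
    have sub1: "A1 \<subseteq> A" "B1 \<subseteq> A" "A1 \<union> B1 = A" using s1(1) by (auto simp: sepn_def)
    have no1: "{p, q} \<notin> ?E" if "p \<in> A1 - B1" "q \<in> B1 - A1" for p q using s1(1) that by (auto simp: sepn_def)
    have noAB: "{p, q} \<notin> E" if "p \<in> A - B" "q \<in> B - A" for p q using s that by (auto simp: sepn_def)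
    have ne1: "B1 - A1 \<noteq> {}"
    proof
      assume e: "B1 - A1 = {}"
      then show False using s1(3) unfolding e by simp
    qed
    \<comment> \<open>A clique is never split by a separation.\<close>
    have Zside: "?Z \<subseteq> A1 \<or> ?Z \<subseteq> B1"
    proof (rule ccontr)
      assume "\<not> ?thesis"
      then obtain p q where pq: "p \<in> ?Z" "p \<notin> A1" "q \<in> ?Z" "q \<notin> B1" by blast
      then have "q \<in> A1 - B1" "p \<in> B1 - A1" "p \<noteq> q" using sub1 by auto
      moreover from this have "{q, p} \<in> clique ?Z" using pq by (auto simp: clique_def)
      ultimately show False using no1 by blast
    qed
    show ?thesis
    proof (cases "?Z \<subseteq> A1")
      case True
      have d: "B1 - (A1 \<union> B) = B1 - A1" "(A1 \<union> B) \<inter> B1 = A1 \<inter> B1" using True sub1 by auto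
      have "{p, q} \<notin> E" if "p \<in> (A1 \<union> B) - B1" "q \<in> B1 - (A1 \<union> B)" for p q
      proof (cases "p \<in> A1")
        case True
        then show ?thesis using no1[of p q] that by auto
      next
        case False
        then have "p \<in> B - A" "q \<in> A - B" using that \<open>?Z \<subseteq> A1\<close> sub1 by auto
        then show ?thesis using noAB[of q p] by (simp add: insert_commute)
      qed
      moreover have "(A1 \<union> B) \<union> B1 = V" using AB sub1 by auto
      ultimately have sV: "sepn V E (A1 \<union> B) B1" by (auto simp: sepn_def)
      have "rho A ?E (B1 - A1) \<le> rho V E (B1 - A1)"
      proof (rule rho_mono[OF finA(1) _ fin])
        fix e assume e: "e \<in> ?E" "e \<subseteq> A" "e \<inter> (B1 - A1) \<noteq> {}"
        then have "e \<notin> clique ?Z" using True by (auto simp: clique_def)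
        then show "e \<in> E \<and> e \<subseteq> V \<and> e \<inter> (B1 - A1) \<noteq> {}" using e AB by auto
      qed
      then have "msep (6 * l) V E X (A1 \<union> B) B1" using sV s1 d by (auto simp: msep_def)
      then show ?thesis using no_msep o1 d by force
    next
      case False
      then have ZB: "?Z \<subseteq> B1" using Zside by blast
      \<comment> \<open>By induction \<open>B1\<close> is linked in the graph with the clique;
        putting \<open>B\<close> back makes \<open>B1 \<union> B\<close> linked in the original
        graph, so it takes over the role of \<open>B\<close>.\<close>
      have "massed (6 * l) B1 ?E (A1 \<inter> B1)"
        by (rule msep_massed[OF finA(1) loop' m]) (use min o1 in force)
      moreover have "card B1 < card V" using sub1 finA cA card_mono[of A B1] by linarith
      moreover have "finite B1" using sub1 finA finite_subset by blast
      moreover have "card (A1 \<inter> B1) \<le> 2 * l" using o1 cX by linarith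
      ultimately have "linked B1 ?E (A1 \<inter> B1)" using IH loop' by blast
      moreover have "?Z = B1 \<inter> B" using ZB sub1 by auto
      ultimately have l1: "linked (B1 \<union> B) E (A1 \<inter> B1)" using linked_replace[of B1 E ?Z "A1 \<inter> B1" B] lB by auto
      have i: "A1 \<inter> (B1 \<union> B) = A1 \<inter> B1" using ZB sub1 by auto
      have "{p, q} \<notin> E" if "p \<in> A1 - (B1 \<union> B)" "q \<in> B1 \<union> B - A1" for p q
      proof (cases "q \<in> B1")
        case True
        then show ?thesis using no1[of p q] that by auto
      next
        case False
        then have "p \<in> A - B" "q \<in> B - A" using that sub1 by auto
        then show ?thesis by (rule noAB)
      qed
      moreover have "A1 \<union> (B1 \<union> B) = V" using AB sub1 by auto
      ultimately have sV: "sepn V E A1 (B1 \<union> B)" by (auto simp: sepn_def)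
      have "A1 \<subset> A" using sub1 ne1 by auto
      then have "card A1 < card A" using finA by (intro psubset_card_mono)
      then show ?thesis using less.hyps[OF _ sV s1(2)] l1 i o1 ne1 by auto
    qed
  qed
qed

text \<open>Menger's theorem leads from a smallest separator between \<open>X\<close> and the
  overlap to the overlap, where the links are made. If the separator is smaller than
  \<open>X\<close>, everything behind it is a linked part of small order and
  \<open>rigid_small\<close> finishes.\<close>

lemma target:
  assumes s: "sepn V E A B" and XA: "X \<subseteq> A"
    and lY: "\<And>Y. Y \<subseteq> A \<inter> B \<Longrightarrow> card Y \<le> card X \<Longrightarrow> X \<inter> (A \<inter> B) \<subseteq> Y \<Longrightarrow> linked B E Y"
    and ne: "B - A \<noteq> {} \<or> card X \<le> card (A \<inter> B)"
  shows "linked V E X"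
proof -
  let ?T = "A \<inter> B"
  have AB: "A \<subseteq> V" "B \<subseteq> V" "A \<union> B = V" using s by (auto simp: sepn_def)
  have finA: "finite A" "finite B" using AB fin finite_subset by auto
  have noAB: "{p, q} \<notin> E" if "p \<in> A - B" "q \<in> B - A" for p q using s that by (auto simp: sepn_def)
  define S where "S x \<longleftrightarrow> sepn A E (fst x) (snd x) \<and> X \<subseteq> fst x \<and> ?T \<subseteq> snd x" for x
  have SX: "S (X, A)" using XA by (auto simp: S_def sepn_def)
  obtain y where y: "S y" "\<And>z. S z \<Longrightarrow> card (fst y \<inter> snd y) \<le> card (fst z \<inter> snd z)"
    using ex_has_least_nat[of S "(X, A)" "\<lambda>x. card (fst x \<inter> snd x)"] SX by blast
  have yX: "card (fst y \<inter> snd y) \<le> card X" using y(2)[OF SX] XA by (simp add: inf_absorb1)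
  \<comment> \<open>At order \<open>card X\<close> the trivial separation \<open>(X, A)\<close> is
    preferred, so that the arms start in \<open>X\<close> itself.\<close>
  define w where "w = (if card (fst y \<inter> snd y) = card X then (X, A) else y)"
  have w: "S w" "\<And>z. S z \<Longrightarrow> card (fst w \<inter> snd w) \<le> card (fst z \<inter> snd z)"
    "card (fst w \<inter> snd w) < card X \<or> w = (X, A)"
    using y SX yX XA by (auto simp: w_def inf_absorb1)
  obtain A0 B0 where w_eq: "w = (A0, B0)" by force
  have s0: "sepn A E A0 B0" "X \<subseteq> A0" "?T \<subseteq> B0" using w(1) w_eq by (auto simp: S_def)
  have sub0: "A0 \<subseteq> A" "B0 \<subseteq> A" "A0 \<union> B0 = A" using s0(1) by (auto simp: sepn_def)
  have min: "card (A0 \<inter> B0) \<le> card (A1 \<inter> B1)" if "sepn A E A1 B1" "X \<subseteq> A1" "?T \<subseteq> B1" for A1 B1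
    using w(2)[of "(A1, B1)"] that w_eq by (simp add: S_def)
  have no0: "{p, q} \<notin> E" if "p \<in> A0 - B0" "q \<in> B0 - A0" for p q using s0(1) that by (auto simp: sepn_def)
  let ?Z = "A0 \<inter> B0"
  have finB0: "finite B0" "finite ?Z" using sub0 finA finite_subset by auto
  have cZ: "card ?Z \<le> card X" using min[of X A] XA by (auto simp: sepn_def inf_absorb1)
  have "card ?Z \<le> card (P \<inter> Q)" if PQ: "sepn B0 E P Q" "?Z \<subseteq> P" "?T \<subseteq> Q" for P Q
  proof -
    have sPQ: "P \<subseteq> B0" "Q \<subseteq> B0" "P \<union> Q = B0" using PQ(1) by (auto simp: sepn_def)
    have "{p, q} \<notin> E" if "p \<in> (A0 \<union> P) - Q" "q \<in> Q - (A0 \<union> P)" for p q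
    proof (cases "p \<in> P")
      case True
      then show ?thesis using PQ(1) that by (auto simp: sepn_def)
    next
      case False
      then have "p \<in> A0 - B0" "q \<in> B0 - A0" using that sPQ by auto
      then show ?thesis by (rule no0)
    qed
    moreover have "(A0 \<union> P) \<union> Q = A" using sub0 sPQ by auto
    ultimately have "sepn A E (A0 \<union> P) Q" by (auto simp: sepn_def)
    then have "card ?Z \<le> card ((A0 \<union> P) \<inter> Q)" by (rule min) (use s0(2) PQ(3) in auto)
    moreover have "(A0 \<union> P) \<inter> Q = P \<inter> Q" using PQ(2) sPQ by auto
    ultimately show ?thesis by simp
  qed
  then obtain F where F: "card F = card ?Z" "finite F" "disjoint F"
    "\<forall>C\<in>F. C \<subseteq> B0 \<and> conn E C \<and> C \<inter> ?Z \<noteq> {} \<and> C \<inter> ?T \<noteq> {}"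
    using menger[OF finB0(1) _ s0(3), of ?Z E "card ?Z"] by auto
  obtain h where h: "bij_betw h ?Z F" "\<And>z. z \<in> ?Z \<Longrightarrow> h z \<inter> ?Z = {z}"
    by (rule disjoint_transversal[OF finB0(2) F(1-3)]) (use F(4) in auto)
  have hF: "h z \<in> F" if "z \<in> ?Z" for z using h(1) that by (auto simp: bij_betw_def)
  have "\<forall>z\<in>?Z. \<exists>U t. U \<subseteq> h z \<and> conn E U \<and> z \<in> U \<and> U \<inter> ?T = {t}"
  proof
    fix z assume z: "z \<in> ?Z"
    have c: "conn E (h z)" "h z \<inter> ?T \<noteq> {}" using F(4) hF[OF z] by auto
    have "z \<in> h z" using h(2)[OF z] by blast
    then show "\<exists>U t. U \<subseteq> h z \<and> conn E U \<and> z \<in> U \<and> U \<inter> ?T = {t}" using conn_stop[OF c(1) _ c(2)] by metis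
  qed
  then obtain h' g where h': "\<And>z. z \<in> ?Z \<Longrightarrow> h' z \<subseteq> h z \<and> conn E (h' z) \<and> z \<in> h' z \<and> h' z \<inter> ?T = {g z}" by metis
  have hd: "h z \<inter> h z' = {}" if "z \<in> ?Z" "z' \<in> ?Z" "z \<noteq> z'" for z z'
    using disjointD[OF F(3) hF[OF that(1)] hF[OF that(2)]] that h(1) unfolding bij_betw_def inj_on_def by metis
  have gT: "g ` ?Z \<subseteq> ?T" using h' by blast
  have cg: "card (g ` ?Z) \<le> card X" using card_image_le[OF finB0(2), of g] cZ by linarith
  have "x \<in> g ` ?Z" if "x \<in> X \<inter> ?T" for x
  proof -
    have xZ: "x \<in> ?Z" using that s0(2,3) by auto
    then have "x \<in> h' x \<inter> ?T" using h'[OF xZ] that by blast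
    moreover have "h' x \<inter> ?T = {g x}" using h'[OF xZ] by blast
    ultimately have "x = g x" by (simp only: singleton_iff)
    then show ?thesis using xZ by (rule image_eqI)
  qed
  then have lg: "linked B E (g ` ?Z)" using lY[OF gT cg] by blast
  have lZ: "linked (B0 \<union> B) E ?Z"
  proof (rule linked_connect[of ?Z h' _ _ B g])
    fix z assume z: "z \<in> ?Z"
    have hz: "h' z \<subseteq> B0" using h'[OF z] F(4) hF[OF z] by blast
    then have "h' z \<inter> B = h' z \<inter> ?T" using sub0(2) by blast
    then show "h' z \<subseteq> B0 \<union> B \<and> conn E (h' z) \<and> z \<in> h' z \<and> h' z \<inter> B = {g z}" using h'[OF z] hz by auto
  next
    fix z z' assume "z \<in> ?Z" "z' \<in> ?Z" "z \<noteq> z'"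
    then show "h' z \<inter> h' z' = {}" using hd h' by blast
  qed (use lg in auto)
  show ?thesis
  proof (cases "w = (X, A)")
    case True
    then have "A0 = X" "B0 = A" using w_eq by auto
    then show ?thesis using lZ XA AB(3) by (simp add: inf_absorb1)
  next
    case False
    then have lt: "card ?Z < card X" using w(3) w_eq by auto
    have i: "A0 \<inter> (B0 \<union> B) = ?Z" using s0(3) sub0 by auto
    have "{p, q} \<notin> E" if "p \<in> A0 - (B0 \<union> B)" "q \<in> B0 \<union> B - A0" for p q
    proof (cases "q \<in> B0")
      case True
      then show ?thesis using no0[of p q] that by auto
    next
      case False
      then have "p \<in> A - B" "q \<in> B - A" using that sub0 s0(3) by auto
      then show ?thesis by (rule noAB)
    qed
    moreover have "A0 \<union> (B0 \<union> B) = V" using AB sub0 by auto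
    ultimately have sV: "sepn V E A0 (B0 \<union> B)" by (auto simp: sepn_def)
    have ne': "B0 \<union> B - A0 \<noteq> {}"
    proof
      assume a: "B0 \<union> B - A0 = {}"
      then have "B - A = {}" using sub0 by blast
      then have "card X \<le> card ?T" using ne by blast
      moreover have "?T \<subseteq> ?Z" using a s0(3) by blast
      then have "card ?T \<le> card ?Z" using finB0 by (intro card_mono)
      ultimately show False using lt by linarith
    qed
    show ?thesis by (rule rigid_small[OF sV s0(2)]) (use lZ i lt ne' in auto)
  qed
qed

text \<open>No massive separation has order below \<open>card X\<close>, so the minimality required
  by \<open>msep_massed\<close> holds vacuously, and \<open>B\<close>, being a proper subset, falls
  under the induction hypothesis.\<close>

lemma massive_sep:
  assumes m: "msep (6 * l) V E X A B" and o: "card (A \<inter> B) \<le> card X" and BV: "B \<noteq> V"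
  shows "linked V E X"
proof -
  have s: "sepn V E A B" "X \<subseteq> A" "6 * l * card (B - A) < rho V E (B - A)" using m by (auto simp: msep_def)
  have B: "B \<subseteq> V" "finite B" using sepn_subset[OF s(1)] fin finite_subset by auto
  have "massed (6 * l) B E (A \<inter> B)"
    by (rule msep_massed[OF fin loop m]) (use no_msep o in force)
  moreover have "card B < card V" using B BV fin by (intro psubset_card_mono) auto
  ultimately have l: "linked B E (A \<inter> B)" using IH[of B E "A \<inter> B"] B(2) loop o cX by auto
  have "B - A \<noteq> {}"
  proof
    assume e: "B - A = {}"
    then show False using s(3) unfolding e by simp
  qed
  then show ?thesis using target[OF s(1,2)] linked_subset[OF l] by blast
qed

end

section \<open>Degree counts, edge deletion and edge contraction\<close>

lemma card_nbrs_edges: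
  assumes loop: "\<forall>e\<in>E. card e = 2" and v: "v \<in> V"
  shows "card (nbrs E V v) = card {e\<in>E. e \<subseteq> V \<and> v \<in> e}"
proof -
  have "{e\<in>E. e \<subseteq> V \<and> v \<in> e} = (\<lambda>w. {v, w}) ` nbrs E V v"
  proof
    show "{e\<in>E. e \<subseteq> V \<and> v \<in> e} \<subseteq> (\<lambda>w. {v, w}) ` nbrs E V v"
    proof
      fix e assume e: "e \<in> {e\<in>E. e \<subseteq> V \<and> v \<in> e}"
      then have "card e = 2" using loop by auto
      then obtain w where "e = {v, w}" using e by (auto simp: card_2_iff)
      then show "e \<in> (\<lambda>w. {v, w}) ` nbrs E V v" using e by (auto simp: nbrs_def)
    qed
    show "(\<lambda>w. {v, w}) ` nbrs E V v \<subseteq> {e\<in>E. e \<subseteq> V \<and> v \<in> e}" using v by (auto simp: nbrs_def)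
  qed
  moreover have "inj_on (\<lambda>w. {v, w}) (nbrs E V v)" by (auto simp: inj_on_def doubleton_eq_iff)
  ultimately show ?thesis by (simp add: card_image)
qed

lemma degree_sum:
  assumes fin: "finite V" and loop: "\<forall>e\<in>E. card e = 2" and W: "W \<subseteq> V"
  shows "(\<Sum>v\<in>W. card (nbrs E V v)) \<le> 2 * rho V E W" "rho V E W \<le> (\<Sum>v\<in>W. card (nbrs E V v))"
proof -
  let ?R = "{e\<in>E. e \<subseteq> V \<and> e \<inter> W \<noteq> {}}"
  have finR: "finite ?R" by (rule finite_edges[OF fin])
  have finW: "finite W" using W fin finite_subset by blast
  have deg: "card (nbrs E V v) = card {e\<in>?R. v \<in> e}" if v: "v \<in> W" for v
  proof -
    have "{e\<in>E. e \<subseteq> V \<and> v \<in> e} = {e\<in>?R. v \<in> e}" using v by auto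
    then show ?thesis using card_nbrs_edges[OF loop, of v V] v W by auto
  qed
  have "(\<Sum>v\<in>W. card (nbrs E V v)) = (\<Sum>v\<in>W. card {e\<in>?R. v \<in> e})" using deg by simp
  also have "\<dots> = (\<Sum>e\<in>?R. card {v\<in>W. v \<in> e})" by (rule sum_multicount_gen[OF finW finR]) simp
  finally have eq: "(\<Sum>v\<in>W. card (nbrs E V v)) = (\<Sum>e\<in>?R. card {v\<in>W. v \<in> e})" .
  have b: "card {v\<in>W. v \<in> e} \<le> 2 \<and> 1 \<le> card {v\<in>W. v \<in> e}" if e: "e \<in> ?R" for e
  proof
    have c: "card e = 2" using e loop by auto
    then have "finite e" by (metis card.infinite zero_neq_numeral)
    then show "card {v\<in>W. v \<in> e} \<le> 2" using card_mono[of e "{v\<in>W. v \<in> e}"] c by auto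
    have "{v\<in>W. v \<in> e} \<noteq> {}" using e by auto
    then have "0 < card {v\<in>W. v \<in> e}" using finW by (simp add: card_gt_0_iff)
    then show "1 \<le> card {v\<in>W. v \<in> e}" by simp
  qed
  have "(\<Sum>e\<in>?R. card {v\<in>W. v \<in> e}) \<le> (\<Sum>e\<in>?R. 2)" using b by (intro sum_mono) blast
  then show "(\<Sum>v\<in>W. card (nbrs E V v)) \<le> 2 * rho V E W" using eq by (simp add: rho_def)
  have "(\<Sum>e\<in>?R. 1) \<le> (\<Sum>e\<in>?R. card {v\<in>W. v \<in> e})" using b by (intro sum_mono) blast
  then show "rho V E W \<le> (\<Sum>v\<in>W. card (nbrs E V v))" using eq by (simp add: rho_def)
qed

context minimal_massed
begin

text \<open>With two edges to spare one could be deleted. Induction then fails only if deletion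
  creates a massive separation of order below \<open>card X\<close>, and moving an end of the edge
  across turns it into one of order at most \<open>card X\<close> in the original graph.\<close>

lemma deletion_tight:
  assumes un: "\<not> linked V E X"
  shows "rho V E (V - X) \<le> 6 * l * card (V - X) + 1"
proof (rule ccontr)
  assume big: "\<not> ?thesis"
  then have "{e\<in>E. e \<subseteq> V \<and> e \<inter> (V - X) \<noteq> {}} \<noteq> {}" unfolding rho_def by (metis card.empty le0)
  then obtain e where e: "e \<in> E" "e \<subseteq> V" "e \<inter> (V - X) \<noteq> {}" by blast
  let ?E = "E - {e}"
  have "{f\<in>?E. f \<subseteq> V} \<subset> {f\<in>E. f \<subseteq> V}" using e by auto
  then have "card {f\<in>?E. f \<subseteq> V} < card {f\<in>E. f \<subseteq> V}"
    using finite_edges[OF fin, of E "\<lambda>_. True"] by (intro psubset_card_mono) auto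
  then have "massed (6 * l) V ?E X \<Longrightarrow> linked V ?E X" using IH[of V ?E X] fin loop cX by auto
  then have nm: "\<not> massed (6 * l) V ?E X" using un linked_mono[of V ?E X V E] by blast
  have "{f\<in>?E. f \<subseteq> V \<and> f \<inter> (V - X) \<noteq> {}} = {f\<in>E. f \<subseteq> V \<and> f \<inter> (V - X) \<noteq> {}} - {e}" by auto
  then have "rho V E (V - X) \<le> rho V ?E (V - X) + 1" unfolding rho_def
    using card_Suc_Diff1[OF finite_edges[OF fin], of e E "\<lambda>f. f \<inter> (V - X) \<noteq> {}"] e by simp
  then have "6 * l * card (V - X) < rho V ?E (V - X)" using big by linarith
  then obtain A B where AB: "msep (6 * l) V ?E X A B" "card (A \<inter> B) < card X"
    using nm XV unfolding massed_def by (meson not_le)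
  have s: "sepn V ?E A B" "X \<subseteq> A" "6 * l * card (B - A) < rho V ?E (B - A)" using AB(1) by (auto simp: msep_def)
  have sub: "A \<subseteq> V" "B \<subseteq> V" "A \<union> B = V" using s(1) by (auto simp: sepn_def)
  have finAB: "finite A" "finite B" using sub fin finite_subset by auto
  have rm: "rho V ?E (B - A) \<le> rho V E (B - A)" by (rule rho_mono[OF fin _ fin]) auto
  have "\<not> sepn V E A B" using no_msep[of A B] s rm AB(2) by (force simp: msep_def)
  then obtain p q where pq: "p \<in> A - B" "q \<in> B - A" "{p, q} \<in> E" using sub(3) by (auto simp: sepn_def)
  have "{p, q} \<notin> ?E" using s(1) pq by (auto simp: sepn_def)
  then have e_eq: "e = {p, q}" using pq by auto
  have no: "{x, y} \<notin> E \<or> x = p \<and> y = q" if "x \<in> A - B" "y \<in> B - A" for x y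
  proof -
    have "{x, y} \<notin> ?E" using s(1) that by (auto simp: sepn_def)
    then show ?thesis using e_eq pq that by (auto simp: doubleton_eq_iff)
  qed
  have sp: "sepn V E A (insert p B)" using no sub pq unfolding sepn_def by blast
  have d: "insert p B - A = B - A" "A \<inter> insert p B = insert p (A \<inter> B)" using pq by auto
  have o: "card (insert p (A \<inter> B)) = card (A \<inter> B) + 1" using pq finAB by simp
  have m: "msep (6 * l) V E X A (insert p B)" using sp s(2,3) rm d by (auto simp: msep_def)
  \<comment> \<open>Otherwise \<open>massive_sep\<close> already applies with \<open>p\<close> moved
    into \<open>B\<close>.\<close>
  have "insert p B = V"
  proof (rule ccontr)
    assume "insert p B \<noteq> V"
    then show False using massive_sep[OF m] d o AB(2) un by simp
  qed
  then have "A = insert p (A \<inter> B)" using sub pq by blast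
  then have "card A = card (insert p (A \<inter> B))" by (rule arg_cong)
  then have "card A \<le> card X" using o AB(2) by linarith
  then have AX: "A = X" using s(2) finAB card_seteq by metis
  have B: "B = V - {p}" using \<open>insert p B = V\<close> pq by blast
  have pX: "p \<in> X" "p \<noteq> q" "q \<in> V - X" using pq AX sub by auto
  \<comment> \<open>In the remaining case \<open>A = X\<close> the other end is moved instead.
    Taking \<open>q\<close> out of the far side loses at most \<open>card X \<le> 2 * l\<close>
    edges, while one vertex accounts for \<open>6 * l\<close>.\<close>
  have "sepn V E (insert q X) B"
    unfolding sepn_def
  proof (intro conjI ballI)
    show "insert q X \<union> B = V" using sub(3) AX pq(2) by blast
    fix x y assume xy: "x \<in> insert q X - B" "y \<in> B - insert q X"
    have "x \<in> A - B" "y \<in> B - A" "y \<noteq> q" using xy AX pq(2) by auto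
    then show "{x, y} \<notin> E" using no[of x y] by auto
  qed
  moreover have "6 * l * card (B - insert q X) < rho V E (B - insert q X)"
  proof -
    have BX: "B - insert q X = V - X - {q}" using B pX by auto
    have cV: "card (V - X) = card (V - X - {q}) + 1" using card_Suc_Diff1[of "V - X" q] fin pX(3) by simp
    have "rho V E (V - X) \<le> card ({e\<in>E. e \<subseteq> V \<and> e \<inter> (V - X - {q}) \<noteq> {}} \<union> (\<lambda>x. {q, x}) ` X)"
      unfolding rho_def
    proof (rule card_mono)
      show "finite ({e\<in>E. e \<subseteq> V \<and> e \<inter> (V - X - {q}) \<noteq> {}} \<union> (\<lambda>x. {q, x}) ` X)"
        by (intro finite_UnI finite_edges fin finite_imageI finX)
      show "{e\<in>E. e \<subseteq> V \<and> e \<inter> (V - X) \<noteq> {}} \<subseteq> {e\<in>E. e \<subseteq> V \<and> e \<inter> (V - X - {q}) \<noteq> {}} \<union> (\<lambda>x. {q, x}) ` X"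
      proof
        fix f assume f: "f \<in> {e\<in>E. e \<subseteq> V \<and> e \<inter> (V - X) \<noteq> {}}"
        then have "card f = 2" using loop by simp
        show "f \<in> {e\<in>E. e \<subseteq> V \<and> e \<inter> (V - X - {q}) \<noteq> {}} \<union> (\<lambda>x. {q, x}) ` X"
        proof (cases "f \<inter> (V - X - {q}) = {}")
          case True
          then have "q \<in> f" using f by blast
          then obtain x where "f = {q, x}" "x \<noteq> q" using \<open>card f = 2\<close> by (auto simp: card_2_iff)
          then have "x \<in> X" using True f by auto
          then show ?thesis using \<open>f = {q, x}\<close> by blast
        qed (use f in auto)
      qed
    qed
    also have "\<dots> \<le> rho V E (V - X - {q}) + card ((\<lambda>x. {q, x}) ` X)" unfolding rho_def by (rule card_Un_le)
    also have "card ((\<lambda>x. {q, x}) ` X) \<le> card X" by (rule card_image_le[OF finX])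
    finally have "rho V E (V - X) \<le> rho V E (V - X - {q}) + card X" by simp
    then have "6 * l * (card (V - X - {q}) + 1) < rho V E (V - X - {q}) + 2 * l"
      using mas cX cV by (simp add: massed_def)
    then show ?thesis unfolding BX by (simp add: algebra_simps)
  qed
  ultimately have m2: "msep (6 * l) V E X (insert q X) B" by (auto simp: msep_def)
  have "insert q X \<inter> B = insert q (X - {p})" using B pX XV by auto
  moreover have "card (insert q (X - {p})) \<le> card X"
    using pX finX card_Suc_Diff1[OF finX pX(1)] by (simp add: card_insert_if)
  ultimately show False using massive_sep[OF m2] B pX XV un by auto
qed

text \<open>The vertex \<open>x\<close> stands for the contracted edge \<open>xy\<close>.\<close>

definition contr :: "'a \<Rightarrow> 'a \<Rightarrow> 'a set set" where
  "contr x y = {e'. card e' = 2 \<and> (\<exists>e\<in>E. e \<subseteq> V \<and> e' = (id(y := x)) ` e)}"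

lemma contr_edge:
  assumes "p \<noteq> y" "q \<noteq> y" "{p, q} \<in> contr x y"
  shows "{p, q} \<in> E \<or> p = x \<and> {y, q} \<in> E \<or> q = x \<and> {p, y} \<in> E"
proof -
  obtain e where e: "e \<in> E" "{p, q} = (id(y := x)) ` e" using assms(3) by (auto simp: contr_def)
  obtain u v where uv: "e = {u, v}" "u \<noteq> v" using e(1) loop by (metis card_2_iff)
  have "{p, q} = {(id(y := x)) u, (id(y := x)) v}" using e(2) uv by simp
  then show ?thesis using e(1) uv assms(1,2)
    by (auto simp: doubleton_eq_iff insert_commute split: if_splits)
qed

lemma contr_edgeI:
  assumes "{p, q} \<in> E" "p \<in> V" "q \<in> V" "p \<noteq> y" "p \<noteq> x" "x \<noteq> y"
  shows "{p, if q = y then x else q} \<in> contr x y"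
proof -
  have "(id(y := x)) ` {p, q} = {p, if q = y then x else q}" using assms by auto
  moreover have "card {p, if q = y then x else q} = 2" using assms no_loop[OF loop assms(1)] by auto
  ultimately show ?thesis using assms unfolding contr_def by (auto intro!: bexI[of _ "{p, q}"])
qed

text \<open>Undoing the contraction: every edge at \<open>x\<close> in the contracted graph comes
  from \<open>x\<close> or from \<open>y\<close>, so a cut of the expanded set is crossed by such an
  edge or by \<open>{x, y}\<close> itself.\<close>

lemma contr_conn:
  assumes xy: "{x, y} \<in> E" and U: "conn (contr x y) U" "y \<notin> U"
  shows "conn E (if x \<in> U then insert y U else U)"
proof (cases "x \<in> U")
  case False
  have "conn E U"
  proof (rule conn_edges_cong[OF U(1)])
    fix a b assume "a \<in> U" "b \<in> U" "{a, b} \<in> contr x y"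
    then show "{a, b} \<in> E" using contr_edge[of a y b x] U(2) False by auto
  qed
  then show ?thesis using False by simp
next
  case True
  have "conn E (insert y U)"
    unfolding conn_iff_cut
  proof (intro conjI allI impI; (elim conjE)?)
    fix P assume P: "P \<subseteq> insert y U" "P \<noteq> {}" "P \<noteq> insert y U"
    show "\<exists>a\<in>P. \<exists>b\<in>insert y U - P. {a, b} \<in> E"
    proof (cases "x \<in> P \<longleftrightarrow> y \<in> P")
      case False
      have "{y, x} \<in> E" using xy by (simp add: insert_commute)
      then show ?thesis using False True xy by blast
    next
      case eq: True
      have "P \<inter> U \<noteq> {}" "P \<inter> U \<noteq> U" using P eq True by auto
      then obtain a b where ab: "a \<in> P \<inter> U" "b \<in> U - P \<inter> U" "{a, b} \<in> contr x y"
        using conn_cut[OF U(1), of "P \<inter> U"] by blast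
      then have "{a, b} \<in> E \<or> a = x \<and> {y, b} \<in> E \<or> b = x \<and> {a, y} \<in> E"
        using contr_edge[of a y b x] U(2) by blast
      then show ?thesis using ab eq True by blast
    qed
  qed simp
  then show ?thesis using True by simp
qed

lemma contr_linked:
  assumes xy: "{x, y} \<in> E" and l: "linked W (contr x y) Z" and y: "y \<notin> W" "y \<notin> Z"
  shows "linked (if x \<in> W then insert y W else W) E Z"
proof (rule linkedI)
  fix M assume M: "pairing Z M"
  obtain U where U: "\<forall>e\<in>M. U e \<subseteq> W \<and> conn (contr x y) (U e) \<and> U e \<inter> Z = e"
    "\<forall>e\<in>M. \<forall>f\<in>M. e \<noteq> f \<longrightarrow> U e \<inter> U f = {}"
    by (rule linkedD[OF l M])
  define Q where "Q e = (if x \<in> U e then insert y (U e) else U e)" for e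
  have yU: "y \<notin> U e" if "e \<in> M" for e using U(1) that y(1) by blast
  have "conn E (Q e)" if "e \<in> M" for e
    unfolding Q_def using contr_conn[OF xy _ yU[OF that]] U(1) that by blast
  moreover have "Q e \<subseteq> (if x \<in> W then insert y W else W)" if "e \<in> M" for e
    using U(1) that by (auto simp: Q_def)
  moreover have "Q e \<inter> Z = e" if "e \<in> M" for e using U(1) that y(2) by (auto simp: Q_def)
  moreover have "Q e \<inter> Q f = {}" if "e \<in> M" "f \<in> M" "e \<noteq> f" for e f
  proof -
    have "U e \<inter> U f = {}" using U(2) that by blast
    then show ?thesis using yU that by (auto simp: Q_def)
  qed
  ultimately show "\<exists>U. (\<forall>e\<in>M. U e \<subseteq> (if x \<in> W then insert y W else W) \<and> conn E (U e) \<and> U e \<inter> Z = e) \<and>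
     (\<forall>e\<in>M. \<forall>f\<in>M. e \<noteq> f \<longrightarrow> U e \<inter> U f = {})" by (intro exI[of _ Q] conjI ballI impI)
qed

text \<open>The ends \<open>w\<close> of those edges \<open>yw\<close> that stop being counted after
  contraction, either because \<open>xw\<close> is an edge already or because the new edge lies
  inside \<open>X\<close>.\<close>

definition common :: "'a \<Rightarrow> 'a \<Rightarrow> 'a set" where
  "common x y = {w\<in>V. w \<noteq> x \<and> {y, w} \<in> E \<and> ({x, w} \<in> E \<or> x \<in> X \<and> w \<in> X)}"

text \<open>Contraction is injective on the counted edges apart from \<open>xy\<close> and the edges
  from \<open>y\<close> to \<open>common x y\<close>.\<close>

lemma contr_rho:
  assumes xy: "{x, y} \<in> E" "x \<in> V" "y \<in> V - X"
  shows "rho V E (V - X) \<le> rho (V - {y}) (contr x y) (V - {y} - X) + (card (common x y) + 1)"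
proof -
  let ?f = "id(y := x)"
  let ?S = "{e\<in>E. e \<subseteq> V \<and> e \<inter> (V - X) \<noteq> {}}" and ?L = "(\<lambda>w. {y, w}) ` insert x (common x y)"
  let ?S' = "{e\<in>contr x y. e \<subseteq> V - {y} \<and> e \<inter> (V - {y} - X) \<noteq> {}}"
  have xny: "x \<noteq> y" using no_loop[OF loop xy(1)] .
  have fc: "finite (common x y)" using fin by (auto simp: common_def)
  have cL: "card ?L \<le> card (common x y) + 1"
  proof -
    have "card ?L \<le> card (insert x (common x y))" using fc by (intro card_image_le) simp
    also have "\<dots> \<le> card (common x y) + 1" using fc by (simp add: card_insert_if)
    finally show ?thesis .
  qed
  have y_edge: "\<exists>w. e = {y, w} \<and> w \<noteq> x \<and> w \<noteq> y \<and> w \<in> V \<and> {x, w} \<notin> E \<and> \<not> (x \<in> X \<and> w \<in> X)"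
    if e: "e \<in> ?S - ?L" "y \<in> e" for e
  proof -
    have "card e = 2" using e loop by auto
    then obtain w where w: "e = {y, w}" "w \<noteq> y" using e(2) by (auto simp: card_2_iff)
    have "w \<notin> insert x (common x y)" using e(1) w by auto
    moreover have "w \<in> V" "{y, w} \<in> E" using e(1) w by auto
    ultimately show ?thesis using w by (auto simp: common_def)
  qed
  have img: "?f ` e \<in> ?S'" if e: "e \<in> ?S - ?L" for e
  proof (cases "y \<in> e")
    case True
    then obtain w where w: "e = {y, w}" "w \<noteq> x" "w \<noteq> y" "w \<in> V" "\<not> (x \<in> X \<and> w \<in> X)"
      using y_edge[OF e] by blast
    then have "?f ` e = {x, w}" by auto
    moreover have "{x, w} \<in> contr x y" using contr_edgeI[of w y y x] e w xny by (auto simp: insert_commute)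
    ultimately show ?thesis using w xy(2) xny by auto
  next
    case False
    then have "?f ` e = e" by (auto simp: image_iff)
    moreover have eE: "e \<in> E" "e \<subseteq> V" "e \<inter> (V - X) \<noteq> {}" using e by auto
    moreover have "e \<in> contr x y" unfolding contr_def using eE loop \<open>?f ` e = e\<close> by force
    moreover have "e \<subseteq> V - {y}" "e \<inter> (V - {y} - X) \<noteq> {}" using eE False by auto
    ultimately show ?thesis by simp
  qed
  have "inj_on ((`) ?f) (?S - ?L)"
  proof (rule inj_onI)
    fix e1 e2 assume e: "e1 \<in> ?S - ?L" "e2 \<in> ?S - ?L" "?f ` e1 = ?f ` e2"
    have no: "?f ` e = e" if "y \<notin> e" for e using that by (auto simp: image_iff)
    have im: "\<exists>w. e = {y, w} \<and> ?f ` e = {x, w} \<and> {x, w} \<notin> E \<and> w \<noteq> x" if "e \<in> ?S - ?L" "y \<in> e" for e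
      using y_edge[OF that] by auto
    show "e1 = e2"
    proof (cases "y \<in> e1"; cases "y \<in> e2")
      assume y: "y \<in> e1" "y \<in> e2"
      obtain v where v: "e1 = {y, v}" "?f ` e1 = {x, v}" "v \<noteq> x" using im[OF e(1) y(1)] by blast
      obtain w where w: "e2 = {y, w}" "?f ` e2 = {x, w}" "w \<noteq> x" using im[OF e(2) y(2)] by blast
      have "{x, v} = {x, w}" using e(3) v(2) w(2) by (simp only:)
      then have "v = w" using v(3) w(3) by (auto simp: doubleton_eq_iff)
      then show ?thesis using v(1) w(1) by simp
    next
      assume y: "y \<in> e1" "y \<notin> e2"
      then have "?f ` e1 \<notin> E" using im[OF e(1)] by auto
      then show ?thesis using no[OF y(2)] e(2,3) by auto
    next
      assume y: "y \<notin> e1" "y \<in> e2"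
      then have "?f ` e2 \<notin> E" using im[OF e(2)] by auto
      then show ?thesis using no[OF y(1)] e(1,3) by auto
    next
      assume "y \<notin> e1" "y \<notin> e2"
      then show ?thesis using no e(3) by metis
    qed
  qed
  then have "card (?S - ?L) = card ((`) ?f ` (?S - ?L))" by (rule card_image[symmetric])
  also have "\<dots> \<le> card ?S'"
    by (rule card_mono[OF finite_edges]) (use fin img in auto)
  finally have 1: "card (?S - ?L) \<le> card ?S'" .
  have "card ?S \<le> card ((?S - ?L) \<union> ?L)"
    by (rule card_mono) (use fc finite_edges[OF fin] in auto)
  also have "\<dots> \<le> card (?S - ?L) + card ?L" by (rule card_Un_le)
  finally show ?thesis using 1 cL unfolding rho_def by linarith
qed

text \<open>If fewer edges are lost, the contracted graph, with one vertex less, is still dense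
  enough. It is linked by induction, or it has a massive separation of small order, which is lifted
  to the original graph.\<close>

lemma contraction_common:
  assumes un: "\<not> linked V E X" and xy: "{x, y} \<in> E" "x \<in> V" "y \<in> V - X"
  shows "6 * l \<le> card (common x y)"
proof (rule ccontr)
  assume small: "\<not> ?thesis"
  let ?V = "V - {y}" and ?E = "contr x y"
  have xny: "x \<noteq> y" using no_loop[OF loop xy(1)] .
  have finV: "finite ?V" using fin by simp
  have loop': "\<forall>e\<in>?E. card e = 2" by (simp add: contr_def)
  have cV: "card V = card ?V + 1" using card_Suc_Diff1[OF fin, of y] xy(3) by simp
  have cVX: "card (V - X) = card (?V - X) + 1"
  proof -
    have "?V - X = V - X - {y}" by auto
    then show ?thesis using card_Suc_Diff1[of "V - X" y] fin xy(3) by simp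
  qed
  have m1: "6 * l * card (?V - X) < rho ?V ?E (?V - X)"
    using contr_rho[OF xy] mas small cVX by (simp add: massed_def algebra_simps)
  have VI: "(if x \<in> ?V then insert y ?V else ?V) = V" using xy(2,3) xny by auto
  have "\<not> massed (6 * l) ?V ?E X"
  proof
    assume "massed (6 * l) ?V ?E X"
    then have "linked ?V ?E X" using IH[OF finV loop' _ cX] cV by simp
    then have "linked V E X" using contr_linked[OF xy(1), of ?V X] xy(3) VI by auto
    then show False using un by simp
  qed
  moreover have "X \<subseteq> ?V" using XV xy(3) by auto
  ultimately have ex: "\<exists>A B. msep (6 * l) ?V ?E X A B \<and> card (A \<inter> B) < card X"
    using m1 by (auto simp: massed_def not_le)
  define S where "S z \<longleftrightarrow> msep (6 * l) ?V ?E X (fst z) (snd z) \<and> card (fst z \<inter> snd z) < card X" for z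
  have "\<exists>z. S z" using ex by (auto simp: S_def)
  then obtain z where z: "S z" "\<And>w. S w \<Longrightarrow> card (snd z) \<le> card (snd w)"
    using ex_has_least_nat[of S _ "\<lambda>z. card (snd z)"] by metis
  obtain A B where z_eq: "z = (A, B)" by force
  have m: "msep (6 * l) ?V ?E X A B" and o: "card (A \<inter> B) < card X" using z(1) z_eq by (auto simp: S_def)
  have min: "card B \<le> card B2" if "msep (6 * l) ?V ?E X A2 B2" "card (A2 \<inter> B2) < card X" for A2 B2
    using z(2)[of "(A2, B2)"] that z_eq by (simp add: S_def)
  have s: "sepn ?V ?E A B" "X \<subseteq> A" "6 * l * card (B - A) < rho ?V ?E (B - A)" using m by (auto simp: msep_def)
  have sub: "A \<subseteq> ?V" "B \<subseteq> ?V" "A \<union> B = ?V" using s(1) by (auto simp: sepn_def)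
  have no: "{p, q} \<notin> ?E" if "p \<in> A - B" "q \<in> B - A" for p q using s(1) that by (auto simp: sepn_def)
  have ne: "B - A \<noteq> {}"
  proof
    assume e: "B - A = {}"
    then show False using s(3) unfolding e by simp
  qed
  have "massed (6 * l) B ?E (A \<inter> B)"
    by (rule msep_massed[OF finV loop' m]) (use min o in force)
  moreover have "card B < card V" using card_mono[OF finV sub(2)] cV by linarith
  moreover have "finite B" using sub finV finite_subset by blast
  ultimately have lB: "linked B ?E (A \<inter> B)" using IH[of B ?E "A \<inter> B"] loop' o cX by auto
  have yAB: "y \<notin> A" "y \<notin> B" using sub by auto
  have l2: "linked (if x \<in> B then insert y B else B) E (A \<inter> B)"
    using contr_linked[OF xy(1) lB] yAB by auto
  have noE: "{p, q} \<notin> E" if "p \<in> A - B" "q \<in> B - A" for p q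
  proof
    assume e: "{p, q} \<in> E"
    have pq: "p \<in> V" "q \<in> V" "p \<noteq> y" "q \<noteq> y" using that sub by auto
    show False
    proof (cases "p = x")
      case False
      then show False using contr_edgeI[OF e pq(1,2,3) False xny] no[OF that] pq by simp
    next
      case True
      then have "q \<noteq> x" using no_loop[OF loop e] by auto
      moreover have "{q, p} \<in> E" using e by (simp add: insert_commute)
      ultimately have "{q, if p = y then x else p} \<in> ?E" using contr_edgeI[of q p] pq xny by blast
      then show False using no[OF that] pq by (simp add: insert_commute)
    qed
  qed
  have noy: "{p, y} \<notin> E" if "p \<noteq> x" "p \<in> V" "p \<noteq> y" "{p, x} \<notin> ?E" for p
    using contr_edgeI[of p y y x] that xy(3) xny by auto
  \<comment> \<open>\<open>y\<close> joins whichever part contains \<open>x\<close>. The order grows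
    only if that is the overlap, and then by one, so \<open>massive_sep\<close> takes the place of
    \<open>rigid_small\<close>.\<close>
  consider "x \<in> B - A" | "x \<in> A - B" | "x \<in> A \<inter> B" using xy(2) xny sub by blast
  then show False
  proof cases
    case 1
    have "{p, q} \<notin> E" if "p \<in> A - insert y B" "q \<in> insert y B - A" for p q
    proof (cases "q = y")
      case True
      have "{p, x} \<notin> ?E" using no[of p x] that 1 by blast
      then show ?thesis using noy[of p] that True 1 sub by auto
    qed (use noE[of p q] that in auto)
    moreover have "A \<union> insert y B = V" using sub xy(3) by auto
    ultimately have sV: "sepn V E A (insert y B)" by (auto simp: sepn_def)
    have i: "A \<inter> insert y B = A \<inter> B" using yAB by auto
    show False using rigid_small[OF sV s(2)] i l2 1 o ne un yAB by auto
  next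
    case 2
    have "{p, q} \<notin> E" if "p \<in> insert y A - B" "q \<in> B - insert y A" for p q
    proof (cases "p = y")
      case True
      have "{x, q} \<notin> ?E" using no[of x q] that 2 by blast
      then show ?thesis using noy[of q] that True 2 sub by (auto simp: insert_commute)
    qed (use noE[of p q] that in auto)
    moreover have "insert y A \<union> B = V" using sub xy(3) by auto
    ultimately have sV: "sepn V E (insert y A) B" by (auto simp: sepn_def)
    have i: "insert y A \<inter> B = A \<inter> B" "B - insert y A = B - A" using yAB by auto
    show False using rigid_small[OF sV] s(2) i l2 2 o ne un by auto
  next
    case 3
    have "{p, q} \<notin> E" if "p \<in> insert y A - insert y B" "q \<in> insert y B - insert y A" for p q
      using noE[of p q] that by auto
    moreover have "insert y A \<union> insert y B = V" using sub xy(3) by auto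
    ultimately have sV: "sepn V E (insert y A) (insert y B)" by (auto simp: sepn_def)
    have d: "insert y B - insert y A = B - A" "insert y A \<inter> insert y B = insert y (A \<inter> B)" using yAB by auto
    have "rho ?V ?E (B - A) \<le> rho V E (B - A)"
    proof -
      have "{e\<in>?E. e \<subseteq> ?V \<and> e \<inter> (B - A) \<noteq> {}} \<subseteq> (`) (id(y := x)) ` {e\<in>E. e \<subseteq> V \<and> e \<inter> (B - A) \<noteq> {}}"
      proof
        fix e' assume e': "e' \<in> {e\<in>?E. e \<subseteq> ?V \<and> e \<inter> (B - A) \<noteq> {}}"
        then obtain e where e: "e \<in> E" "e \<subseteq> V" "e' = (id(y := x)) ` e" by (auto simp: contr_def)
        obtain p where p: "p \<in> e'" "p \<in> B - A" using e' by blast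
        then obtain u where u: "u \<in> e" "p = (id(y := x)) u" using e(3) by blast
        have "u = p" using u(2) p(2) 3 by (cases "u = y") auto
        then show "e' \<in> (`) (id(y := x)) ` {e\<in>E. e \<subseteq> V \<and> e \<inter> (B - A) \<noteq> {}}" using e u p by blast
      qed
      then show ?thesis unfolding rho_def by (rule surj_card_le[OF finite_edges[OF fin]])
    qed
    then have m2: "msep (6 * l) V E X (insert y A) (insert y B)" using sV s d by (auto simp: msep_def)
    have "card (insert y (A \<inter> B)) \<le> card X" using o sub finV by (simp add: card_insert_if finite_subset)
    moreover have "insert y B \<noteq> V"
    proof
      assume "insert y B = V"
      then have "A \<subseteq> B" using sub yAB by blast
      then have "X \<subseteq> A \<inter> B" "finite (A \<inter> B)" using s(2) finite_subset[OF sub(1) finV] by auto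
      then show False using o card_mono[of "A \<inter> B" X] by simp
    qed
    ultimately show False using massive_sep[OF m2] d un by simp
  qed
qed

text \<open>An isolated vertex only dilutes the density: without it the rest is massive behind
  \<open>X\<close>.\<close>

lemma isolated_linked:
  assumes v: "v \<in> V - X" "nbrs E V v = {}"
  shows "linked V E X"
proof (rule massive_sep)
  let ?A = "insert v X" and ?B = "V - {v}"
  have BA: "?B - ?A = V - X - {v}" by auto
  have nov: "{v, w} \<notin> E" if "w \<in> V" for w using v(2) that by (auto simp: nbrs_def)
  have "sepn V E ?A ?B" unfolding sepn_def using nov XV v(1) by auto
  moreover have "rho V E (V - X) \<le> rho V E (V - X - {v})"
  proof (rule rho_mono[OF fin _ fin])
    fix e assume e: "e \<in> E" "e \<subseteq> V" "e \<inter> (V - X) \<noteq> {}"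
    obtain p q where pq: "e = {p, q}" "p \<noteq> q" using e(1) loop by (metis card_2_iff)
    then have "v \<noteq> p" "v \<noteq> q" using nov[of p] nov[of q] e by (auto simp: insert_commute)
    then show "e \<in> E \<and> e \<subseteq> V \<and> e \<inter> (V - X - {v}) \<noteq> {}" using e pq by auto
  qed
  moreover have "6 * l * card (V - X - {v}) \<le> 6 * l * card (V - X)"
    using fin by (intro mult_le_mono2 card_mono) auto
  moreover have "6 * l * card (V - X) < rho V E (V - X)" using mas by (simp add: massed_def)
  ultimately have "sepn V E ?A ?B" "6 * l * card (V - X - {v}) < rho V E (V - X - {v})" by linarith+
  then show "msep (6 * l) V E X ?A ?B" unfolding msep_def BA by auto
  have "?A \<inter> ?B = X" using v(1) XV by auto
  then show "card (?A \<inter> ?B) \<le> card X" by simp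
  show "?B \<noteq> V" using v(1) by auto
qed

text \<open>Degrees above \<open>12 * l\<close> throughout would, by \<open>deletion_tight\<close>,
  leave at most two vertices outside \<open>X\<close>. These have degree at most
  \<open>2 * l + 2\<close>, too small for the assumed density.\<close>

lemma small_degree:
  assumes un: "\<not> linked V E X" and l: "0 < l"
  shows "\<exists>v\<in>V - X. nbrs E V v \<noteq> {} \<and> card (nbrs E V v) \<le> 12 * l"
proof (rule ccontr)
  assume no: "\<not> ?thesis"
  let ?W = "V - X" and ?n = "card (V - X)"
  have WV: "?W \<subseteq> V" by blast
  have "12 * l + 1 \<le> card (nbrs E V v)" if "v \<in> ?W" for v
    using no that isolated_linked[OF that] un by force
  then have "(\<Sum>v\<in>?W. 12 * l + 1) \<le> (\<Sum>v\<in>?W. card (nbrs E V v))" by (intro sum_mono)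
  then have "?n * (12 * l + 1) \<le> (\<Sum>v\<in>?W. card (nbrs E V v))" by simp
  moreover have "?n * (12 * l + 1) = 2 * (6 * l * ?n) + ?n" by (simp add: algebra_simps)
  ultimately have n2: "?n \<le> 2" using degree_sum(1)[OF fin loop WV] deletion_tight[OF un] by linarith
  have "card (nbrs E V v) \<le> ?n + 2 * l" for v
  proof -
    have "card (nbrs E V v) \<le> card V" using fin by (intro card_mono) (auto simp: nbrs_def)
    also have "card V = ?n + card X" using XV fin finX by (metis card_Diff_subset card_mono le_add_diff_inverse2)
    finally show ?thesis using cX by linarith
  qed
  then have "(\<Sum>v\<in>?W. card (nbrs E V v)) \<le> (\<Sum>v\<in>?W. ?n + 2 * l)" by (intro sum_mono)
  then have "(\<Sum>v\<in>?W. card (nbrs E V v)) \<le> ?n * (?n + 2 * l)" by simp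
  moreover have "6 * l * ?n < rho V E ?W" using mas by (simp add: massed_def)
  moreover have "6 * l * ?n = ?n * (6 * l)" by (rule mult.commute)
  ultimately have "?n * (6 * l) < ?n * (?n + 2 * l)" using degree_sum(2)[OF fin loop WV] by linarith
  then have "6 * l < ?n + 2 * l" using mult_less_cancel1 by blast
  then show False using n2 l by linarith
qed

text \<open>In the closed neighbourhood \<open>L\<close> of a vertex of small degree every vertex
  outside \<open>X\<close> has at least \<open>6 * l + 1\<close> neighbours, by
  \<open>contraction_common\<close>. Either \<open>L\<close> is the target, or some unlinkable pairs
  in it lead to a dense piece away from their terminals.\<close>

lemma exists_target:
  assumes un: "\<not> linked V E X" and l: "0 < l"
  shows "\<exists>C. C \<subseteq> V \<and> 2 * l \<le> card C \<and> (\<forall>Y. Y \<subseteq> C \<longrightarrow> card Y \<le> 2 * l \<longrightarrow> X \<inter> C \<subseteq> Y \<longrightarrow> linked C E Y)"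
proof -
  obtain v where v: "v \<in> V - X" "nbrs E V v \<noteq> {}" "card (nbrs E V v) \<le> 12 * l"
    using small_degree[OF un l] by blast
  define N where "N = nbrs E V v"
  define L where "L = insert v N"
  have finN: "finite N" using fin by (auto simp: N_def nbrs_def)
  have vN: "v \<notin> N" using no_loop[OF loop, of v v] by (auto simp: N_def nbrs_def)
  have LV: "L \<subseteq> V" "finite L" using v(1) finN by (auto simp: L_def N_def nbrs_def)
  have cL: "card L \<le> 12 * l + 1" using v(3) finN vN by (simp add: L_def N_def)
  have N_iff: "w \<in> N \<longleftrightarrow> w \<in> V \<and> {v, w} \<in> E" for w by (simp add: N_def nbrs_def)
  have com: "6 * l \<le> card (common x v)" if "x \<in> N" for x
    by (rule contraction_common[OF un]) (use that v(1) in \<open>auto simp: N_iff insert_commute\<close>)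
  have comN: "common x v \<subseteq> N - {x}" for x by (auto simp: common_def N_iff)
  have degv: "6 * l + 1 \<le> card N"
  proof -
    obtain x where x: "x \<in> N" using v(2) by (auto simp: N_def)
    have "card (common x v) \<le> card (N - {x})" using comN finN by (intro card_mono) auto
    then show ?thesis using com[OF x] card_Suc_Diff1[OF finN x] by linarith
  qed
  have deg: "6 * l + 1 \<le> card (nbrs E L w)" if w: "w \<in> L - X" for w
  proof (cases "w = v")
    case True
    have "N \<subseteq> nbrs E L w" using True by (auto simp: nbrs_def L_def N_iff)
    then have "card N \<le> card (nbrs E L w)" using LV by (intro card_mono) (auto simp: nbrs_def)
    then show ?thesis using degv by linarith
  next
    case False
    then have wN: "w \<in> N" using w by (simp add: L_def)
    have "insert v (common w v) \<subseteq> nbrs E L w"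
      using w wN comN[of w] by (auto simp: nbrs_def L_def N_iff common_def insert_commute)
    then have "card (insert v (common w v)) \<le> card (nbrs E L w)" using LV by (intro card_mono) (auto simp: nbrs_def)
    moreover have "v \<notin> common w v" "finite (common w v)" using comN[of w] vN finN finite_subset by auto
    ultimately show ?thesis using com[OF wN] by simp
  qed
  have c2: "2 * l \<le> card L" using degv finN vN by (simp add: L_def)
  show ?thesis
  proof (cases "\<forall>(J :: 'a set set) s t. finite J \<longrightarrow> card J = l \<longrightarrow> terminals J s t \<longrightarrow> s ` J \<union> t ` J \<subseteq> L \<longrightarrow>
      X \<inter> L \<subseteq> s ` J \<union> t ` J \<longrightarrow> linkable L E J s t")
    case True
    have "linked L E Y" if "Y \<subseteq> L" "card Y \<le> 2 * l" "X \<inter> L \<subseteq> Y" for Y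
      by (rule linked_of_linkable[OF LV(2) that(1,3,2) c2]) (use True in blast)
    then show ?thesis using LV c2 by blast
  next
    case False
    then obtain J :: "'a set set" and s t where J: "finite J" "card J = l" "terminals J s t"
      "s ` J \<union> t ` J \<subseteq> L" "X \<inter> L \<subseteq> s ` J \<union> t ` J" "\<not> linkable L E J s t" by blast
    let ?T = "s ` J \<union> t ` J"
    have cT: "card ?T = 2 * l" "finite ?T" using card_terminals[OF J(3,1)] J(1,2) by auto
    \<comment> \<open>At most \<open>2 * l - 1\<close> neighbours are other terminals. For
      \<open>x\<close> in \<open>X\<close>, the members of \<open>common x v\<close> that are not
      neighbours of \<open>x\<close> lie in \<open>X\<close>, hence are terminals too and are
      discounted with them.\<close>
    have tdeg: "4 * l + 2 \<le> card (nbrs E (L - ?T) x)"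
      if x: "x \<in> ?T" "y \<in> ?T" "x \<noteq> y" "{x, y} \<notin> E" for x y
    proof -
      have fn: "finite (nbrs E (L - ?T) x)" using LV by (auto simp: nbrs_def)
      have bound: "6 * l + 1 \<le> card (nbrs E (L - ?T) x) + c" if
        "S \<subseteq> nbrs E (L - ?T) x \<union> R" "6 * l + 1 \<le> card S" "R \<subseteq> ?T" "card R = c" for S R c
      proof -
        have "finite R" using that(3) cT finite_subset by blast
        then have "card S \<le> card (nbrs E (L - ?T) x \<union> R)" using that(1) fn by (intro card_mono) auto
        also have "\<dots> \<le> card (nbrs E (L - ?T) x) + card R" by (rule card_Un_le)
        finally show ?thesis using that by linarith
      qed
      have c1: "card (?T - {x}) + 1 = 2 * l" using card_Suc_Diff1[OF cT(2) x(1)] cT by simp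
      show ?thesis
      proof (cases "x \<in> X")
        case True
        then have xN: "x \<in> N" using x(1) J(4) v(1) by (auto simp: L_def)
        have "insert v (common x v) \<subseteq> nbrs E (L - ?T) x \<union> (?T - {x})"
        proof
          fix w assume w: "w \<in> insert v (common x v)"
          have wL: "w \<in> L" "w \<noteq> x" using w comN[of x] xN vN by (auto simp: L_def)
          show "w \<in> nbrs E (L - ?T) x \<union> (?T - {x})"
          proof (cases "w \<in> ?T")
            case False
            then have "w \<notin> X" using J(5) wL by blast
            then have "{x, w} \<in> E" using w xN by (auto simp: common_def N_iff insert_commute)
            then show ?thesis using False wL by (auto simp: nbrs_def)
          qed (use wL in auto)
        qed
        moreover have "v \<notin> common x v" "finite (common x v)" using comN[of x] vN finN finite_subset by auto
        then have "6 * l + 1 \<le> card (insert v (common x v))" using com[OF xN] by simp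
        ultimately have "6 * l + 1 \<le> card (nbrs E (L - ?T) x) + card (?T - {x})" using bound by blast
        then show ?thesis using c1 by linarith
      next
        case False
        have "nbrs E L x \<subseteq> nbrs E (L - ?T) x \<union> (?T - {x})"
          using no_loop[OF loop, of x x] by (auto simp: nbrs_def)
        then have "6 * l + 1 \<le> card (nbrs E (L - ?T) x) + card (?T - {x})"
          using bound[of "nbrs E L x"] deg[of x] False x(1) J(4) by blast
        then show ?thesis using c1 by linarith
      qed
    qed
    have d1: "6 * l + 1 \<le> card (nbrs E L w)" if "w \<in> L - ?T" for w using deg[of w] that J(5) by blast
    have d2: "4 * l + 2 \<le> card (nbrs E (L - ?T) (s i)) \<and> 4 * l + 2 \<le> card (nbrs E (L - ?T) (t i))"
      if i: "i \<in> J" "{s i, t i} \<notin> E" for i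
    proof -
      have "s i \<noteq> t i" using terminals_distinct(1)[OF J(3) i(1) i(1)] .
      then show ?thesis using tdeg[of "s i" "t i"] tdeg[of "t i" "s i"] i by (auto simp: insert_commute)
    qed
    obtain C where C: "C \<subseteq> L - ?T" "3 * l \<le> card C"
      "\<And>(J' :: 'a set set) u v. finite J' \<Longrightarrow> card J' = l \<Longrightarrow> terminals J' u v \<Longrightarrow> u ` J' \<union> v ` J' \<subseteq> C \<Longrightarrow> linkable C E J' u v"
      using dense_or_linkable[OF LV(2) J(1) J(2)[symmetric] loop J(3,4) cL d1 d2 J(6), where 'j = "'a set"] by blast
    have finC: "finite C" using C(1) LV finite_subset by blast
    have "linked C E Y" if "Y \<subseteq> C" "card Y \<le> 2 * l" for Y
      by (rule linked_of_linkable[OF finC that(1) empty_subsetI that(2)]) (use C in auto)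
    then show ?thesis using C LV by (intro exI[of _ C]) auto
  qed
qed

lemma linked_step: "linked V E X"
proof (rule ccontr)
  assume un: "\<not> linked V E X"
  have "0 < l"
  proof (rule ccontr)
    assume "\<not> 0 < l"
    then have X: "X = {}" using cX finX by simp
    have "M = {}" if "pairing X M" for M using that X unfolding pairing_def by fastforce
    then show False using un unfolding linked_def by blast
  qed
  from exists_target[OF un this] obtain C where C: "C \<subseteq> V" "2 * l \<le> card C"
    "\<And>Y. Y \<subseteq> C \<Longrightarrow> card Y \<le> 2 * l \<Longrightarrow> X \<inter> C \<subseteq> Y \<Longrightarrow> linked C E Y" by blast
  have VC: "V \<inter> C = C" using C(1) by blast
  \<comment> \<open>A degenerate separation: nothing lies beyond \<open>C\<close>, and the last
    premise of \<open>target\<close> holds because \<open>C\<close> has at least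
    \<open>card X\<close> vertices.\<close>
  have "sepn V E V C" using C(1) by (auto simp: sepn_def)
  then have "linked V E X"
    by (rule target[OF _ XV]) (use C cX VC in auto)
  then show False using un by simp
qed

end

text \<open>Passing to one side of a separation or contracting lowers the number of vertices;
  deleting an edge lowers only the second component of the order.\<close>

theorem massed_linked:
  fixes V :: "'a set"
  assumes "finite V" "\<forall>e\<in>E. card e = 2" "massed (6 * l) V E X" "card X \<le> 2 * l"
  shows "linked V E X"
  using assms
proof (induction "(card V, card {e\<in>E. e \<subseteq> V})" arbitrary: V E X
    rule: wf_induct_rule[OF wf_lex_prod[OF wf_less_than wf_less_than]])
  case 1
  interpret minimal_massed l V E X
  proof
    fix V' :: "'a set" and E' X'
    assume "finite V'" "\<forall>e\<in>E'. card e = 2" "massed (6 * l) V' E' X'" "card X' \<le> 2 * l"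
      "card V' < card V \<or> card V' = card V \<and> card {e\<in>E'. e \<subseteq> V'} < card {e\<in>E. e \<subseteq> V}"
    then show "linked V' E' X'" by (intro 1(1)) auto
  qed (use 1 in auto)
  show ?case by (rule linked_step)
qed

section \<open>The Tutte-Berge formula\<close>

text \<open>The core of Gallai's lemma: not being missed together by a maximum matching is
  transitive. Among the maximum matchings missing \<open>t\<close>, the one sharing most edges with
  \<open>M\<close> can be changed to share one more.\<close>

lemma gallai_exchange:
  assumes fin: "finite V"
    and mx: "\<And>M'. pairing V M' \<Longrightarrow> M' \<subseteq> E \<Longrightarrow> card M' \<le> n"
    and ut: "\<And>M'. pairing V M' \<Longrightarrow> M' \<subseteq> E \<Longrightarrow> card M' = n \<Longrightarrow> u \<in> \<Union> M' \<or> t \<in> \<Union> M'"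
    and tv: "\<And>M'. pairing V M' \<Longrightarrow> M' \<subseteq> E \<Longrightarrow> card M' = n \<Longrightarrow> t \<in> \<Union> M' \<or> v \<in> \<Union> M'"
    and t: "pairing V N0" "N0 \<subseteq> E" "card N0 = n" "t \<notin> \<Union> N0"
    and M: "pairing V M" "M \<subseteq> E" "card M = n" "u \<notin> \<Union> M" "v \<notin> \<Union> M" "u \<noteq> v"
  shows False
proof -
  define Q where "Q N \<longleftrightarrow> pairing V N \<and> N \<subseteq> E \<and> card N = n \<and> t \<notin> \<Union> N" for N
  have finp: "finite N" if "pairing V N" for N using card_Union_pairing(1)[OF that fin] .
  have "\<exists>N. Q N \<and> (\<forall>N'. Q N' \<longrightarrow> card (M \<inter> N') \<le> card (M \<inter> N))"
  proof (rule ex_has_greatest_nat[where k = N0 and b = "n + 1" and f = "\<lambda>N. card (M \<inter> N)"])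
    show "Q N0" using t by (simp add: Q_def)
    show "\<forall>y. Q y \<longrightarrow> card (M \<inter> y) < n + 1"
      using card_mono[OF finp[OF M(1)], of "M \<inter> _"] M(3) by (auto simp: less_Suc_eq_le)
  qed
  then obtain N where N: "Q N" "\<And>N'. Q N' \<Longrightarrow> card (M \<inter> N') \<le> card (M \<inter> N)" by blast
  have NQ: "pairing V N" "N \<subseteq> E" "card N = n" "t \<notin> \<Union> N" using N(1) by (auto simp: Q_def)
  have cov: "u \<in> \<Union> N" "v \<in> \<Union> N" "t \<in> \<Union> M" using ut[OF NQ(1-3)] tv[OF NQ(1-3)] ut[OF M(1-3)] NQ(4) M(4) by auto
  have finU: "finite (\<Union> M)" "finite (\<Union> N)"
    using M(1) NQ(1) fin by (auto simp: pairing_def intro: finite_subset)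
  have eqc: "card (\<Union> M) = card (\<Union> N)" using card_Union_pairing(2)[OF M(1) fin] card_Union_pairing(2)[OF NQ(1) fin] M(3) NQ(3) by simp
  \<comment> \<open>\<open>N\<close> covers two vertices that \<open>M\<close> misses, so
    \<open>M\<close> covers two that \<open>N\<close> misses, and one of these is not
    \<open>t\<close>.\<close>
  have "card {u, v} \<le> card (\<Union> N - \<Union> M)" using cov M(4,5) finU by (intro card_mono) auto
  moreover have "card (\<Union> N - \<Union> M) = card (\<Union> M - \<Union> N)"
    using eqc finU by (metis card_Diff_subset_Int finite_Int inf_commute)
  ultimately have "2 \<le> card (\<Union> M - \<Union> N)" using M(6) by simp
  then have "\<not> \<Union> M - \<Union> N \<subseteq> {t}" using card_mono[of "{t}" "\<Union> M - \<Union> N"] by auto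
  then obtain x where x: "x \<in> \<Union> M" "x \<notin> \<Union> N" "x \<noteq> t" by blast
  then obtain e where e: "e \<in> M" "x \<in> e" by blast
  then have "card e = 2" "e \<subseteq> V" using M(1) by (auto simp: pairing_def)
  then obtain y where y: "e = {x, y}" "y \<noteq> x" using e(2) by (auto simp: card_2_iff)
  have eN: "e \<notin> N" using x e by blast
  have eV: "e \<subseteq> V" "card e = 2" using \<open>e \<subseteq> V\<close> \<open>card e = 2\<close> by auto
  have yN: "y \<in> \<Union> N"
  proof (rule ccontr)
    assume "y \<notin> \<Union> N"
    then have d: "e \<inter> g = {}" if "g \<in> N" for g using that x y by auto
    have "pairing V (insert e N)" unfolding pairing_def disjoint_def
      using NQ(1) eV d unfolding pairing_def disjoint_def by (auto simp: Int_commute)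
    moreover have "insert e N \<subseteq> E" using NQ(2) e M(2) by auto
    ultimately have "card (insert e N) \<le> n" by (rule mx)
    then show False using eN finp[OF NQ(1)] NQ(3) by simp
  qed
  then obtain f where f: "f \<in> N" "y \<in> f" by blast
  have d: "e \<inter> g = {}" if "g \<in> N - {f}" for g
    using that x y f pairing_disjoint[OF NQ(1), of g f y] by auto
  define N' where "N' = insert e (N - {f})"
  have "pairing V N'" unfolding N'_def pairing_def disjoint_def
    using NQ(1) eV d unfolding pairing_def disjoint_def by (auto simp: Int_commute)
  moreover have "N' \<subseteq> E" using NQ(2) e M(2) by (auto simp: N'_def)
  moreover have "card N' = n"
    using f eN finp[OF NQ(1)] NQ(3) card_Suc_Diff1[of N f] by (simp add: N'_def)
  moreover have "t \<notin> \<Union> N'" using NQ(4) x(3) y yN by (auto simp: N'_def)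
  ultimately have "Q N'" by (simp add: Q_def)
  then have le: "card (M \<inter> N') \<le> card (M \<inter> N)" by (rule N(2))
  have "f \<notin> M"
  proof
    assume "f \<in> M"
    then have "f = e" using pairing_disjoint[OF M(1), of f e y] e f y by auto
    then show False using f eN by simp
  qed
  then have "M \<inter> N' = insert e (M \<inter> N)" using e(1) by (auto simp: N'_def)
  then show False using le eN finp[OF NQ(1)] by simp
qed

text \<open>A disconnected graph is treated part by part. In a connected one, a vertex covered by
  all maximum matchings is moved into \<open>U\<close>; if there is none, Gallai's lemma shows that
  a maximum matching misses at most one vertex.\<close>

theorem tutte_berge:
  fixes V :: "'a set"
  assumes "finite V" "\<forall>e\<in>E. card e = 2"
  shows "\<exists>M U \<C>. pairing V M \<and> M \<subseteq> E \<and> U \<subseteq> V \<and> \<Union> \<C> = V - U \<and> disjoint \<C> \<and>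
    (\<forall>e\<in>E. e \<subseteq> V - U \<longrightarrow> (\<exists>C\<in>\<C>. e \<subseteq> C)) \<and>
    card V + card U \<le> 2 * card M + card {C\<in>\<C>. odd (card C)}"
  using assms(1)
proof (induction "card V" arbitrary: V rule: less_induct)
  case less
  note fin = less.prems
  have "\<exists>M. (pairing V M \<and> M \<subseteq> E) \<and> (\<forall>M'. pairing V M' \<and> M' \<subseteq> E \<longrightarrow> card M' \<le> card M)"
  proof (rule ex_has_greatest_nat[where k = "{}" and b = "card V + 1"])
    show "pairing V {} \<and> {} \<subseteq> E" by (simp add: pairing_def disjoint_def)
    show "\<forall>M'. pairing V M' \<and> M' \<subseteq> E \<longrightarrow> card M' < card V + 1"
    proof (intro allI impI)
      fix M' assume M': "pairing V M' \<and> M' \<subseteq> E"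
      then have "\<Union> M' \<subseteq> V" by (auto simp: pairing_def)
      then have "card (\<Union> M') \<le> card V" using fin by (rule card_mono[rotated])
      then show "card M' < card V + 1" using card_Union_pairing(2)[OF _ fin, of M'] M' by simp
    qed
  qed
  then obtain M where M: "pairing V M" "M \<subseteq> E" and mx: "\<And>M'. pairing V M' \<Longrightarrow> M' \<subseteq> E \<Longrightarrow> card M' \<le> card M" by blast
  have MV: "\<Union> M \<subseteq> V" using M(1) by (auto simp: pairing_def)
  show ?case
  proof (cases "V = {} \<or> conn E V")
    case False
    then obtain P where P: "P \<subseteq> V" "P \<noteq> {}" "P \<noteq> V" "\<forall>a\<in>P. \<forall>b\<in>V - P. {a, b} \<notin> E"
      unfolding conn_iff_cut by blast
    have lt: "card P < card V" "card (V - P) < card V"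
      using P fin by (auto intro!: psubset_card_mono)
    have finP: "finite P" "finite (V - P)" using finite_subset[OF P(1) fin] fin by auto
    obtain M1 U1 C1 where 1: "pairing P M1" "M1 \<subseteq> E" "U1 \<subseteq> P" "\<Union> C1 = P - U1" "disjoint C1"
      "\<forall>e\<in>E. e \<subseteq> P - U1 \<longrightarrow> (\<exists>C\<in>C1. e \<subseteq> C)" "card P + card U1 \<le> 2 * card M1 + card {C\<in>C1. odd (card C)}"
      using less.hyps[OF lt(1) finP(1)] by (elim exE conjE)
    obtain M2 U2 C2 where 2: "pairing (V - P) M2" "M2 \<subseteq> E" "U2 \<subseteq> V - P" "\<Union> C2 = V - P - U2" "disjoint C2"
      "\<forall>e\<in>E. e \<subseteq> V - P - U2 \<longrightarrow> (\<exists>C\<in>C2. e \<subseteq> C)" "card (V - P) + card U2 \<le> 2 * card M2 + card {C\<in>C2. odd (card C)}"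
      using less.hyps[OF lt(2) finP(2)] by (elim exE conjE)
    have sub1: "e \<subseteq> P" "card e = 2" if "e \<in> M1" for e using 1(1) that by (auto simp: pairing_def)
    have sub2: "e \<subseteq> V - P" "card e = 2" if "e \<in> M2" for e using 2(1) that by (auto simp: pairing_def)
    have dM: "M1 \<inter> M2 = {}"
    proof (rule ccontr)
      assume "M1 \<inter> M2 \<noteq> {}"
      then obtain e where e: "e \<in> M1" "e \<in> M2" by blast
      have "e = {}" using sub1(1)[OF e(1)] sub2(1)[OF e(2)] by blast
      then show False using sub1(2)[OF e(1)] by simp
    qed
    have fM: "finite M1" "finite M2" by (rule card_Union_pairing(1)[OF 1(1) finP(1)], rule card_Union_pairing(1)[OF 2(1) finP(2)])
    have dis: "disjoint (F \<union> G)" if "disjoint F" "disjoint G" "\<And>C. C \<in> F \<Longrightarrow> C \<subseteq> P" "\<And>C. C \<in> G \<Longrightarrow> C \<subseteq> V - P" for F G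
    proof (rule disjointI)
      fix a b assume ab: "a \<in> F \<union> G" "b \<in> F \<union> G" "a \<noteq> b"
      then consider "a \<in> F" "b \<in> F" | "a \<in> G" "b \<in> G" | "a \<in> F" "b \<in> G" | "a \<in> G" "b \<in> F" by blast
      then show "a \<inter> b = {}"
      proof cases
        case 3
        then show ?thesis using that(3)[of a] that(4)[of b] by blast
      next
        case 4
        then show ?thesis using that(3)[of b] that(4)[of a] by blast
      qed (use ab(3) disjointD[OF that(1)] disjointD[OF that(2)] in auto)
    qed
    have "pairing V (M1 \<union> M2)"
      unfolding pairing_def
    proof (intro conjI ballI)
      show "disjoint (M1 \<union> M2)" by (rule dis) (use 1(1) 2(1) sub1 sub2 in \<open>auto simp: pairing_def\<close>)
      fix e assume "e \<in> M1 \<union> M2"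
      then have "(e \<subseteq> P \<or> e \<subseteq> V - P) \<and> card e = 2" using sub1[of e] sub2[of e] by blast
      then show "e \<subseteq> V" "card e = 2" using P(1) by blast+
    qed
    moreover have "M1 \<union> M2 \<subseteq> E" using 1 2 by auto
    moreover have "U1 \<union> U2 \<subseteq> V" using 1(3) 2(3) P by auto
    moreover have "\<Union> (C1 \<union> C2) = V - (U1 \<union> U2)" using 1(3,4) 2(3,4) P by auto
    moreover have "disjoint (C1 \<union> C2)" by (rule dis[OF 1(5) 2(5)]) (use 1(4) 2(4) in auto)
    moreover have "\<exists>C\<in>C1 \<union> C2. e \<subseteq> C" if e: "e \<in> E" "e \<subseteq> V - (U1 \<union> U2)" for e
    proof -
      obtain a b where ab: "e = {a, b}" using assms(2) e(1) by (metis card_2_iff)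
      have "{a, b} \<in> E" "{b, a} \<in> E" "a \<in> V" "b \<in> V" using ab e by (auto simp: insert_commute)
      then have "a \<in> P \<longleftrightarrow> b \<in> P" using P(4) by blast
      then have "e \<subseteq> P \<or> e \<subseteq> V - P" using ab \<open>a \<in> V\<close> \<open>b \<in> V\<close> by blast
      then have "e \<subseteq> P - U1 \<or> e \<subseteq> V - P - U2" using e(2) by blast
      then show ?thesis
      proof
        assume "e \<subseteq> P - U1"
        from 1(6)[rule_format, OF e(1) this] show ?thesis by (rule bexE) (rule bexI[OF _ UnI1])
      next
        assume "e \<subseteq> V - P - U2"
        from 2(6)[rule_format, OF e(1) this] show ?thesis by (rule bexE) (rule bexI[OF _ UnI2])
      qed
    qed
    moreover have "card V + card (U1 \<union> U2) \<le> 2 * card (M1 \<union> M2) + card {C\<in>C1 \<union> C2. odd (card C)}"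
    proof -
      have "finite C1" by (rule finite_UnionD) (simp add: 1(4) finP)
      moreover have "finite C2" by (rule finite_UnionD) (simp only: 2(4) finP finite_Diff)
      ultimately have fC: "finite {C\<in>C1. odd (card C)}" "finite {C\<in>C2. odd (card C)}" by simp_all
      have "{C\<in>C1 \<union> C2. odd (card C)} = {C\<in>C1. odd (card C)} \<union> {C\<in>C2. odd (card C)}" by auto
      moreover have "{C\<in>C1. odd (card C)} \<inter> {C\<in>C2. odd (card C)} = {}"
      proof (rule ccontr)
        assume "\<not> ?thesis"
        then obtain C where C: "C \<in> C1" "C \<in> C2" "odd (card C)" by blast
        then have "C \<subseteq> P" "C \<subseteq> V - P" using 1(4) 2(4) by auto
        then have "C = {}" by blast
        then show False using C(3) by simp
      qed
      ultimately have "card {C\<in>C1 \<union> C2. odd (card C)} = card {C\<in>C1. odd (card C)} + card {C\<in>C2. odd (card C)}"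
        using fC by (simp add: card_Un_disjoint)
      moreover have "card (M1 \<union> M2) = card M1 + card M2" using fM dM by (simp add: card_Un_disjoint)
      moreover have "card V = card P + card (V - P)" using card_Diff_subset[OF finP(1) P(1)] card_mono[OF fin P(1)] by simp
      moreover have "card (U1 \<union> U2) \<le> card U1 + card U2" by (rule card_Un_le)
      ultimately show ?thesis using 1(7) 2(7) by linarith
    qed
    ultimately show ?thesis
      by (intro exI[of _ "M1 \<union> M2"] exI[of _ "U1 \<union> U2"] exI[of _ "C1 \<union> C2"] conjI ballI impI)
  next
    case c: True
    show ?thesis
    proof (cases "\<exists>v\<in>V. \<forall>M'. pairing V M' \<and> M' \<subseteq> E \<and> card M' = card M \<longrightarrow> v \<in> \<Union> M'")
      case True
      then obtain v where v: "v \<in> V" "\<And>M'. pairing V M' \<Longrightarrow> M' \<subseteq> E \<Longrightarrow> card M' = card M \<Longrightarrow> v \<in> \<Union> M'" by blast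
      have cV: "card (V - {v}) + 1 = card V" using card_Suc_Diff1[OF fin v(1)] by simp
      then have lt: "card (V - {v}) < card V" by simp
      have finv: "finite (V - {v})" using fin by simp
      obtain M1 U1 C1 where 1: "pairing (V - {v}) M1" "M1 \<subseteq> E" "U1 \<subseteq> V - {v}" "\<Union> C1 = V - {v} - U1" "disjoint C1"
        "\<forall>e\<in>E. e \<subseteq> V - {v} - U1 \<longrightarrow> (\<exists>C\<in>C1. e \<subseteq> C)" "card (V - {v}) + card U1 \<le> 2 * card M1 + card {C\<in>C1. odd (card C)}"
        using less.hyps[OF lt finv] by (elim exE conjE)
      have p1: "pairing V M1" using pairing_mono[OF 1(1)] by blast
      have "v \<notin> \<Union> M1" using 1(1) by (auto simp: pairing_def)
      then have "card M1 \<noteq> card M" using v(2)[OF p1 1(2)] by blast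
      then have "card M1 + 1 \<le> card M" using mx[OF p1 1(2)] by simp
      moreover have "card (insert v U1) \<le> card U1 + 1" using finv 1(3) by (simp add: card_insert_if finite_subset)
      ultimately have "card V + card (insert v U1) \<le> 2 * card M + card {C\<in>C1. odd (card C)}"
        using 1(7) cV by linarith
      moreover have d: "V - {v} - U1 = V - insert v U1" by auto
      moreover have "insert v U1 \<subseteq> V" using 1(3) v(1) by blast
      ultimately show ?thesis
        using M 1(4,5,6) unfolding d by (intro exI[of _ M] exI[of _ "insert v U1"] exI[of _ C1] conjI)
    next
      case False
      then have miss: "\<exists>N. pairing V N \<and> N \<subseteq> E \<and> card N = card M \<and> t \<notin> \<Union> N" if "t \<in> V" for t using that by blast
      \<comment> \<open>Holds along edges, since a matching missing both ends could be enlarged, and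
        is transitive by \<open>gallai_exchange\<close>; connectivity spreads it to all pairs of
        vertices.\<close>
      define eqv where "eqv u v \<longleftrightarrow> u = v \<or> (\<forall>M'. pairing V M' \<longrightarrow> M' \<subseteq> E \<longrightarrow> card M' = card M \<longrightarrow> u \<in> \<Union> M' \<or> v \<in> \<Union> M')" for u v
      have eqv_trans: "eqv u v" if e: "eqv u t" "eqv t v" "t \<in> V" for u t v
      proof (rule ccontr)
        assume n: "\<not> eqv u v"
        then obtain M' where M': "pairing V M'" "M' \<subseteq> E" "card M' = card M" "u \<notin> \<Union> M'" "v \<notin> \<Union> M'" "u \<noteq> v"
          unfolding eqv_def by blast
        obtain N where Nt: "pairing V N" "N \<subseteq> E" "card N = card M" "t \<notin> \<Union> N" using miss[OF e(3)] by blast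
        have "u \<noteq> t" "t \<noteq> v" using n e by auto
        have ut: "u \<in> \<Union> K \<or> t \<in> \<Union> K" if "pairing V K" "K \<subseteq> E" "card K = card M" for K
          using \<open>eqv u t\<close>[unfolded eqv_def] \<open>u \<noteq> t\<close> that by simp
        have tv: "t \<in> \<Union> K \<or> v \<in> \<Union> K" if "pairing V K" "K \<subseteq> E" "card K = card M" for K
          using \<open>eqv t v\<close>[unfolded eqv_def] \<open>t \<noteq> v\<close> that by simp
        show False by (rule gallai_exchange[OF fin mx ut tv Nt M'])
      qed
      have eqv_edge: "eqv u v" if uv: "{u, v} \<in> E" "u \<in> V" "v \<in> V" for u v
      proof (rule ccontr)
        assume "\<not> eqv u v"
        then obtain M' where M': "pairing V M'" "M' \<subseteq> E" "card M' = card M" "u \<notin> \<Union> M'" "v \<notin> \<Union> M'"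
          unfolding eqv_def by blast
        have "pairing V (insert {u, v} M')"
          unfolding pairing_def disjoint_def
          using M'(1,4,5) uv assms(2) unfolding pairing_def disjoint_def by auto
        then have "card (insert {u, v} M') \<le> card M" using mx M'(2) uv(1) by simp
        moreover have "{u, v} \<notin> M'" using M'(4) by blast
        ultimately show False using card_Union_pairing(1)[OF M'(1) fin] M'(3) by simp
      qed
      have all: "eqv u v" if uv: "u \<in> V" "v \<in> V" for u v
      proof -
        have "(u, v) \<in> (adj_in E V)\<^sup>*" using c uv unfolding conn_def by blast
        then show ?thesis
        proof (induction rule: rtrancl_induct)
          case base
          then show ?case by (simp add: eqv_def)
        next
          case (step y z)
          then show ?case using eqv_trans[of u y z] eqv_edge[of y z] by (auto simp: adj_in_def)
        qed
      qed
      have cM: "card (\<Union> M) = 2 * card M" using card_Union_pairing(2)[OF M(1) fin] .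
      have "card (V - \<Union> M) \<le> 1"
      proof (rule ccontr)
        assume "\<not> ?thesis"
        then have "2 \<le> card (V - \<Union> M)" by linarith
        then obtain Z where Z: "Z \<subseteq> V - \<Union> M" "card Z = 2" by (rule obtain_subset_with_card_n)
        from Z(2) obtain u v where "Z = {u, v}" "u \<noteq> v" unfolding card_2_iff by (elim exE conjE)
        then have uv: "u \<in> V" "u \<notin> \<Union> M" "v \<in> V" "v \<notin> \<Union> M" "u \<noteq> v" using Z(1) by simp_all
        have "\<forall>M'. pairing V M' \<longrightarrow> M' \<subseteq> E \<longrightarrow> card M' = card M \<longrightarrow> u \<in> \<Union> M' \<or> v \<in> \<Union> M'"
          using all[OF uv(1,3)] uv(5) unfolding eqv_def by (elim disjE) simp_all
        from this[rule_format, OF M refl] show False using uv by simp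
      qed
      moreover have "card (V - \<Union> M) + card (\<Union> M) = card V"
        using MV fin by (metis card_Diff_subset card_mono finite_subset le_add_diff_inverse2)
      ultimately have b: "card V \<le> 2 * card M + 1" using cM by linarith
      have "card V \<le> 2 * card M + card {C\<in>{V}. odd (card C)}"
      proof (cases "odd (card V)")
        case True
        then have "{C\<in>{V}. odd (card C)} = {V}" by auto
        then show ?thesis using b by simp
      next
        case False
        then have "card V \<noteq> 2 * card M + 1" by presburger
        then show ?thesis using b by simp
      qed
      then show ?thesis using M
        by (intro exI[of _ M] exI[of _ "{}"] exI[of _ "{V}"]) (auto simp: disjoint_def)
    qed
  qed
qed

section \<open>Odd paths between vertices of a set\<close>

text \<open>\<open>length\<close> counts vertices, so an even value means an odd number of edges; in
  particular the two ends are distinct.\<close>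

definition odd_path :: "'a set \<Rightarrow> 'a set set \<Rightarrow> 'a set \<Rightarrow> 'a list \<Rightarrow> bool" where
  "odd_path V E A p \<longleftrightarrow> is_path V E p \<and> even (length p) \<and> hd p \<in> A \<and> last p \<in> A \<and> set p \<inter> A = {hd p, last p}"

text \<open>An odd \<open>A\<close>-path corresponds to an alternating path changing the copy at each inner vertex.\<close>

definition dbl_verts :: "'a set \<Rightarrow> 'a set \<Rightarrow> ('a \<times> bool) set" where
  "dbl_verts V A = V \<times> {False} \<union> (V - A) \<times> {True}"

definition dbl_edges :: "'a set \<Rightarrow> 'a set set \<Rightarrow> 'a set \<Rightarrow> ('a \<times> bool) set set" where
  "dbl_edges V E A = {{(u, b), (v, b)} |u v b. {u, v} \<in> E \<and> u \<noteq> v} \<union> {{(v, False), (v, True)} |v. v \<in> V - A}"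

lemma dbl_verts_iff: "(v, b) \<in> dbl_verts V A \<longleftrightarrow> v \<in> V \<and> (v \<in> A \<longrightarrow> \<not> b)"
  by (auto simp: dbl_verts_def)

lemma dbl_edges_card: "\<forall>e\<in>dbl_edges V E A. card e = 2"
  by (auto simp: dbl_edges_def)

lemma dbl_edgesI: "{u, v} \<in> E \<Longrightarrow> u \<noteq> v \<Longrightarrow> {(u, b), (v, b)} \<in> dbl_edges V E A"
  by (auto simp: dbl_edges_def)

lemma dbl_edges_cases:
  assumes "{x, y} \<in> dbl_edges V E A"
  shows "snd x = snd y \<and> {fst x, fst y} \<in> E \<or> fst x = fst y"
  using assms by (auto simp: dbl_edges_def doubleton_eq_iff insert_commute)

text \<open>Matching edges start at even positions; between them the list jumps from one copy of a
  vertex to the other. Both ends are covered by matching edges.\<close>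

definition alt :: "('a \<times> bool) set set \<Rightarrow> ('a \<times> bool) list \<Rightarrow> bool" where
  "alt M ls \<longleftrightarrow> even (length ls) \<and> ls \<noteq> [] \<and> distinct ls \<and>
     (\<forall>j. Suc j < length ls \<longrightarrow> (if even j then {ls ! j, ls ! Suc j} \<in> M else fst (ls ! j) = fst (ls ! Suc j)))"

lemma alt_append:
  assumes p: "alt M p" and q: "alt M q" and d: "set p \<inter> set q = {}" and e: "fst (last p) = fst (hd q)"
  shows "alt M (p @ q)"
  unfolding alt_def
proof (intro conjI allI impI)
  show "even (length (p @ q))" "p @ q \<noteq> []" "distinct (p @ q)" using p q d by (auto simp: alt_def)
  fix j assume j: "Suc j < length (p @ q)"
  have ev: "even (length p)" "p \<noteq> []" "q \<noteq> []" using p q by (auto simp: alt_def)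
  consider "Suc j < length p" | "Suc j = length p" | "length p \<le> j" by linarith
  then show "if even j then {(p @ q) ! j, (p @ q) ! Suc j} \<in> M else fst ((p @ q) ! j) = fst ((p @ q) ! Suc j)"
  proof cases
    case 1
    then show ?thesis using p by (simp add: alt_def nth_append)
  next
    case 2
    then have "odd j" using ev by (metis even_Suc)
    moreover have "(p @ q) ! j = last p" using 2 ev by (simp add: nth_append last_conv_nth flip: 2)
    moreover have "(p @ q) ! Suc j = hd q" using 2 ev by (simp add: nth_append hd_conv_nth)
    ultimately show ?thesis using e by simp
  next
    case 3
    then obtain i where i: "j = length p + i" using le_Suc_ex by blast
    then have "even i = even j" "Suc i < length q" using ev j by auto
    then show ?thesis using q i by (simp add: alt_def nth_append)
  qed
qed

lemma alt_rev:
  assumes "alt M p"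
  shows "alt M (rev p)"
  unfolding alt_def
proof (intro conjI allI impI)
  show "even (length (rev p))" "rev p \<noteq> []" "distinct (rev p)" using assms by (auto simp: alt_def)
  fix j assume j: "Suc j < length (rev p)"
  define i where "i = length p - Suc (Suc j)"
  have i: "rev p ! j = p ! Suc i" "rev p ! Suc j = p ! i" "Suc i < length p" "even i = even j"
    using j assms by (auto simp: rev_nth i_def alt_def Suc_diff_Suc)
  have "if even i then {p ! i, p ! Suc i} \<in> M else fst (p ! i) = fst (p ! Suc i)"
    using assms i(3) by (simp add: alt_def)
  then show "if even j then {rev p ! j, rev p ! Suc j} \<in> M else fst (rev p ! j) = fst (rev p ! Suc j)"
    using i by (simp add: insert_commute split: if_splits)
qed

text \<open>Processing the vertices outside \<open>A\<close> one by one, the matching edges are merged into alternating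
  paths; each vertex costs at most one path.\<close>

lemma alternating_paths:
  assumes M: "pairing W M" "finite W" and mate: "\<And>v. {(v, False), (v, True)} \<notin> M"
    and S: "finite S"
  shows "\<exists>F. finite F \<and> (\<forall>p\<in>F. alt M p \<and> set p \<subseteq> W \<and> fst (hd p) \<notin> S \<and> fst (last p) \<notin> S \<and>
      (\<forall>x\<in>set p. x \<noteq> hd p \<longrightarrow> x \<noteq> last p \<longrightarrow> fst x \<in> S)) \<and>
      (\<forall>p\<in>F. \<forall>q\<in>F. p \<noteq> q \<longrightarrow> set p \<inter> set q = {}) \<and> card M \<le> card F + card S"
  using S
proof (induction S rule: finite_induct)
  case empty
  have "\<forall>e\<in>M. \<exists>x y. e = {x, y} \<and> x \<noteq> y" using M(1) by (auto simp: pairing_def card_2_iff)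
  then obtain x y where xy: "\<And>e. e \<in> M \<Longrightarrow> e = {x e, y e} \<and> x e \<noteq> y e" by metis
  define h where "h e = [x e, y e]" for e
  have set_h: "set (h e) = e" if "e \<in> M" for e using xy[OF that] by (simp add: h_def)
  have finM: "finite M" using card_Union_pairing(1)[OF M] .
  have inj: "inj_on h M" by (rule inj_onI) (metis set_h)
  have alt_h: "alt M (h e)" if e: "e \<in> M" for e
    unfolding alt_def
  proof (intro conjI allI impI)
    show "even (length (h e))" "h e \<noteq> []" "distinct (h e)" using xy[OF e] by (auto simp: h_def)
    fix j assume "Suc j < length (h e)"
    then have "j = 0" by (simp add: h_def)
    then show "if even j then {h e ! j, h e ! Suc j} \<in> M else fst (h e ! j) = fst (h e ! Suc j)"
      using xy[OF e] e by (simp add: h_def)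
  qed
  have disj: "set p \<inter> set q = {}" if pq: "p \<in> h ` M" "q \<in> h ` M" "p \<noteq> q" for p q
  proof -
    obtain e f where ef: "e \<in> M" "f \<in> M" "p = h e" "q = h f" using pq by blast
    then have "e \<noteq> f" using pq(3) by blast
    then have "e \<inter> f = {}" using M(1) ef by (auto simp: pairing_def disjoint_def)
    then show ?thesis using set_h ef by simp
  qed
  have sub: "set p \<subseteq> W" if "p \<in> h ` M" for p using that set_h M(1) by (auto simp: pairing_def)
  have ends: "x = hd p \<or> x = last p" if "p \<in> h ` M" "x \<in> set p" for p x using that by (auto simp: h_def)
  have "card (h ` M) = card M" using inj by (rule card_image)
  then have "card M \<le> card (h ` M) + card ({} :: 'a set)" by simp
  moreover have "\<forall>p\<in>h ` M. alt M p \<and> set p \<subseteq> W \<and> fst (hd p) \<notin> {} \<and> fst (last p) \<notin> {} \<and>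
      (\<forall>x\<in>set p. x \<noteq> hd p \<longrightarrow> x \<noteq> last p \<longrightarrow> fst x \<in> {})"
  proof (intro ballI conjI impI)
    fix p x assume "p \<in> h ` M" "x \<in> set p" "x \<noteq> hd p" "x \<noteq> last p"
    then show "fst x \<in> {}" using ends by metis
  qed (use alt_h sub in auto)
  moreover have "\<forall>p\<in>h ` M. \<forall>q\<in>h ` M. p \<noteq> q \<longrightarrow> set p \<inter> set q = {}" using disj by (intro ballI impI)
  moreover have "finite (h ` M)" using finM by simp
  ultimately show ?case by (intro exI[of _ "h ` M"] conjI)
next
  case (insert v S)
  obtain F where F: "finite F" "\<forall>p\<in>F. alt M p \<and> set p \<subseteq> W \<and> fst (hd p) \<notin> S \<and> fst (last p) \<notin> S \<and>
      (\<forall>x\<in>set p. x \<noteq> hd p \<longrightarrow> x \<noteq> last p \<longrightarrow> fst x \<in> S)"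
    "\<forall>p\<in>F. \<forall>q\<in>F. p \<noteq> q \<longrightarrow> set p \<inter> set q = {}" "card M \<le> card F + card S"
    using insert.IH by (elim exE conjE)
  have Fp: "alt M p" "set p \<subseteq> W" "fst (hd p) \<notin> S" "fst (last p) \<notin> S"
    "\<And>x. x \<in> set p \<Longrightarrow> x \<noteq> hd p \<Longrightarrow> x \<noteq> last p \<Longrightarrow> fst x \<in> S" "p \<noteq> []" "hd p \<in> set p" "last p \<in> set p"
    if "p \<in> F" for p using F(2) that by (auto simp: alt_def)
  have dF: "p = q" if "p \<in> F" "q \<in> F" "x \<in> set p" "x \<in> set q" for p q x using F(3) that by blast
  \<comment> \<open>The paths are disjoint and \<open>v\<close> has two copies, so at most two of
    them end at \<open>v\<close>. A single one is discarded; two are joined by a jump between the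
    copies.\<close>
  define T where "T = {p\<in>F. fst (hd p) = v \<or> fst (last p) = v}"
  have TF: "T \<subseteq> F" "finite T" using F(1) by (auto simp: T_def)
  define u where "u p = (if fst (hd p) = v then hd p else last p)" for p :: "('a \<times> bool) list"
  have u: "u p \<in> {(v, False), (v, True)}" "u p \<in> set p" if "p \<in> T" for p
  proof -
    have "fst (u p) = v" using that by (auto simp: T_def u_def)
    then show "u p \<in> {(v, False), (v, True)}" by (cases "u p") auto
    show "u p \<in> set p" using that Fp(7,8) TF by (auto simp: u_def)
  qed
  have inju: "inj_on u T" by (rule inj_onI) (metis dF TF(1) u(2) subsetD)
  have cS: "card (insert v S) = card S + 1" using insert by simp
  have good: "alt M p \<and> set p \<subseteq> W \<and> fst (hd p) \<notin> insert v S \<and> fst (last p) \<notin> insert v S \<and>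
      (\<forall>x\<in>set p. x \<noteq> hd p \<longrightarrow> x \<noteq> last p \<longrightarrow> fst x \<in> insert v S)" if "p \<in> F - T" for p
    using Fp[of p] that by (auto simp: T_def)
  show ?case
  proof (cases "card T \<le> 1")
    case True
    have "card (F - T) + card T = card F" using TF F(1) by (metis card_Diff_subset card_mono le_add_diff_inverse2)
    then have "card M \<le> card (F - T) + card (insert v S)" using F(4) True cS by linarith
    moreover have "\<forall>p\<in>F - T. \<forall>q\<in>F - T. p \<noteq> q \<longrightarrow> set p \<inter> set q = {}" using F(3) by blast
    moreover have "\<forall>p\<in>F - T. alt M p \<and> set p \<subseteq> W \<and> fst (hd p) \<notin> insert v S \<and> fst (last p) \<notin> insert v S \<and>
      (\<forall>x\<in>set p. x \<noteq> hd p \<longrightarrow> x \<noteq> last p \<longrightarrow> fst x \<in> insert v S)" using good by (rule ballI)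
    moreover have "finite (F - T)" using F(1) by simp
    ultimately show ?thesis by (intro exI[of _ "F - T"] conjI)
  next
    case False
    have "card T \<le> card (u ` T)" using inju by (simp add: card_image)
    moreover have uT: "u ` T \<subseteq> {(v, False), (v, True)}" using u(1) by blast
    ultimately have c2: "card T = 2"
      using False card_mono[OF _ uT] by simp
    then have "u ` T = {(v, False), (v, True)}" using uT inju by (intro card_subset_eq) (auto simp: card_image)
    then obtain p q where pq: "p \<in> T" "u p = (v, False)" "q \<in> T" "u q = (v, True)" by (metis imageE insertCI)
    have pqn: "p \<noteq> q" using pq by auto
    have pF: "p \<in> F" "q \<in> F" using pq TF by auto
    have Tpq: "T = {p, q}" using c2 pq pqn TF(2) by (metis card_2_iff card_seteq empty_subsetI insert_subset order_refl card_mono)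
    define p' where "p' = (if last p = (v, False) then p else rev p)"
    define q' where "q' = (if hd q = (v, True) then q else rev q)"
    have p': "alt M p'" "last p' = (v, False)" "set p' = set p" "hd p' \<in> {hd p, last p}" "{hd p', last p'} = {hd p, last p}"
      using pq(2) Fp(1,6)[OF pF(1)] alt_rev[of M p] by (auto simp: p'_def u_def last_rev hd_rev split: if_splits)
    have q': "alt M q'" "hd q' = (v, True)" "set q' = set q" "last q' \<in> {hd q, last q}" "{hd q', last q'} = {hd q, last q}"
      using pq(4) Fp(1,6)[OF pF(2)] alt_rev[of M q] by (auto simp: q'_def u_def last_rev hd_rev split: if_splits)
    have dpq: "set p \<inter> set q = {}" using F(3) pF pqn by blast
    define r where "r = p' @ q'"
    have n: "p' \<noteq> []" "q' \<noteq> []" using p'(1) q'(1) by (auto simp: alt_def)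
    have r: "alt M r" unfolding r_def using p' q' dpq by (intro alt_append) auto
    have hr: "hd r = hd p'" "last r = last q'" "set r = set p \<union> set q" using n p' q' by (auto simp: r_def hd_append)
    have hv: "fst (hd p') \<noteq> v"
    proof
      assume "fst (hd p') = v"
      then have "hd p' = (v, False) \<or> hd p' = (v, True)" by (cases "hd p'") auto
      moreover have "hd p' \<noteq> last p'" using p'(1) unfolding alt_def
        by (metis One_nat_def diff_Suc_1 distinct_Ex1 even_Suc hd_conv_nth last_conv_nth length_greater_0_conv nth_eq_iff_index_eq odd_pos lessI diff_less even_zero Suc_pred zero_less_one)
      ultimately have "hd p' = (v, True)" using p'(2) by auto
      then have "(v, True) \<in> set p" using p'(3) n hd_in_set by metis
      moreover have "(v, True) \<in> set q" using q'(2,3) n hd_in_set by metis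
      ultimately show False using dpq by blast
    qed
    have lv: "fst (last q') \<noteq> v"
    proof
      assume "fst (last q') = v"
      then have "last q' = (v, False) \<or> last q' = (v, True)" by (cases "last q'") auto
      moreover have "hd q' \<noteq> last q'" using q'(1) unfolding alt_def
        by (metis One_nat_def diff_Suc_1 distinct_Ex1 even_Suc hd_conv_nth last_conv_nth length_greater_0_conv nth_eq_iff_index_eq odd_pos lessI diff_less even_zero Suc_pred zero_less_one)
      ultimately have "last q' = (v, False)" using q'(2) by auto
      then have "(v, False) \<in> set q" using q'(3) n last_in_set by metis
      moreover have "(v, False) \<in> set p" using p'(2,3) n last_in_set by metis
      ultimately show False using dpq by blast
    qed
    have "fst (hd r) \<notin> insert v S" "fst (last r) \<notin> insert v S"
      using hr hv lv p'(4) q'(4) Fp(3,4)[OF pF(1)] Fp(3,4)[OF pF(2)] by auto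
    moreover have "fst x \<in> insert v S" if x: "x \<in> set r" "x \<noteq> hd r" "x \<noteq> last r" for x
    proof (cases "x = last p' \<or> x = hd q'")
      case True
      then show ?thesis using p'(2) q'(2) by auto
    next
      case False
      have "x \<in> set p \<Longrightarrow> x \<notin> {hd p, last p}" using False x(2) hr(1) p'(5) by auto
      moreover have "x \<in> set q \<Longrightarrow> x \<notin> {hd q, last q}" using False x(3) hr(2) q'(5) by auto
      moreover have "x \<in> set p \<or> x \<in> set q" using x(1) hr(3) by blast
      ultimately have "fst x \<in> S" using Fp(5)[OF pF(1), of x] Fp(5)[OF pF(2), of x] by blast
      then show ?thesis by blast
    qed
    moreover have "set r \<subseteq> W" using hr(3) Fp(2)[OF pF(1)] Fp(2)[OF pF(2)] by auto
    ultimately have goodr: "alt M r \<and> set r \<subseteq> W \<and> fst (hd r) \<notin> insert v S \<and> fst (last r) \<notin> insert v S \<and>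
      (\<forall>x\<in>set r. x \<noteq> hd r \<longrightarrow> x \<noteq> last r \<longrightarrow> fst x \<in> insert v S)" using r by blast
    have dr: "set r \<inter> set q1 = {}" if q1: "q1 \<in> F - T" for q1
    proof -
      have "q1 \<in> F" "q1 \<noteq> p" "q1 \<noteq> q" using q1 Tpq by auto
      then have "set p \<inter> set q1 = {}" "set q \<inter> set q1 = {}" using F(3) pF by blast+
      then show ?thesis using hr(3) by blast
    qed
    have rn: "r \<notin> F - T" using dr[of r] n by (auto simp: r_def)
    have "card (F - T) + 2 = card F" using TF F(1) c2 by (metis card_Diff_subset card_mono le_add_diff_inverse2)
    then have "card M \<le> card (insert r (F - T)) + card (insert v S)" using F(1,4) rn cS by simp
    moreover have "\<forall>p1\<in>insert r (F - T). \<forall>q1\<in>insert r (F - T). p1 \<noteq> q1 \<longrightarrow> set p1 \<inter> set q1 = {}"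
      using F(3) dr by (auto simp: Int_commute)
    moreover have "\<forall>p\<in>insert r (F - T). alt M p \<and> set p \<subseteq> W \<and> fst (hd p) \<notin> insert v S \<and> fst (last p) \<notin> insert v S \<and>
      (\<forall>x\<in>set p. x \<noteq> hd p \<longrightarrow> x \<noteq> last p \<longrightarrow> fst x \<in> insert v S)"
      using goodr good by (blast elim: insertE)
    moreover have "finite (insert r (F - T))" using F(1) by simp
    ultimately show ?thesis by (intro exI[of _ "insert r (F - T)"] conjI)
  qed
qed


text \<open>Projecting to the first coordinate keeps the matching edges and merges each jump into
  one vertex. The copy changes at every inner vertex and is \<open>False\<close> at both ends, so
  the number of edges is odd.\<close>

lemma odd_path_of_alt:
  assumes ls: "alt M ls" "set ls \<subseteq> dbl_verts V A"
    and edges: "\<And>x y. {x, y} \<in> M \<Longrightarrow> snd x = snd y \<and> {fst x, fst y} \<in> E"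
    and ends: "fst (hd ls) \<in> A" "fst (last ls) \<in> A"
    and inner: "\<And>x. x \<in> set ls \<Longrightarrow> x \<noteq> hd ls \<Longrightarrow> x \<noteq> last ls \<Longrightarrow> fst x \<notin> A"
  shows "\<exists>p. odd_path V E A p \<and> (\<forall>v\<in>set p. (v, False) \<in> set ls)"
proof -
  obtain m where m: "length ls = 2 * m" using ls(1) unfolding alt_def by (elim conjE evenE)
  have m0: "0 < m" using ls(1) m by (cases m) (auto simp: alt_def)
  have dist: "distinct ls" and ne: "ls \<noteq> []" using ls(1) by (auto simp: alt_def)
  have ev: "snd (ls ! (2 * i)) = snd (ls ! (2 * i + 1)) \<and> {fst (ls ! (2 * i)), fst (ls ! (2 * i + 1))} \<in> E" if "i < m" for i
  proof -
    have "Suc (2 * i) < length ls" using that m by simp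
    then have "{ls ! (2 * i), ls ! Suc (2 * i)} \<in> M" using ls(1) by (simp add: alt_def)
    then show ?thesis using edges by simp
  qed
  have od: "fst (ls ! (2 * i - 1)) = fst (ls ! (2 * i))" if "0 < i" "i < m" for i
  proof -
    have "Suc (2 * i - 1) < length ls" "odd (2 * i - 1)" "Suc (2 * i - 1) = 2 * i" using that m by auto
    then show ?thesis using ls(1) unfolding alt_def by metis
  qed
  have inj: "snd (ls ! a) \<noteq> snd (ls ! b)" if "fst (ls ! a) = fst (ls ! b)" "a < 2 * m" "b < 2 * m" "a \<noteq> b" for a b
  proof
    assume "snd (ls ! a) = snd (ls ! b)"
    then have "ls ! a = ls ! b" using that(1) by (rule prod_eqI[rotated])
    then show False using that(2-4) dist m by (simp add: nth_eq_iff_index_eq)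
  qed
  have W: "snd (ls ! a) = False" if "fst (ls ! a) \<in> A" "a < 2 * m" for a
  proof -
    have "ls ! a \<in> dbl_verts V A" using ls(2) that m by (metis nth_mem subsetD)
    then show ?thesis using that(1) by (cases "ls ! a") (simp add: dbl_verts_iff)
  qed
  define f where "f i = (if i = 0 then fst (ls ! 0) else fst (ls ! (2 * i - 1)))" for i
  define p where "p = map f [0..<Suc m]"
  have f1: "f i = fst (ls ! (2 * i))" if "i < m" for i using od[of i] that by (auto simp: f_def)
  have f2: "f (Suc i) = fst (ls ! (2 * i + 1))" for i by (simp add: f_def)
  have hl: "hd ls = ls ! 0" "last ls = ls ! (2 * m - 1)" using ne m by (auto simp: hd_conv_nth last_conv_nth)
  have end0: "f 0 \<in> A" "f m \<in> A" using ends hl m0 by (auto simp: f_def)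
  have inn: "f i \<notin> A" if i: "0 < i" "i < m" for i
  proof -
    have "ls ! (2 * i) \<in> set ls" using i m by (intro nth_mem) simp
    moreover have "ls ! (2 * i) \<noteq> hd ls" unfolding hl using i m dist by (subst nth_eq_iff_index_eq) auto
    moreover have "ls ! (2 * i) \<noteq> last ls" unfolding hl using i m dist m0 by (subst nth_eq_iff_index_eq) (blast | presburger | simp)+
    ultimately show ?thesis using inner f1[OF i(2)] by simp
  qed
  have ne_f: "f i \<noteq> f j" if ij: "i < j" "j \<le> m" for i j
  proof
    assume e: "f i = f j"
    have j: "f j = fst (ls ! (2 * j - 1))" using ij by (auto simp: f_def)
    have i: "f i = fst (ls ! (2 * i))" using f1 ij by simp
    have ne1: "snd (ls ! (2 * i)) \<noteq> snd (ls ! (2 * j - 1))"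
      by (rule inj) (use e i j ij in auto)
    show False
    proof (cases "i = 0")
      case True
      then have "fst (ls ! (2 * i)) \<in> A" "fst (ls ! (2 * j - 1)) \<in> A" using end0 e i j by auto
      then show False using W[of "2 * i"] W[of "2 * j - 1"] ne1 ij by auto
    next
      case False
      have k: "f i = fst (ls ! (2 * i - 1))" using False by (simp add: f_def)
      have "snd (ls ! (2 * i - 1)) \<noteq> snd (ls ! (2 * j - 1))"
        by (rule inj) (use e k j ij False in auto)
      moreover have "snd (ls ! (2 * i - 1)) \<noteq> snd (ls ! (2 * i))"
        by (rule inj) (use k i ij False in auto)
      ultimately show False using ne1 by blast
    qed
  qed
  have dp: "distinct p"
    unfolding p_def distinct_map
  proof (intro conjI inj_onI)
    fix i j assume ij: "i \<in> set [0..<Suc m]" "j \<in> set [0..<Suc m]" "f i = f j"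
    then show "i = j" using ne_f[of i j] ne_f[of j i] by (cases i j rule: linorder_cases) auto
  qed simp
  have set_p: "\<exists>i\<le>m. v = f i" if "v \<in> set p" for v using that
    by (auto simp: p_def less_Suc_eq_le simp del: upt_Suc)
  have sub: "v \<in> V \<and> (v, False) \<in> set ls" if v: "v \<in> set p" for v
  proof -
    obtain i where i: "i \<le> m" "v = f i" using set_p[OF v] by blast
    have mem: "ls ! a \<in> set ls" if "a < 2 * m" for a using that m by simp
    have snd_mem: "(fst (ls ! a), False) \<in> set ls" if "a < 2 * m" "\<not> snd (ls ! a)" for a
      using mem[OF that(1)] that(2) by (metis prod.collapse)
    have "(v, False) \<in> set ls"
    proof (cases "v \<in> A")
      case True
      show ?thesis
      proof (cases "i = m")
        case True
        then have "v = fst (ls ! (2 * m - 1))" using i m0 by (simp add: f_def)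
        then show ?thesis using snd_mem[of "2 * m - 1"] W[of "2 * m - 1"] \<open>v \<in> A\<close> m0 by auto
      next
        case False
        then have "v = fst (ls ! (2 * i))" using i f1 by simp
        then show ?thesis using snd_mem[of "2 * i"] W[of "2 * i"] \<open>v \<in> A\<close> i False by auto
      qed
    next
      case False
      then have "i \<noteq> 0" "i \<noteq> m" using end0 i by metis+
      then have im: "0 < i" "i < m" using i by auto
      have "v = fst (ls ! (2 * i))" "v = fst (ls ! (2 * i - 1))" using i f1[OF im(2)] od[OF im] by auto
      moreover have "snd (ls ! (2 * i)) \<noteq> snd (ls ! (2 * i - 1))"
        by (rule inj) (use od[OF im] im in auto)
      ultimately show ?thesis using snd_mem[of "2 * i"] snd_mem[of "2 * i - 1"] im by auto
    qed
    moreover have "v \<in> V" using \<open>(v, False) \<in> set ls\<close> ls(2) by (auto simp: dbl_verts_iff dest: subsetD)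
    ultimately show ?thesis by blast
  qed
  \<comment> \<open>Members of \<open>A\<close> have no \<open>True\<close> copy, which fixes the
    copy at the start; it flips with each jump.\<close>
  have sheet: "snd (ls ! (2 * i)) = odd i" if "i < m" for i
    using that
  proof (induction i)
    case 0
    then show ?case using W[of 0] end0(1) by (simp add: f_def)
  next
    case (Suc i)
    have "snd (ls ! (2 * Suc i - 1)) \<noteq> snd (ls ! (2 * Suc i))"
      by (rule inj) (use od[of "Suc i"] Suc.prems in auto)
    moreover have "snd (ls ! (2 * Suc i - 1)) = odd i" using ev[of i] Suc by simp
    ultimately show ?case by auto
  qed
  obtain m' where m': "m = Suc m'" using m0 by (cases m) auto
  have "snd (ls ! (2 * m - 1)) = odd m'" using ev[of m'] sheet[of m'] m' by simp
  moreover have "snd (ls ! (2 * m - 1)) = False" using W[of "2 * m - 1"] end0(2) m0 by (simp add: f_def)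
  ultimately have "even (length p)" by (simp add: p_def m')
  moreover have "hd p = f 0" "last p = f m" by (simp_all add: p_def hd_map upt_rec[of 0])
  moreover have "set p \<inter> A = {f 0, f m}"
  proof
    show "set p \<inter> A \<subseteq> {f 0, f m}"
    proof
      fix v assume v: "v \<in> set p \<inter> A"
      then obtain i where i: "i \<le> m" "v = f i" using set_p by blast
      then show "v \<in> {f 0, f m}" using inn[of i] v by (cases "i = 0 \<or> i = m") auto
    qed
    show "{f 0, f m} \<subseteq> set p \<inter> A" using end0 m0 by (auto simp: p_def)
  qed
  moreover have "is_path V E p"
    unfolding is_path_def
  proof (intro conjI allI impI)
    show "p \<noteq> []" by (simp add: p_def)
    show "distinct p" by (rule dp)
    show "set p \<subseteq> V" using sub by blast
    fix j assume j: "Suc j < length p"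
    then have jm: "j < m" by (simp add: p_def)
    have "p ! j = f j" "p ! Suc j = f (Suc j)" using j by (auto simp: p_def simp del: upt_Suc)
    then show "{p ! j, p ! Suc j} \<in> E" using ev[OF jm] f1[OF jm] f2[of j] by simp
  qed
  ultimately have "odd_path V E A p" using end0 by (simp add: odd_path_def)
  then show ?thesis using sub by blast
qed

text \<open>Edges joining the two copies of a vertex give a matching of size
  \<open>card (V - A)\<close>; what goes beyond it becomes odd paths.\<close>

lemma odd_paths_of_matching:
  assumes fin: "finite V" and A: "A \<subseteq> V"
    and M: "pairing (dbl_verts V A) M" "M \<subseteq> dbl_edges V E A" and big: "card (V - A) + n \<le> card M"
  shows "\<exists>F. finite F \<and> card F = n \<and> (\<forall>p\<in>F. odd_path V E A p) \<and> (\<forall>p\<in>F. \<forall>q\<in>F. p \<noteq> q \<longrightarrow> set p \<inter> set q = {})"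
proof -
  let ?W = "dbl_verts V A"
  let ?mate = "\<lambda>v. {(v, False), (v, True)}"
  \<comment> \<open>Vertices whose two copies are matched to each other are removed together with
    these edges, which lowers both sides of the inequality equally.\<close>
  define D where "D = {v\<in>V - A. ?mate v \<in> M}"
  define M1 where "M1 = M - ?mate ` D"
  define S where "S = V - A - D"
  have finW: "finite ?W" using fin by (simp add: dbl_verts_def)
  have finM: "finite M" using card_Union_pairing(1)[OF M(1) finW] .
  have DV: "D \<subseteq> V - A" "finite D" using fin by (auto simp: D_def)
  have inj: "inj_on ?mate D" by (auto simp: inj_on_def doubleton_eq_iff)
  have "?mate ` D \<subseteq> M" by (auto simp: D_def)
  then have "card M1 + card (?mate ` D) = card M"
    using card_Diff_subset[of "?mate ` D" M] card_mono[OF finM, of "?mate ` D"] DV(2) unfolding M1_def by simp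
  then have "card M1 + card D = card M" using card_image[OF inj] by simp
  moreover have "card S + card D = card (V - A)" using card_Diff_subset[OF DV(2,1)] card_mono[OF _ DV(1)] fin
    unfolding S_def by simp
  ultimately have c1: "card S + n \<le> card M1" using big by linarith
  have p1: "pairing ?W M1" using M(1) by (auto simp: M1_def pairing_def disjoint_def)
  have mate: "?mate v \<notin> M1" for v
  proof
    assume v: "?mate v \<in> M1"
    then have "?mate v \<subseteq> ?W" using p1 by (auto simp: pairing_def)
    then have "v \<in> V - A" by (auto simp: dbl_verts_iff)
    moreover have "?mate v \<in> M" "?mate v \<notin> ?mate ` D" using v unfolding M1_def by blast+
    ultimately show False by (auto simp: D_def)
  qed
  have edges: "snd x = snd y \<and> {fst x, fst y} \<in> E" if xy: "{x, y} \<in> M1" for x y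
  proof -
    have "{x, y} \<in> dbl_edges V E A" using xy M(2) by (auto simp: M1_def)
    then have "snd x = snd y \<and> {fst x, fst y} \<in> E \<or> fst x = fst y" by (rule dbl_edges_cases)
    moreover have "fst x \<noteq> fst y"
    proof
      assume f: "fst x = fst y"
      have "card {x, y} = 2" using xy p1 by (auto simp: pairing_def)
      then have "x \<noteq> y" by auto
      then have "{x, y} = ?mate (fst x)" using f by (cases x; cases y) (auto simp: insert_commute)
      then show False using mate xy by simp
    qed
    ultimately show ?thesis by blast
  qed
  have "finite S" using fin by (simp add: S_def)
  obtain F where F: "finite F" "\<forall>p\<in>F. alt M1 p \<and> set p \<subseteq> ?W \<and> fst (hd p) \<notin> S \<and> fst (last p) \<notin> S \<and>
      (\<forall>x\<in>set p. x \<noteq> hd p \<longrightarrow> x \<noteq> last p \<longrightarrow> fst x \<in> S)"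
    "\<forall>p\<in>F. \<forall>q\<in>F. p \<noteq> q \<longrightarrow> set p \<inter> set q = {}" "card M1 \<le> card F + card S"
    using alternating_paths[OF p1 finW mate \<open>finite S\<close>] by (elim exE conjE)
  have "\<forall>ls\<in>F. \<exists>p. odd_path V E A p \<and> (\<forall>v\<in>set p. (v, False) \<in> set ls)"
  proof
    fix ls assume ls: "ls \<in> F"
    have l: "alt M1 ls" "set ls \<subseteq> ?W" "fst (hd ls) \<notin> S" "fst (last ls) \<notin> S"
      "\<And>x. x \<in> set ls \<Longrightarrow> x \<noteq> hd ls \<Longrightarrow> x \<noteq> last ls \<Longrightarrow> fst x \<in> S" using F(2) ls by blast+
    have ne: "ls \<noteq> []" "even (length ls)" using l(1) by (auto simp: alt_def)
    have cov: "x \<in> \<Union> M1" if x: "x \<in> set ls" for x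
    proof -
      obtain a where a: "a < length ls" "x = ls ! a" using x by (auto simp: in_set_conv_nth)
      show ?thesis
      proof (cases "even a")
        case True
        then have "Suc a < length ls" using a(1) ne(2) by (metis Suc_lessI even_Suc)
        then have "{ls ! a, ls ! Suc a} \<in> M1" using l(1) True by (simp add: alt_def)
        then show ?thesis using a by blast
      next
        case False
        then obtain b where b: "a = Suc b" "even b" by (cases a) auto
        then have "{ls ! b, ls ! Suc b} \<in> M1" using l(1) a(1) by (simp add: alt_def)
        then show ?thesis using a b by blast
      qed
    qed
    have nD: "fst x \<notin> D" if x: "x \<in> set ls" for x
    proof
      assume d: "fst x \<in> D"
      obtain e where e: "e \<in> M1" "x \<in> e" using cov[OF x] by blast
      have "x \<in> ?mate (fst x)" by (cases x) auto
      moreover have "?mate (fst x) \<in> M" "e \<in> M" using d e by (auto simp: D_def M1_def)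
      ultimately have "e = ?mate (fst x)" using pairing_disjoint[OF M(1), of e "?mate (fst x)" x] e by blast
      then show False using mate e(1) by simp
    qed
    have inV: "fst x \<in> V" if "x \<in> set ls" for x
      using subsetD[OF l(2) that] by (cases x) (simp add: dbl_verts_iff)
    have "fst (hd ls) \<in> A" "fst (last ls) \<in> A"
      using nD[of "hd ls"] nD[of "last ls"] inV[of "hd ls"] inV[of "last ls"] l(3,4) ne by (auto simp: S_def)
    moreover have "fst x \<notin> A" if "x \<in> set ls" "x \<noteq> hd ls" "x \<noteq> last ls" for x
      using l(5)[OF that] by (simp add: S_def)
    ultimately show "\<exists>p. odd_path V E A p \<and> (\<forall>v\<in>set p. (v, False) \<in> set ls)"
      using odd_path_of_alt[OF l(1,2) edges] by blast
  qed
  then obtain g where g: "\<forall>ls\<in>F. odd_path V E A (g ls) \<and> (\<forall>v\<in>set (g ls). (v, False) \<in> set ls)" by metis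
  have dg: "set (g p) \<inter> set (g q) = {}" if "p \<in> F" "q \<in> F" "p \<noteq> q" for p q
    using g F(3) that by blast
  have ing: "inj_on g F"
  proof (rule inj_onI, rule ccontr)
    fix p q assume pq: "p \<in> F" "q \<in> F" "g p = g q" "p \<noteq> q"
    then have "set (g p) = {}" using dg by fastforce
    moreover have "is_path V E (g p)" using g pq(1) by (auto simp: odd_path_def)
    ultimately show False by (simp add: is_path_def)
  qed
  have "n \<le> card F" using F(4) c1 by linarith
  then obtain F' where F': "F' \<subseteq> F" "card F' = n" "finite F'" by (rule obtain_subset_with_card_n)
  have "card (g ` F') = n" using F' ing card_image inj_on_subset by metis
  moreover have "\<forall>p\<in>g ` F'. odd_path V E A p" using g F' by blast
  moreover have "\<forall>p\<in>g ` F'. \<forall>q\<in>g ` F'. p \<noteq> q \<longrightarrow> set p \<inter> set q = {}" using dg F' by blast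
  ultimately show ?thesis using F'(3) by (intro exI[of _ "g ` F'"] conjI) simp_all
qed

text \<open>The projection of \<open>U\<close> together with \<open>A\<close> hits everything, but
  is too large. One vertex is saved for each odd component, because a path that avoids the rest
  cannot leave a component except through its representative.\<close>

lemma odd_paths_hitting:
  assumes fin: "finite V" and A: "A \<subseteq> V" and U: "U \<subseteq> dbl_verts V A"
    and C: "\<Union> \<C> = dbl_verts V A - U" "disjoint \<C>"
    and edges: "\<forall>e\<in>dbl_edges V E A. e \<subseteq> dbl_verts V A - U \<longrightarrow> (\<exists>C\<in>\<C>. e \<subseteq> C)"
  shows "\<exists>Y\<subseteq>V. card Y + card {C\<in>\<C>. odd (card C)} \<le> card A + card U \<and> (\<forall>p. \<not> odd_path (V - Y) E A p)"
proof -
  let ?W = "dbl_verts V A"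
  define Odd where "Odd = {C\<in>\<C>. odd (card C)}"
  \<comment> \<open>The boundary of a component: its vertices in \<open>A\<close>, and those whose
    other copy lies in \<open>U\<close>.\<close>
  define b where "b C = {v\<in>A. (v, False) \<in> C} \<union> {v\<in>V - A. \<exists>\<beta>. (v, \<beta>) \<in> C \<and> (v, \<not> \<beta>) \<in> U}" for C
  have finW: "finite ?W" using fin by (simp add: dbl_verts_def)
  have CW: "C \<subseteq> ?W - U" if "C \<in> \<C>" for C using that C(1) by blast
  have uniq: "C = D" if "C \<in> \<C>" "D \<in> \<C>" "x \<in> C" "x \<in> D" for C D x using that C(2) by (auto simp: disjoint_def)
  have same: "x \<in> C \<longleftrightarrow> y \<in> C" if xy: "{x, y} \<in> dbl_edges V E A" "x \<in> ?W - U" "y \<in> ?W - U" "C \<in> \<C>" for x y C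
  proof -
    obtain D where D: "D \<in> \<C>" "{x, y} \<subseteq> D" using edges[rule_format, OF xy(1)] xy(2,3) by blast
    then show ?thesis using uniq[OF xy(4) D(1)] by blast
  qed
  \<comment> \<open>A component without boundary contains both copies of each of its vertices and is
    therefore even.\<close>
  have bne: "b C \<noteq> {}" if C: "C \<in> Odd" for C
  proof
    assume e: "b C = {}"
    have CC: "C \<in> \<C>" "odd (card C)" using C by (auto simp: Odd_def)
    have out: "v \<in> V - A" if "(v, \<beta>) \<in> C" for v \<beta>
    proof -
      have "(v, \<beta>) \<in> ?W" using CW[OF CC(1)] that by blast
      then show ?thesis using e that by (cases \<beta>) (auto simp: b_def dbl_verts_iff)
    qed
    have both: "(v, \<not> \<beta>) \<in> C" if v: "(v, \<beta>) \<in> C" for v \<beta>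
    proof -
      have vA: "v \<in> V - A" using out[OF v] .
      then have "(v, \<not> \<beta>) \<notin> U" using e v by (auto simp: b_def)
      moreover have "(v, \<not> \<beta>) \<in> ?W" using vA by (simp add: dbl_verts_iff)
      moreover have "{(v, \<beta>), (v, \<not> \<beta>)} \<in> dbl_edges V E A"
        using vA by (cases \<beta>) (auto simp: dbl_edges_def insert_commute)
      ultimately show ?thesis using same[of "(v, \<beta>)" "(v, \<not> \<beta>)" C] CC(1) CW[OF CC(1)] v by blast
    qed
    have "C = {v. (v, False) \<in> C} \<times> UNIV"
    proof (intro set_eqI iffI)
      fix x assume "x \<in> C"
      then show "x \<in> {v. (v, False) \<in> C} \<times> UNIV" using both[of "fst x" "snd x"] by (cases x; cases "snd x") auto
    next
      fix x assume "x \<in> {v. (v, False) \<in> C} \<times> (UNIV :: bool set)"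
      then show "x \<in> C" using both[of "fst x" False] by (cases x; cases "snd x") auto
    qed
    then have "card C = card ({v. (v, False) \<in> C} \<times> (UNIV :: bool set))" by simp
    also have "\<dots> = card {v. (v, False) \<in> C} * 2" by (simp add: card_cartesian_product)
    finally show False using CC(2) by simp
  qed
  define c where "c C = (SOME v. v \<in> b C)" for C
  have c: "c C \<in> b C" if "C \<in> Odd" for C unfolding c_def using bne[OF that] by (simp add: some_in_eq)
  have b_uniq: "C = D" if CD: "C \<in> \<C>" "D \<in> \<C>" "v \<in> b C" "v \<in> b D" for C D v
  proof (cases "v \<in> A")
    case True
    then show ?thesis using CD uniq[OF CD(1,2), of "(v, False)"] by (auto simp: b_def)
  next
    case False
    then obtain \<beta> \<gamma> where bg: "(v, \<beta>) \<in> C" "(v, \<not> \<beta>) \<in> U" "(v, \<gamma>) \<in> D" "(v, \<not> \<gamma>) \<in> U"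
      using CD(3,4) by (auto simp: b_def)
    then have "\<beta> = \<gamma>" using CW[OF CD(1)] CW[OF CD(2)] by (cases \<beta>; cases \<gamma>) auto
    then show ?thesis using uniq[OF CD(1,2)] bg by blast
  qed
  have injc: "inj_on c Odd"
    by (rule inj_onI) (metis (no_types, lifting) b_uniq c Odd_def mem_Collect_eq)
  have bsub: "b C \<subseteq> A \<union> fst ` U" for C unfolding b_def by force
  define Y where "Y = A \<union> fst ` U - c ` Odd"
  have finU: "finite U" using U finW finite_subset by blast
  have "finite \<C>" by (rule finite_UnionD) (simp add: C(1) finW)
  then have finO: "finite Odd" by (simp add: Odd_def)
  have finA: "finite A" using A fin finite_subset by blast
  have cO: "c ` Odd \<subseteq> A \<union> fst ` U" using c bsub by blast
  have "card Y + card Odd = card (A \<union> fst ` U)"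
    using card_Diff_subset[OF finite_imageI[OF finO] cO] card_mono[OF _ cO] finA finU card_image[OF injc]
    unfolding Y_def by simp
  also have "\<dots> \<le> card A + card (fst ` U)" by (rule card_Un_le)
  also have "\<dots> \<le> card A + card U" using card_image_le[OF finU, of fst] by simp
  finally have cY: "card Y + card Odd \<le> card A + card U" .
  have UV: "fst ` U \<subseteq> V" using U by (auto simp: dbl_verts_iff dest!: subsetD)
  have "\<not> odd_path (V - Y) E A p" for p
  proof
    assume p: "odd_path (V - Y) E A p"
    then have ip: "p \<noteq> []" "distinct p" "set p \<subseteq> V - Y" "\<And>j. Suc j < length p \<Longrightarrow> {p ! j, p ! Suc j} \<in> E"
      and pe: "even (length p)" "set p \<inter> A = {hd p, last p}" by (auto simp: odd_path_def is_path_def)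
    obtain m where m: "length p = Suc m" "odd m" using ip(1) pe(1) by (cases p) auto
    have hl: "hd p = p ! 0" "last p = p ! m" using ip(1) m by (auto simp: hd_conv_nth last_conv_nth)
    have endA: "p ! 0 \<in> A" "p ! m \<in> A" using pe(2) hl by auto
    have neq: "p ! i \<noteq> p ! j" if "i \<noteq> j" "i \<le> m" "j \<le> m" for i j
      using that ip(2) m by (simp add: nth_eq_iff_index_eq)
    have inner: "p ! j \<notin> A" if j: "0 < j" "j < m" for j
    proof
      assume "p ! j \<in> A"
      moreover have "p ! j \<in> set p" using j m by simp
      ultimately have "p ! j \<in> {hd p, last p}" using pe(2) by blast
      then have "p ! j \<in> {p ! 0, p ! m}" using hl by simp
      then show False using neq[of j 0] neq[of j m] j by auto
    qed
    have pV: "p ! j \<in> V" if "j \<le> m" for j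
    proof -
      have "p ! j \<in> set p" using that m by simp
      then show ?thesis using ip(3) by blast
    qed
    have cov: "\<exists>C\<in>Odd. c C = p ! j" if "j \<le> m" "p ! j \<in> A \<union> fst ` U" for j
    proof -
      have "p ! j \<in> set p" using that m by simp
      then have "p ! j \<notin> Y" using ip(3) by blast
      then show ?thesis using that(2) by (auto simp: Y_def)
    qed
    \<comment> \<open>Following the path, copy \<open>odd j\<close> of its vertex number
      \<open>j\<close> lies in an odd component whose representative has already been
      passed.\<close>
    have inv: "\<exists>D\<in>Odd. (p ! j, odd j) \<in> D \<and> (\<exists>i\<le>j. c D = p ! i)" if "j < m" for j
      using that
    proof (induction j)
      case 0
      obtain C where C0: "C \<in> Odd" "c C = p ! 0" using cov[of 0] endA by auto
      then have "(p ! 0, False) \<in> C" using c[OF C0(1)] endA(1) by (auto simp: b_def)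
      then show ?case using C0 by auto
    next
      case (Suc j)
      then obtain D i where D: "D \<in> Odd" "(p ! j, odd j) \<in> D" "i \<le> j" "c D = p ! i" by auto
      have DC: "D \<in> \<C>" using D(1) by (simp add: Odd_def)
      have nA: "p ! Suc j \<notin> A" using inner[of "Suc j"] Suc.prems by simp
      have inW: "(p ! Suc j, \<beta>) \<in> ?W" for \<beta> using nA pV[of "Suc j"] Suc.prems by (simp add: dbl_verts_iff)
      have ee: "{(p ! j, odd j), (p ! Suc j, odd j)} \<in> dbl_edges V E A"
        by (rule dbl_edgesI) (use ip(4)[of j] neq[of j "Suc j"] Suc.prems m in simp_all)
      show ?case
      proof (cases "p ! Suc j \<in> fst ` U")
        case False
        then have nU: "(p ! Suc j, \<beta>) \<notin> U" for \<beta> by force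
        have y: "(p ! Suc j, odd j) \<in> D" using same[OF ee _ _ DC] CW[OF DC] D(2) inW nU by blast
        have "{(p ! Suc j, odd j), (p ! Suc j, odd (Suc j))} \<in> dbl_edges V E A"
          using nA pV[of "Suc j"] Suc.prems by (cases "odd j") (auto simp: dbl_edges_def insert_commute)
        from same[OF this _ _ DC] have "(p ! Suc j, odd (Suc j)) \<in> D" using inW nU y by blast
        moreover have "i \<le> Suc j" using D(3) by simp
        ultimately show ?thesis using D(1,4) by blast
      next
        case True
        then obtain C where C0: "C \<in> Odd" "c C = p ! Suc j" using cov[of "Suc j"] Suc.prems by auto
        then obtain \<beta> where \<beta>: "(p ! Suc j, \<beta>) \<in> C" "(p ! Suc j, \<not> \<beta>) \<in> U"
          using c[OF C0(1)] nA by (auto simp: b_def)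
        have CC: "C \<in> \<C>" using C0(1) by (simp add: Odd_def)
        \<comment> \<open>If the component of the representative is met on the current copy, it is
          the old component and its representative would occur twice. So the path enters the new
          component on the other copy, at that component's representative.\<close>
        show ?thesis
        proof (cases "\<beta> = odd j")
          case True
          then have "(p ! Suc j, odd j) \<in> ?W - U" using CW[OF CC] \<beta> by blast
          then have "(p ! Suc j, odd j) \<in> D" using same[OF ee _ _ DC] CW[OF DC] D(2) by blast
          then have "C = D" using uniq[OF CC DC] \<beta>(1) True by blast
          then have "p ! Suc j = p ! i" using C0 D by simp
          then show ?thesis using neq[of "Suc j" i] D(3) Suc.prems by simp
        next
          case False
          then have "\<beta> = odd (Suc j)" by auto
          then have "(p ! Suc j, odd (Suc j)) \<in> C" using \<beta>(1) by simp
          then show ?thesis using C0 by blast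
        qed
      qed
    qed
    obtain m' where m': "m = Suc m'" "even m'" using m(2) by (cases m) auto
    obtain D i where D: "D \<in> Odd" "(p ! m', odd m') \<in> D" "i \<le> m'" "c D = p ! i" using inv[of m'] m' by auto
    have DC: "D \<in> \<C>" using D(1) by (simp add: Odd_def)
    obtain C where C0: "C \<in> Odd" "c C = p ! m" using cov[of m] endA by auto
    have CC: "C \<in> \<C>" using C0(1) by (simp add: Odd_def)
    have mC: "(p ! m, False) \<in> C" using c[OF C0(1)] C0(2) endA(2) by (auto simp: b_def)
    have ee: "{(p ! m', False), (p ! m, False)} \<in> dbl_edges V E A"
      by (rule dbl_edgesI) (use ip(4)[of m'] neq[of m' m] m m' in simp_all)
    have "(p ! m', False) \<in> D" using D(2) m'(2) by simp
    then have "(p ! m, False) \<in> D" using same[OF ee _ _ DC] CW[OF DC] CW[OF CC] mC by blast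
    then have "C = D" using uniq[OF CC DC mC] by blast
    then have "p ! m = p ! i" using C0 D by simp
    then show False using neq[of m i] D(3) m' by simp
  qed
  moreover have "Y \<subseteq> V" using A UV by (auto simp: Y_def)
  ultimately show ?thesis using cY unfolding Odd_def by blast
qed

text \<open>The doubled graph has \<open>card A + 2 * card (V - A)\<close> vertices. If the matching
  from \<open>tutte_berge\<close> falls short of \<open>card (V - A) + n\<close>, its formula leaves
  at most \<open>2 * n - 2\<close> vertices for the hitting set.\<close>

theorem gallai_odd_paths:
  assumes fin: "finite V" and A: "A \<subseteq> V" and n: "1 \<le> n"
  shows "(\<exists>F. finite F \<and> card F = n \<and> (\<forall>p\<in>F. odd_path V E A p) \<and> (\<forall>p\<in>F. \<forall>q\<in>F. p \<noteq> q \<longrightarrow> set p \<inter> set q = {})) \<or>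
    (\<exists>Y\<subseteq>V. card Y \<le> 2 * n - 2 \<and> (\<forall>p. \<not> odd_path (V - Y) E A p))"
proof -
  let ?W = "dbl_verts V A"
  have finW: "finite ?W" using fin by (simp add: dbl_verts_def)
  obtain M U \<C> where M: "pairing ?W M" "M \<subseteq> dbl_edges V E A" and U: "U \<subseteq> ?W" "\<Union> \<C> = ?W - U" "disjoint \<C>"
    "\<forall>e\<in>dbl_edges V E A. e \<subseteq> ?W - U \<longrightarrow> (\<exists>C\<in>\<C>. e \<subseteq> C)"
    "card ?W + card U \<le> 2 * card M + card {C\<in>\<C>. odd (card C)}"
    using tutte_berge[OF finW dbl_edges_card[of V E A]] by (elim exE conjE)
  show ?thesis
  proof (cases "card (V - A) + n \<le> card M")
    case True
    then show ?thesis using odd_paths_of_matching[OF fin A M] by blast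
  next
    case False
    obtain Y where Y: "Y \<subseteq> V" "card Y + card {C\<in>\<C>. odd (card C)} \<le> card A + card U" "\<forall>p. \<not> odd_path (V - Y) E A p"
      using odd_paths_hitting[OF fin A U(1-4)] by (elim exE conjE)
    have "card ?W = card (V \<times> {False}) + card ((V - A) \<times> {True})"
      unfolding dbl_verts_def using fin by (intro card_Un_disjoint) auto
    also have "\<dots> = card V + card (V - A)" by (simp add: card_cartesian_product)
    also have "card V = card A + card (V - A)"
      using card_Diff_subset[OF finite_subset[OF A fin] A] card_mono[OF fin A] by simp
    finally have "card ?W = card A + 2 * card (V - A)" by simp
    then have "card Y \<le> 2 * n - 2" using False U(5) Y(2) n by linarith
    then show ?thesis using Y by blast
  qed
qed

section \<open>Parity breaking paths\<close>

text \<open>A path breaks parity with respect to \<open>X\<close> if it has an odd number of edges with both ends on the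
  same side of \<open>X\<close>.\<close>

definition brk :: "'a set \<Rightarrow> 'a list \<Rightarrow> bool" where
  "brk X p \<longleftrightarrow> (even (length p) \<noteq> ((hd p \<in> X) \<noteq> (last p \<in> X)))"

lemma brk_split:
  assumes "i < length p"
  shows "brk X p \<longleftrightarrow> (brk X (take (Suc i) p) \<noteq> brk X (drop i p))"
proof -
  have "hd (take (Suc i) p) = hd p" "last (take (Suc i) p) = p ! i" "hd (drop i p) = p ! i" "last (drop i p) = last p"
    using assms by (auto simp: take_Suc_conv_app_nth hd_drop_conv_nth hd_append hd_conv_nth)
  moreover have "even (length (take (Suc i) p)) = odd i" "even (length (drop i p)) = (even (length p) = even i)"
    using assms by (simp_all add: min_def) presburger+
  ultimately show ?thesis unfolding brk_def by auto
qed

text \<open>Breaking parity adds up modulo two when a path is cut at a vertex, so at an inner vertex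
  of \<open>W\<close> exactly one of the two pieces inherits it.\<close>

lemma brk_segment:
  assumes "is_path V E p" "brk X p" "hd p \<in> W" "last p \<in> W"
  shows "\<exists>q. is_path V E q \<and> brk X q \<and> set q \<subseteq> set p \<and> hd q \<in> W \<and> last q \<in> W \<and> set q \<inter> W = {hd q, last q}"
  using assms
proof (induction "length p" arbitrary: p rule: less_induct)
  case less
  have ne: "p \<noteq> []" using less.prems(1) by (simp add: is_path_def)
  show ?case
  proof (cases "\<exists>i. 0 < i \<and> Suc i < length p \<and> p ! i \<in> W")
    case True
    then obtain i where i: "0 < i" "Suc i < length p" "p ! i \<in> W" by blast
    have hl: "hd (take (Suc i) p) = hd p" "last (take (Suc i) p) = p ! i" "hd (drop i p) = p ! i" "last (drop i p) = last p"
      using i by (auto simp: take_Suc_conv_app_nth hd_drop_conv_nth hd_append hd_conv_nth)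
    have "i < length p" using i(2) by simp
    then consider "brk X (take (Suc i) p)" | "brk X (drop i p)" using less.prems(2) brk_split by blast
    then show ?thesis
    proof cases
      case 1
      have "length (take (Suc i) p) < length p" using i(2) by simp
      from less.hyps[OF this is_path_take[OF less.prems(1)] 1] obtain q where
        q: "is_path V E q" "brk X q" "set q \<subseteq> set (take (Suc i) p)" "hd q \<in> W" "last q \<in> W" "set q \<inter> W = {hd q, last q}"
        using hl less.prems(3) i(3) by auto
      have "set q \<subseteq> set p" using q(3) set_take_subset[of "Suc i" p] by blast
      then show ?thesis using q by blast
    next
      case 2
      have "length (drop i p) < length p" using i by simp
      from less.hyps[OF this is_path_drop[OF less.prems(1)] 2] obtain q where
        q: "is_path V E q" "brk X q" "set q \<subseteq> set (drop i p)" "hd q \<in> W" "last q \<in> W" "set q \<inter> W = {hd q, last q}"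
        using hl less.prems(4) i by auto
      have "set q \<subseteq> set p" using q(3) set_drop_subset[of i p] by blast
      then show ?thesis using q by blast
    qed
  next
    case False
    have "x = hd p \<or> x = last p" if x: "x \<in> set p" "x \<in> W" for x
    proof -
      obtain i where i: "i < length p" "p ! i = x" using x(1) unfolding in_set_conv_nth by blast
      have "\<not> (0 < i \<and> Suc i < length p)" using False i x(2) by blast
      then have "i = 0 \<or> i = length p - 1" using i(1) by linarith
      then show ?thesis using i ne by (auto simp: hd_conv_nth last_conv_nth)
    qed
    then have "set p \<inter> W = {hd p, last p}" using less.prems(3,4) ne by auto
    then show ?thesis using less.prems by blast
  qed
qed

lemma path_first_hit:
  assumes "is_path V E p" "set p \<inter> T \<noteq> {}"
  obtains q where "is_path V E q" "hd q = hd p" "last q \<in> T" "set q \<subseteq> set p" "set q \<inter> T = {last q}"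
proof -
  obtain ys z zs where p: "p = ys @ z # zs" "z \<in> T" "\<forall>y\<in>set ys. y \<notin> T"
    using split_list_first_prop[of p "\<lambda>x. x \<in> T"] assms(2) by blast
  have eq: "ys @ [z] = take (Suc (length ys)) p" using p(1) by simp
  have "is_path V E (ys @ [z])" unfolding eq by (rule is_path_take[OF assms(1)]) simp
  moreover have "hd (ys @ [z]) = hd p" using p(1) by (simp add: hd_append)
  moreover have "set (ys @ [z]) \<inter> T = {z}" using p by auto
  ultimately show ?thesis using that[of "ys @ [z]"] p by auto
qed

lemma path_glue:
  assumes p: "is_path V E p" and q: "is_path V E q" and m: "last p = hd q" "set p \<inter> set q = {last p}"
  shows "is_path V E (p @ tl q)" "hd (p @ tl q) = hd p" "last (p @ tl q) = last q"
    "set (p @ tl q) = set p \<union> set q" "length (p @ tl q) + 1 = length p + length q"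
    "brk X (p @ tl q) \<longleftrightarrow> brk X p \<noteq> brk X q"
proof -
  have pn: "p \<noteq> []" using p by (simp add: is_path_def)
  obtain x q' where q': "q = x # q'" using q by (cases q) (auto simp: is_path_def)
  show s: "set (p @ tl q) = set p \<union> set q" using m pn q' by auto
  show "hd (p @ tl q) = hd p" using pn by simp
  show "last (p @ tl q) = last q" using m q' by simp
  show l: "length (p @ tl q) + 1 = length p + length q" using q' by simp
  then have "even (length (p @ tl q)) = (even (length p) \<noteq> even (length q))" by presburger
  then show "brk X (p @ tl q) \<longleftrightarrow> brk X p \<noteq> brk X q"
    unfolding brk_def \<open>hd (p @ tl q) = hd p\<close> \<open>last (p @ tl q) = last q\<close> m(1) by auto
  show "is_path V E (p @ tl q)"
  proof (cases q')
    case Nil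
    then show ?thesis using p q' by simp
  next
    case (Cons y q'')
    have "is_path V E ([x] @ q')" using q q' by simp
    then have xq: "is_path V E q'" "x \<notin> set q'" "{x, hd q'} \<in> E" using Cons is_path_append[of "[x]" q' V E] by auto
    have "set p \<inter> set q' \<subseteq> {x}" using m q' by auto
    then have "set p \<inter> set q' = {}" using xq(2) by blast
    then have "is_path V E (p @ q')" using xq p m(1) q' pn Cons is_path_append[of p q' V E] by auto
    then show ?thesis using q' by simp
  qed
qed

section \<open>Cut edges, connectivity and odd cycles\<close>

definition cross :: "'a set set \<Rightarrow> 'a set \<Rightarrow> 'a set set" where
  "cross E X = {e\<in>E. e \<inter> X \<noteq> {} \<and> \<not> e \<subseteq> X}"

lemma cross_iff: "{u, v} \<in> cross E X \<longleftrightarrow> {u, v} \<in> E \<and> (u \<in> X) \<noteq> (v \<in> X)"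
  by (auto simp: cross_def)

lemma cross_subset: "cross E X \<subseteq> E"
  by (auto simp: cross_def)

lemma cross_path:
  assumes "is_path V (cross E X) p"
  shows "\<not> brk X p"
proof -
  have "p \<noteq> []" "successively (\<lambda>x y. {x, y} \<in> cross E X) p" using assms by (auto simp: is_path_alt)
  then show ?thesis
  proof (induction p rule: induct_list012)
    case (3 x y zs)
    then show ?case by (auto simp: brk_def cross_iff)
  qed (auto simp: brk_def)
qed

text \<open>The two-colouring of a spanning tree, without a tree: an outside neighbour
  \<open>b\<close> of a maximal set connected by cut edges can be put on the side opposite to its
  neighbour, and no edge inside the set is affected.\<close>

lemma spanning_cross:
  assumes fin: "finite V" and c: "conn E V"
  shows "\<exists>X. conn (cross E X) V"
proof -
  obtain v where v: "v \<in> V" using c by (auto simp: conn_def)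
  define P where "P U \<longleftrightarrow> U \<subseteq> V \<and> (\<exists>X. conn (cross E X) U)" for U
  have "\<exists>U. P U \<and> (\<forall>U'. P U' \<longrightarrow> card U' \<le> card U)"
  proof (rule ex_has_greatest_nat[where k = "{v}" and b = "card V + 1"])
    show "P {v}" using v by (simp add: P_def)
    show "\<forall>U. P U \<longrightarrow> card U < card V + 1" using card_mono[OF fin] by (auto simp: P_def less_Suc_eq_le)
  qed
  then obtain U where U: "P U" "\<forall>U'. P U' \<longrightarrow> card U' \<le> card U" by blast
  obtain X where X: "U \<subseteq> V" "conn (cross E X) U" using U(1) by (auto simp: P_def)
  have "U = V"
  proof (rule ccontr)
    assume n: "U \<noteq> V"
    have "U \<noteq> {}" using X(2) by (auto simp: conn_def)
    then obtain a b where ab: "a \<in> U" "b \<in> V - U" "{a, b} \<in> E" using conn_cut[OF c X(1) _ n] by metis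
    define X' where "X' = (if a \<in> X then X - {b} else insert b X)"
    have "conn (cross E X') U"
      by (rule conn_edges_cong[OF X(2)]) (use ab in \<open>auto simp: cross_iff X'_def\<close>)
    moreover have "{a, b} \<in> cross E X'" using ab by (auto simp: cross_iff X'_def)
    ultimately have "conn (cross E X') (insert b U)" using ab(1) by (intro conn_insert)
    then have "P (insert b U)" using X(1) ab(2) by (auto simp: P_def)
    then have "card (insert b U) \<le> card U" using U(2) by blast
    then show False using ab(2) finite_subset[OF X(1) fin] by simp
  qed
  then show ?thesis using X(2) by blast
qed

text \<open>The deletion condition of \<open>k_connected\<close> in terms of \<open>conn\<close>;
  the number of vertices is carried separately where it matters.\<close>

definition kconn :: "nat \<Rightarrow> 'a set \<Rightarrow> 'a set set \<Rightarrow> bool" where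
  "kconn n V E \<longleftrightarrow> (\<forall>Z\<subseteq>V. card Z < n \<longrightarrow> conn E (V - Z))"

lemma kconn_sepn:
  assumes "kconn n V E" "sepn V E A B" "card (A \<inter> B) < n"
  shows "A \<subseteq> B \<or> B \<subseteq> A"
proof (rule ccontr)
  assume n: "\<not> ?thesis"
  have AB: "A \<union> B = V" using assms(2) by (simp add: sepn_def)
  then have "conn E (V - A \<inter> B)" using assms(1,3) unfolding kconn_def by blast
  moreover have "A - B \<subseteq> V - A \<inter> B" "A - B \<noteq> {}" "A - B \<noteq> V - A \<inter> B" using n AB by auto
  ultimately obtain a b where "a \<in> A - B" "b \<in> V - A \<inter> B - (A - B)" "{a, b} \<in> E" using conn_cut by metis
  then show False using assms(2) AB unfolding sepn_def by blast
qed

lemma kconn_delete: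
  assumes k: "kconn n V E" and Y: "finite V" "Y \<subseteq> V" "card Y + m \<le> n"
  shows "kconn m (V - Y) E"
  unfolding kconn_def
proof (intro allI impI)
  fix Z assume Z: "Z \<subseteq> V - Y" "card Z < m"
  have "card (Y \<union> Z) \<le> card Y + card Z" by (rule card_Un_le)
  then have "card (Y \<union> Z) < n" using Z Y(3) by linarith
  moreover have "Y \<union> Z \<subseteq> V" using Z Y by blast
  ultimately have "conn E (V - (Y \<union> Z))" using k unfolding kconn_def by blast
  moreover have "V - (Y \<union> Z) = V - Y - Z" by blast
  ultimately show "conn E (V - Y - Z)" by simp
qed

lemma kconn_disjoint:
  assumes k: "kconn n V E" and fin: "finite V" and ST: "S \<subseteq> V" "T \<subseteq> V" "n \<le> card S" "n \<le> card T"
  shows "\<exists>F. card F = n \<and> finite F \<and> disjoint F \<and> (\<forall>C\<in>F. C \<subseteq> V \<and> conn E C \<and> C \<inter> S \<noteq> {} \<and> C \<inter> T \<noteq> {})"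
proof (rule menger[OF fin ST(1,2)], rule ccontr)
  fix A B assume AB: "sepn V E A B" "S \<subseteq> A" "T \<subseteq> B" "\<not> n \<le> card (A \<inter> B)"
  then have "A \<subseteq> B \<or> B \<subseteq> A" using kconn_sepn[OF k AB(1)] by simp
  then have "S \<subseteq> A \<inter> B \<or> T \<subseteq> A \<inter> B" using AB by blast
  moreover have "finite (A \<inter> B)" using AB(1) fin by (auto simp: sepn_def)
  ultimately show False using AB(4) ST(3,4) card_mono by (meson order_trans)
qed

lemma kconn_of_k_connected:
  assumes "k_connected n V E"
  shows "kconn n V E"
  unfolding kconn_def
proof (intro allI impI)
  fix Z assume Z: "Z \<subseteq> V" "card Z < n"
  then have c: "connected_graph (V - Z) (del_edges Z E)" using assms by (simp add: k_connected_def)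
  show "conn E (V - Z)"
    unfolding conn_iff_cut
  proof (intro conjI allI impI; (elim conjE)?)
    show "V - Z \<noteq> {}" using c by (simp add: connected_graph_def)
    fix P assume P: "P \<subseteq> V - Z" "P \<noteq> {}" "P \<noteq> V - Z"
    then obtain u v where uv: "u \<in> P" "v \<in> V - Z" "v \<notin> P" by blast
    then obtain p where p: "is_path (V - Z) (del_edges Z E) p" "hd p = u" "last p = v"
      using c P(1) unfolding connected_graph_def by blast
    have pn: "p \<noteq> []" using p(1) by (simp add: is_path_def)
    define j where "j = (LEAST j. j < length p \<and> p ! j \<notin> P)"
    have ex: "length p - 1 < length p \<and> p ! (length p - 1) \<notin> P" using pn p(3) uv(3) by (simp add: last_conv_nth)
    have j: "j < length p" "p ! j \<notin> P" using LeastI[of "\<lambda>j. j < length p \<and> p ! j \<notin> P", OF ex] by (simp_all add: j_def)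
    have "j \<noteq> 0" using j(2) p(2) uv(1) pn by (metis hd_conv_nth)
    then obtain i where i: "j = Suc i" by (cases j) auto
    then have "p ! i \<in> P" using not_less_Least[of i "\<lambda>j. j < length p \<and> p ! j \<notin> P"] j(1) by (simp add: j_def[symmetric])
    moreover have "{p ! i, p ! j} \<in> E" using p(1) i j(1) by (auto simp: is_path_def del_edges_def)
    moreover have "p ! j \<in> V - Z" using p(1) nth_mem[OF j(1)] by (auto simp: is_path_def)
    ultimately show "\<exists>a\<in>P. \<exists>b\<in>V - Z - P. {a, b} \<in> E" using j(2) by blast
  qed
qed

text \<open>The two arcs of an odd cycle between distinct vertices differ in parity.\<close>

lemma cycle_arcs:
  assumes q: "is_path V E q" "{last q, hd q} \<in> E" "odd (length q)" and ij: "i < length q" "j < length q" "i \<noteq> j"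
  shows "\<exists>r. is_path V E r \<and> hd r = q ! i \<and> last r = q ! j \<and> set r \<subseteq> set q \<and> even (length r) = b"
proof -
  have main: "\<exists>r. is_path V E r \<and> hd r = q ! i \<and> last r = q ! j \<and> set r \<subseteq> set q \<and> even (length r) = b"
    if ij: "i < j" "j < length q" for i j b
  proof -
    define r1 where "r1 = take (Suc (j - i)) (drop i q)"
    define r2 where "r2 = rev (take (Suc i) q) @ rev (drop j q)"
    have l: "length r1 = Suc (j - i)" "length r2 = Suc i + (length q - j)" using ij by (auto simp: r1_def r2_def)
    have p1: "is_path V E r1" unfolding r1_def using ij by (intro is_path_take is_path_drop q) auto
    have e1: "hd r1 = q ! i" "last r1 = q ! j" "set r1 \<subseteq> set q"
      using ij l(1) by (auto simp: r1_def hd_conv_nth last_conv_nth dest!: in_set_takeD in_set_dropD)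
    have "set (take (Suc i) q) \<inter> set (drop j q) = {}"
      using q(1) ij by (intro set_take_disj_set_drop_if_distinct) (auto simp: is_path_def)
    moreover have "last (rev (take (Suc i) q)) = hd q" "hd (rev (drop j q)) = last q"
      using ij by (auto simp: last_rev hd_rev)
    moreover have "is_path V E (rev (take (Suc i) q))" "is_path V E (rev (drop j q))"
      using ij by (auto intro!: is_path_rev is_path_take is_path_drop q)
    ultimately have p2: "is_path V E r2" unfolding r2_def using ij q(2)
      by (subst is_path_append) (auto simp: insert_commute)
    have e2: "hd r2 = q ! i" "last r2 = q ! j" "set r2 \<subseteq> set q"
      using ij by (auto simp: r2_def hd_rev last_rev take_Suc_conv_app_nth hd_drop_conv_nth hd_append
          dest: in_set_takeD in_set_dropD)
    have "even (length r1) \<noteq> even (length r2)" using l q(3) ij by auto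
    then show ?thesis using p1 e1 p2 e2 by (cases "even (length r1) = b") blast+
  qed
  show ?thesis
  proof (cases "i < j")
    case True
    then show ?thesis using main ij by blast
  next
    case False
    then obtain r where r: "is_path V E r" "hd r = q ! j" "last r = q ! i" "set r \<subseteq> set q" "even (length r) = b"
      using main[of j i b] ij by auto
    have "r \<noteq> []" using r(1) by (simp add: is_path_def)
    then show ?thesis using r is_path_rev[OF r(1)] by (intro exI[of _ "rev r"]) (simp add: hd_rev last_rev)
  qed
qed

text \<open>An edge inside one side of a spanning bipartite subgraph closes an odd cycle. Two
  disjoint paths from \<open>a\<close> and \<open>b\<close> to the cycle can be joined along the arc
  of the right parity.\<close>

lemma odd_path_exists:
  assumes fin: "finite V" and loop: "\<forall>e\<in>E. card e = 2" and k: "kconn 2 V E" and nb: "\<not> bipartite V E"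
    and ab: "a \<in> A \<inter> V" "b \<in> A \<inter> V" "a \<noteq> b"
  shows "\<exists>p. odd_path V E A p"
proof -
  have "conn E (V - {})" using k[unfolded kconn_def, rule_format, of "{}"] by simp
  then obtain X where X: "conn (cross E X) V" using spanning_cross[OF fin] by auto
  have "\<not> (independent E (V \<inter> X) \<and> independent E (V - X))"
    using nb unfolding bipartite_def by (metis Int_Diff_Un Int_Diff_disjoint)
  then obtain e where e: "e \<in> E" "e \<subseteq> V \<inter> X \<or> e \<subseteq> V - X" unfolding independent_def by blast
  moreover obtain u v where uv: "e = {u, v}" "u \<noteq> v" using loop e(1) by (metis card_2_iff)
  ultimately have uv': "{v, u} \<in> E" "u \<in> V" "v \<in> V" "u \<in> X \<longleftrightarrow> v \<in> X" by (auto simp: insert_commute)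
  obtain q where q: "is_path V (cross E X) q" "hd q = u" "last q = v" using conn_path[OF X uv'(2,3)] .
  have qn: "q \<noteq> []" using q(1) by (simp add: is_path_def)
  have oq: "odd (length q)" using cross_path[OF q(1)] uv'(4) q(2,3) by (simp add: brk_def)
  have qE: "is_path V E q" using is_path_mono[OF q(1) subset_refl cross_subset] .
  have "card {u, v} \<le> card (set q)"
    using q(2,3) qn by (intro card_mono) auto
  then have c2: "2 \<le> card (set q)" using uv(2) by simp
  have "set q \<subseteq> V" "{a, b} \<subseteq> V" "2 \<le> card {a, b}" using qE ab by (auto simp: is_path_def)
  then obtain F where F: "card F = 2" "disjoint F" "\<forall>C\<in>F. C \<subseteq> V \<and> conn E C \<and> C \<inter> {a, b} \<noteq> {} \<and> C \<inter> set q \<noteq> {}"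
    using kconn_disjoint[OF k fin, of "{a, b}" "set q"] c2 by auto
  obtain C D where CD: "F = {C, D}" "C \<noteq> D" using F(1) by (auto simp: card_2_iff)
  have dCD: "C \<inter> D = {}" using F(2) CD by (simp add: disjoint_def)
  have two: "\<exists>c d. {c, d} = {a, b} \<and> c \<in> C \<and> d \<in> D" using F(3) CD dCD by (cases "a \<in> C"; cases "b \<in> C") auto
  then obtain c d where cd: "{c, d} = {a, b}" "c \<in> C" "d \<in> D" by blast
  have arm: "\<exists>r. is_path V E r \<and> hd r = x \<and> set r \<subseteq> Z \<and> set r \<inter> set q = {last r} \<and> last r \<in> set q"
    if Z: "Z \<in> F" "x \<in> Z" for Z x
  proof -
    have Z': "Z \<subseteq> V" "conn E Z" "Z \<inter> set q \<noteq> {}" using F(3) Z(1) by blast+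
    then obtain y where y: "y \<in> Z" "y \<in> set q" by blast
    obtain r where r: "is_path Z E r" "hd r = x" "last r = y" using conn_path[OF Z'(2) Z(2) y(1)] .
    then have "set r \<inter> set q \<noteq> {}" using y(2) by (metis disjoint_iff is_path_def last_in_set)
    from path_first_hit[OF r(1) this] obtain r' where r': "is_path Z E r'" "hd r' = hd r" "last r' \<in> set q" "set r' \<inter> set q = {last r'}"
      by metis
    have "set r' \<subseteq> Z" using r'(1) by (simp add: is_path_def)
    then show ?thesis using r' r(2) is_path_mono[OF r'(1) Z'(1) subset_refl] by blast
  qed
  obtain r1 where r1: "is_path V E r1" "hd r1 = c" "set r1 \<subseteq> C" "set r1 \<inter> set q = {last r1}" "last r1 \<in> set q"
    using arm[of C c] CD cd by auto
  obtain r2 where r2: "is_path V E r2" "hd r2 = d" "set r2 \<subseteq> D" "set r2 \<inter> set q = {last r2}" "last r2 \<in> set q"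
    using arm[of D d] CD cd by auto
  have n12: "r1 \<noteq> []" "r2 \<noteq> []" using r1(1) r2(1) by (auto simp: is_path_def)
  obtain i j where ij: "i < length q" "last r1 = q ! i" "j < length q" "last r2 = q ! j"
    using r1(5) r2(5) by (metis in_set_conv_nth)
  have "last r1 \<in> C" "last r2 \<in> D" using r1(3) r2(3) n12 last_in_set by blast+
  then have "i \<noteq> j" using ij dCD by auto
  \<comment> \<open>The two junctions are counted twice each, which does not affect parity, so the
    arc must match the two arms in parity of length.\<close>
  then obtain r where r: "is_path V E r" "hd r = q ! i" "last r = q ! j" "set r \<subseteq> set q" "even (length r) = even (length r1 + length r2)"
    using cycle_arcs[OF qE _ oq ij(1,3), of "even (length r1 + length r2)"] uv'(1) q(2,3) by auto
  have rn: "r \<noteq> []" using r(1) by (simp add: is_path_def)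
  have s1: "set r1 \<inter> set r = {last r1}" using r1(4,5) r(2,4) ij(2) rn hd_in_set[OF rn] by auto
  have g1: "last r1 = hd r" using ij r by simp
  note G = path_glue[OF r1(1) r(1) g1 s1]
  have r2r: "is_path V E (rev r2)" "hd (rev r2) = last r2" "last (rev r2) = d" "set (rev r2) = set r2" "length (rev r2) = length r2"
    using is_path_rev[OF r2(1)] n12 r2(2) by (auto simp: hd_rev last_rev)
  have "set r2 \<inter> set r \<subseteq> {last r2}" using r2(4) r(4) by blast
  moreover have "set r2 \<inter> set r1 = {}" using r1(3) r2(3) dCD by blast
  moreover have "last r2 \<in> set r" "last r2 \<in> set r2" using r(3) ij(4) rn n12 last_in_set by metis+
  ultimately have s2: "set (r1 @ tl r) \<inter> set (rev r2) = {last (r1 @ tl r)}" unfolding G(3,4) r2r(4) r(3) ij(4)[symmetric] by blast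
  have g2: "last (r1 @ tl r) = hd (rev r2)" using G(3) r(3) ij(4) r2r(2) by simp
  note H = path_glue[OF G(1) r2r(1) g2 s2]
  let ?p = "(r1 @ tl r) @ tl (rev r2)"
  have "even (length ?p)"
  proof -
    have "length ?p + 2 = length r1 + length r + length r2" using G(5) H(5) r2r(5) by linarith
    then have "even (length ?p) = even (length r1 + length r2 + length r)" by presburger
    then show ?thesis using r(5) by auto
  qed
  \<comment> \<open>With an empty side, breaking parity means odd length, so
    \<open>brk_segment\<close> trims the path to one without inner vertices in
    \<open>A\<close>.\<close>
  then have "brk {} ?p" by (simp add: brk_def)
  moreover have "hd ?p = c" "last ?p = d" using H(2,3) G(2) r1(2) r2r(3) by simp_all
  moreover have "c \<in> A" "d \<in> A" using cd(1) ab(1,2) by (auto simp: doubleton_eq_iff)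
  ultimately obtain p where p: "is_path V E p" "brk {} p" "hd p \<in> A" "last p \<in> A" "set p \<inter> A = {hd p, last p}"
    using brk_segment[OF H(1), of "{}" A] by metis
  then show ?thesis unfolding odd_path_def brk_def by auto
qed

text \<open>Pairs with \<open>g l = h l\<close> are allowed, which a family of two-element sets
  cannot express; they occur when a path to \<open>W\<close> ends where the breaking path
  begins.\<close>

lemma linked_pairs:
  fixes g h :: "'i \<Rightarrow> 'a"
  assumes l: "linked W H X" and X: "X \<subseteq> W"
    and gh: "\<forall>l\<in>L. g l \<in> X \<and> h l \<in> X"
    and d: "\<forall>l\<in>L. \<forall>m\<in>L. l \<noteq> m \<longrightarrow> {g l, h l} \<inter> {g m, h m} = {}"
  shows "\<exists>K. (\<forall>l\<in>L. K l \<subseteq> W \<and> conn H (K l) \<and> K l \<inter> X = {g l, h l}) \<and>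
    (\<forall>l\<in>L. \<forall>m\<in>L. l \<noteq> m \<longrightarrow> K l \<inter> K m = {})"
proof -
  define M where "M = {{g l, h l} |l. l \<in> L \<and> g l \<noteq> h l}"
  have "pairing X M"
    unfolding pairing_def disjoint_def
  proof (intro conjI ballI impI)
    fix e f assume "e \<in> M" "f \<in> M" "e \<noteq> f"
    then obtain l m where lm: "e = {g l, h l}" "f = {g m, h m}" "l \<in> L" "m \<in> L" unfolding M_def by blast
    then have "l \<noteq> m" using \<open>e \<noteq> f\<close> by blast
    then show "e \<inter> f = {}" using d[rule_format, OF lm(3,4)] lm(1,2) by simp
  qed (use gh in \<open>auto simp: M_def\<close>)
  from linkedD[OF l this] obtain U where U: "\<forall>e\<in>M. U e \<subseteq> W \<and> conn H (U e) \<and> U e \<inter> X = e"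
    "\<forall>e\<in>M. \<forall>f\<in>M. e \<noteq> f \<longrightarrow> U e \<inter> U f = {}" .
  define K where "K l = (if g l = h l then {g l} else U {g l, h l})" for l
  have inM: "{g l, h l} \<in> M" if "l \<in> L" "g l \<noteq> h l" for l using that unfolding M_def by blast
  have K: "K l \<subseteq> W \<and> conn H (K l) \<and> K l \<inter> X = {g l, h l}" if "l \<in> L" for l
  proof (cases "g l = h l")
    case True
    then show ?thesis using gh that X by (auto simp: K_def)
  next
    case False
    then show ?thesis using U(1) inM[OF that False] unfolding K_def by simp
  qed
  have "K l \<inter> K m = {}" if lm: "l \<in> L" "m \<in> L" "l \<noteq> m" for l m
  proof -
    have dd: "{g l, h l} \<inter> {g m, h m} = {}" using d lm by blast
    consider "g l = h l" | "g m = h m" | "g l \<noteq> h l" "g m \<noteq> h m" by blast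
    then show ?thesis
    proof cases
      case 1
      then have "K l = {g l}" "g l \<in> X" using gh lm by (auto simp: K_def)
      moreover have "K m \<inter> X \<subseteq> {g m, h m}" using K[OF lm(2)] by simp
      ultimately show ?thesis using dd by auto
    next
      case 2
      then have "K m = {g m}" "g m \<in> X" using gh lm by (auto simp: K_def)
      moreover have "K l \<inter> X \<subseteq> {g l, h l}" using K[OF lm(1)] by simp
      ultimately show ?thesis using dd by auto
    next
      case 3
      have "{g l, h l} \<noteq> {g m, h m}" using dd by blast
      then show ?thesis using U(2)[rule_format, OF inM inM] lm 3 by (simp add: K_def)
    qed
  qed
  then show ?thesis using K by blast
qed

section \<open>Assembling the prescribed paths\<close>

lemma brk_rev: "brk X (rev p) \<longleftrightarrow> brk X p"
  by (cases "p = []") (auto simp: brk_def hd_rev last_rev)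

lemma brk_ends: "is_path V E p \<Longrightarrow> brk X p \<Longrightarrow> hd p \<noteq> last p"
  by (cases p) (auto simp: brk_def is_path_def split: if_splits)

lemma cross_link:
  assumes "conn (cross E X) K" "K \<subseteq> V" "a \<in> K" "b \<in> K"
  obtains p where "is_path V E p" "hd p = a" "last p = b" "set p \<subseteq> K" "\<not> brk X p" "a \<in> set p" "b \<in> set p"
proof -
  obtain p where p: "is_path K (cross E X) p" "hd p = a" "last p = b" using conn_path[OF assms(1,3,4)] .
  have "p \<noteq> []" "set p \<subseteq> K" using p(1) by (auto simp: is_path_def)
  then show ?thesis using that[of p] p cross_path[OF p(1)] is_path_mono[OF p(1) assms(2) cross_subset] by auto
qed

text \<open>Links inside the cut never break parity, so only \<open>R i\<close>, \<open>R' i\<close>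
  and the optional detour \<open>Q i\<close> count. The inclusions for \<open>Q i\<close> permit a
  breaking path to start or end on an access path of its own pair, as a matching edge at a terminal
  does.\<close>

theorem compose_paths:
  fixes R R' Q :: "'i \<Rightarrow> 'a list"
  assumes l: "linked W (cross E Xc) X" and X: "X \<subseteq> W" "W \<subseteq> V" and IJ: "I \<subseteq> J"
    and R: "\<forall>i\<in>J. is_path V E (R i) \<and> hd (R i) = s i \<and> set (R i) \<inter> W = {last (R i)} \<and> last (R i) \<in> X"
    and R': "\<forall>i\<in>J. is_path V E (R' i) \<and> hd (R' i) = t i \<and> set (R' i) \<inter> W = {last (R' i)} \<and> last (R' i) \<in> X"
    and RR': "\<forall>i\<in>J. set (R i) \<inter> set (R' i) = {}"
    and Q: "\<forall>i\<in>I. is_path V E (Q i) \<and> brk Xc (Q i) \<and> set (Q i) \<inter> W = {hd (Q i), last (Q i)} \<and> hd (Q i) \<in> X \<and>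
      last (Q i) \<in> X \<and> set (Q i) \<inter> set (R i) \<subseteq> {hd (Q i)} \<and> set (Q i) \<inter> set (R' i) \<subseteq> {last (Q i)}"
    and dis: "\<forall>i\<in>J. \<forall>j\<in>J. i \<noteq> j \<longrightarrow> (set (R i) \<union> set (R' i) \<union> (if i \<in> I then set (Q i) else {})) \<inter>
      (set (R j) \<union> set (R' j) \<union> (if j \<in> I then set (Q j) else {})) = {}"
  shows "\<exists>P. (\<forall>i\<in>J. is_path V E (P i) \<and> hd (P i) = s i \<and> last (P i) = t i) \<and>
    (\<forall>i\<in>J. \<forall>j\<in>J. i \<noteq> j \<longrightarrow> set (P i) \<inter> set (P j) = {}) \<and>
    (\<forall>i\<in>I. even (path_length (P i)) \<longleftrightarrow> p i)"
proof -
  define S where "S i = set (R i) \<union> set (R' i) \<union> (if i \<in> I then set (Q i) else {})" for i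
  \<comment> \<open>\<open>p i\<close> asks for even length; given the sides of the two ends,
    \<open>tg i\<close> says whether a path of that parity has to break parity.\<close>
  define tg where "tg i \<longleftrightarrow> (\<not> p i) \<noteq> ((s i \<in> Xc) \<noteq> (t i \<in> Xc))" for i
  \<comment> \<open>The pairs that need the detour: those whose access paths together do not already
    have the desired effect.\<close>
  define N where "N = {i\<in>I. (brk Xc (R i) \<noteq> brk Xc (R' i)) \<noteq> tg i}"
  define e where "e i = last (R i)" for i
  define f where "f i = last (R' i)" for i
  define x where "x i = hd (Q i)" for i
  define y where "y i = last (Q i)" for i
  have NI: "N \<subseteq> I" by (auto simp: N_def)
  have Ri: "is_path V E (R i)" "hd (R i) = s i" "set (R i) \<inter> W = {e i}" "e i \<in> X" "e i \<in> set (R i)" "R i \<noteq> []"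
    if "i \<in> J" for i using R that by (auto simp: e_def is_path_def)
  have Ri': "is_path V E (R' i)" "hd (R' i) = t i" "set (R' i) \<inter> W = {f i}" "f i \<in> X" "f i \<in> set (R' i)" "R' i \<noteq> []"
    if "i \<in> J" for i using R' that by (auto simp: f_def is_path_def)
  have Qi: "is_path V E (Q i)" "brk Xc (Q i)" "set (Q i) \<inter> W = {x i, y i}" "x i \<in> X" "y i \<in> X"
    "set (Q i) \<inter> set (R i) \<subseteq> {x i}" "set (Q i) \<inter> set (R' i) \<subseteq> {y i}" "x i \<in> set (Q i)" "y i \<in> set (Q i)" "Q i \<noteq> []"
    if "i \<in> I" for i using Q that by (auto simp: x_def y_def is_path_def)
  have xy: "x i \<noteq> y i" if "i \<in> I" for i using brk_ends[OF Qi(1,2)[OF that]] by (simp add: x_def y_def)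
  have ef: "e i \<noteq> f i" if "i \<in> J" for i using RR' Ri(5) Ri'(5) that by (metis disjoint_iff)
  have ey: "e i \<noteq> y i" if iI: "i \<in> I" for i
  proof
    assume "e i = y i"
    then have "y i \<in> set (Q i) \<inter> set (R i)" using Qi(9)[OF iI] Ri(5)[of i] iI IJ by auto
    then show False using Qi(6)[OF iI] xy[OF iI] by auto
  qed
  have xf: "x i \<noteq> f i" if iI: "i \<in> I" for i
  proof
    assume "x i = f i"
    then have "x i \<in> set (Q i) \<inter> set (R' i)" using Qi(8)[OF iI] Ri'(5)[of i] iI IJ by auto
    then show False using Qi(7)[OF iI] xy[OF iI] by auto
  qed
  have dS: "S i \<inter> S j = {}" if "i \<in> J" "j \<in> J" "i \<noteq> j" for i j using dis that unfolding S_def by blast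
  have SW: "S i \<inter> W \<subseteq> X" if "i \<in> J" for i
  proof -
    have "set (R i) \<inter> W \<subseteq> X" "set (R' i) \<inter> W \<subseteq> X" using Ri(3,4)[OF that] Ri'(3,4)[OF that] by auto
    moreover have "i \<in> I \<longrightarrow> set (Q i) \<inter> W \<subseteq> X" using Qi(3-5)[of i] by auto
    ultimately show ?thesis unfolding S_def by auto
  qed
  \<comment> \<open>One link for every pair, and a second one, marked \<open>True\<close>, behind
    the detour.\<close>
  define L where "L = J \<times> {False} \<union> N \<times> {True}"
  define g where "g l = (if snd l then y (fst l) else e (fst l))" for l
  define h where "h l = (if snd l \<or> fst l \<notin> N then f (fst l) else x (fst l))" for l
  have gS: "g l \<in> S (fst l) \<and> h l \<in> S (fst l) \<and> g l \<in> X \<and> h l \<in> X \<and> fst l \<in> J" if l: "l \<in> L" for l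
  proof -
    have iJ: "fst l \<in> J" and a: "snd l \<Longrightarrow> fst l \<in> N" using l NI IJ by (auto simp: L_def)
    have "e (fst l) \<in> S (fst l)" "f (fst l) \<in> S (fst l)" using Ri(5)[OF iJ] Ri'(5)[OF iJ] by (auto simp: S_def)
    moreover have "x (fst l) \<in> S (fst l)" "y (fst l) \<in> S (fst l)" "x (fst l) \<in> X" "y (fst l) \<in> X" if "fst l \<in> N"
      using Qi(4,5,8,9)[of "fst l"] that NI by (auto simp: S_def)
    ultimately show ?thesis using a iJ Ri(4)[OF iJ] Ri'(4)[OF iJ] by (auto simp: g_def h_def)
  qed
  have pd: "\<forall>l\<in>L. \<forall>m\<in>L. l \<noteq> m \<longrightarrow> {g l, h l} \<inter> {g m, h m} = {}"
  proof (intro ballI impI)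
    fix l m assume lm: "l \<in> L" "m \<in> L" "l \<noteq> m"
    show "{g l, h l} \<inter> {g m, h m} = {}"
    proof (cases "fst l = fst m")
      case False
      have "S (fst l) \<inter> S (fst m) = {}" using dS[OF _ _ False] gS[OF lm(1)] gS[OF lm(2)] by simp
      moreover have "{g l, h l} \<subseteq> S (fst l)" "{g m, h m} \<subseteq> S (fst m)" using gS[OF lm(1)] gS[OF lm(2)] by simp_all
      ultimately show ?thesis by blast
    next
      case True
      then have sn: "snd l \<noteq> snd m" using lm(3) by (auto simp: prod_eq_iff)
      define i where "i = fst l"
      have iN: "i \<in> N" using lm(1,2) sn True by (auto simp: L_def i_def)
      then have iI: "i \<in> I" "i \<in> J" using NI IJ by auto
      have "{e i, x i} \<inter> {y i, f i} = {}" using xy ey xf ef iI by auto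
      then show ?thesis using sn iN True by (cases "snd l") (auto simp: g_def h_def i_def)
    qed
  qed
  have "\<forall>l\<in>L. g l \<in> X \<and> h l \<in> X" using gS by simp
  then obtain K where K: "\<forall>l\<in>L. K l \<subseteq> W \<and> conn (cross E Xc) (K l) \<and> K l \<inter> X = {g l, h l}"
    "\<forall>l\<in>L. \<forall>m\<in>L. l \<noteq> m \<longrightarrow> K l \<inter> K m = {}"
    by (rule linked_pairs[OF l X(1) _ pd, THEN exE]) blast+
  have KS: "K l \<inter> S i = {}" if l: "l \<in> L" and i: "i \<in> J" "i \<noteq> fst l" for l i
  proof -
    have "K l \<inter> S i \<subseteq> {g l, h l}" using K(1) l SW[OF i(1)] by blast
    then show ?thesis using gS[OF l] dS[of i "fst l"] i by blast
  qed
  define T where "T i = S i \<union> K (i, False) \<union> (if i \<in> N then K (i, True) else {})" for i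
  have dT: "T i \<inter> T j = {}" if ij: "i \<in> J" "j \<in> J" "i \<noteq> j" for i j
  proof -
    have Lm: "(i, False) \<in> L" "(j, False) \<in> L" "i \<in> N \<Longrightarrow> (i, True) \<in> L" "j \<in> N \<Longrightarrow> (j, True) \<in> L"
      using ij by (auto simp: L_def)
    have a: "K l \<inter> T j = {}" if l: "l \<in> L" "fst l = i" for l
    proof -
      have "l \<noteq> (j, False)" "l \<noteq> (j, True)" "j \<noteq> fst l" using l(2) ij(3) by auto
      then have "K l \<inter> S j = {}" "K l \<inter> K (j, False) = {}" "j \<in> N \<longrightarrow> K l \<inter> K (j, True) = {}"
        using KS[OF l(1) ij(2)] K(2)[rule_format, OF l(1) Lm(2)] K(2)[rule_format, OF l(1) Lm(4)] by simp_all
      then show ?thesis unfolding T_def by auto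
    qed
    have b: "S i \<inter> T j = {}" unfolding T_def
      using dS[OF ij] KS[OF Lm(2) ij(1)] KS[OF Lm(4) ij(1)] ij(3) by auto
    show ?thesis using a[OF Lm(1)] a[OF Lm(3)] b unfolding T_def[of i] by auto
  qed
  have "\<exists>P. is_path V E P \<and> hd P = s i \<and> last P = t i \<and> set P \<subseteq> T i \<and> (i \<in> I \<longrightarrow> brk Xc P = tg i)" if iJ: "i \<in> J" for i
  proof -
    have rr: "is_path V E (rev (R' i))" "hd (rev (R' i)) = f i" "last (rev (R' i)) = t i" "set (rev (R' i)) = set (R' i)"
      using is_path_rev[OF Ri'(1)[OF iJ]] Ri'(2,6)[OF iJ] by (auto simp: hd_rev last_rev f_def)
    have RR: "set (R i) \<inter> set (R' i) = {}" using RR' iJ by blast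
    have L0: "(i, False) \<in> L" using iJ by (simp add: L_def)
    have K0: "K (i, False) \<subseteq> W" "conn (cross E Xc) (K (i, False))" "K (i, False) \<inter> X = {g (i, False), h (i, False)}"
      using K(1) L0 by blast+
    have K0V: "K (i, False) \<subseteq> V" using K0(1) X(2) by blast
    have STi: "set (R i) \<subseteq> T i" "set (R' i) \<subseteq> T i" "K (i, False) \<subseteq> T i" by (auto simp: T_def S_def)
    show ?thesis
    proof (cases "i \<in> N")
      case False
      have gh: "g (i, False) = e i" "h (i, False) = f i" using False by (auto simp: g_def h_def)
      obtain D where D: "is_path V E D" "hd D = e i" "last D = f i" "set D \<subseteq> K (i, False)" "\<not> brk Xc D" "e i \<in> set D" "f i \<in> set D"
        by (rule cross_link[OF K0(2) K0V, of "e i" "f i"]) (use K0(3) gh in auto)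
      have DW: "set D \<subseteq> W" using D(4) K0(1) by blast
      have a: "last (R i) = hd D" "set (R i) \<inter> set D = {last (R i)}"
        using D(2,6) DW Ri(3,5)[OF iJ] unfolding e_def[symmetric] by auto
      note G = path_glue[OF Ri(1)[OF iJ] D(1) a]
      have b: "last (R i @ tl D) = hd (rev (R' i))" "set (R i @ tl D) \<inter> set (rev (R' i)) = {last (R i @ tl D)}"
        unfolding G(3,4) rr using D(3,7) DW Ri'(3,5)[OF iJ] RR by auto
      note H = path_glue[OF G(1) rr(1) b]
      have "brk Xc ((R i @ tl D) @ tl (rev (R' i))) \<longleftrightarrow> (brk Xc (R i) \<noteq> brk Xc (R' i))"
        unfolding H(6) G(6) brk_rev using D(5) by simp
      moreover have "i \<in> I \<longrightarrow> (brk Xc (R i) \<noteq> brk Xc (R' i)) = tg i" using False by (auto simp: N_def)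
      moreover have "set ((R i @ tl D) @ tl (rev (R' i))) \<subseteq> T i" unfolding H(4) G(4) rr(4) using STi D(4) by blast
      ultimately show ?thesis using H(1,2,3) G(2) Ri(2)[OF iJ] rr(3)
        by (intro exI[of _ "(R i @ tl D) @ tl (rev (R' i))"]) simp
    next
      case True
      then have iI: "i \<in> I" using NI by blast
      have L1: "(i, True) \<in> L" using True by (simp add: L_def)
      have K1: "K (i, True) \<subseteq> W" "conn (cross E Xc) (K (i, True))" "K (i, True) \<inter> X = {g (i, True), h (i, True)}"
        using K(1) L1 by blast+
      have K1V: "K (i, True) \<subseteq> V" using K1(1) X(2) by blast
      have dK: "K (i, False) \<inter> K (i, True) = {}" using K(2) L0 L1 by blast
      have gh: "g (i, False) = e i" "h (i, False) = x i" "g (i, True) = y i" "h (i, True) = f i"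
        using True by (auto simp: g_def h_def)
      obtain D where D: "is_path V E D" "hd D = e i" "last D = x i" "set D \<subseteq> K (i, False)" "\<not> brk Xc D" "e i \<in> set D" "x i \<in> set D"
        by (rule cross_link[OF K0(2) K0V, of "e i" "x i"]) (use K0(3) gh in auto)
      obtain D' where D': "is_path V E D'" "hd D' = y i" "last D' = f i" "set D' \<subseteq> K (i, True)" "\<not> brk Xc D'" "y i \<in> set D'" "f i \<in> set D'"
        by (rule cross_link[OF K1(2) K1V, of "y i" "f i"]) (use K1(3) gh in auto)
      have DW: "set D \<subseteq> W" "set D' \<subseteq> W" "set D \<inter> set D' = {}" using D(4) D'(4) K0(1) K1(1) dK by blast+
      have DX: "set D \<inter> X \<subseteq> {e i, x i}" "set D' \<inter> X \<subseteq> {y i, f i}" using D(4) D'(4) K0(3) K1(3) unfolding gh by auto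
      have RW: "set (R i) \<inter> W \<subseteq> {e i}" "set (R' i) \<inter> W \<subseteq> {f i}" using Ri(3)[OF iJ] Ri'(3)[OF iJ] by auto
      have QX: "set (Q i) \<inter> W \<subseteq> {x i, y i}" "x i \<in> X" "y i \<in> X" using Qi[OF iI] by auto
      have a: "last (R i) = hd D" "set (R i) \<inter> set D = {last (R i)}"
        using D(2,6) DW Ri(3,5)[OF iJ] unfolding e_def[symmetric] by auto
      note G1 = path_glue[OF Ri(1)[OF iJ] D(1) a]
      have "set (R i @ tl D) \<inter> set (Q i) = {x i}"
      proof
        have "y i \<notin> set D" using subsetD[OF DX(1), of "y i"] QX(3) xy[OF iI] ey[OF iI] by auto
        then have "set D \<inter> set (Q i) \<subseteq> {x i}" using DW(1) QX(1) by blast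
        then show "set (R i @ tl D) \<inter> set (Q i) \<subseteq> {x i}" unfolding G1(4) using Qi(6)[OF iI] by blast
        show "{x i} \<subseteq> set (R i @ tl D) \<inter> set (Q i)" unfolding G1(4) using D(7) Qi(8)[OF iI] by blast
      qed
      then have b: "last (R i @ tl D) = hd (Q i)" "set (R i @ tl D) \<inter> set (Q i) = {last (R i @ tl D)}"
        unfolding G1(3) D(3) by (simp_all add: x_def)
      note G2 = path_glue[OF G1(1) Qi(1)[OF iI] b]
      let ?p2 = "(R i @ tl D) @ tl (Q i)"
      have "set ?p2 \<inter> set D' = {y i}"
      proof
        have "e i \<notin> set D'" using DX(2) Ri(4)[OF iJ] ey[OF iI] ef[OF iJ] by blast
        then have "set (R i) \<inter> set D' = {}" using RW(1) DW(2) by blast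
        moreover have "x i \<notin> set D'" using DX(2) QX(2) xy[OF iI] xf[OF iI] by blast
        then have "set (Q i) \<inter> set D' \<subseteq> {y i}" using DW(2) QX(1) by blast
        ultimately show "set ?p2 \<inter> set D' \<subseteq> {y i}" unfolding G2(4) G1(4) using DW(3) by blast
        show "{y i} \<subseteq> set ?p2 \<inter> set D'" unfolding G2(4) using D'(6) Qi(9)[OF iI] by blast
      qed
      then have c: "last ?p2 = hd D'" "set ?p2 \<inter> set D' = {last ?p2}"
        unfolding G2(3) D'(2) by (simp_all add: y_def)
      note G3 = path_glue[OF G2(1) D'(1) c]
      let ?p3 = "?p2 @ tl D'"
      have "set ?p3 \<inter> set (R' i) = {f i}"
      proof
        have "f i \<notin> set D" using subsetD[OF DX(1), of "f i"] Ri'(4)[OF iJ] xf[OF iI] ef[OF iJ] by auto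
        then have "set D \<inter> set (R' i) = {}" using RW(2) DW(1) by blast
        moreover have "set (Q i) \<inter> set (R' i) \<subseteq> {f i}"
        proof -
          have "y i \<in> W" using Qi(3)[OF iI] by auto
          then show ?thesis using RW(2) Qi(7)[OF iI] by blast
        qed
        moreover have "set D' \<inter> set (R' i) \<subseteq> {f i}" using RW(2) DW(2) by blast
        ultimately show "set ?p3 \<inter> set (R' i) \<subseteq> {f i}" unfolding G3(4) G2(4) G1(4) using RR by blast
        show "{f i} \<subseteq> set ?p3 \<inter> set (R' i)" unfolding G3(4) using D'(7) Ri'(5)[OF iJ] by blast
      qed
      then have d: "last ?p3 = hd (rev (R' i))" "set ?p3 \<inter> set (rev (R' i)) = {last ?p3}"
        unfolding G3(3) rr(2,4) D'(3) by simp_all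
      note G4 = path_glue[OF G3(1) rr(1) d]
      have "brk Xc (?p3 @ tl (rev (R' i))) \<longleftrightarrow> ((brk Xc (R i) \<noteq> brk Xc (R' i)) \<noteq> True)"
        unfolding G4(6) G3(6) G2(6) G1(6) brk_rev using D(5) D'(5) Qi(2)[OF iI] by auto
      also have "\<dots> \<longleftrightarrow> tg i" using True by (auto simp: N_def)
      finally have "brk Xc (?p3 @ tl (rev (R' i))) = tg i" .
      moreover have "set (?p3 @ tl (rev (R' i))) \<subseteq> T i"
      proof -
        have "set (Q i) \<subseteq> T i" "K (i, True) \<subseteq> T i" using True iI by (auto simp: T_def S_def)
        then show ?thesis unfolding G4(4) G3(4) G2(4) G1(4) rr(4) using STi D(4) D'(4) by blast
      qed
      moreover have "hd (?p3 @ tl (rev (R' i))) = s i" using G4(2) G3(2) G2(2) G1(2) Ri(2)[OF iJ] by simp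
      moreover have "last (?p3 @ tl (rev (R' i))) = t i" using G4(3) rr(3) by simp
      ultimately show ?thesis using G4(1) by blast
    qed
  qed
  then have "\<forall>i\<in>J. \<exists>P. is_path V E P \<and> hd P = s i \<and> last P = t i \<and> set P \<subseteq> T i \<and> (i \<in> I \<longrightarrow> brk Xc P = tg i)"
    by blast
  then obtain P where P: "\<forall>i\<in>J. is_path V E (P i) \<and> hd (P i) = s i \<and> last (P i) = t i \<and> set (P i) \<subseteq> T i \<and> (i \<in> I \<longrightarrow> brk Xc (P i) = tg i)"
    by (rule bchoice[THEN exE])
  have par: "even (path_length (P i)) \<longleftrightarrow> p i" if iI: "i \<in> I" for i
  proof -
    have Pi: "P i \<noteq> []" "hd (P i) = s i" "last (P i) = t i" "brk Xc (P i) = tg i" using P iI IJ by (auto simp: is_path_def)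
    then have "even (length (P i)) = (\<not> p i)" unfolding brk_def tg_def by auto
    then show ?thesis using Pi(1) by (cases "P i") (auto simp: path_length_def)
  qed
  have "set (P i) \<inter> set (P j) = {}" if "i \<in> J" "j \<in> J" "i \<noteq> j" for i j
    using P dT[OF that] that(1,2) by blast
  then show ?thesis using P par by (intro exI[of _ P] conjI ballI impI) auto
qed

section \<open>Small odd cycle covers\<close>

text \<open>Separations of order below \<open>2 * l\<close> are trivial here, and a massive one has
  a nonempty far side; so its near side, and with it \<open>X\<close>, lies in the overlap.\<close>

lemma kconn_massed:
  assumes fin: "finite V" and k: "kconn (2 * l) V H" and X: "X \<subseteq> V" "card X \<le> 2 * l"
    and r: "a * card (V - X) < rho V H (V - X)"
  shows "massed a V H X"
  unfolding massed_def
proof (intro conjI allI impI X(1) r, rule ccontr)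
  fix A B assume m: "msep a V H X A B" and n: "\<not> card X \<le> card (A \<inter> B)"
  have s: "sepn V H A B" "X \<subseteq> A" "a * card (B - A) < rho V H (B - A)" using m by (auto simp: msep_def)
  have "card (A \<inter> B) < 2 * l" using n X(2) by linarith
  then have "A \<subseteq> B \<or> B \<subseteq> A" by (rule kconn_sepn[OF k s(1)])
  moreover have "\<not> B \<subseteq> A"
  proof
    assume "B \<subseteq> A"
    then have e: "B - A = {}" by blast
    show False using s(3) unfolding e by simp
  qed
  ultimately have "X \<subseteq> A \<inter> B" using s(2) by blast
  moreover have "finite (A \<inter> B)" using s(1) fin by (auto simp: sepn_def)
  ultimately show False using n card_mono by blast
qed

lemma rho_split:
  assumes fin: "finite V" and Y: "Y \<subseteq> V"
  shows "(\<Sum>y\<in>Y - X. card (nbrs E (V - Y) y)) + rho (V - Y) E (V - Y - X) \<le> rho V E (V - X)"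
proof -
  let ?S = "SIGMA y:Y - X. nbrs E (V - Y) y"
  let ?f = "\<lambda>(y, w). {y, w}"
  let ?R = "{e\<in>E. e \<subseteq> V - Y \<and> e \<inter> (V - Y - X) \<noteq> {}}"
  have finY: "finite (Y - X)" using Y fin finite_subset by blast
  have finN: "finite (nbrs E (V - Y) y)" for y using fin nbrs_sub finite_subset by (metis finite_Diff)
  have inj: "inj_on ?f ?S"
  proof (rule inj_onI)
    fix p q assume pq: "p \<in> ?S" "q \<in> ?S" "?f p = ?f q"
    obtain y w y' w' where yw: "p = (y, w)" "q = (y', w')" by (cases p; cases q)
    then have "y \<in> Y" "y' \<in> Y" "w \<notin> Y" "w' \<notin> Y" "{y, w} = {y', w'}" using pq by (auto simp: nbrs_def)
    then show "p = q" using yw by (auto simp: doubleton_eq_iff)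
  qed
  have "finite ?S" using finY finN by blast
  have "(\<Sum>y\<in>Y - X. card (nbrs E (V - Y) y)) = card ?S" using finY finN by (simp add: card_SigmaI)
  also have "\<dots> = card (?f ` ?S)" using inj by (simp add: card_image)
  finally have "(\<Sum>y\<in>Y - X. card (nbrs E (V - Y) y)) + rho (V - Y) E (V - Y - X) = card (?f ` ?S) + card ?R"
    unfolding rho_def by simp
  also have "\<dots> = card (?f ` ?S \<union> ?R)"
  proof (rule card_Un_disjoint[symmetric])
    show "finite (?f ` ?S)" using \<open>finite ?S\<close> by (rule finite_imageI)
    show "finite ?R" using fin by (intro finite_edges) simp
    show "?f ` ?S \<inter> ?R = {}" by auto
  qed
  also have "\<dots> \<le> rho V E (V - X)"
    unfolding rho_def by (rule card_mono[OF finite_edges[OF fin]]) (use Y in \<open>auto simp: nbrs_def\<close>)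
  finally show ?thesis .
qed

lemma kconn_degree:
  assumes fin: "finite V" and loop: "\<forall>e\<in>E. card e = 2" and k: "kconn c V E" and big: "c < card V" and v: "v \<in> V"
  shows "c \<le> card (nbrs E V v)"
proof (rule ccontr)
  assume s: "\<not> ?thesis"
  have N: "nbrs E V v \<subseteq> V" "v \<notin> nbrs E V v" using no_loop[OF loop, of v v] by (auto simp: nbrs_def)
  have c: "conn E (V - nbrs E V v)" using k s N(1) unfolding kconn_def by simp
  have "card (insert v (nbrs E V v)) < card V"
    using s big N finite_subset[OF N(1) fin] by simp
  then have "insert v (nbrs E V v) \<noteq> V" by (metis less_irrefl)
  then have "{v} \<noteq> V - nbrs E V v" using N(1) v by blast
  moreover have "{v} \<subseteq> V - nbrs E V v" using v N by blast
  ultimately obtain b where "b \<in> V - nbrs E V v" "{v, b} \<in> E" using conn_cut[OF c, of "{v}"] by (metis Diff_iff insert_not_empty singletonD)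
  then show False by (auto simp: nbrs_def)
qed

text \<open>Outside \<open>Y\<close> all edges are cut edges, and niceness leaves each vertex of
  \<open>Y\<close> at least half of its neighbours there. This gives both the connectivity and the
  density for \<open>massed_linked\<close>.\<close>

lemma nice_cover_linked:
  assumes fin: "finite V" and loop: "\<forall>e\<in>E. card e = 2" and EV: "\<forall>e\<in>E. e \<subseteq> V"
    and k: "kconn c V E" "c < card V" and AB: "A \<union> B = V" "A \<inter> B = {}"
    and Y: "Y \<subseteq> V" "card Y + 12 * l + 1 \<le> c" and ind: "independent E (A - Y)" "independent E (B - Y)"
    and nice: "\<forall>v\<in>Y. card (neighbours E v \<inter> (B - Y)) > card (neighbours E v \<inter> (A - Y)) \<longrightarrow> v \<in> A"
      "\<forall>v\<in>Y. card (neighbours E v \<inter> (A - Y)) > card (neighbours E v \<inter> (B - Y)) \<longrightarrow> v \<in> B"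
    and X: "X \<subseteq> V" "card X \<le> 2 * l"
  shows "linked V (cross E A) X"
proof -
  let ?H = "cross E A"
  have loopH: "\<forall>e\<in>?H. card e = 2" using loop by (simp add: cross_def)
  have deg: "c \<le> card (nbrs E V v)" if "v \<in> V" for v using kconn_degree[OF fin loop k that] .
  have finY: "finite Y" using Y(1) fin finite_subset by blast
  have out: "12 * l + 1 \<le> card (nbrs E V v - Y)" if v: "v \<in> V" for v
    using deg[OF v] Y(2) diff_card_le_card_Diff[OF finY, of "nbrs E V v"] by linarith
  have acr: "{u, v} \<in> ?H" if "{u, v} \<in> E" "u \<in> V - Y" "v \<in> V - Y" for u v
      proof -
    have "\<not> {u, v} \<subseteq> A - Y" "\<not> {u, v} \<subseteq> B - Y" 
      using bspec[OF ind(1)[unfolded independent_def] that(1)] bspec[OF ind(2)[unfolded independent_def] that(1)] by blast+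
    then have "(u \<in> A) \<noteq> (v \<in> A)" using that(2,3) AB by auto
    then show ?thesis using that(1) by (simp add: cross_iff)
  qed
  have d1: "12 * l + 1 \<le> card (nbrs ?H (V - Y) v)" if v: "v \<in> V - Y" for v
  proof -
    have "nbrs E V v - Y \<subseteq> nbrs ?H (V - Y) v" using acr v by (auto simp: nbrs_def)
    moreover have "finite (nbrs ?H (V - Y) v)" using fin by (simp add: nbrs_def)
    ultimately have "card (nbrs E V v - Y) \<le> card (nbrs ?H (V - Y) v)" by (rule card_mono[rotated])
    then show ?thesis using out[of v] v by simp
  qed
  \<comment> \<open>\<open>v\<close> lies opposite the larger part of its at least
    \<open>12 * l + 1\<close> neighbours outside \<open>Y\<close>, and half of that number, rounded
    up, is \<open>6 * l + 1\<close>.\<close>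
  have d2: "6 * l + 1 \<le> card (nbrs ?H (V - Y) v)" if v: "v \<in> Y" for v
  proof -
    let ?a = "neighbours E v \<inter> (A - Y)" and ?b = "neighbours E v \<inter> (B - Y)"
    have "nbrs E V v - Y = ?a \<union> ?b" using AB by (auto simp: nbrs_def neighbours_def)
    moreover have "card (?a \<union> ?b) = card ?a + card ?b" using AB fin by (intro card_Un_disjoint) (auto intro: finite_subset)
    ultimately have s: "12 * l + 1 \<le> card ?a + card ?b" using out[of v] v Y(1) by auto
    have fn: "finite (nbrs ?H (V - Y) v)" using fin by (simp add: nbrs_def)
    have cA: "card ?b \<le> card (nbrs ?H (V - Y) v)" if "v \<in> A"
      using AB that fn by (intro card_mono) (auto simp: nbrs_def neighbours_def cross_iff)
    have cB: "card ?a \<le> card (nbrs ?H (V - Y) v)" if "v \<in> B"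
      using AB that fn by (intro card_mono) (auto simp: nbrs_def neighbours_def cross_iff)
    consider "card ?b > card ?a" | "card ?a > card ?b" | "card ?a = card ?b" by linarith
    then show ?thesis
    proof cases
      case 1
      then have "v \<in> A" using nice(1) v by blast
      then show ?thesis using cA s 1 by linarith
    next
      case 2
      then have "v \<in> B" using nice(2) v by blast
      then show ?thesis using cB s 2 by linarith
    next
      case 3
      have "v \<in> A \<or> v \<in> B" using v Y(1) AB by blast
      then show ?thesis using cA cB s 3 by auto
    qed
  qed
  \<comment> \<open>What remains outside \<open>Y\<close> is connected by cut edges, and each
    surviving vertex of \<open>Y\<close> keeps a neighbour there, since fewer than
    \<open>2 * l\<close> vertices are deleted.\<close>
  have kc: "kconn (2 * l) V ?H"
    unfolding kconn_def
  proof (intro allI impI)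
    fix Z assume Z: "Z \<subseteq> V" "card Z < 2 * l"
    have finZ: "finite Z" using Z(1) fin finite_subset by blast
    have "card (Y \<union> Z) \<le> card Y + card Z" by (rule card_Un_le)
    then have "card (Y \<union> Z) < c" using Y(2) Z(2) by linarith
    moreover have "Y \<union> Z \<subseteq> V" using Y(1) Z(1) by blast
    ultimately have "conn E (V - (Y \<union> Z))" using k(1) unfolding kconn_def by blast
    then have base: "conn ?H (V - (Y \<union> Z))" by (rule conn_edges_cong) (use acr in auto)
    have att: "\<exists>w\<in>V - (Y \<union> Z). {y, w} \<in> ?H" if y: "y \<in> Y" for y
    proof -
      have "nbrs ?H (V - Y) y - Z \<noteq> {}"
        using d2[OF y] diff_card_le_card_Diff[OF finZ, of "nbrs ?H (V - Y) y"] Z(2) by fastforce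
      then show ?thesis by (auto simp: nbrs_def)
    qed
    have "conn ?H (V - (Y \<union> Z) \<union> T)" if "finite T" "T \<subseteq> Y - Z" for T
      using that
    proof (induction T rule: finite_induct)
      case empty
      then show ?case using base by simp
    next
      case (insert y T)
      obtain w where w: "w \<in> V - (Y \<union> Z)" "{y, w} \<in> ?H" using att[of y] insert.prems by blast
      have "{w, y} \<in> ?H" using w(2) by (simp add: insert_commute)
      then have "conn ?H (insert y (V - (Y \<union> Z) \<union> T))" using insert w(1) by (intro conn_insert) auto
      then show ?case by simp
    qed
    from this[of "Y - Z"] have "conn ?H (V - (Y \<union> Z) \<union> (Y - Z))" using finY by simp
    moreover have "V - (Y \<union> Z) \<union> (Y - Z) = V - Z" using Y(1) by blast
    ultimately show "conn ?H (V - Z)" by simp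
  qed
  have finVX: "finite (V - Y - X)" "finite (Y - X)" using fin finY by auto
  have "card (Y - X) * (6 * l + 1) \<le> (\<Sum>y\<in>Y - X. card (nbrs ?H (V - Y) y))"
    using d2 sum_bounded_below[of "Y - X" "6 * l + 1" "\<lambda>y. card (nbrs ?H (V - Y) y)"] by simp
  moreover have "card (V - Y - X) * (12 * l + 1) \<le> (\<Sum>v\<in>V - Y - X. card (nbrs ?H (V - Y) v))"
    using d1 sum_bounded_below[of "V - Y - X" "12 * l + 1" "\<lambda>y. card (nbrs ?H (V - Y) y)"] by simp
  moreover have "(\<Sum>v\<in>V - Y - X. card (nbrs ?H (V - Y) v)) \<le> 2 * rho (V - Y) ?H (V - Y - X)"
    by (rule degree_sum(1)) (use fin loopH in auto)
  moreover have "(\<Sum>y\<in>Y - X. card (nbrs ?H (V - Y) y)) + rho (V - Y) ?H (V - Y - X) \<le> rho V ?H (V - X)"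
    by (rule rho_split[OF fin Y(1)])
  \<comment> \<open>Edges inside \<open>V - Y\<close> are charged half to each end, edges from
    \<open>Y\<close> to \<open>V - Y\<close> wholly to \<open>Y\<close>; either way a vertex
    receives more than \<open>6 * l\<close>.\<close>
  ultimately have r1: "2 * (card (Y - X) * (6 * l + 1)) + card (V - Y - X) * (12 * l + 1) \<le> 2 * rho V ?H (V - X)"
    by linarith
  have "V - X = (V - Y - X) \<union> (Y - X)" using Y(1) by blast
  then have cVX: "card (V - X) = card (V - Y - X) + card (Y - X)" using finVX by (simp add: card_Un_disjoint[of "V - Y - X" "Y - X"] Int_commute disjoint_iff)
  have "card X < card V" using X(2) Y(2) k(2) by linarith
  then have "0 < card (V - X)" using diff_card_le_card_Diff[of X V] finite_subset[OF X(1) fin] by linarith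
  moreover have "2 * (card (Y - X) * (6 * l + 1)) = 12 * l * card (Y - X) + 2 * card (Y - X)"
    "card (V - Y - X) * (12 * l + 1) = 12 * l * card (V - Y - X) + card (V - Y - X)"
    "12 * l * card (V - X) = 12 * l * card (V - Y - X) + 12 * l * card (Y - X)"
    "12 * l * card (V - X) = 2 * (6 * l * card (V - X))"
    using cVX by (simp_all add: algebra_simps)
  ultimately have "6 * l * card (V - X) < rho V ?H (V - X)" using r1 cVX by linarith
  then have "massed (6 * l) V ?H X" by (rule kconn_massed[OF fin kc X])
  then show ?thesis by (rule massed_linked[OF fin loopH _ X(2)])
qed

text \<open>Here \<open>W = V\<close>: each terminal is its own access path, and the matching edges
  are the breaking paths.\<close>

lemma small_cover_case:
  fixes s t :: "nat \<Rightarrow> 'a"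
  assumes fin: "finite V" and loop: "\<forall>e\<in>E. card e = 2" and EV: "\<forall>e\<in>E. e \<subseteq> V"
    and k: "kconn c V E" "c < card V" and I: "I \<subseteq> {1..k}"
    and st: "s ` {1..k} \<subseteq> V" "t ` {1..k} \<subseteq> V" "inj_on s {1..k}" "inj_on t {1..k}" "s ` {1..k} \<inter> t ` {1..k} = {}"
    and AB: "partition2 V A B" and m: "parity_breaking_matching E A B k s t I m"
    and Y: "Y \<subseteq> V" "card Y + 12 * (k + card I) + 1 \<le> c" and ind: "independent E (A - Y)" "independent E (B - Y)"
    and nice: "\<forall>v\<in>Y. card (neighbours E v \<inter> (B - Y)) > card (neighbours E v \<inter> (A - Y)) \<longrightarrow> v \<in> A"
      "\<forall>v\<in>Y. card (neighbours E v \<inter> (A - Y)) > card (neighbours E v \<inter> (B - Y)) \<longrightarrow> v \<in> B"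
  shows "\<exists>P. (\<forall>i\<in>{1..k}. is_path V E (P i) \<and> hd (P i) = s i \<and> last (P i) = t i) \<and>
    (\<forall>i\<in>{1..k}. \<forall>j\<in>{1..k}. i \<noteq> j \<longrightarrow> set (P i) \<inter> set (P j) = {}) \<and>
    (\<forall>i\<in>I. even (path_length (P i)) \<longleftrightarrow> p i)"
proof -
  let ?J = "{1..k}"
  have AB': "A \<union> B = V" "A \<inter> B = {}" using AB by (auto simp: partition2_def)
  have finI: "finite I" using I finite_subset by blast
  have mE: "m i \<in> E" "m i \<subseteq> A \<or> m i \<subseteq> B" "card (m i) = 2" "m i \<subseteq> V" if "i \<in> I" for i
    using m that loop EV unfolding parity_breaking_matching_def edges_AB_def by auto
  have md: "m i \<inter> m j = {}" if "i \<in> I" "j \<in> I" "i \<noteq> j" for i j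
    using m that unfolding parity_breaking_matching_def by blast
  have mst: "s j \<notin> m i" "t j \<notin> m i" if "i \<in> I" "j \<in> ?J" "j \<noteq> i" for i j
    using m that unfolding parity_breaking_matching_def by blast+
  have stn: "s i \<noteq> t j" if "i \<in> ?J" "j \<in> ?J" for i j using st(5) that by (metis disjoint_iff imageI)
  have ss: "s i \<noteq> s j" "t i \<noteq> t j" if "i \<in> ?J" "j \<in> ?J" "i \<noteq> j" for i j
    using inj_onD[OF st(3)] inj_onD[OF st(4)] that by metis+
  \<comment> \<open>Orients the matching edge so that a terminal lying on it comes at the proper
    end, \<open>s i\<close> first and \<open>t i\<close> last.\<close>
  have "\<exists>u v. m i = {u, v} \<and> u \<noteq> v \<and> (s i \<in> m i \<longrightarrow> s i = u) \<and> (t i \<in> m i \<longrightarrow> t i = v)" if iI: "i \<in> I" for i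
  proof -
    obtain a b where ab: "m i = {a, b}" "a \<noteq> b" using mE(3)[OF iI] by (auto simp: card_2_iff)
    have ne: "s i \<noteq> t i" using stn iI I by blast
    show ?thesis
    proof (cases "a = t i \<or> b = s i")
      case True
      then show ?thesis using ab ne by (intro exI[of _ b] exI[of _ a]) auto
    next
      case False
      then show ?thesis using ab ne by (intro exI[of _ a] exI[of _ b]) auto
    qed
  qed
  then obtain u v where uv: "m i = {u i, v i}" "u i \<noteq> v i" "s i \<in> m i \<Longrightarrow> s i = u i" "t i \<in> m i \<Longrightarrow> t i = v i"
    if "i \<in> I" for i by metis
  define X where "X = s ` ?J \<union> t ` ?J \<union> \<Union> (m ` I)"
  have XV: "X \<subseteq> V" using st(1,2) mE(4) unfolding X_def by (intro Un_least UN_least)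
  have "card (\<Union> (m ` I)) \<le> (\<Sum>i\<in>I. card (m i))" by (rule card_UN_le[OF finI])
  also have "\<dots> = 2 * card I" using mE(3) by simp
  finally have c1: "card (\<Union> (m ` I)) \<le> 2 * card I" .
  have "card (s ` ?J) \<le> k" "card (t ` ?J) \<le> k" using card_image_le[of ?J s] card_image_le[of ?J t] by auto
  then have "card (s ` ?J \<union> t ` ?J) \<le> k + k" using card_Un_le[of "s ` ?J" "t ` ?J"] by linarith
  then have "card X \<le> (k + k) + 2 * card I" unfolding X_def by (rule order_trans[OF card_Un_le add_mono[OF _ c1]])
  then have cX: "card X \<le> 2 * (k + card I)" by simp
  have lk: "linked V (cross E A) X"
    by (rule nice_cover_linked[OF fin loop EV k AB' Y ind nice XV cX])
  show ?thesis
  proof (rule compose_paths[OF lk XV subset_refl I, where R = "\<lambda>i. [s i]" and R' = "\<lambda>i. [t i]" and Q = "\<lambda>i. [u i, v i]"])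
    show "\<forall>i\<in>?J. is_path V E [s i] \<and> hd [s i] = s i \<and> set [s i] \<inter> V = {last [s i]} \<and> last [s i] \<in> X"
      using st(1) by (auto simp: X_def)
    show "\<forall>i\<in>?J. is_path V E [t i] \<and> hd [t i] = t i \<and> set [t i] \<inter> V = {last [t i]} \<and> last [t i] \<in> X"
      using st(2) by (auto simp: X_def)
    show "\<forall>i\<in>?J. set [s i] \<inter> set [t i] = {}" using stn by auto
    show "\<forall>i\<in>I. is_path V E [u i, v i] \<and> brk A [u i, v i] \<and> set [u i, v i] \<inter> V = {hd [u i, v i], last [u i, v i]} \<and>
      hd [u i, v i] \<in> X \<and> last [u i, v i] \<in> X \<and> set [u i, v i] \<inter> set [s i] \<subseteq> {hd [u i, v i]} \<and>
      set [u i, v i] \<inter> set [t i] \<subseteq> {last [u i, v i]}"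
    proof
      fix i assume iI: "i \<in> I"
      have uV: "u i \<in> V" "v i \<in> V" "{u i, v i} \<in> E" "u i \<in> X" "v i \<in> X"
        using mE(1,4)[OF iI] uv(1)[OF iI] iI by (auto simp: X_def)
      have "is_path V E [u i, v i]" using uV uv(2)[OF iI] by (auto simp: is_path_alt)
      moreover have "u i \<in> A \<longleftrightarrow> v i \<in> A" using mE(2)[OF iI] uv(1)[OF iI] AB' by auto
      then have "brk A [u i, v i]" by (simp add: brk_def)
      moreover have "{u i, v i} \<inter> {s i} \<subseteq> {u i}" "{u i, v i} \<inter> {t i} \<subseteq> {v i}"
        using uv(1,3,4)[OF iI] by auto
      ultimately show "is_path V E [u i, v i] \<and> brk A [u i, v i] \<and> set [u i, v i] \<inter> V = {hd [u i, v i], last [u i, v i]} \<and>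
        hd [u i, v i] \<in> X \<and> last [u i, v i] \<in> X \<and> set [u i, v i] \<inter> set [s i] \<subseteq> {hd [u i, v i]} \<and>
        set [u i, v i] \<inter> set [t i] \<subseteq> {last [u i, v i]}" using uV by auto
    qed
    show "\<forall>i\<in>?J. \<forall>j\<in>?J. i \<noteq> j \<longrightarrow>
      (set [s i] \<union> set [t i] \<union> (if i \<in> I then set [u i, v i] else {})) \<inter>
      (set [s j] \<union> set [t j] \<union> (if j \<in> I then set [u j, v j] else {})) = {}"
    proof (intro ballI impI)
      fix i j assume ij: "i \<in> ?J" "j \<in> ?J" "i \<noteq> j"
      have mm: "(if i \<in> I then set [u i, v i] else {}) = (if i \<in> I then m i else {})" for i using uv(1)[of i] by auto
      show "(set [s i] \<union> set [t i] \<union> (if i \<in> I then set [u i, v i] else {})) \<inter>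
        (set [s j] \<union> set [t j] \<union> (if j \<in> I then set [u j, v j] else {})) = {}"
        unfolding mm using ss[OF ij] stn[OF ij(1,2)] stn[OF ij(2,1)] mst[of i j] mst[of j i] md[of i j] ij by auto
    qed
  qed
qed

section \<open>Large odd cycle covers\<close>

text \<open>Moving a vertex to the other side exchanges its cut edges with its remaining edges, so
  in a maximum cut at least half of them are cut.\<close>

lemma max_cut:
  assumes fin: "finite V" and loop: "\<forall>e\<in>E. card e = 2" and EV: "\<forall>e\<in>E. e \<subseteq> V"
  shows "\<exists>X. \<forall>v\<in>V. card (nbrs E V v) \<le> 2 * card (nbrs (cross E X) V v)"
proof -
  have "E \<subseteq> Pow V" using EV by blast
  then have finE: "finite E" using fin by (metis finite_Pow_iff finite_subset)
  have "\<exists>X. True \<and> (\<forall>X'. True \<longrightarrow> card (cross E X') \<le> card (cross E X))"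
    by (rule ex_has_greatest_nat[where k = "{}" and b = "card E + 1"])
      (use card_mono[OF finE cross_subset] in \<open>auto simp: less_Suc_eq_le\<close>)
  then obtain X where mx: "\<And>X'. card (cross E X') \<le> card (cross E X)" by blast
  have "card (nbrs E V v) \<le> 2 * card (nbrs (cross E X) V v)" if v: "v \<in> V" for v
  proof -
    define X' where "X' = (if v \<in> X then X - {v} else insert v X)"
    let ?C = "cross E X" let ?S = "{e\<in>E. v \<in> e}"
    have loopC: "\<forall>e\<in>?C. card e = 2" using loop by (simp add: cross_def)
    have finC: "finite ?C" using finite_subset[OF cross_subset finE] .
    have d: "card (nbrs E V v) = card ?S" "card (nbrs ?C V v) = card (?C \<inter> ?S)"
    proof -
      have "{e\<in>E. e \<subseteq> V \<and> v \<in> e} = ?S" using EV by blast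
      then show "card (nbrs E V v) = card ?S" using card_nbrs_edges[OF loop v] by simp
      have "{e\<in>?C. e \<subseteq> V \<and> v \<in> e} = ?C \<inter> ?S" using EV by (auto simp: cross_def)
      then show "card (nbrs ?C V v) = card (?C \<inter> ?S)" using card_nbrs_edges[OF loopC v] by simp
    qed
    have "e \<in> cross E X' \<longleftrightarrow> e \<in> (?C - ?S) \<union> (?S - ?C)" for e
    proof (cases "e \<in> E")
      case True
      then obtain a b where ab: "e = {a, b}" "a \<noteq> b" using loop by (metis card_2_iff)
      have "(a \<in> X') \<noteq> (b \<in> X') \<longleftrightarrow> ((a \<in> X) \<noteq> (b \<in> X)) \<noteq> (v \<in> e)"
        using ab by (auto simp: X'_def)
      then show ?thesis using True unfolding ab by (auto simp: cross_iff)
    qed (auto simp: cross_def)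
    then have "cross E X' = (?C - ?S) \<union> (?S - ?C)" by blast
    then have "card (cross E X') = card (?C - ?S) + card (?S - ?C)"
      using finC finE by (simp add: card_Un_disjoint[of "?C - ?S" "?S - ?C"] Diff_Int_distrib2 disjoint_iff)
    moreover have "card (?C - ?S) + card (?C \<inter> ?S) = card ?C" using card_Int_Diff[OF finC, of ?S] by simp
    moreover have "card (?S - ?C) + card (?C \<inter> ?S) = card ?S" using card_Int_Diff[of ?S ?C] finE by (simp add: Int_commute)
    ultimately show ?thesis using mx[of X'] d by linarith
  qed
  then show ?thesis by blast
qed

lemma edges_inside_le:
  assumes fin: "finite U" and loop: "\<forall>e\<in>H. card e = 2"
  shows "2 * card {e\<in>H. e \<subseteq> U} \<le> card U * card U"
proof -
  have "card {e\<in>H. e \<subseteq> U} \<le> card {e. e \<subseteq> U \<and> card e = 2}"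
    using fin loop by (intro card_mono) auto
  also have "\<dots> = card U choose 2" by (rule n_subsets[OF fin])
  also have "\<dots> = card U * (card U - 1) div 2" by (rule choose_two)
  finally have "2 * card {e\<in>H. e \<subseteq> U} \<le> card U * (card U - 1)" by linarith
  also have "\<dots> \<le> card U * card U" by simp
  finally show ?thesis .
qed

text \<open>A smallest set \<open>W\<close> that still has many edges is highly connected, since the bound is superadditive
  across separations of order less than \<open>2 * l\<close>.\<close>

lemma dense_core:
  assumes fin: "finite V" and loop: "\<forall>e\<in>H. card e = 2" and l: "l \<le> 2 * k" "k \<le> l" "0 < k"
    and deg: "\<forall>v\<in>V. 12 * l + k \<le> card (nbrs H V v)" and big: "4 * l \<le> card V"
    and tri: "\<forall>u v. {u, v} \<in> H \<longrightarrow> nbrs H V u \<inter> nbrs H V v = {}"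
  shows "\<exists>W\<subseteq>V. 12 * l + 2 \<le> card W \<and> (\<forall>X\<subseteq>W. card X \<le> 2 * l \<longrightarrow> linked W H X)"
proof -
  define D where "D = 12 * l + k"
  define e where "e U = card {e\<in>H. e \<subseteq> U}" for U
  \<comment> \<open>Average degree \<open>D\<close> up to a credit of \<open>D * (2 * l)\<close>,
    which is spent when a separation counts its fewer than \<open>2 * l\<close> overlap vertices
    twice.\<close>
  define P where "P U \<longleftrightarrow> U \<subseteq> V \<and> 4 * l \<le> card U \<and> D * card U < 2 * e U + D * (2 * l)" for U
  have finU: "finite U" if "U \<subseteq> V" for U using that fin finite_subset by blast
  have fe: "finite {e\<in>H. e \<subseteq> U}" if "U \<subseteq> V" for U using finite_edges[OF finU[OF that], of H "\<lambda>_. True"] by simp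
  have "P V"
  proof -
    have "card V * D \<le> (\<Sum>v\<in>V. card (nbrs H V v))"
      using deg sum_bounded_below[of V D "\<lambda>v. card (nbrs H V v)"] by (simp add: D_def)
    also have "\<dots> \<le> 2 * rho V H V" by (rule degree_sum(1)[OF fin loop subset_refl])
    also have "rho V H V \<le> e V" unfolding rho_def e_def by (rule card_mono[OF fe]) auto
    finally have "D * card V \<le> 2 * e V" by (simp add: mult.commute)
    moreover have "0 < D * (2 * l)" using l by (simp add: D_def)
    ultimately have "D * card V < 2 * e V + D * (2 * l)" by linarith
    then show ?thesis using big by (simp add: P_def)
  qed
  then obtain W where W: "P W" "\<And>U. P U \<Longrightarrow> card W \<le> card U"
    using ex_has_least_nat[of P V card] by blast
  have WV: "W \<subseteq> V" "4 * l \<le> card W" "D * card W < 2 * e W + D * (2 * l)" using W(1) by (auto simp: P_def)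
  have finW: "finite W" using finU[OF WV(1)] .
  have min: "2 * e U + D * (2 * l) \<le> D * card U" if "U \<subseteq> W" "U \<noteq> W" "4 * l \<le> card U" for U
  proof (rule ccontr)
    assume "\<not> ?thesis"
    then have "P U" using that WV(1) by (auto simp: P_def)
    then have "card W \<le> card U" by (rule W(2))
    moreover have "card U < card W" using that finW by (intro psubset_card_mono) auto
    ultimately show False by simp
  qed
  \<comment> \<open>A graph on \<open>4 * l\<close> vertices is too small to contain that many
    edges, so deleting one vertex stays within the range of the minimality.\<close>
  have big4: "4 * l < card W"
  proof (rule ccontr)
    assume "\<not> ?thesis"
    then have c: "card W = 4 * l" using WV(2) by simp
    have "2 * e W \<le> 4 * l * (4 * l)" using edges_inside_le[OF finW loop] unfolding e_def c .
    moreover have "D * (4 * l) = 48 * (l * l) + 4 * (k * l)" "D * (2 * l) = 24 * (l * l) + 2 * (k * l)" "4 * l * (4 * l) = 16 * (l * l)"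
      by (simp_all add: D_def algebra_simps)
    ultimately show False using WV(3) unfolding c by linarith
  qed
  have degW: "6 * l + 1 \<le> card (nbrs H W v)" if v: "v \<in> W" for v
  proof -
    have c: "card (W - {v}) + 1 = card W" using card_Suc_Diff1[OF finW v] by simp
    have "2 * e (W - {v}) + D * (2 * l) \<le> D * card (W - {v})"
      using v big4 c by (intro min) auto
    moreover have "D * card W = D * card (W - {v}) + D" using c[symmetric] by (simp add: algebra_simps)
    moreover have "e W \<le> e (W - {v}) + card (nbrs H W v)"
    proof -
      have "{e\<in>H. e \<subseteq> W} \<subseteq> {e\<in>H. e \<subseteq> W - {v}} \<union> {e\<in>H. e \<subseteq> W \<and> v \<in> e}" by auto
      then have "e W \<le> card ({e\<in>H. e \<subseteq> W - {v}} \<union> {e\<in>H. e \<subseteq> W \<and> v \<in> e})"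
        unfolding e_def using fe[of "W - {v}"] WV(1) finite_edges[OF finW] by (intro card_mono) auto
      also have "\<dots> \<le> e (W - {v}) + card {e\<in>H. e \<subseteq> W \<and> v \<in> e}" unfolding e_def by (rule card_Un_le)
      finally show ?thesis using card_nbrs_edges[OF loop v] by simp
    qed
    ultimately have "D < 2 * card (nbrs H W v)" using WV(3) by linarith
    then show ?thesis using l unfolding D_def by linarith
  qed
  \<comment> \<open>Adjacent vertices have disjoint neighbourhoods, each with at least
    \<open>6 * l + 1\<close> vertices.\<close>
  have big12: "12 * l + 2 \<le> card W"
  proof -
    have "W \<noteq> {}" using big4 by auto
    then obtain v where v: "v \<in> W" by blast
    have "nbrs H W v \<noteq> {}" using degW[OF v] by auto
    then obtain u where u: "u \<in> W" "{v, u} \<in> H" by (auto simp: nbrs_def)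
    have "nbrs H W v \<inter> nbrs H W u = {}" using tri u(2) WV(1) by (fastforce simp: nbrs_def)
    moreover have "finite (nbrs H W v)" "finite (nbrs H W u)" using finW by (auto simp: nbrs_def)
    ultimately have "card (nbrs H W v \<union> nbrs H W u) = card (nbrs H W v) + card (nbrs H W u)" by (intro card_Un_disjoint)
    moreover have "card (nbrs H W v \<union> nbrs H W u) \<le> card W" using finW by (intro card_mono) (auto simp: nbrs_def)
    ultimately show ?thesis using degW[OF v] degW[OF u(1)] by linarith
  qed
  have kc: "kconn (2 * l) W H"
    unfolding kconn_def
  proof (intro allI impI, rule ccontr)
    fix Z assume Z: "Z \<subseteq> W" "card Z < 2 * l" "\<not> conn H (W - Z)"
    have finZ: "finite Z" using Z(1) finW finite_subset by blast
    have "W - Z \<noteq> {}" using Z big12 card_mono[OF finZ, of W] by fastforce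
    then obtain S where S: "S \<subseteq> W - Z" "S \<noteq> {}" "S \<noteq> W - Z" "\<forall>a\<in>S. \<forall>b\<in>W - Z - S. {a, b} \<notin> H"
      using Z(3) unfolding conn_iff_cut by blast
    define A where "A = S \<union> Z"
    define B where "B = W - S"
    have AB: "A \<subseteq> W" "B \<subseteq> W" "A \<noteq> W" "B \<noteq> W" "A \<union> B = W" "A \<inter> B = Z" using S Z(1) by (auto simp: A_def B_def)
    have finAB: "finite A" "finite B" using AB(1,2) finW finite_subset by blast+
    obtain v where v: "v \<in> S" using S(2) by blast
    have "nbrs H W v \<subseteq> A" using S(4) v by (auto simp: nbrs_def A_def)
    then have cA: "6 * l + 1 \<le> card A" using degW[of v] v S(1) card_mono[OF finAB(1)] by (meson Diff_subset order_trans subsetD)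
    obtain u where u: "u \<in> W - Z - S" using S(1,3) by blast
    have "nbrs H W u \<subseteq> B"
    proof
      fix w assume "w \<in> nbrs H W u"
      then have "w \<in> W" "{w, u} \<in> H" by (auto simp: nbrs_def insert_commute)
      then show "w \<in> B" using S(4) u by (auto simp: B_def)
    qed
    then have cB: "6 * l + 1 \<le> card B" using degW[of u] u card_mono[OF finAB(2)] by (meson Diff_subset order_trans subsetD)
    have m1: "2 * e A + D * (2 * l) \<le> D * card A" using cA by (intro min AB) simp
    have m2: "2 * e B + D * (2 * l) \<le> D * card B" using cB by (intro min AB) simp
    have "{e\<in>H. e \<subseteq> W} \<subseteq> {e\<in>H. e \<subseteq> A} \<union> {e\<in>H. e \<subseteq> B}"
    proof
      fix f assume f: "f \<in> {e\<in>H. e \<subseteq> W}"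
      then have "card f = 2" using loop by auto
      then obtain a b where ab: "f = {a, b}" by (auto simp: card_2_iff)
      then have "{a, b} \<in> H" "{b, a} \<in> H" "a \<in> W" "b \<in> W" using f by (auto simp: insert_commute)
      then have "{a, b} \<subseteq> A \<or> {a, b} \<subseteq> B" using S(4) Z(1) unfolding A_def B_def by blast
      then show "f \<in> {e\<in>H. e \<subseteq> A} \<union> {e\<in>H. e \<subseteq> B}" using f ab by blast
    qed
    then have "e W \<le> card ({e\<in>H. e \<subseteq> A} \<union> {e\<in>H. e \<subseteq> B})"
      unfolding e_def using fe[of A] fe[of B] AB(1,2) WV(1) by (intro card_mono) auto
    also have "\<dots> \<le> e A + e B" unfolding e_def by (rule card_Un_le)
    finally have eAB: "e W \<le> e A + e B" .
    have "card A + card B = card W + card Z" using card_Un_Int[OF finAB] AB(5,6) by simp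
    then have "D * card A + D * card B = D * card W + D * card Z" by (metis distrib_left)
    moreover have "D * card Z \<le> D * (2 * l)" using Z(2) by simp
    ultimately show False using m1 m2 eAB WV(3) by linarith
  qed
  \<comment> \<open>Edges inside \<open>X\<close> do not count for the density. The \<open>k\<close>
    by which \<open>D\<close> exceeds \<open>12 * l\<close> pays for them, because
    \<open>l \<le> 2 * k\<close> and \<open>W\<close> has more than \<open>12 * l\<close>
    vertices.\<close>
  have full: "linked W H X" if X: "X \<subseteq> W" "card X = 2 * l" for X
  proof -
    have finX: "finite X" using X(1) finW finite_subset by blast
    have "{e\<in>H. e \<subseteq> W} \<subseteq> {e\<in>H. e \<subseteq> W \<and> e \<inter> (W - X) \<noteq> {}} \<union> {e\<in>H. e \<subseteq> X}" by auto
    then have "e W \<le> card ({e\<in>H. e \<subseteq> W \<and> e \<inter> (W - X) \<noteq> {}} \<union> {e\<in>H. e \<subseteq> X})"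
      unfolding e_def using finite_edges[OF finW] fe[of X] X(1) WV(1) by (intro card_mono) auto
    also have "\<dots> \<le> rho W H (W - X) + e X" unfolding rho_def e_def by (rule card_Un_le)
    finally have a: "e W \<le> rho W H (W - X) + e X" .
    have b: "2 * e X \<le> 2 * l * (2 * l)" using edges_inside_le[OF finX loop] unfolding e_def X(2) .
    have c: "card W = card (W - X) + 2 * l" using card_Diff_subset[OF finX X(1)] card_mono[OF finW X(1)] X(2) by linarith
    have eqs: "D * card W = 12 * (l * card (W - X)) + 24 * (l * l) + k * card W" "D * (2 * l) = 24 * (l * l) + 2 * (k * l)"
      "2 * l * (2 * l) = 4 * (l * l)" "6 * l * card (W - X) = 6 * (l * card (W - X))"
      unfolding D_def c by (simp_all add: algebra_simps)
    have "k * (12 * l + 2) \<le> k * card W" using big12 by (rule mult_le_mono2)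
    moreover have "k * (12 * l + 2) = 12 * (k * l) + 2 * k" by (simp add: algebra_simps)
    moreover have "l * l \<le> 2 * (k * l)" using mult_le_mono1[OF l(1), of l] by simp
    ultimately have "6 * l * card (W - X) < rho W H (W - X)" using a b eqs WV(3) by linarith
    then have "massed (6 * l) W H X" using X by (intro kconn_massed[OF finW kc]) auto
    then show ?thesis by (rule massed_linked[OF finW loop]) (simp add: X(2))
  qed
  have "linked W H X" if X: "X \<subseteq> W" "card X \<le> 2 * l" for X
  proof -
    have finX: "finite X" using X(1) finW finite_subset by blast
    have "2 * l - card X \<le> card (W - X)" using card_Diff_subset[OF finX X(1)] big4 by linarith
    then obtain X' where X': "X' \<subseteq> W - X" "card X' = 2 * l - card X" "finite X'" by (rule obtain_subset_with_card_n)
    have "card (X \<union> X') = 2 * l" using X' X(2) finX by (subst card_Un_disjoint) auto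
    then have "linked W H (X \<union> X')" using X(1) X'(1) by (intro full) auto
    then show ?thesis by (rule linked_subset) simp
  qed
  then show ?thesis using WV(1) big12 by blast
qed

fun pedges :: "'a list \<Rightarrow> 'a set set" where
  "pedges (x # y # zs) = insert {x, y} (pedges (y # zs))"
| "pedges _ = {}"

lemma pedges_append: "p \<noteq> [] \<Longrightarrow> q \<noteq> [] \<Longrightarrow> pedges (p @ q) = pedges p \<union> pedges q \<union> {{last p, hd q}}"
proof (induction p rule: pedges.induct)
  case ("2_2" v)
  then show ?case by (cases q) auto
qed auto

lemma pedges_rev: "pedges (rev p) = pedges p"
proof (induction p rule: pedges.induct)
  case (1 x y zs)
  have "pedges (rev (x # y # zs)) = pedges (rev (y # zs) @ [x])" by simp
  also have "\<dots> = pedges (rev (y # zs)) \<union> pedges [x] \<union> {{last (rev (y # zs)), hd [x]}}"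
    by (rule pedges_append) simp_all
  finally show ?case using 1 by (auto simp: last_rev insert_commute)
qed auto

lemma pedges_sub: "e \<in> pedges p \<Longrightarrow> e \<subseteq> set p"
  by (induction p rule: pedges.induct) auto

lemma pedges_path: "is_path V E p \<Longrightarrow> pedges p \<subseteq> E"
proof -
  assume "is_path V E p"
  then have "successively (\<lambda>x y. {x, y} \<in> E) p" by (simp add: is_path_alt)
  then show ?thesis by (induction p rule: pedges.induct) auto
qed

lemma pedges_finite: "finite (pedges p)"
  by (induction p rule: pedges.induct) auto

text \<open>Members of \<open>\<Q>\<close> are disjoint, so a path using only their edges cannot
  change from one to another.\<close>

lemma pedges_stay:
  assumes "pedges (v # ys) \<subseteq> \<Union> (pedges ` \<Q>)" "v \<in> set q" "q \<in> \<Q>"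
    and "\<forall>p\<in>\<Q>. \<forall>q\<in>\<Q>. p \<noteq> q \<longrightarrow> set p \<inter> set q = {}"
  shows "set (v # ys) \<subseteq> set q"
  using assms(1,2)
proof (induction ys arbitrary: v)
  case (Cons w ys)
  then obtain q' where q': "q' \<in> \<Q>" "{v, w} \<in> pedges q'" by auto
  have "v \<in> set q'" "w \<in> set q'" using pedges_sub[OF q'(2)] by auto
  then have "q' = q" using assms(3,4) q'(1) Cons.prems(2) by blast
  then have "w \<in> set q" using \<open>w \<in> set q'\<close> by simp
  then have "set (w # ys) \<subseteq> set q" using Cons.prems(1) by (intro Cons.IH) auto
  then show ?case using Cons.prems(2) by simp
qed simp

definition path_system :: "'a set \<Rightarrow> 'a set set \<Rightarrow> 'a set \<Rightarrow> 'a set \<Rightarrow> ('a \<Rightarrow> 'a list) \<Rightarrow> bool" where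
  "path_system V E T W R \<longleftrightarrow> (\<forall>z\<in>T. is_path V E (R z) \<and> hd (R z) = z \<and> set (R z) \<inter> W = {last (R z)}) \<and>
     (\<forall>z\<in>T. \<forall>z'\<in>T. z \<noteq> z' \<longrightarrow> set (R z) \<inter> set (R z') = {})"

lemma path_system_exists:
  assumes k: "kconn n V E" and fin: "finite V" and TW: "T \<subseteq> V" "W \<subseteq> V" "card T = n" "n \<le> card W"
  shows "\<exists>R. path_system V E T W R"
proof -
  obtain F where F: "card F = n" "finite F" "disjoint F" "\<forall>C\<in>F. C \<subseteq> V \<and> conn E C \<and> C \<inter> T \<noteq> {} \<and> C \<inter> W \<noteq> {}"
    using kconn_disjoint[OF k fin TW(1,2)] TW(3,4) by auto
  have finT: "finite T" using TW(1) fin finite_subset by blast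
  have cFT: "card F = card T" using F(1) TW(3) by simp
  have FT: "C \<inter> T \<noteq> {}" if "C \<in> F" for C using F(4) that by blast
  from disjoint_transversal[OF finT cFT F(2,3) FT] obtain h where
    h: "bij_betw h T F" "\<And>z. z \<in> T \<Longrightarrow> h z \<inter> T = {z}" by blast
  have hF: "h z \<in> F" if "z \<in> T" for z using h(1) that by (auto simp: bij_betw_def)
  have "\<exists>r. is_path V E r \<and> hd r = z \<and> set r \<inter> W = {last r} \<and> set r \<subseteq> h z" if z: "z \<in> T" for z
  proof -
    have hz: "h z \<subseteq> V" "conn E (h z)" "h z \<inter> W \<noteq> {}" "z \<in> h z" using F(4) hF[OF z] h(2)[OF z] by auto
    then obtain w where w: "w \<in> h z" "w \<in> W" by blast
    obtain r where r: "is_path (h z) E r" "hd r = z" "last r = w" using conn_path[OF hz(2,4) w(1)] .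
    have "r \<noteq> []" using r(1) by (simp add: is_path_def)
    then have "w \<in> set r" using r(3) last_in_set by blast
    then have "set r \<inter> W \<noteq> {}" using w(2) by blast
    from path_first_hit[OF r(1) this] obtain r' where
      r': "is_path (h z) E r'" "hd r' = hd r" "set r' \<inter> W = {last r'}" by metis
    have "set r' \<subseteq> h z" using r'(1) by (simp add: is_path_def)
    then show ?thesis using r' r(2) is_path_mono[OF r'(1) hz(1) subset_refl] by auto
  qed
  then obtain R where R: "\<And>z. z \<in> T \<Longrightarrow> is_path V E (R z) \<and> hd (R z) = z \<and> set (R z) \<inter> W = {last (R z)} \<and> set (R z) \<subseteq> h z"
    by metis
  have "set (R z) \<inter> set (R z') = {}" if zz: "z \<in> T" "z' \<in> T" "z \<noteq> z'" for z z'
  proof -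
    have "h z \<noteq> h z'" using zz h(1) by (auto simp: bij_betw_def inj_on_def)
    then have "h z \<inter> h z' = {}" using F(3) hF zz by (auto simp: disjoint_def)
    then show ?thesis using R[OF zz(1)] R[OF zz(2)] by blast
  qed
  then show ?thesis using R unfolding path_system_def by (intro exI[of _ R]) simp
qed

text \<open>Choosing the system with as few edges outside the paths of \<open>\<Q>\<close> as possible, a path of \<open>\<Q>\<close> that is
  met can be followed to its end in \<open>W\<close>, unless it already contains an end of the system.\<close>

lemma path_system_hits:
  assumes ex: "path_system V E T W R0" and finT: "finite T" and loop: "\<forall>e\<in>E. card e = 2"
    and Q: "\<forall>q\<in>\<Q>. is_path V E q \<and> set q \<inter> W = {hd q, last q} \<and> hd q \<noteq> last q"
    and dQ: "\<forall>p\<in>\<Q>. \<forall>q\<in>\<Q>. p \<noteq> q \<longrightarrow> set p \<inter> set q = {}"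
  shows "\<exists>R. path_system V E T W R \<and> (\<forall>q\<in>\<Q>. (\<exists>z\<in>T. set q \<inter> set (R z) \<noteq> {}) \<longrightarrow> (\<exists>z\<in>T. last (R z) \<in> set q))"
proof -
  define EQ where "EQ = \<Union> (pedges ` \<Q>)"
  \<comment> \<open>Edges on paths of \<open>\<Q>\<close> are free of charge, so rerouting along
    such a path never costs anything.\<close>
  define cost where "cost R = card (\<Union> ((\<lambda>z. pedges (R z)) ` T) - EQ)" for R :: "'a \<Rightarrow> 'a list"
  obtain R where R: "path_system V E T W R" "\<And>R'. path_system V E T W R' \<Longrightarrow> cost R \<le> cost R'"
    using ex_has_least_nat[of "path_system V E T W" R0 cost] ex by blast
  have Rz: "is_path V E (R z)" "hd (R z) = z" "set (R z) \<inter> W = {last (R z)}" if "z \<in> T" for z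
    using R(1) that by (auto simp: path_system_def)
  have dR: "set (R z) \<inter> set (R z') = {}" if "z \<in> T" "z' \<in> T" "z \<noteq> z'" for z z'
    using R(1) that by (auto simp: path_system_def)
  have "\<exists>z\<in>T. last (R z) \<in> set q" if q: "q \<in> \<Q>" and hit: "\<exists>z\<in>T. set q \<inter> set (R z) \<noteq> {}" for q
  proof (rule ccontr)
    assume no: "\<not> ?thesis"
    have q': "is_path V E q" "set q \<inter> W = {hd q, last q}" "hd q \<noteq> last q" "q \<noteq> []" "distinct q"
      using Q q by (auto simp: is_path_def)
    obtain us v ws where split: "q = us @ v # ws" "\<exists>z\<in>T. v \<in> set (R z)" "\<forall>u\<in>set us. \<not> (\<exists>z\<in>T. u \<in> set (R z))"
      using split_list_first_prop[of q "\<lambda>v. \<exists>z\<in>T. v \<in> set (R z)"] hit by blast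
    obtain z where z: "z \<in> T" "v \<in> set (R z)" using split(2) by blast
    have vq: "v \<in> set q" using split(1) by simp
    have lz: "last (R z) \<notin> set q" using no z(1) by blast
    have us: "us \<noteq> []"
    proof
      assume "us = []"
      then have "v \<in> W" using split(1) q'(2) by auto
      then have "v = last (R z)" using Rz(3)[OF z(1)] z(2) by blast
      then show False using lz vq by simp
    qed
    obtain xs ys where xy: "R z = xs @ v # ys" using split_list[OF z(2)] by blast
    have ys: "ys \<noteq> []" using lz vq xy by auto
    \<comment> \<open>Follow \<open>R z\<close> to the first vertex \<open>v\<close> of
      \<open>q\<close> that is met at all, then go back along the untouched initial piece of
      \<open>q\<close> to its end in \<open>W\<close>.\<close>
    define N where "N = (xs @ [v]) @ rev us"
    define R' where "R' = R(z := N)"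
    have dz: "distinct (R z)" using Rz(1)[OF z(1)] by (simp add: is_path_def)
    have p1: "is_path V E (xs @ [v])"
    proof -
      have "xs @ [v] = take (Suc (length xs)) (R z)" by (simp add: xy)
      then show ?thesis using is_path_take[OF Rz(1)[OF z(1)], of "Suc (length xs)"] by simp
    qed
    have usq: "is_path V E us \<and> {last us, v} \<in> E"
      using q'(1) us is_path_append[of us "v # ws" V E] by (simp add: split(1))
    have usR: "set us \<inter> set (R z') = {}" if "z' \<in> T" for z' using split(3) that by blast
    have xR: "set (xs @ [v]) \<subseteq> set (R z)" by (auto simp: xy)
    have pN: "is_path V E N" unfolding N_def
    proof (subst is_path_append)
      show "is_path V E (xs @ [v]) \<and> is_path V E (rev us) \<and> set (xs @ [v]) \<inter> set (rev us) = {} \<and> {last (xs @ [v]), hd (rev us)} \<in> E"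
        using p1 usq is_path_rev[of V E us] usR[OF z(1)] xR us by (auto simp: hd_rev insert_commute)
    qed (use us in auto)
    have hN: "hd N = z" using Rz(2)[OF z(1)] by (cases xs) (auto simp: N_def xy)
    have lN: "last N = hd q" using us by (simp add: N_def last_rev split(1))
    have NW: "set N \<inter> W = {last N}"
    proof -
      have "last (R z) = last ys" using ys by (simp add: xy)
      then have "last (R z) \<notin> set (xs @ [v])" using dz ys by (auto simp: xy)
      moreover have "set (xs @ [v]) \<inter> W \<subseteq> {last (R z)}" using Rz(3)[OF z(1)] xR by auto
      ultimately have "set (xs @ [v]) \<inter> W = {}" by blast
      moreover have "last q \<in> set (v # ws)" by (simp add: split(1))
      then have "last q \<notin> set us" using q'(5) by (auto simp: split(1))
      then have "set us \<inter> W \<subseteq> {hd q}" using q'(2) split(1) by auto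
      moreover have "hd q \<in> set us \<inter> W" using us q'(2,4) by (auto simp: split(1))
      ultimately show ?thesis unfolding lN by (auto simp: N_def)
    qed
    have Nsub: "set N \<subseteq> set (R z) \<union> set us" using xR by (auto simp: N_def)
    have dN: "set N \<inter> set (R z') = {}" if "z' \<in> T" "z' \<noteq> z" for z'
    proof -
      have "set (R z) \<inter> set (R z') = {}" using dR[OF z(1) that(1)] that(2) by simp
      then show ?thesis using Nsub usR[OF that(1)] by blast
    qed
    have sys: "path_system V E T W R'"
      unfolding path_system_def
    proof (intro conjI ballI impI)
      fix a assume a: "a \<in> T"
      show "is_path V E (R' a)" "hd (R' a) = a" "set (R' a) \<inter> W = {last (R' a)}"
        using pN hN NW Rz[OF a] by (simp_all add: R'_def)
      fix b assume b: "b \<in> T" "a \<noteq> b"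
      show "set (R' a) \<inter> set (R' b) = {}"
        using dN[OF a] dN[OF b(1)] dR[OF a b] b(2) by (auto simp: R'_def Int_commute)
    qed
    \<comment> \<open>The discarded tail ends off \<open>q\<close>, so it must contain an edge that
      was charged; dropping it makes the new system cheaper.\<close>
    have "\<not> pedges (v # ys) \<subseteq> EQ"
    proof
      assume "pedges (v # ys) \<subseteq> EQ"
      then have "set (v # ys) \<subseteq> set q" using pedges_stay[OF _ vq q dQ] by (simp add: EQ_def)
      moreover have "last (R z) \<in> set (v # ys)" using ys by (simp add: xy)
      ultimately show False using lz by blast
    qed
    then obtain f where f: "f \<in> pedges (v # ys)" "f \<notin> EQ" by blast
    have prefix: "pedges (xs @ [v]) \<subseteq> pedges (R z)"
    proof (cases "xs = []")
      case False
      then show ?thesis using pedges_append[of xs "[v]"] pedges_append[of xs "v # ys"] by (auto simp: xy)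
    qed simp
    have suffix: "pedges (v # ys) \<subseteq> pedges (R z)"
      using pedges_append[of xs "v # ys"] by (cases "xs = []") (auto simp: xy)
    have usE: "pedges us \<subseteq> pedges q" "{v, last us} \<in> pedges q"
      using pedges_append[of us "v # ws"] us by (auto simp: split(1) insert_commute)
    have "pedges N = pedges (xs @ [v]) \<union> pedges us \<union> {{v, last us}}"
      unfolding N_def using pedges_append[of "xs @ [v]" "rev us"] us by (simp add: pedges_rev hd_rev)
    then have Nedges: "pedges N \<subseteq> pedges (xs @ [v]) \<union> EQ" using usE q by (auto simp: EQ_def)
    have f2: "card f = 2" using f(1) suffix pedges_path[OF Rz(1)[OF z(1)]] loop by blast
    have fN: "f \<notin> pedges N"
    proof
      assume "f \<in> pedges N"
      then have "f \<in> pedges (xs @ [v])" using Nedges f(2) by blast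
      then have "f \<subseteq> set (xs @ [v])" by (rule pedges_sub)
      moreover have "f \<subseteq> set (v # ys)" using f(1) by (rule pedges_sub)
      moreover have "set (xs @ [v]) \<inter> set (v # ys) = {v}" using dz by (auto simp: xy)
      ultimately have "f \<subseteq> {v}" by blast
      then have "card f \<le> 1" using card_mono[of "{v}" f] by simp
      then show False using f2 by simp
    qed
    have fz: "f \<notin> pedges (R z')" if "z' \<in> T" "z' \<noteq> z" for z'
    proof
      assume "f \<in> pedges (R z')"
      then have "f \<subseteq> set (R z')" by (rule pedges_sub)
      moreover have "f \<subseteq> set (R z)" using f(1) suffix pedges_sub by blast
      ultimately have "f = {}" using dR[OF that(1) z(1) that(2)] by blast
      then show False using f2 by simp
    qed
    let ?old = "\<Union> ((\<lambda>z. pedges (R z)) ` T) - EQ" and ?new = "\<Union> ((\<lambda>z. pedges (R' z)) ` T) - EQ"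
    have "?new \<subseteq> ?old"
    proof
      fix g assume "g \<in> ?new"
      then obtain a where a: "a \<in> T" "g \<in> pedges (R' a)" "g \<notin> EQ" by blast
      then show "g \<in> ?old" using Nedges prefix z(1) by (cases "a = z") (auto simp: R'_def)
    qed
    moreover have "f \<in> ?old" using f suffix z(1) by blast
    moreover have "f \<notin> ?new"
    proof
      assume "f \<in> ?new"
      then obtain a where "a \<in> T" "f \<in> pedges (R' a)" by blast
      then show False using fN fz[of a] by (cases "a = z") (auto simp: R'_def)
    qed
    ultimately have "?new \<subset> ?old" by blast
    moreover have "finite ?old" using finT pedges_finite by auto
    ultimately have "cost R' < cost R" unfolding cost_def by (rule psubset_card_mono[rotated])
    then show False using R(2)[OF sys] by simp
  qed
  then show ?thesis using R(1) by blast
qed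

text \<open>Half of \<open>W\<close> lies on one side of \<open>X\<close>, and odd paths between
  vertices on the same side break parity. A hitting set of at most \<open>2 * n - 2\<close> vertices
  would leave two ends in a connected enough, nonbipartite graph, where an odd path still
  exists.\<close>

lemma breaking_paths:
  assumes fin: "finite V" and loop: "\<forall>e\<in>E. card e = 2" and k: "kconn (2 * n) V E" and n: "1 \<le> n"
    and W: "W \<subseteq> V" "4 * n \<le> card W"
    and nb: "\<forall>Y\<subseteq>V. card Y \<le> 2 * n - 2 \<longrightarrow> \<not> bipartite (V - Y) E"
  shows "\<exists>F. finite F \<and> card F = n \<and> (\<forall>q\<in>F. is_path V E q \<and> brk X q \<and> set q \<inter> W = {hd q, last q}) \<and>
    (\<forall>p\<in>F. \<forall>q\<in>F. p \<noteq> q \<longrightarrow> set p \<inter> set q = {})"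
proof -
  have finW: "finite W" using W(1) fin finite_subset by blast
  have "card W = card (W \<inter> X) + card (W - X)" using card_Int_Diff[OF finW] by simp
  then have "2 * n \<le> card (W \<inter> X) \<or> 2 * n \<le> card (W - X)" using W(2) by linarith
  then obtain A where A: "A \<subseteq> W" "2 * n \<le> card A" "A \<subseteq> X \<or> A \<inter> X = {}"
    by (metis Diff_disjoint Diff_subset Int_commute Int_lower1 Int_lower2)
  have AV: "A \<subseteq> V" using A W by blast
  have "\<exists>F. finite F \<and> card F = n \<and> (\<forall>p\<in>F. odd_path V E A p) \<and> (\<forall>p\<in>F. \<forall>q\<in>F. p \<noteq> q \<longrightarrow> set p \<inter> set q = {})"
  proof (rule ccontr)
    assume "\<not> ?thesis"
    then obtain Y where Y: "Y \<subseteq> V" "card Y \<le> 2 * n - 2" "\<forall>p. \<not> odd_path (V - Y) E A p"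
      using gallai_odd_paths[OF fin AV n, of E] by blast
    have finY: "finite Y" using Y(1) fin finite_subset by blast
    have "2 \<le> card (A - Y)" using diff_card_le_card_Diff[OF finY, of A] A(2) Y(2) n by linarith
    then obtain Z where Z: "Z \<subseteq> A - Y" "card Z = 2" by (rule obtain_subset_with_card_n)
    from Z(2) obtain a b where ab: "Z = {a, b}" "a \<noteq> b" by (auto simp: card_2_iff)
    have "kconn 2 (V - Y) E" using Y n by (intro kconn_delete[OF k fin]) linarith+
    moreover have "\<not> bipartite (V - Y) E" using nb Y by blast
    moreover have "a \<in> A \<inter> (V - Y)" "b \<in> A \<inter> (V - Y)" using ab Z AV by auto
    ultimately have "\<exists>p. odd_path (V - Y) E A p" using ab(2) fin by (intro odd_path_exists[OF _ loop]) auto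
    then show False using Y(3) by blast
  qed
  then obtain F where F: "finite F" "card F = n" "\<forall>p\<in>F. odd_path V E A p" "\<forall>p\<in>F. \<forall>q\<in>F. p \<noteq> q \<longrightarrow> set p \<inter> set q = {}"
    by (elim exE conjE)
  have "\<exists>q. is_path V E q \<and> brk X q \<and> set q \<subseteq> set p \<and> set q \<inter> W = {hd q, last q}" if p: "p \<in> F" for p
  proof -
    have o: "is_path V E p" "even (length p)" "hd p \<in> A" "last p \<in> A" using F(3) p by (auto simp: odd_path_def)
    then have "brk X p" using A(3) by (auto simp: brk_def)
    then show ?thesis using brk_segment[OF o(1), of X W] o(3,4) A(1) by blast
  qed
  then obtain g where g: "\<And>p. p \<in> F \<Longrightarrow> is_path V E (g p) \<and> brk X (g p) \<and> set (g p) \<subseteq> set p \<and> set (g p) \<inter> W = {hd (g p), last (g p)}"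
    by metis
  have dg: "set (g p) \<inter> set (g q) = {}" if pq: "p \<in> F" "q \<in> F" "p \<noteq> q" for p q
  proof -
    have "set p \<inter> set q = {}" using F(4) pq by blast
    then show ?thesis using g[OF pq(1)] g[OF pq(2)] by blast
  qed
  have "inj_on g F"
  proof (rule inj_onI, rule ccontr)
    fix p q assume pq: "p \<in> F" "q \<in> F" "g p = g q" "p \<noteq> q"
    then have "set (g p) = {}" using dg[OF pq(1,2,4)] by simp
    then show False using g[OF pq(1)] by (simp add: is_path_def)
  qed
  then have "card (g ` F) = n" using F(2) by (simp add: card_image)
  moreover have "\<forall>q\<in>g ` F. is_path V E q \<and> brk X q \<and> set q \<inter> W = {hd q, last q}" using g by simp
  moreover have "\<forall>p\<in>g ` F. \<forall>q\<in>g ` F. p \<noteq> q \<longrightarrow> set p \<inter> set q = {}" using dg by blast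
  moreover have "finite (g ` F)" using F(1) by simp
  ultimately show ?thesis by (intro exI[of _ "g ` F"] conjI)
qed

lemma large_cover_case:
  fixes s t :: "nat \<Rightarrow> 'a"
  assumes fin: "finite V" and loop: "\<forall>e\<in>E. card e = 2" and EV: "\<forall>e\<in>E. e \<subseteq> V"
    and k: "1 \<le> k" "kconn c V E" "c < card V" "c = 26 * k + 24 * card I" and I: "I \<subseteq> {1..k}"
    and st: "s ` {1..k} \<subseteq> V" "t ` {1..k} \<subseteq> V" "inj_on s {1..k}" "inj_on t {1..k}" "s ` {1..k} \<inter> t ` {1..k} = {}"
    and nb: "\<forall>Y\<subseteq>V. card Y \<le> 4 * k + 2 * card I \<longrightarrow> \<not> bipartite (V - Y) E"
  shows "\<exists>P. (\<forall>i\<in>{1..k}. is_path V E (P i) \<and> hd (P i) = s i \<and> last (P i) = t i) \<and>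
    (\<forall>i\<in>{1..k}. \<forall>j\<in>{1..k}. i \<noteq> j \<longrightarrow> set (P i) \<inter> set (P j) = {}) \<and>
    (\<forall>i\<in>I. even (path_length (P i)) \<longleftrightarrow> p i)"
proof -
  let ?J = "{1..k}"
  define r where "r = card I"
  define l where "l = k + r"
  have finI: "finite I" using I finite_subset by blast
  have rk: "r \<le> k" using card_mono[OF _ I] by (simp add: r_def)
  obtain Xc where Xc: "\<forall>v\<in>V. card (nbrs E V v) \<le> 2 * card (nbrs (cross E Xc) V v)"
    using max_cut[OF fin loop EV] by blast
  let ?H = "cross E Xc"
  have loopH: "\<forall>e\<in>?H. card e = 2" using loop by (simp add: cross_def)
  have "\<exists>W\<subseteq>V. 12 * l + 2 \<le> card W \<and> (\<forall>X\<subseteq>W. card X \<le> 2 * l \<longrightarrow> linked W ?H X)"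
  proof (rule dense_core[OF fin loopH, where k = k])
    show "l \<le> 2 * k" "k \<le> l" "0 < k" using rk k(1) by (auto simp: l_def)
    show "4 * l \<le> card V" using k(3,4) by (simp add: l_def r_def)
    show "\<forall>v\<in>V. 12 * l + k \<le> card (nbrs ?H V v)"
    proof
      fix v assume v: "v \<in> V"
      have "c \<le> card (nbrs E V v)" by (rule kconn_degree[OF fin loop k(2,3) v])
      also have "\<dots> \<le> 2 * card (nbrs ?H V v)" using Xc v by blast
      finally show "12 * l + k \<le> card (nbrs ?H V v)" using k(4) by (simp add: l_def r_def)
    qed
    show "\<forall>u v. {u, v} \<in> ?H \<longrightarrow> nbrs ?H V u \<inter> nbrs ?H V v = {}" by (auto simp: nbrs_def cross_iff)
  qed
  then obtain W where W: "W \<subseteq> V" "12 * l + 2 \<le> card W" "\<And>X. X \<subseteq> W \<Longrightarrow> card X \<le> 2 * l \<Longrightarrow> linked W ?H X" by blast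
  \<comment> \<open>A hitting set for \<open>n\<close> odd paths has at most
    \<open>4 * k + 2 * card I - 2\<close> vertices, within the range that \<open>nb\<close>
    excludes.\<close>
  define n where "n = 2 * k + r"
  have kc: "kconn m V E" if "m \<le> c" for m
    using kconn_delete[OF k(2) fin, of "{}" m] that by simp
  obtain F where F: "finite F" "card F = n" "\<forall>q\<in>F. is_path V E q \<and> brk Xc q \<and> set q \<inter> W = {hd q, last q}"
    "\<forall>p\<in>F. \<forall>q\<in>F. p \<noteq> q \<longrightarrow> set p \<inter> set q = {}"
  proof -
    have "kconn (2 * n) V E" using k(4) by (intro kc) (simp add: n_def r_def)
    moreover have "1 \<le> n" "4 * n \<le> card W" using k(1) W(2) by (auto simp: n_def l_def)
    moreover have "\<forall>Y\<subseteq>V. card Y \<le> 2 * n - 2 \<longrightarrow> \<not> bipartite (V - Y) E" using nb by (auto simp: n_def r_def)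
    ultimately show ?thesis using breaking_paths[OF fin loop _ _ W(1), of n Xc] that by blast
  qed
  define T where "T = s ` ?J \<union> t ` ?J"
  have cT: "card T = 2 * k"
    unfolding T_def using st(3,4,5) by (subst card_Un_disjoint) (auto simp: card_image)
  have finT: "finite T" by (simp add: T_def)
  have TV: "T \<subseteq> V" using st(1,2) by (auto simp: T_def)
  have "\<exists>R. path_system V E T W R"
  proof (rule path_system_exists[OF _ fin TV W(1) cT])
    show "kconn (2 * k) V E" using k(4) by (intro kc) simp
    show "2 * k \<le> card W" using W(2) by (simp add: l_def)
  qed
  then obtain R0 where R0: "path_system V E T W R0" by blast
  have FQ: "\<forall>q\<in>F. is_path V E q \<and> set q \<inter> W = {hd q, last q} \<and> hd q \<noteq> last q" using F(3) brk_ends by metis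
  obtain R where R: "path_system V E T W R"
    "\<forall>q\<in>F. (\<exists>z\<in>T. set q \<inter> set (R z) \<noteq> {}) \<longrightarrow> (\<exists>z\<in>T. last (R z) \<in> set q)"
    using path_system_hits[OF R0 finT loop FQ F(4)] by (elim exE conjE)
  have Rz: "is_path V E (R z)" "hd (R z) = z" "set (R z) \<inter> W = {last (R z)}" if "z \<in> T" for z
    using R(1) that by (auto simp: path_system_def)
  have dR: "set (R z) \<inter> set (R z') = {}" if "z \<in> T" "z' \<in> T" "z \<noteq> z'" for z z'
    using R(1) that by (auto simp: path_system_def)
  define Hit where "Hit = {q\<in>F. \<exists>z\<in>T. set q \<inter> set (R z) \<noteq> {}}"
  have "\<forall>q\<in>Hit. \<exists>z\<in>T. last (R z) \<in> set q" using R(2) by (simp add: Hit_def)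
  then obtain z where z: "\<And>q. q \<in> Hit \<Longrightarrow> z q \<in> T \<and> last (R (z q)) \<in> set q" by metis
  \<comment> \<open>Each path that is hit contains an end of an access path, and disjoint paths
    contain different ends; so at most \<open>2 * k\<close> are hit.\<close>
  have "inj_on z Hit"
  proof (rule inj_onI, rule ccontr)
    fix p q assume pq: "p \<in> Hit" "q \<in> Hit" "z p = z q" "p \<noteq> q"
    then have "set p \<inter> set q = {}" using F(4) by (simp add: Hit_def)
    then show False using z[OF pq(1)] z[OF pq(2)] pq(3) by auto
  qed
  moreover have "z ` Hit \<subseteq> T" using z by blast
  ultimately have "card Hit \<le> 2 * k" using card_inj_on_le[of z Hit T] finT cT by simp
  moreover have "card (F - Hit) = card F - card Hit" using F(1) by (intro card_Diff_subset) (auto simp: Hit_def)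
  ultimately have "card I \<le> card (F - Hit)" using F(2) by (simp add: n_def r_def)
  then obtain Q where Q: "inj_on Q I" "Q ` I \<subseteq> F - Hit"
    using inj_on_iff_card_le[OF finI, of "F - Hit"] F(1) by auto
  have Qi: "is_path V E (Q i)" "brk Xc (Q i)" "set (Q i) \<inter> W = {hd (Q i), last (Q i)}" "\<And>z. z \<in> T \<Longrightarrow> set (Q i) \<inter> set (R z) = {}"
    if i: "i \<in> I" for i
  proof -
    have "Q i \<in> F" "Q i \<notin> Hit" using Q(2) i by auto
    then show "is_path V E (Q i)" "brk Xc (Q i)" "set (Q i) \<inter> W = {hd (Q i), last (Q i)}" "\<And>z. z \<in> T \<Longrightarrow> set (Q i) \<inter> set (R z) = {}"
      using F(3) by (auto simp: Hit_def)
  qed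
  have dQ: "set (Q i) \<inter> set (Q j) = {}" if ij: "i \<in> I" "j \<in> I" "i \<noteq> j" for i j
  proof -
    have "Q i \<in> F" "Q j \<in> F" "Q i \<noteq> Q j" using Q ij by (auto simp: inj_on_def)
    then show ?thesis using F(4) by blast
  qed
  define X where "X = (\<lambda>z. last (R z)) ` T \<union> (\<lambda>i. hd (Q i)) ` I \<union> (\<lambda>i. last (Q i)) ` I"
  have XW: "X \<subseteq> W" using Rz(3) Qi(3) by (fastforce simp: X_def)
  have "card X \<le> card ((\<lambda>z. last (R z)) ` T) + card ((\<lambda>i. hd (Q i)) ` I) + card ((\<lambda>i. last (Q i)) ` I)"
    unfolding X_def by (rule order_trans[OF card_Un_le add_mono[OF card_Un_le order_refl]])
  also have "\<dots> \<le> card T + card I + card I" by (intro add_mono card_image_le finT finI)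
  finally have "card X \<le> 2 * l" using cT by (simp add: l_def r_def)
  then have lk: "linked W ?H X" by (rule W(3)[OF XW])
  have sT: "s i \<in> T" "t i \<in> T" if "i \<in> ?J" for i using that by (auto simp: T_def)
  have stn: "s i \<noteq> t j" if "i \<in> ?J" "j \<in> ?J" for i j using st(5) that by (metis disjoint_iff imageI)
  have ss: "s i \<noteq> s j" "t i \<noteq> t j" if "i \<in> ?J" "j \<in> ?J" "i \<noteq> j" for i j
    using inj_onD[OF st(3)] inj_onD[OF st(4)] that by metis+
  show ?thesis
  proof (rule compose_paths[OF lk XW W(1) I, where R = "\<lambda>i. R (s i)" and R' = "\<lambda>i. R (t i)" and Q = Q])
    show "\<forall>i\<in>?J. is_path V E (R (s i)) \<and> hd (R (s i)) = s i \<and> set (R (s i)) \<inter> W = {last (R (s i))} \<and> last (R (s i)) \<in> X"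
      using Rz sT by (auto simp: X_def)
    show "\<forall>i\<in>?J. is_path V E (R (t i)) \<and> hd (R (t i)) = t i \<and> set (R (t i)) \<inter> W = {last (R (t i))} \<and> last (R (t i)) \<in> X"
      using Rz sT by (auto simp: X_def)
    show "\<forall>i\<in>?J. set (R (s i)) \<inter> set (R (t i)) = {}" using dR sT stn by blast
    show "\<forall>i\<in>I. is_path V E (Q i) \<and> brk Xc (Q i) \<and> set (Q i) \<inter> W = {hd (Q i), last (Q i)} \<and> hd (Q i) \<in> X \<and>
      last (Q i) \<in> X \<and> set (Q i) \<inter> set (R (s i)) \<subseteq> {hd (Q i)} \<and> set (Q i) \<inter> set (R (t i)) \<subseteq> {last (Q i)}"
    proof
      fix i assume i: "i \<in> I"
      then have "i \<in> ?J" using I by blast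
      then show "is_path V E (Q i) \<and> brk Xc (Q i) \<and> set (Q i) \<inter> W = {hd (Q i), last (Q i)} \<and> hd (Q i) \<in> X \<and>
        last (Q i) \<in> X \<and> set (Q i) \<inter> set (R (s i)) \<subseteq> {hd (Q i)} \<and> set (Q i) \<inter> set (R (t i)) \<subseteq> {last (Q i)}"
        using Qi[OF i] sT[of i] i by (simp add: X_def)
    qed
    show "\<forall>i\<in>?J. \<forall>j\<in>?J. i \<noteq> j \<longrightarrow>
      (set (R (s i)) \<union> set (R (t i)) \<union> (if i \<in> I then set (Q i) else {})) \<inter>
      (set (R (s j)) \<union> set (R (t j)) \<union> (if j \<in> I then set (Q j) else {})) = {}"
    proof (intro ballI impI)
      fix i j assume ij: "i \<in> ?J" "j \<in> ?J" "i \<noteq> j"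
      have 1: "set (R (s i)) \<inter> set (R (s j)) = {}" "set (R (s i)) \<inter> set (R (t j)) = {}"
        "set (R (t i)) \<inter> set (R (s j)) = {}" "set (R (t i)) \<inter> set (R (t j)) = {}"
        using ss[OF ij] stn[OF ij(1,2)] stn[OF ij(2,1)] sT[OF ij(1)] sT[OF ij(2)] by (simp_all add: dR)
      have 2: "i \<in> I \<longrightarrow> set (Q i) \<inter> (set (R (s j)) \<union> set (R (t j))) = {}"
        "j \<in> I \<longrightarrow> (set (R (s i)) \<union> set (R (t i))) \<inter> set (Q j) = {}"
        using Qi(4)[of i "s j"] Qi(4)[of i "t j"] Qi(4)[of j "s i"] Qi(4)[of j "t i"] sT[OF ij(1)] sT[OF ij(2)]
        by (simp_all add: Int_Un_distrib Int_commute)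
      have 3: "i \<in> I \<longrightarrow> j \<in> I \<longrightarrow> set (Q i) \<inter> set (Q j) = {}" using dQ ij(3) by blast
      show "(set (R (s i)) \<union> set (R (t i)) \<union> (if i \<in> I then set (Q i) else {})) \<inter>
        (set (R (s j)) \<union> set (R (t j)) \<union> (if j \<in> I then set (Q j) else {})) = {}"
        using 1 2 3 by (simp add: Int_Un_distrib Int_Un_distrib2)
    qed
  qed
qed

theorem theorem4:
  fixes V :: "'a set" and E :: "'a set set" and k :: nat and I :: "nat set"
    and s t :: "nat \<Rightarrow> 'a"
  assumes "simple_graph V E"
    and "k \<ge> 1"
    and "I \<subseteq> {1..k}"
    and "k_connected (26 * k + 24 * card I) V E"
    and "s ` {1..k} \<subseteq> V" and "t ` {1..k} \<subseteq> V"
    and "inj_on s {1..k}" and "inj_on t {1..k}"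
    and "s ` {1..k} \<inter> t ` {1..k} = {}"
    and "\<exists>A B m. nice_partition V E A B \<and> parity_breaking_matching E A B k s t I m"
  shows "\<forall>p :: nat \<Rightarrow> bool. \<exists>P :: nat \<Rightarrow> 'a list.
     (\<forall>i\<in>{1..k}. is_path V E (P i) \<and> hd (P i) = s i \<and> last (P i) = t i) \<and>
     (\<forall>i\<in>{1..k}. \<forall>j\<in>{1..k}. i \<noteq> j \<longrightarrow> set (P i) \<inter> set (P j) = {}) \<and>
     (\<forall>i\<in>I. even (path_length (P i)) \<longleftrightarrow> p i)"
proof
  fix p :: "nat \<Rightarrow> bool"
  have fin: "finite V" and loop: "\<forall>e\<in>E. card e = 2" and EV: "\<forall>e\<in>E. e \<subseteq> V"
    using assms(1) by (auto simp: simple_graph_def)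
  have kc: "kconn (26 * k + 24 * card I) V E" by (rule kconn_of_k_connected[OF assms(4)])
  have big: "26 * k + 24 * card I < card V" using assms(4) by (simp add: k_connected_def)
  obtain A B m where ABm: "nice_partition V E A B" "parity_breaking_matching E A B k s t I m" using assms(10) by blast
  then obtain Y where AB: "partition2 V A B" and Y: "min_odd_cycle_cover V E Y"
    and ind: "independent E (A - Y)" "independent E (B - Y)"
    and nice: "\<forall>v\<in>Y. card (neighbours E v \<inter> (B - Y)) > card (neighbours E v \<inter> (A - Y)) \<longrightarrow> v \<in> A"
      "\<forall>v\<in>Y. card (neighbours E v \<inter> (A - Y)) > card (neighbours E v \<inter> (B - Y)) \<longrightarrow> v \<in> B"
    unfolding nice_partition_def by blast
  have YV: "Y \<subseteq> V" using Y by (simp add: min_odd_cycle_cover_def odd_cycle_cover_def)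
  show "\<exists>P. (\<forall>i\<in>{1..k}. is_path V E (P i) \<and> hd (P i) = s i \<and> last (P i) = t i) \<and>
     (\<forall>i\<in>{1..k}. \<forall>j\<in>{1..k}. i \<noteq> j \<longrightarrow> set (P i) \<inter> set (P j) = {}) \<and>
     (\<forall>i\<in>I. even (path_length (P i)) \<longleftrightarrow> p i)"
  \<comment> \<open>The threshold is the largest size of a cover that still leaves every vertex
    \<open>12 * (k + card I) + 1\<close> neighbours outside it.\<close>
  proof (cases "card Y + 12 * (k + card I) + 1 \<le> 26 * k + 24 * card I")
    case True
    show ?thesis
      by (rule small_cover_case[OF fin loop EV kc big assms(3,5-9) AB ABm(2) YV True ind nice])
  next
    case False
    \<comment> \<open>Every cover now has at least \<open>14 * k + 12 * card I\<close> vertices, far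
      more than a hitting set from Gallai's theorem.\<close>
    have "\<not> bipartite (V - Z) E" if Z: "Z \<subseteq> V" "card Z \<le> 4 * k + 2 * card I" for Z
    proof
      assume "bipartite (V - Z) E"
      moreover have "independent (del_edges Z E) U" if "independent E U" for U
        using that by (auto simp: independent_def del_edges_def)
      ultimately have "bipartite (V - Z) (del_edges Z E)" unfolding bipartite_def by metis
      then have "odd_cycle_cover V E Z" using Z(1) by (simp add: odd_cycle_cover_def)
      then have "card Y \<le> card Z" using Y by (simp add: min_odd_cycle_cover_def)
      then show False using False Z(2) assms(2) by (simp; fail | arith)
    qed
    then show ?thesis
      by (intro large_cover_case[OF fin loop EV assms(2) kc big refl assms(3,5-9)]) blast
  qed
qed

end
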